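(* There is an absolute constant $C>0$ such that the following holds. Let $n,d,p\in\mathbb N$ with $p\ge 2$ and $d\le n\le d^2$, and let $\eta\in[0,1]$. Let $x_1,\dots,x_n$ be i.i.d. samples from $\mathcal N(0,I_d)$ and let $w_1,\dots,w_n$ be indeterminates. Then \[ \mathbb E_{x_1,\dots,x_n}\ \inf\Big\{B\in\mathbb R:\ \Big\{\{w_i^2=w_i\}_{i\in[n]},\ \textstyle\sum_{i\le n}w_i\le \eta n\Big\}\vdash^{w}_{Cp}\ \Big\|\tfrac1n\textstyle\sum_{i\le n}w_ix_ix_i^\top\Big\|_p^p\le B\Big\} \ \le\ (p\log n)^{Cp}\cdot d^{5/2}\cdot\max\Big\{\tfrac dn,\ \tfrac{\eta d}{\sqrt n}\Big\}^{p/2}. \]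
   Context: Sum-of-squares (SoS) proofs: for a system $\mathcal A=\{q_1\ge0,\dots,q_m\ge0\}$ of polynomial inequalities in formal variables $X$ (an equality $q=0$ is encoded as the two inequalities $q\ge0,-q\ge0$) and a polynomial $P$, we write $\mathcal A\vdash^X_t P\ge 0$ if $P=\sum_{S\subseteq[m]}b_S\prod_{i\in S}q_i$ where each $b_S$ is a sum of squares of polynomials in $X$ and every summand has degree at most $t$; $\mathcal A\vdash_t P\le Q$ means $\mathcal A\vdash_t Q-P\ge0$. Here $x_1,\dots,x_n$ are fixed (sampled) vectors, so the polynomials are in the variables $w$ with coefficients depending on the $x_i$. For the matrix $M(w)=\frac1n\sum_i w_ix_ix_i^\top$ (symmetric, with polynomial entries), $\|M(w)\|_p^p$ denotes the polynomial $\operatorname{tr}(M(w)^p)$.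
   Formalization: The formal theorem assumes n ≥ 2; this excludes only n = 0, where 1/n and log n are undefined, and n = d = 1, where log n = 0 makes the right-hand side 0 and the claim fails for η = 1 (for p = 2 the left side is at least E x^4 = 3). *)

theory Defs
  imports
    "HOL-Probability.Probability"
    "HOL-Library.Poly_Mapping"
    "Jordan_Normal_Form.Matrix"
begin

section \<open>Real polynomials in formal variables\<close>

text \<open>A monomial is a finitely supported exponent vector and a polynomial is a finitely supported
  coefficient family on monomials, multiplied by convolution.\<close>

type_synonym rpoly = "(nat \<Rightarrow>\<^sub>0 nat) \<Rightarrow>\<^sub>0 real"

definition pconst :: "real \<Rightarrow> rpoly" where
  "pconst c = Poly_Mapping.single 0 c"

definition pvar :: "nat \<Rightarrow> rpoly" where
  "pvar i = Poly_Mapping.single (Poly_Mapping.single i 1) 1"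

definition polys_in :: "nat set \<Rightarrow> rpoly set" where
  "polys_in V = {P. \<forall>m \<in> Poly_Mapping.keys P. Poly_Mapping.keys m \<subseteq> V}"

text \<open>Total degree; the zero polynomial gets degree 0, so it satisfies every degree bound \<open>t \<ge> 0\<close>.\<close>

definition total_degree :: "rpoly \<Rightarrow> nat" where
  "total_degree P = Max (insert 0
     ((\<lambda>m. \<Sum>i \<in> Poly_Mapping.keys m. Poly_Mapping.lookup m i) ` Poly_Mapping.keys P))"

section \<open>Sum-of-squares proofs\<close>

definition is_sos :: "nat set \<Rightarrow> rpoly \<Rightarrow> bool" where
  "is_sos V b \<longleftrightarrow> (\<exists>fs. set fs \<subseteq> polys_in V \<and> b = (\<Sum>f\<leftarrow>fs. f ^ 2))"

text \<open>\<open>sos_proves V t qs P\<close>: from the system \<open>q \<ge> 0\<close> (\<open>q\<close> in the list \<open>qs\<close>) there is a proof of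
  \<open>P \<ge> 0\<close> of degree at most \<open>t\<close> in the variables \<open>V\<close>. The degree bound is real because it is used
  with \<open>t = C * p\<close> for a real constant \<open>C\<close>.\<close>

definition sos_proves :: "nat set \<Rightarrow> real \<Rightarrow> rpoly list \<Rightarrow> rpoly \<Rightarrow> bool" where
  "sos_proves V t qs P \<longleftrightarrow>
     (\<exists>b :: nat set \<Rightarrow> rpoly.
        (\<forall>S \<subseteq> {..<length qs}.
            is_sos V (b S) \<and> real (total_degree (b S * (\<Prod>i\<in>S. qs ! i))) \<le> t) \<and>
        P = (\<Sum>S \<in> Pow {..<length qs}. b S * (\<Prod>i\<in>S. qs ! i)))"

definition sos_le :: "nat set \<Rightarrow> real \<Rightarrow> rpoly list \<Rightarrow> rpoly \<Rightarrow> rpoly \<Rightarrow> bool" where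
  "sos_le V t qs P Q \<longleftrightarrow> sos_proves V t qs (Q - P)"

definition eq_constraint :: "rpoly \<Rightarrow> rpoly \<Rightarrow> rpoly list" where
  "eq_constraint P Q = [P - Q, Q - P]"

definition le_constraint :: "rpoly \<Rightarrow> rpoly \<Rightarrow> rpoly list" where
  "le_constraint P Q = [Q - P]"

section \<open>The weighted sample covariance\<close>

text \<open>Indices are shifted to start at 0: the indeterminates are \<open>pvar i\<close> for \<open>i < n\<close>, and \<open>x i a\<close> is
  the \<open>a\<close>-th coordinate (\<open>a < d\<close>) of the \<open>i\<close>-th sample.\<close>

definition sparse_system :: "nat \<Rightarrow> real \<Rightarrow> rpoly list" where
  "sparse_system n \<eta> =
     concat (map (\<lambda>i. eq_constraint (pvar i ^ 2) (pvar i)) [0..<n]) @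
     le_constraint (\<Sum>i<n. pvar i) (pconst (\<eta> * real n))"

definition weighted_cov :: "nat \<Rightarrow> nat \<Rightarrow> (nat \<Rightarrow> nat \<Rightarrow> real) \<Rightarrow> rpoly mat" where
  "weighted_cov n d x =
     mat d d (\<lambda>(a, b). pconst (1 / real n) * (\<Sum>i<n. pvar i * pconst (x i a * x i b)))"

definition mat_trace :: "'a :: comm_monoid_add mat \<Rightarrow> 'a" where
  "mat_trace A = sum_list (diag_mat A)"

definition schatten_pow :: "nat \<Rightarrow> 'a :: comm_semiring_1 mat \<Rightarrow> 'a" where
  "schatten_pow p A = mat_trace (A ^\<^sub>m p)"

text \<open>The infimum is taken in the extended reals, so it is \<open>\<infinity>\<close> if no bound is provable.\<close>

definition best_sos_bound :: "real \<Rightarrow> nat \<Rightarrow> nat \<Rightarrow> nat \<Rightarrow> real \<Rightarrow> (nat \<Rightarrow> nat \<Rightarrow> real) \<Rightarrow> ereal" where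
  "best_sos_bound t n d p \<eta> x =
     Inf (ereal ` {B :: real. sos_le {..<n} t (sparse_system n \<eta>)
                                (schatten_pow p (weighted_cov n d x)) (pconst B)})"

section \<open>Gaussian samples and expectation\<close>

definition gaussian_vector :: "nat \<Rightarrow> (nat \<Rightarrow> real) measure" where
  "gaussian_vector d = (\<Pi>\<^sub>M a\<in>{..<d}. std_normal_distribution)"

definition gaussian_samples :: "nat \<Rightarrow> nat \<Rightarrow> (nat \<Rightarrow> nat \<Rightarrow> real) measure" where
  "gaussian_samples n d = (\<Pi>\<^sub>M i\<in>{..<n}. gaussian_vector d)"

text \<open>Expectation of an extended-real random variable: integral of the positive part minus integral
  of the negative part (\<^const>\<open>e2ennreal\<close> sends negative numbers to 0). The undefined form
  \<open>\<infinity> - \<infinity>\<close> is \<open>\<infinity>\<close> in \<^typ>\<open>ereal\<close>, so it cannot satisfy a finite upper bound.\<close>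

definition ereal_expectation :: "'a measure \<Rightarrow> ('a \<Rightarrow> ereal) \<Rightarrow> ereal" where
  "ereal_expectation M f =
     enn2ereal (\<integral>\<^sup>+ x. e2ennreal (f x) \<partial>M) - enn2ereal (\<integral>\<^sup>+ x. e2ennreal (- f x) \<partial>M)"

end

theory Submission
  imports Defs "HOL-Probability.Probability" "HOL-Computational_Algebra.Polynomial"
begin

text \<open>Write \<open>Y\<^sub>i = x\<^sub>i x\<^sub>i\<^sup>T - I\<close>, let \<open>\<sigma>\<close> be the mean of the \<open>w\<^sub>i\<close>, and put
  \<open>h(z) = (z - \<sigma>)\<^sup>2 - (d/n) z - \<sigma>/n\<close>. Modulo \<open>w\<^sub>i\<^sup>2 = w\<^sub>i\<close> the matrix \<open>n\<^sup>2 h(M)\<close> is the sum of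
  \<open>w\<^sub>i w\<^sub>j Y\<^sub>i Y\<^sub>j\<close> over \<open>i \<noteq> j\<close> and of a small diagonal part, so \<open>tr h(M)\<^sup>2\<close> has degree 4 in \<open>w\<close>.
  After a random splitting of the indices it becomes an average of quadratic and bilinear forms in the
  products \<open>w\<^sub>i w\<^sub>j\<close> whose coefficient matrices are Gaussian and free of \<open>w\<close>. Spectral norm bounds for such forms
  are sum-of-squares proofs, because a real positive semidefinite matrix is a Gram matrix. The matrices
  are conditionally sums of independent positive semidefinite matrices, whose trace moments are bounded
  by induction on the exponent.

  A bound \<open>tr h(M)\<^sup>2 \<le> f\<close> propagates to high powers: \<open>M\<^sup>2 \<le> c + 2 h(M)\<close> up to squares gives
  \<open>tr M\<^bsup>4j+4\<^esup> \<le> (2 c\<^sup>2 + 8 f) tr M\<^bsup>4j\<^esup>\<close>, where \<open>tr g(M)\<^sup>2\<close> is a sum of squares for every polynomial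
  \<open>g\<close> since \<open>M\<close> is symmetric. Young's inequality then bounds \<open>tr M\<^sup>p\<close>.

  For measurability, the proofs with bounded number of squares, degrees and coefficients form a compact
  set, so the samples that admit such a proof of a given bound form a closed set.\<close>

section \<open>Positive semidefinite matrices over finite index sets\<close>

text \<open>The quadratic \<open>h\<close> records an approximate equation for \<open>M\<close>.
  Since \<open>Y_i^2 = (|x_i|^2 - 2) x_i x_i^T + I\<close>, the diagonal part of the square of the
  mean of the \<open>w_i Y_i\<close> is close to \<open>(d/n) M + \<sigma>/n\<close>; subtracting
  this replaces a coefficient of order \<open>d\<close> by one of order \<open>sqrt d\<close>. With
  \<open>T = max (d/n) (\<eta> d / sqrt n)\<close> the bound on \<open>tr h(M)^2\<close> is of order
  \<open>T^2\<close> and the constant \<open>c\<close> of order at most \<open>T\<close>, so every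
  four powers of \<open>M\<close> cost a factor of order \<open>T^2\<close>. This is where
  \<open>T\<close> to the power \<open>p/2\<close> comes from. The obstacle: \<open>w\<close> may
  depend on the sample, so coefficient matrices are controlled by spectral norms, and their entries
  are dependent polynomials in Gaussians. Fixing all groups of indices but one leaves independent
  summands. Their sum is controlled by its variance in the worst direction and the norm of one
  summand, which are bounded by norms of the same kind with fewer groups. Each round costs factors
  polynomial in the moment order and powers of \<open>n\<close> not depending on it; passing to a
  high moment leaves only \<open>sqrt n <= d\<close> of the latter.\<close>

definition mm :: "'i set \<Rightarrow> ('i \<Rightarrow> 'i \<Rightarrow> real) \<Rightarrow> ('i \<Rightarrow> 'i \<Rightarrow> real) \<Rightarrow> 'i \<Rightarrow> 'i \<Rightarrow> real" where
  "mm I A B = (\<lambda>i j. \<Sum>k\<in>I. A i k * B k j)"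

definition mtr :: "'i set \<Rightarrow> ('i \<Rightarrow> 'i \<Rightarrow> real) \<Rightarrow> real" where
  "mtr I A = (\<Sum>i\<in>I. A i i)"

text \<open>Vanishing outside \<open>I\<close> makes \<open>mone I\<close> a genuine unit and lets
  matrix identities be equalities of functions on the whole type; \<open>mres\<close> enforces it
  for arbitrary kernels.\<close>

definition msupp :: "'i set \<Rightarrow> ('i \<Rightarrow> 'i \<Rightarrow> real) \<Rightarrow> bool" where
  "msupp I A \<longleftrightarrow> (\<forall>i j. i \<notin> I \<or> j \<notin> I \<longrightarrow> A i j = 0)"

definition mone :: "'i set \<Rightarrow> 'i \<Rightarrow> 'i \<Rightarrow> real" where
  "mone I = (\<lambda>i j. if i = j \<and> i \<in> I then 1 else 0)"

primrec mpow :: "'i set \<Rightarrow> ('i \<Rightarrow> 'i \<Rightarrow> real) \<Rightarrow> nat \<Rightarrow> 'i \<Rightarrow> 'i \<Rightarrow> real" where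
  "mpow I A 0 = mone I"
| "mpow I A (Suc m) = mm I A (mpow I A m)"

definition mtp :: "('i \<Rightarrow> 'i \<Rightarrow> real) \<Rightarrow> 'i \<Rightarrow> 'i \<Rightarrow> real" where
  "mtp A = (\<lambda>i j. A j i)"

definition mv :: "'i set \<Rightarrow> ('i \<Rightarrow> 'i \<Rightarrow> real) \<Rightarrow> ('i \<Rightarrow> real) \<Rightarrow> 'i \<Rightarrow> real" where
  "mv I A u = (\<lambda>i. \<Sum>j\<in>I. A i j * u j)"

definition quad :: "'i set \<Rightarrow> ('i \<Rightarrow> 'i \<Rightarrow> real) \<Rightarrow> ('i \<Rightarrow> real) \<Rightarrow> real" where
  "quad I G u = (\<Sum>i\<in>I. \<Sum>j\<in>I. u i * G i j * u j)"

definition sqn :: "'i set \<Rightarrow> ('i \<Rightarrow> real) \<Rightarrow> real" where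
  "sqn I u = (\<Sum>i\<in>I. (u i)\<^sup>2)"

definition psd :: "'i set \<Rightarrow> ('i \<Rightarrow> 'i \<Rightarrow> real) \<Rightarrow> bool" where
  "psd I G \<longleftrightarrow> (\<forall>i\<in>I. \<forall>j\<in>I. G i j = G j i) \<and> (\<forall>u. 0 \<le> quad I G u)"

lemma mm_assoc: "mm I (mm I A B) C = mm I A (mm I B C)"
  unfolding mm_def by (intro ext) (simp add: sum_distrib_left sum_distrib_right mult.assoc, rule sum.swap)

lemma mm_diff_left: "mm I (\<lambda>i j. A i j - B i j) C = (\<lambda>i j. mm I A C i j - mm I B C i j)"
  by (simp add: mm_def algebra_simps sum_subtractf)

lemma mm_diff_right: "mm I C (\<lambda>i j. A i j - B i j) = (\<lambda>i j. mm I C A i j - mm I C B i j)"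
  by (simp add: mm_def algebra_simps sum_subtractf)

lemma mm_add_left: "mm I (\<lambda>i j. A i j + B i j) C = (\<lambda>i j. mm I A C i j + mm I B C i j)"
  by (simp add: mm_def algebra_simps sum.distrib)

lemma mm_add_right: "mm I C (\<lambda>i j. A i j + B i j) = (\<lambda>i j. mm I C A i j + mm I C B i j)"
  by (simp add: mm_def algebra_simps sum.distrib)

lemma mm_scale_left: "mm I (\<lambda>i j. c * A i j) C = (\<lambda>i j. c * mm I A C i j)"
  by (simp add: mm_def mult.assoc sum_distrib_left)

lemma mm_sum_left: "mm I (\<lambda>i j. \<Sum>x\<in>X. A x i j) C = (\<lambda>i j. \<Sum>x\<in>X. mm I (A x) C i j)"
  unfolding mm_def by (intro ext) (simp add: sum_distrib_right, rule sum.swap)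

lemma mtr_diff: "mtr I (\<lambda>i j. A i j - B i j) = mtr I A - mtr I B"
  by (simp add: mtr_def sum_subtractf)

lemma mtr_add: "mtr I (\<lambda>i j. A i j + B i j) = mtr I A + mtr I B"
  by (simp add: mtr_def sum.distrib)

lemma mtr_scale: "mtr I (\<lambda>i j. c * A i j) = c * mtr I A"
  by (simp add: mtr_def sum_distrib_left)

lemma mtr_sum: "mtr I (\<lambda>i j. \<Sum>x\<in>X. A x i j) = (\<Sum>x\<in>X. mtr I (A x))"
  unfolding mtr_def by (rule sum.swap)

lemma mtr_comm: "mtr I (mm I A B) = mtr I (mm I B A)"
  unfolding mtr_def mm_def by (subst sum.swap) (simp add: mult.commute)

lemma mtp_mm: "mtp (mm I A B) = mm I (mtp B) (mtp A)"
  by (simp add: mtp_def mm_def mult.commute)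

lemma mtp_mone [simp]: "mtp (mone I) = mone I"
  by (auto simp: mtp_def mone_def fun_eq_iff)

lemma msupp_mone [simp]: "msupp I (mone I)"
  by (simp add: msupp_def mone_def)

lemma msupp_mm [simp]: "msupp I A \<Longrightarrow> msupp I B \<Longrightarrow> msupp I (mm I A B)"
  by (auto simp: msupp_def mm_def)

lemma msupp_add [simp]: "msupp I A \<Longrightarrow> msupp I B \<Longrightarrow> msupp I (\<lambda>i j. A i j + B i j)"
  by (simp add: msupp_def)

lemma msupp_mpow [simp]: "msupp I A \<Longrightarrow> msupp I (mpow I A m)"
  by (induction m) auto

lemma mm_mone_left [simp]:
  assumes "finite I" "msupp I A" shows "mm I (mone I) A = A"
proof (intro ext)
  fix i j
  have "mm I (mone I) A i j = (\<Sum>k\<in>I. if k = i then A k j else 0)"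
    unfolding mm_def mone_def by (intro sum.cong) auto
  then show "mm I (mone I) A i j = A i j" using assms by (auto simp: msupp_def)
qed

lemma mm_mone_right [simp]:
  assumes "finite I" "msupp I A" shows "mm I A (mone I) = A"
proof (intro ext)
  fix i j
  have "mm I A (mone I) i j = (\<Sum>k\<in>I. if k = j then A i k else 0)"
    unfolding mm_def mone_def by (intro sum.cong) auto
  then show "mm I A (mone I) i j = A i j" using assms by (auto simp: msupp_def)
qed

lemma mpow_add:
  assumes "finite I" "msupp I A"
  shows "mpow I A (a + b) = mm I (mpow I A a) (mpow I A b)"
  using assms by (induction a) (auto simp: mm_assoc)

lemma mpow_Suc_right:
  assumes "finite I" "msupp I A"
  shows "mm I (mpow I A m) A = mpow I A (Suc m)"
  using mpow_add[OF assms, of m 1] assms by simp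

lemma mtp_mpow:
  assumes "finite I" "msupp I A" "mtp A = A"
  shows "mtp (mpow I A m) = mpow I A m"
proof (induction m)
  case (Suc m)
  have "mtp (mpow I A (Suc m)) = mm I (mtp (mpow I A m)) (mtp A)" by (simp add: mtp_mm)
  also have "\<dots> = mm I (mpow I A m) A" using Suc assms by simp
  finally show ?case using mpow_Suc_right[OF assms(1,2)] by simp
qed simp

lemma quad_cong: "(\<And>i j. i \<in> I \<Longrightarrow> j \<in> I \<Longrightarrow> G i j = H i j) \<Longrightarrow> (\<And>i. i \<in> I \<Longrightarrow> u i = v i) \<Longrightarrow> quad I G u = quad I H v"
  by (simp add: quad_def)

lemma psd_cong: "(\<And>i j. i \<in> I \<Longrightarrow> j \<in> I \<Longrightarrow> G i j = H i j) \<Longrightarrow> psd I G = psd I H"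
  unfolding psd_def using quad_cong[of I G H] by auto

lemma quad_mv: "quad I (mm I (mm I (mtp V) B) V) u = quad I B (mv I V u)"
proof -
  have "quad I (mm I (mm I (mtp V) B) V) u = (\<Sum>i\<in>I. \<Sum>j\<in>I. \<Sum>l\<in>I. \<Sum>k\<in>I. u i * V k i * B k l * V l j * u j)"
    by (simp add: quad_def mm_def mtp_def sum_distrib_left sum_distrib_right mult.assoc)
  also have "\<dots> = (\<Sum>k\<in>I. \<Sum>l\<in>I. \<Sum>i\<in>I. \<Sum>j\<in>I. u i * V k i * B k l * V l j * u j)"
  proof -
    have "(\<Sum>i\<in>I. \<Sum>j\<in>I. \<Sum>l\<in>I. \<Sum>k\<in>I. F i j l k) = (\<Sum>k\<in>I. \<Sum>l\<in>I. \<Sum>i\<in>I. \<Sum>j\<in>I. F i j l k)" for F :: "'a \<Rightarrow> 'a \<Rightarrow> 'a \<Rightarrow> 'a \<Rightarrow> real"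
    proof -
      have "(\<Sum>i\<in>I. \<Sum>j\<in>I. \<Sum>l\<in>I. \<Sum>k\<in>I. F i j l k) = (\<Sum>i\<in>I. \<Sum>j\<in>I. \<Sum>k\<in>I. \<Sum>l\<in>I. F i j l k)"
        by (intro sum.cong refl sum.swap)
      also have "\<dots> = (\<Sum>i\<in>I. \<Sum>k\<in>I. \<Sum>j\<in>I. \<Sum>l\<in>I. F i j l k)"
        by (intro sum.cong refl sum.swap)
      also have "\<dots> = (\<Sum>k\<in>I. \<Sum>i\<in>I. \<Sum>j\<in>I. \<Sum>l\<in>I. F i j l k)" by (rule sum.swap)
      also have "\<dots> = (\<Sum>k\<in>I. \<Sum>i\<in>I. \<Sum>l\<in>I. \<Sum>j\<in>I. F i j l k)"
        by (intro sum.cong refl sum.swap)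
      also have "\<dots> = (\<Sum>k\<in>I. \<Sum>l\<in>I. \<Sum>i\<in>I. \<Sum>j\<in>I. F i j l k)"
        by (intro sum.cong refl sum.swap)
      finally show ?thesis .
    qed
    then show ?thesis .
  qed
  also have "\<dots> = quad I B (mv I V u)"
    by (simp add: quad_def mv_def sum_distrib_left sum_distrib_right mult_ac)
  finally show ?thesis .
qed

lemma psd_conj:
  assumes "psd I B" shows "psd I (mm I (mm I (mtp V) B) V)"
  unfolding psd_def
proof (intro conjI ballI allI)
  fix u show "0 \<le> quad I (mm I (mm I (mtp V) B) V) u"
    using assms by (simp add: quad_mv psd_def)
next
  fix i j assume ij: "i \<in> I" "j \<in> I"
  have "mm I (mm I (mtp V) B) V i j = (\<Sum>k\<in>I. \<Sum>l\<in>I. V l i * B l k * V k j)"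
    by (simp add: mm_def mtp_def sum_distrib_right)
  also have "\<dots> = (\<Sum>l\<in>I. \<Sum>k\<in>I. V l i * B l k * V k j)" by (rule sum.swap)
  also have "\<dots> = (\<Sum>l\<in>I. \<Sum>k\<in>I. V k j * B k l * V l i)"
    using assms by (intro sum.cong refl) (simp add: psd_def)
  also have "\<dots> = mm I (mm I (mtp V) B) V j i"
    by (simp add: mm_def mtp_def sum_distrib_right)
  finally show "mm I (mm I (mtp V) B) V i j = mm I (mm I (mtp V) B) V j i" .
qed

lemma quad_mone: "finite I \<Longrightarrow> quad I (mone I) u = sqn I u"
  by (simp add: quad_def mone_def sqn_def power2_eq_square if_distrib if_distribR cong: if_cong)

lemma sqn_nonneg [simp]: "0 \<le> sqn I u" by (simp add: sqn_def sum_nonneg)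

lemma psd_mone: "finite I \<Longrightarrow> psd I (mone I)"
  by (auto simp: psd_def quad_mone) (auto simp: mone_def)

lemma psd_mtp: "msupp I A \<Longrightarrow> psd I A \<Longrightarrow> mtp A = A"
  by (auto simp: psd_def mtp_def msupp_def fun_eq_iff) metis

lemma psd_mpow:
  assumes "finite I" "msupp I A" "psd I A"
  shows "psd I (mpow I A m)"
proof -
  have tp: "mtp (mpow I A k) = mpow I A k" for k
    using mtp_mpow[OF assms(1,2) psd_mtp] assms by auto
  \<comment> \<open>An even power is \<open>A^k A^k\<close>, an odd one \<open>A^k A A^k\<close>; as
    \<open>A^k\<close> is symmetric, both are congruences by \<open>A^k\<close> of a positive
    semidefinite matrix.\<close>
  define k where "k = m div 2"
  have "m = k + k \<or> m = k + Suc k"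
    unfolding k_def by presburger
  then show ?thesis
  proof
    assume "m = k + k"
    then have "mpow I A m = mm I (mm I (mtp (mpow I A k)) (mone I)) (mpow I A k)"
      using assms by (simp add: tp mpow_add)
    then show ?thesis using psd_conj[OF psd_mone[OF assms(1)]] by simp
  next
    assume "m = k + Suc k"
    then have "mpow I A m = mm I (mm I (mtp (mpow I A k)) A) (mpow I A k)"
      using mpow_add[OF assms(1,2), of k "Suc k"] by (simp add: tp mm_assoc)
    then show ?thesis using psd_conj[OF assms(3)] by simp
  qed
qed

lemma quad_insert:
  assumes "finite I" "a \<notin> I" "\<And>j. j \<in> I \<Longrightarrow> G j a = G a j"
  shows "quad (insert a I) G u = (u a)\<^sup>2 * G a a + 2 * u a * (\<Sum>j\<in>I. G a j * u j) + quad I G u"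
proof -
  have "quad (insert a I) G u = u a * G a a * u a + (\<Sum>j\<in>I. u a * G a j * u j)
      + (\<Sum>i\<in>I. u i * G i a * u a) + quad I G u"
    using assms(1,2) by (simp add: quad_def sum.distrib)
  also have "(\<Sum>i\<in>I. u i * G i a * u a) = (\<Sum>j\<in>I. u a * G a j * u j)"
    using assms(3) by (intro sum.cong) auto
  finally show ?thesis by (simp add: power2_eq_square sum_distrib_left mult_ac)
qed

text \<open>Elimination of one row at a time. Gram factorizations stand in for an eigenvalue
  decomposition: they give the trace inequalities below and, applied to coefficient matrices,
  explicit squares of polynomials.\<close>

lemma psd_cholesky:
  assumes "finite I" "psd I G"
  shows "\<exists>(k::nat) L. \<forall>i\<in>I. \<forall>j\<in>I. G i j = (\<Sum>r<k. L r i * L r j)"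
  using assms
proof (induction I arbitrary: G rule: finite_induct)
  case (insert a I)
  have sym: "G j i = G i j" if "i \<in> insert a I" "j \<in> insert a I" for i j
    using insert.prems that by (auto simp: psd_def)
  have q: "quad (insert a I) G u = (u a)\<^sup>2 * G a a + 2 * u a * (\<Sum>j\<in>I. G a j * u j) + quad I G u" for u
    using insert.hyps sym by (intro quad_insert) auto
  have pos: "0 \<le> (u a)\<^sup>2 * G a a + 2 * u a * (\<Sum>j\<in>I. G a j * u j) + quad I G u" for u
  proof -
    have "0 \<le> quad (insert a I) G u" using insert.prems unfolding psd_def by blast
    then show ?thesis unfolding q .
  qed
  have quad0: "quad I G (u(a := t)) = quad I G u" for u t
    using insert.hyps by (intro quad_cong) auto
  have sum0: "(\<Sum>j\<in>I. G a j * (u(a := t)) j) = (\<Sum>j\<in>I. G a j * u j)" for u t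
    using insert.hyps by (intro sum.cong) auto
  have pos': "0 \<le> t\<^sup>2 * G a a + 2 * t * (\<Sum>j\<in>I. G a j * u j) + quad I G u" for u t
    using pos[of "u(a := t)"] unfolding quad0 sum0 by simp
  have p0: "0 \<le> G a a" using pos'[of 1 "\<lambda>_. 0"] by (simp add: quad_def)
  show ?case
  proof (cases "G a a = 0")
    case True
    \<comment> \<open>A zero pivot forces a zero row: otherwise the form would be affine and
      nonconstant in the coordinate at \<open>a\<close>, hence negative somewhere.\<close>
    have z: "G a j = 0" if "j \<in> I" for j
    proof -
      define u where "u = (\<lambda>i. if i = j then 1 else 0 :: real)"
      have s: "(\<Sum>i\<in>I. G a i * u i) = G a j"
        using that insert.hyps by (simp add: u_def if_distrib cong: if_cong)
      have h: "0 \<le> 2 * t * G a j + quad I G u" for t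
        using pos'[of t u] True by (simp add: s)
      show ?thesis
      proof (rule ccontr)
        assume nz: "G a j \<noteq> 0"
        have "2 * (- (quad I G u + 1) / (2 * G a j)) * G a j = - (quad I G u + 1)"
          using nz by (simp add: field_simps)
        then show False using h[of "- (quad I G u + 1) / (2 * G a j)"] by linarith
      qed
    qed
    have "psd I G" unfolding psd_def
    proof (intro conjI ballI allI)
      fix u show "0 \<le> quad I G u" using pos'[of 0 u] by simp
    qed (use sym in auto)
    then obtain k L where L: "\<forall>i\<in>I. \<forall>j\<in>I. G i j = (\<Sum>r<(k::nat). L r i * L r j)"
      using insert.IH by blast
    have "\<forall>i\<in>insert a I. \<forall>j\<in>insert a I. G i j = (\<Sum>r<k. (if i = a then 0 else L r i) * (if j = a then 0 else L r j))"
    proof (intro ballI)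
      fix i j assume ij: "i \<in> insert a I" "j \<in> insert a I"
      show "G i j = (\<Sum>r<k. (if i = a then 0 else L r i) * (if j = a then 0 else L r j))"
      proof (cases "i = a \<or> j = a")
        case True
        have "(\<Sum>r<k. (if i = a then 0 else L r i) * (if j = a then 0 else L r j)) = 0"
          using True by (intro sum.neutral) auto
        moreover have "G i j = 0" using True z ij sym[OF ij] \<open>G a a = 0\<close> by auto
        ultimately show ?thesis by simp
      next
        case False
        then show ?thesis using L ij by auto
      qed
    qed
    then show ?thesis by (intro exI[of _ k] exI[of _ "\<lambda>r i. if i = a then 0 else L r i"])
  next
    case False
    define p where "p = G a a"
    have p: "p > 0" using p0 False by (simp add: p_def)
    \<comment> \<open>The Schur complement. Its form is the minimum of the original form over the
      coordinate at \<open>a\<close>, attained at \<open>- S / p\<close>.\<close>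
    define G' where "G' = (\<lambda>i j. G i j - G a i * G a j / p)"
    have "psd I G'" unfolding psd_def
    proof (intro conjI ballI allI)
      fix i j assume "i \<in> I" "j \<in> I" then show "G' i j = G' j i"
        using sym[of i j] by (simp add: G'_def mult.commute)
    next
      fix u :: "'a \<Rightarrow> real"
      define S where "S = (\<Sum>j\<in>I. G a j * u j)"
      have "quad I G' u = quad I G u - S\<^sup>2 / p"
      proof -
        have "u i * G' i j * u j = u i * G i j * u j - (G a i * u i) * (G a j * u j) / p" for i j
          by (simp add: G'_def algebra_simps)
        then have "quad I G' u = quad I G u - (\<Sum>i\<in>I. \<Sum>j\<in>I. (G a i * u i) * (G a j * u j) / p)"
          by (simp add: quad_def sum_subtractf)
        also have "(\<Sum>i\<in>I. \<Sum>j\<in>I. (G a i * u i) * (G a j * u j) / p) = S\<^sup>2 / p"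
          by (simp only: S_def power2_eq_square sum_product sum_divide_distrib)
        finally show ?thesis .
      qed
      moreover have "(- S / p)\<^sup>2 * p + 2 * (- S / p) * S = - S\<^sup>2 / p"
        using p by (simp add: power2_eq_square field_simps)
      ultimately show "0 \<le> quad I G' u" using pos'[of "- S / p" u] by (simp add: p_def S_def)
    qed
    then obtain k L where L: "\<forall>i\<in>I. \<forall>j\<in>I. G' i j = (\<Sum>r<(k::nat). L r i * L r j)"
      using insert.IH by blast
    define L' where "L' = (\<lambda>r i. case r of 0 \<Rightarrow> G a i / sqrt p | Suc s \<Rightarrow> if i = a then 0 else L s i)"
    have e: "(\<Sum>r<Suc k. L' r i * L' r j) = G a i * G a j / p + (\<Sum>r<k. (if i = a then 0 else L r i) * (if j = a then 0 else L r j))" for i j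
      using p by (subst sum.lessThan_Suc_shift) (simp add: L'_def)
    have "\<forall>i\<in>insert a I. \<forall>j\<in>insert a I. G i j = (\<Sum>r<Suc k. L' r i * L' r j)"
    proof (intro ballI)
      fix i j assume ij: "i \<in> insert a I" "j \<in> insert a I"
      show "G i j = (\<Sum>r<Suc k. L' r i * L' r j)"
      proof (cases "i = a \<or> j = a")
        case True
        then have "G a i * G a j / p = G i j" using p sym[OF ij] by (auto simp: p_def)
        moreover have "(\<Sum>r<k. (if i = a then 0 else L r i) * (if j = a then 0 else L r j)) = 0"
          using True by (intro sum.neutral) auto
        ultimately show ?thesis unfolding e by simp
      next
        case False
        then have "G' i j = (\<Sum>r<k. L r i * L r j)" using L ij by auto
        then show ?thesis using False unfolding e by (simp add: G'_def)
      qed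
    qed
    then show ?thesis by blast
  qed
qed auto

lemma quad_gram:
  assumes "\<And>i j. i \<in> I \<Longrightarrow> j \<in> I \<Longrightarrow> G i j = (\<Sum>r\<in>R. L r i * L r j)"
  shows "quad I G u = (\<Sum>r\<in>R. (\<Sum>i\<in>I. L r i * u i)\<^sup>2)"
proof -
  have "quad I G u = (\<Sum>i\<in>I. \<Sum>j\<in>I. \<Sum>r\<in>R. (L r i * u i) * (L r j * u j))"
    unfolding quad_def by (intro sum.cong refl) (simp add: assms sum_distrib_left sum_distrib_right mult_ac)
  also have "\<dots> = (\<Sum>i\<in>I. \<Sum>r\<in>R. \<Sum>j\<in>I. (L r i * u i) * (L r j * u j))"
    by (intro sum.cong refl sum.swap)
  also have "\<dots> = (\<Sum>r\<in>R. \<Sum>i\<in>I. \<Sum>j\<in>I. (L r i * u i) * (L r j * u j))"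
    by (rule sum.swap)
  finally show ?thesis by (simp add: power2_eq_square sum_product)
qed

lemma psd_gram:
  assumes "\<And>i j. i \<in> I \<Longrightarrow> j \<in> I \<Longrightarrow> G i j = (\<Sum>r\<in>R. L r i * L r j)"
  shows "psd I G"
  unfolding psd_def using assms by (simp add: quad_gram[OF assms] sum_nonneg mult.commute)

lemma mtr_mm_gram:
  assumes "\<And>i j. i \<in> I \<Longrightarrow> j \<in> I \<Longrightarrow> C i j = (\<Sum>r\<in>R. L r i * L r j)"
  shows "mtr I (mm I B C) = (\<Sum>r\<in>R. quad I B (L r))"
proof -
  have "mtr I (mm I B C) = (\<Sum>i\<in>I. \<Sum>j\<in>I. \<Sum>r\<in>R. L r i * B i j * L r j)"
    unfolding mtr_def mm_def by (intro sum.cong refl) (simp add: assms sum_distrib_left mult_ac)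
  also have "\<dots> = (\<Sum>i\<in>I. \<Sum>r\<in>R. \<Sum>j\<in>I. L r i * B i j * L r j)"
    by (intro sum.cong refl sum.swap)
  also have "\<dots> = (\<Sum>r\<in>R. \<Sum>i\<in>I. \<Sum>j\<in>I. L r i * B i j * L r j)" by (rule sum.swap)
  finally show ?thesis by (simp add: quad_def)
qed

lemma mtr_psd_mult_nonneg:
  assumes "finite I" "psd I B" "psd I C"
  shows "0 \<le> mtr I (mm I B C)"
proof -
  obtain k and L :: "nat \<Rightarrow> 'a \<Rightarrow> real" where L: "\<forall>i\<in>I. \<forall>j\<in>I. C i j = (\<Sum>r<(k::nat). L r i * L r j)"
    using psd_cholesky[OF assms(1,3)] by blast
  have "mtr I (mm I B C) = (\<Sum>r<k. quad I B (L r))" using L by (intro mtr_mm_gram) auto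
  then show ?thesis using assms(2) by (simp add: psd_def sum_nonneg)
qed

lemma psd_cauchy_schwarz:
  assumes "finite I" "psd I B"
  shows "(\<Sum>i\<in>I. \<Sum>j\<in>I. u i * B i j * v j)\<^sup>2 \<le> quad I B u * quad I B v"
proof -
  obtain k and L :: "nat \<Rightarrow> 'a \<Rightarrow> real" where L: "\<forall>i\<in>I. \<forall>j\<in>I. B i j = (\<Sum>r<(k::nat). L r i * L r j)"
    using psd_cholesky[OF assms] by blast
  have q: "quad I B w = (\<Sum>r<k. (\<Sum>i\<in>I. L r i * w i)\<^sup>2)" for w
    using L by (intro quad_gram) auto
  have "(\<Sum>i\<in>I. \<Sum>j\<in>I. u i * B i j * v j) = (\<Sum>i\<in>I. \<Sum>j\<in>I. \<Sum>r<k. (L r i * u i) * (L r j * v j))"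
    using L by (intro sum.cong refl) (simp add: sum_distrib_left sum_distrib_right mult_ac)
  also have "\<dots> = (\<Sum>i\<in>I. \<Sum>r<k. \<Sum>j\<in>I. (L r i * u i) * (L r j * v j))"
    by (intro sum.cong refl sum.swap)
  also have "\<dots> = (\<Sum>r<k. \<Sum>i\<in>I. \<Sum>j\<in>I. (L r i * u i) * (L r j * v j))" by (rule sum.swap)
  also have "\<dots> = (\<Sum>r<k. (\<Sum>i\<in>I. L r i * u i) * (\<Sum>i\<in>I. L r i * v i))" by (simp add: sum_product)
  finally show ?thesis unfolding q by (simp only: Cauchy_Schwarz_ineq_sum)
qed

lemma quad_le_mtr:
  assumes "finite I" "psd I B"
  shows "quad I B u \<le> mtr I B * sqn I u"
proof -
  obtain k and L :: "nat \<Rightarrow> 'a \<Rightarrow> real" where L: "\<forall>i\<in>I. \<forall>j\<in>I. B i j = (\<Sum>r<(k::nat). L r i * L r j)"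
    using psd_cholesky[OF assms] by blast
  have "quad I B u = (\<Sum>r<k. (\<Sum>i\<in>I. L r i * u i)\<^sup>2)" using L by (intro quad_gram) auto
  also have "\<dots> \<le> (\<Sum>r<k. (\<Sum>i\<in>I. (L r i)\<^sup>2) * sqn I u)"
    unfolding sqn_def by (intro sum_mono Cauchy_Schwarz_ineq_sum)
  also have "\<dots> = mtr I B * sqn I u"
    using L by (simp add: mtr_def sum_distrib_right[symmetric] power2_eq_square) (subst sum.swap, simp)
  finally show ?thesis .
qed

lemma mv_quad: "(\<Sum>i\<in>I. v i * mv I P u i) = (\<Sum>i\<in>I. \<Sum>j\<in>I. v i * P i j * u j)"
  by (simp add: mv_def sum_distrib_left mult.assoc)

text \<open>Cauchy-Schwarz for the form \<open>P\<close> at the pair \<open>P u\<close>,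
  \<open>u\<close> bounds \<open>|P u|^4\<close> by the product of the two values of the form; the
  hypothesis bounds the first by \<open>\<rho> |P u|^2\<close>, and one factor
  \<open>|P u|^2\<close> cancels.\<close>

lemma sqn_mv_le:
  assumes "finite I" "psd I P" "\<And>u. quad I P u \<le> \<rho> * sqn I u"
  shows "sqn I (mv I P u) \<le> \<rho> * quad I P u"
proof -
  let ?s = "sqn I (mv I P u)"
  have "?s = (\<Sum>i\<in>I. mv I P u i * mv I P u i)" by (simp add: sqn_def power2_eq_square)
  also have "\<dots> = (\<Sum>i\<in>I. \<Sum>j\<in>I. mv I P u i * P i j * u j)" by (rule mv_quad)
  finally have "?s\<^sup>2 \<le> quad I P (mv I P u) * quad I P u"
    using psd_cauchy_schwarz[OF assms(1,2), of "mv I P u" u] by simp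
  also have "\<dots> \<le> \<rho> * ?s * quad I P u"
    using assms(2,3) by (intro mult_right_mono) (auto simp: psd_def)
  finally have h: "?s * ?s \<le> ?s * (\<rho> * quad I P u)" by (simp add: power2_eq_square mult_ac)
  show ?thesis
  proof (cases "?s = 0")
    case False
    then have "0 < ?s" using sqn_nonneg[of I "mv I P u"] by linarith
    then show ?thesis using h by simp
  next
    case True
    show ?thesis
    proof (cases "\<rho> \<ge> 0")
      case True then show ?thesis using \<open>?s = 0\<close> assms(2) by (auto simp: psd_def)
    next
      case False
      then have "quad I P u \<le> 0" using assms(3)[of u] sqn_nonneg[of I u]
        by (meson mult_nonneg_nonneg mult_nonpos_nonneg not_less order_trans less_imp_le linorder_not_le)
      then show ?thesis using \<open>?s = 0\<close> False by (simp add: mult_nonpos_nonpos)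
    qed
  qed
qed

lemma psd_sub_square:
  assumes "finite I" "msupp I P" "psd I P" "\<And>u. quad I P u \<le> \<rho> * sqn I u"
  shows "psd I (\<lambda>i j. \<rho> * P i j - mm I P P i j)"
proof -
  have tp: "mtp P = P" using psd_mtp assms by auto
  have e: "mm I P P = mm I (mm I (mtp P) (mone I)) P" using assms by (simp add: tp)
  have "quad I (\<lambda>i j. \<rho> * P i j - mm I P P i j) u = \<rho> * quad I P u - quad I (mm I P P) u" for u
    by (simp add: quad_def algebra_simps sum_subtractf sum_distrib_left)
  moreover have "quad I (mm I P P) u = sqn I (mv I P u)" for u
    unfolding e quad_mv using assms by (simp add: quad_mone)
  moreover have "psd I (mm I P P)" unfolding e by (intro psd_conj psd_mone assms)
  ultimately show ?thesis using sqn_mv_le[OF assms(1,3,4)] assms(3) by (simp add: psd_def)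
qed

section \<open>Traces of powers under a positive semidefinite perturbation\<close>

lemma convex_le_ends:
  fixes g :: "nat \<Rightarrow> real"
  assumes "\<And>t. t + 2 \<le> n \<Longrightarrow> 2 * g (t + 1) \<le> g t + g (t + 2)" "t \<le> n"
  shows "g t \<le> max (g 0) (g n)"
proof -
  have up: "g (t + 1) \<le> g (t + 2)" if "g t \<le> g (t + 1)" "t + 2 \<le> n" for t
    using assms(1)[OF that(2)] that(1) by linarith
  have mono: "g t \<le> g (t + k)" if "g t \<le> g (t + 1)" "t + k \<le> n" for t k
  proof -
    have "g t \<le> g (t + k) \<and> (t + k + 1 \<le> n \<longrightarrow> g (t + k) \<le> g (t + k + 1))"
      using that(2) by (induction k) (use that(1) up in \<open>force simp: add.assoc\<close>)+
    then show ?thesis by simp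
  qed
  have "g t \<le> g 0 \<or> (t < n \<longrightarrow> g t \<le> g (t + 1))" if "t \<le> n" for t
    using that
  proof (induction t)
    case (Suc t)
    show ?case
    proof (cases "g t \<le> g (t + 1)")
      case True then show ?thesis using up[of t] Suc.prems by auto
    next
      case False
      then have "g t \<le> g 0" using Suc by auto
      then show ?thesis using False by auto
    qed
  qed simp
  then show ?thesis
    using assms(2) mono[of t "n - t"] by (cases "t = n") fastforce+
qed

lemma trace_pert:
  fixes I :: "'i set"
  assumes fin: "finite I" and A: "msupp I A" "psd I A" and P: "msupp I P" "psd I P"
    and \<rho>: "\<And>u. quad I P u \<le> \<rho> * sqn I u" "0 \<le> \<rho>"
    and X: "X = (\<lambda>i j. A i j + P i j)"
  shows "mtr I (mm I P (mpow I X (Suc m))) \<le> mtr I (mm I P (mpow I A (Suc m)))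
      + real (Suc m) * \<rho> * (mtr I (mm I P (mpow I A m)) + mtr I (mm I P (mpow I X m)))"
proof -
  have Xs: "msupp I X" unfolding X using A P by simp
  have Xp: "psd I X"
    using A P unfolding X psd_def quad_def by (simp add: algebra_simps sum.distrib)
  have tpA: "mtp A = A" and tpP: "mtp P = P" and tpX: "mtp X = X"
    using psd_mtp A P Xs Xp by auto
  define e where "e = (\<lambda>t. mtr I (mm I P (mm I (mpow I A t) (mpow I X (Suc m - t)))))"
  define g where "g = (\<lambda>t. mtr I (mm I P (mm I (mpow I A t) (mm I P (mpow I X (m - t))))))"
  have X': "mm I X Z = (\<lambda>i j. mm I A Z i j + mm I P Z i j)" for Z by (simp add: X mm_add_left)
  have step: "e t - e (Suc t) = g t" if "t < Suc m" for t
  proof -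
    have s: "Suc m - t = Suc (m - t)" using that by simp
    have "e t = mtr I (mm I P (mm I (mpow I A t) (mm I A (mpow I X (m - t))))) + g t"
      unfolding e_def g_def s mpow.simps X' by (simp add: mm_add_right mtr_add)
    also have "mm I (mpow I A t) (mm I A (mpow I X (m - t))) = mm I (mpow I A (Suc t)) (mpow I X (Suc m - Suc t))"
      using mpow_Suc_right[OF fin A(1), of t] by (simp add: mm_assoc[symmetric] del: mpow.simps)
    finally show ?thesis by (simp add: e_def)
  qed
  have tele: "e 0 - e (Suc m) = (\<Sum>t<Suc m. g t)"
    using step sum_lessThan_telescope'[of e "Suc m"] by (simp add: atLeast0LessThan)
  have conv: "2 * g (t + 1) \<le> g t + g (t + 2)" if t: "t + 2 \<le> m" for t
  proof -
    define y where "y = m - t - 2"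
    have my: "m - t = Suc (Suc y)" "m - (t + 1) = Suc y" "m - (t + 2) = y" using t by (auto simp: y_def)
    \<comment> \<open>With \<open>V = A P - P X\<close> the trace of \<open>V^T A^t V X^y\<close> is
      nonnegative and, by cyclicity, expands to
      \<open>g (t + 2) - 2 g (t + 1) + g t\<close>.\<close>
    define V where "V = (\<lambda>i j. mm I A P i j - mm I P X i j)"
    have tpV: "mtp V = (\<lambda>i j. mm I P A i j - mm I X P i j)"
      using arg_cong[OF mtp_mm, of "\<lambda>f. f", of I A P] arg_cong[OF mtp_mm, of "\<lambda>f. f", of I P X]
      by (simp add: tpA tpP tpX) (auto simp: V_def mtp_def fun_eq_iff)
    have "0 \<le> mtr I (mm I (mm I (mm I (mtp V) (mpow I A t)) V) (mpow I X y))"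
      by (intro mtr_psd_mult_nonneg psd_conj psd_mpow fin A Xs Xp)
    also have "mtr I (mm I (mm I (mm I (mtp V) (mpow I A t)) V) (mpow I X y)) =
       mtr I (mm I (mm I P A) (mm I (mpow I A t) (mm I (mm I A P) (mpow I X y))))
       - mtr I (mm I (mm I P A) (mm I (mpow I A t) (mm I (mm I P X) (mpow I X y))))
       - (mtr I (mm I (mm I X P) (mm I (mpow I A t) (mm I (mm I A P) (mpow I X y))))
       - mtr I (mm I (mm I X P) (mm I (mpow I A t) (mm I (mm I P X) (mpow I X y)))))"
      by (subst tpV, unfold V_def) (simp only: mm_assoc mm_diff_left mm_diff_right mtr_diff)
    also have "mtr I (mm I (mm I P A) (mm I (mpow I A t) (mm I (mm I A P) (mpow I X y)))) = g (t + 2)"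
    proof -
      have "mpow I A (t + 2) = mm I A (mm I (mpow I A t) A)"
        using mpow_Suc_right[OF fin A(1), of t] by simp
      then show ?thesis unfolding g_def my by (simp add: mm_assoc)
    qed
    also have "mtr I (mm I (mm I P A) (mm I (mpow I A t) (mm I (mm I P X) (mpow I X y)))) = g (t + 1)"
      unfolding g_def my by (simp add: mm_assoc)
    also have "mtr I (mm I (mm I X P) (mm I (mpow I A t) (mm I (mm I A P) (mpow I X y)))) = g (t + 1)"
    proof -
      have "mtr I (mm I (mm I X P) (mm I (mpow I A t) (mm I (mm I A P) (mpow I X y))))
        = mtr I (mm I X (mm I P (mm I (mm I (mpow I A t) A) (mm I P (mpow I X y)))))"
        by (simp add: mm_assoc)
      also have "\<dots> = mtr I (mm I P (mm I (mm I (mpow I A t) A) (mm I P (mm I (mpow I X y) X))))"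
        by (subst mtr_comm) (simp add: mm_assoc)
      finally show ?thesis unfolding g_def my mpow_Suc_right[OF fin A(1)] mpow_Suc_right[OF fin Xs] by simp
    qed
    also have "mtr I (mm I (mm I X P) (mm I (mpow I A t) (mm I (mm I P X) (mpow I X y)))) = g t"
    proof -
      have "mtr I (mm I (mm I X P) (mm I (mpow I A t) (mm I (mm I P X) (mpow I X y))))
        = mtr I (mm I X (mm I P (mm I (mpow I A t) (mm I P (mpow I X (Suc y))))))"
        by (simp add: mm_assoc)
      also have "\<dots> = mtr I (mm I P (mm I (mpow I A t) (mm I P (mm I (mpow I X (Suc y)) X))))"
        by (subst mtr_comm) (simp add: mm_assoc)
      finally show ?thesis unfolding g_def my mpow_Suc_right[OF fin Xs] by simp
    qed
    finally show ?thesis by simp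
  qed
  \<comment> \<open>At both ends of the range of \<open>t\<close> the two copies of \<open>P\<close>
    can be made adjacent, and \<open>P^2\<close> is at most \<open>\<rho> P\<close>.\<close>
  have sub: "mtr I (mm I (mm I P P) (mpow I Z m)) \<le> \<rho> * mtr I (mm I P (mpow I Z m))"
    if Z: "msupp I Z" "psd I Z" for Z
  proof -
    have "0 \<le> mtr I (mm I (\<lambda>i j. \<rho> * P i j - mm I P P i j) (mpow I Z m))"
      by (intro mtr_psd_mult_nonneg psd_sub_square psd_mpow fin P \<rho> Z)
    then show ?thesis by (simp add: mm_diff_left mtr_diff mm_scale_left mtr_scale)
  qed
  have g0: "g 0 \<le> \<rho> * mtr I (mm I P (mpow I X m))"
    using sub[OF Xs Xp] fin P Xs by (simp add: g_def mm_assoc)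
  have gm: "g m \<le> \<rho> * mtr I (mm I P (mpow I A m))"
  proof -
    have "g m = mtr I (mm I P (mm I (mpow I A m) P))" using fin P by (simp add: g_def)
    also have "\<dots> = mtr I (mm I (mm I P P) (mpow I A m))"
      by (subst mm_assoc[symmetric], subst mtr_comm) (simp add: mm_assoc)
    finally show ?thesis using sub[OF A] by simp
  qed
  have nn: "0 \<le> mtr I (mm I P (mpow I X m))" "0 \<le> mtr I (mm I P (mpow I A m))"
    by (intro mtr_psd_mult_nonneg psd_mpow fin P A Xs Xp)+
  have "g t \<le> \<rho> * (mtr I (mm I P (mpow I A m)) + mtr I (mm I P (mpow I X m)))" if "t < Suc m" for t
  proof -
    have "g t \<le> max (g 0) (g m)" using convex_le_ends[of m g t] conv that by simp
    also have "\<dots> \<le> \<rho> * mtr I (mm I P (mpow I A m)) + \<rho> * mtr I (mm I P (mpow I X m))"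
      using g0 gm mult_nonneg_nonneg[OF \<rho>(2) nn(1)] mult_nonneg_nonneg[OF \<rho>(2) nn(2)] by linarith
    finally show ?thesis by (simp add: algebra_simps)
  qed
  then have "(\<Sum>t<Suc m. g t) \<le> real (card {..<Suc m}) * (\<rho> * (mtr I (mm I P (mpow I A m)) + mtr I (mm I P (mpow I X m))))"
    by (intro sum_bounded_above) auto
  moreover have "e 0 = mtr I (mm I P (mpow I X (Suc m)))"
    unfolding e_def using fin Xs by (simp add: mm_assoc[symmetric] P del: mpow.simps(2))
  moreover have "e (Suc m) = mtr I (mm I P (mpow I A (Suc m)))"
    unfolding e_def using fin A by (simp del: mpow.simps(2))
  ultimately show ?thesis using tele by (simp add: mult.assoc)
qed

text \<open>Telescoping replaces \<open>X = A + P\<close> by \<open>A\<close> one factor at a time; each step costs a factor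
  \<open>\<rho>\<close>, and the mixed traces are bounded by the extreme ones by convexity in the exponent.\<close>

lemma trace_pert_iterated:
  assumes "finite I" "msupp I A" "psd I A" "msupp I P" "psd I P"
    and \<rho>: "\<And>u. quad I P u \<le> \<rho> * sqn I u" "0 \<le> \<rho>"
    and X: "X = (\<lambda>i j. A i j + P i j)" and "m \<le> q"
  shows "mtr I (mm I P (mpow I X m)) \<le> (\<Sum>t\<le>m. 2 * (real q * \<rho>) ^ t * mtr I (mm I P (mpow I A (m - t))))"
proof -
  let ?a = "\<lambda>m. mtr I (mm I P (mpow I A m))"
  let ?c = "real q * \<rho>"
  have na: "0 \<le> ?a k" for k by (intro mtr_psd_mult_nonneg psd_mpow assms)
  have Xp: "psd I X" "msupp I X"
    using assms unfolding X psd_def quad_def by (simp_all add: algebra_simps sum.distrib)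
  have nb: "0 \<le> mtr I (mm I P (mpow I X k))" for k by (intro mtr_psd_mult_nonneg psd_mpow assms Xp)
  \<comment> \<open>Weakening \<open>Suc m\<close> to \<open>q\<close> gives the recursion
    \<open>b (m + 1) <= a (m + 1) + c (a m + b m)\<close> a constant coefficient. The term
    \<open>a m\<close> occurs directly and again in the bound for \<open>b m\<close>, hence the
    factor 2.\<close>
  have "mtr I (mm I P (mpow I X m)) \<le> ?a m + (\<Sum>t<m. 2 * ?c ^ Suc t * ?a (m - Suc t))"
    using \<open>m \<le> q\<close>
  proof (induction m)
    case (Suc m)
    let ?b = "mtr I (mm I P (mpow I X m))"
    have "mtr I (mm I P (mpow I X (Suc m))) \<le> ?a (Suc m) + real (Suc m) * \<rho> * (?a m + ?b)"
      by (rule trace_pert[OF assms(1-5) \<rho> X])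
    also have "\<dots> \<le> ?a (Suc m) + ?c * (?a m + ?b)"
      using Suc.prems \<rho> na nb by (intro add_left_mono mult_right_mono) auto
    also have "\<dots> \<le> ?a (Suc m) + ?c * (?a m + (?a m + (\<Sum>t<m. 2 * ?c ^ Suc t * ?a (m - Suc t))))"
      using Suc \<rho> by (intro add_left_mono mult_left_mono) auto
    also have "\<dots> = ?a (Suc m) + (\<Sum>t<Suc m. 2 * ?c ^ Suc t * ?a (Suc m - Suc t))"
      unfolding sum.lessThan_Suc_shift[of _ m] by (simp add: algebra_simps sum_distrib_left)
    finally show ?case .
  qed simp
  also have "\<dots> \<le> 2 * ?a m + (\<Sum>t<m. 2 * ?c ^ Suc t * ?a (m - Suc t))" using na[of m] by simp
  also have "\<dots> = (\<Sum>t\<le>m. 2 * ?c ^ t * ?a (m - t))"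
    by (subst lessThan_Suc_atMost[symmetric], subst sum.lessThan_Suc_shift) simp
  finally show ?thesis .
qed

section \<open>The operator norm of a positive semidefinite matrix through traces of powers\<close>

definition mres :: "'i set \<Rightarrow> ('i \<Rightarrow> 'i \<Rightarrow> real) \<Rightarrow> 'i \<Rightarrow> 'i \<Rightarrow> real" where
  "mres I G = (\<lambda>i j. if i \<in> I \<and> j \<in> I then G i j else 0)"

lemma msupp_mres [simp]: "msupp I (mres I G)"
  by (simp add: msupp_def mres_def)

lemma quad_mres [simp]: "quad I (mres I G) u = quad I G u"
  by (intro quad_cong) (auto simp: mres_def)

lemma psd_mres [simp]: "psd I (mres I G) = psd I G"
  by (intro psd_cong) (auto simp: mres_def)

lemma mpow_mres:
  assumes "finite I" "i \<in> I"
  shows "mpow I (mres I G) m i j = mpow I G m i j"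
  using assms(2)
proof (induction m arbitrary: i)
  case (Suc m)
  have "mm I (mres I G) (mpow I (mres I G) m) i j = (\<Sum>k\<in>I. G i k * mpow I G m k j)"
    unfolding mm_def using Suc by (intro sum.cong) (auto simp: mres_def)
  then show ?case by (simp add: mm_def)
qed simp

lemma mtr_mpow_mres: "finite I \<Longrightarrow> mtr I (mpow I (mres I G) m) = mtr I (mpow I G m)"
  by (simp add: mtr_def mpow_mres)

text \<open>The operator norm of a positive semidefinite matrix, as an infimum over countably many polynomial
  expressions in the entries, which makes it measurable.\<close>

definition nrm :: "'i set \<Rightarrow> ('i \<Rightarrow> 'i \<Rightarrow> real) \<Rightarrow> real" where
  "nrm I G = (INF k\<in>{1..}. root k (mtr I (mpow I G k)))"

lemma mtr_nonneg:
  assumes "finite I" "psd I B" shows "0 \<le> mtr I B"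
proof -
  have "0 \<le> mtr I (mm I (mres I B) (mone I))"
    by (intro mtr_psd_mult_nonneg psd_mone) (use assms in auto)
  then have "0 \<le> mtr I (mres I B)" using assms by simp
  then show ?thesis by (simp add: mtr_def mres_def)
qed

lemma mtr_mpow_nonneg:
  assumes "finite I" "psd I G" shows "0 \<le> mtr I (mpow I G k)"
  using mtr_nonneg[of I "mpow I (mres I G) k"] psd_mpow[of I "mres I G" k] assms
  by (simp add: mtr_mpow_mres)

lemma nrm_bdd: "finite I \<Longrightarrow> psd I G \<Longrightarrow> bdd_below ((\<lambda>k. root k (mtr I (mpow I G k))) ` {1..})"
  by (intro bdd_belowI[of _ 0]) (auto simp: mtr_mpow_nonneg)

lemma nrm_nonneg: "finite I \<Longrightarrow> psd I G \<Longrightarrow> 0 \<le> nrm I G"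
  unfolding nrm_def by (intro cINF_greatest) (auto simp: mtr_mpow_nonneg)

lemma nrm_power_le:
  assumes "finite I" "psd I G" "1 \<le> k"
  shows "nrm I G ^ k \<le> mtr I (mpow I G k)"
proof -
  have "nrm I G \<le> root k (mtr I (mpow I G k))"
    unfolding nrm_def using assms by (intro cINF_lower nrm_bdd) auto
  then have "nrm I G ^ k \<le> root k (mtr I (mpow I G k)) ^ k"
    using assms by (intro power_mono nrm_nonneg)
  then show ?thesis using assms by (simp add: mtr_mpow_nonneg)
qed

text \<open>The numbers \<open>q k = u^T G^k u\<close> are log-convex by Cauchy-Schwarz, so the
  ratios \<open>q (k + 1) / q k\<close> are at least the first one, which is
  \<open>u^T G u\<close>.\<close>

lemma quad_power_le:
  assumes fin: "finite I" and G: "msupp I G" "psd I G" and u: "sqn I u = 1"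
  shows "quad I G u ^ k \<le> quad I (mpow I G k) u"
proof -
  define q where "q = (\<lambda>k. quad I (mpow I G k) u)"
  have q0: "q 0 = 1" using fin u by (simp add: q_def quad_mone)
  have q1: "q 1 = quad I G u" using fin G by (simp add: q_def)
  have nn: "0 \<le> q k" for k using psd_mpow[OF fin G] by (simp add: q_def psd_def)
  have tpG: "mtp G = G" using psd_mtp G by auto
  have cs: "(q (Suc k))\<^sup>2 \<le> q k * q (Suc (Suc k))" for k
  proof -
    have "(\<Sum>i\<in>I. \<Sum>j\<in>I. u i * mpow I G k i j * mv I G u j) = q (Suc k)"
    proof -
      have "(\<Sum>j\<in>I. u i * mpow I G k i j * mv I G u j) = (\<Sum>j\<in>I. u i * mm I (mpow I G k) G i j * u j)" for i
      proof -
        have "(\<Sum>j\<in>I. u i * mpow I G k i j * mv I G u j) = (\<Sum>j\<in>I. \<Sum>l\<in>I. u i * mpow I G k i j * G j l * u l)"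
          by (simp add: mv_def sum_distrib_left mult.assoc)
        also have "\<dots> = (\<Sum>l\<in>I. \<Sum>j\<in>I. u i * mpow I G k i j * G j l * u l)" by (rule sum.swap)
        finally show ?thesis by (simp add: mm_def sum_distrib_left sum_distrib_right mult.assoc)
      qed
      then show ?thesis by (simp only: q_def quad_def mpow_Suc_right[OF fin G(1)])
    qed
    moreover have "quad I (mpow I G k) (mv I G u) = q (Suc (Suc k))"
    proof -
      have "quad I (mpow I G k) (mv I G u) = quad I (mm I (mm I (mtp G) (mpow I G k)) G) u"
        by (simp add: quad_mv)
      also have "mm I (mm I (mtp G) (mpow I G k)) G = mpow I G (Suc (Suc k))"
        using mpow_Suc_right[OF fin G(1), of "Suc k"] by (simp add: tpG)
      finally show ?thesis by (simp add: q_def)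
    qed
    ultimately show ?thesis
      using psd_cauchy_schwarz[OF fin psd_mpow[OF fin G], of u k "mv I G u"] by (simp add: q_def)
  qed
  show ?thesis
  proof (cases "q 1 = 0")
    case True
    then show ?thesis using nn[of k] q0 q1 by (cases k) (auto simp: q_def)
  next
    case False
    then have p1: "0 < q 1" using nn[of 1] by linarith
    have "0 < q k \<and> q k * q 1 \<le> q (Suc k)" for k
    proof (induction k)
      case 0 then show ?case using q0 by simp
    next
      case (Suc k)
      have pos: "0 < q (Suc k)" using Suc p1 by (meson mult_pos_pos order_less_le_trans)
      have "q (Suc k) * (q k * q 1) \<le> (q (Suc k))\<^sup>2"
        using Suc pos by (simp add: power2_eq_square)
      also have "\<dots> \<le> q k * q (Suc (Suc k))" by (rule cs)
      finally have "q k * (q (Suc k) * q 1) \<le> q k * q (Suc (Suc k))" by (simp add: mult_ac)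
      then show ?case using Suc pos by simp
    qed note st = this
    have "q 1 ^ k \<le> q k"
    proof (induction k)
      case (Suc k)
      have "q 1 ^ Suc k \<le> q k * q 1" using Suc p1 by (simp add: mult.commute)
      then show ?case using st[of k] by linarith
    qed (simp add: q0)
    then show ?thesis by (simp add: q_def fin G)
  qed
qed

text \<open>For a unit vector the \<open>k\<close>-th power of the form is at most the form of
  \<open>G^k\<close>, hence at most \<open>tr G^k\<close>; so every root in the infimum is an upper
  bound.\<close>

lemma quad_le_nrm:
  assumes "finite I" "psd I G"
  shows "quad I G u \<le> nrm I G * sqn I u"
proof (cases "sqn I u = 0")
  case True
  then have "u i = 0" if "i \<in> I" for i using assms(1) that by (auto simp: sqn_def sum_nonneg_eq_0_iff)
  then show ?thesis using True by (simp add: quad_def)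
next
  case False
  then have sp: "0 < sqn I u" using sqn_nonneg[of I u] by linarith
  define v where "v = (\<lambda>i. u i / sqrt (sqn I u))"
  have qv: "quad I G v = quad I G u / sqn I u"
    using sp by (simp add: quad_def v_def sum_divide_distrib)
  have "(v i)\<^sup>2 = (u i)\<^sup>2 / sqn I u" for i
    using sp by (simp add: v_def power_divide)
  then have "sqn I v = sqn I u / sqn I u"
    by (simp add: sqn_def[of I v] sum_divide_distrib[symmetric]) (simp add: sqn_def)
  then have sv: "sqn I v = 1" using sp by simp
  have "quad I G v \<le> root k (mtr I (mpow I G k))" if k: "1 \<le> k" for k
  proof -
    have "quad I (mres I G) v ^ k \<le> quad I (mpow I (mres I G) k) v"
      by (intro quad_power_le) (use assms sv in auto)
    also have "\<dots> \<le> mtr I (mpow I (mres I G) k) * sqn I v"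
      by (intro quad_le_mtr psd_mpow) (use assms in auto)
    finally have "quad I G v ^ k \<le> mtr I (mpow I G k)" using assms sv by (simp add: mtr_mpow_mres)
    then have "root k (quad I G v ^ k) \<le> root k (mtr I (mpow I G k))" using k by (intro real_root_le_mono) auto
    moreover have "0 \<le> quad I G v" using assms by (simp add: psd_def)
    ultimately show ?thesis using k by (simp add: real_root_power_cancel)
  qed
  then have "quad I G v \<le> nrm I G"
    unfolding nrm_def by (intro cINF_greatest) auto
  then show ?thesis unfolding qv using sp by (simp add: field_simps)
qed

lemma mpow_measurable [measurable]:
  assumes "finite I" "\<And>i j. i \<in> I \<Longrightarrow> j \<in> I \<Longrightarrow> (\<lambda>x. G x i j) \<in> borel_measurable M" "i \<in> I" "j \<in> I"
  shows "(\<lambda>x. mpow I (G x) k i j) \<in> borel_measurable M"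
  using assms(3,4)
proof (induction k arbitrary: i)
  case (Suc k)
  then show ?case using assms(2) by (auto simp: mm_def intro!: borel_measurable_sum borel_measurable_times)
qed simp

lemma mtr_mpow_measurable:
  assumes "finite I" "\<And>i j. i \<in> I \<Longrightarrow> j \<in> I \<Longrightarrow> (\<lambda>x. G x i j) \<in> borel_measurable M"
  shows "(\<lambda>x. mtr I (mpow I (G x) k)) \<in> borel_measurable M"
  unfolding mtr_def using assms by (intro borel_measurable_sum mpow_measurable) auto

lemma nrm_measurable:
  assumes "finite I" "\<And>i j. i \<in> I \<Longrightarrow> j \<in> I \<Longrightarrow> (\<lambda>x. G x i j) \<in> borel_measurable M"
  shows "(\<lambda>x. nrm I (G x)) \<in> borel_measurable M"
proof -
  have [measurable]: "(\<lambda>x. mtr I (mpow I (G x) k)) \<in> borel_measurable M" for k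
    using mtr_mpow_measurable assms by blast
  show ?thesis unfolding nrm_def
    by (intro borel_measurable_cINF_real) (auto intro: borel_measurable_root)
qed

section \<open>Sums of independent positive semidefinite matrices\<close>

locale samples = prob_space \<mu> for \<mu> :: "'x measure" +
  fixes n :: nat
begin

abbreviation "Om \<equiv> (\<Pi>\<^sub>M i\<in>{..<n}. \<mu>)"

sublocale Om: prob_space Om
  by (intro prob_space_PiM) (rule prob_space_axioms)

sublocale Pr: product_sigma_finite "\<lambda>_. \<mu>"
  by (standard) 

lemma upd_measurable:
  assumes "i < n"
  shows "(\<lambda>(\<xi>, y). \<xi>(i := y)) \<in> measurable (Om \<Otimes>\<^sub>M \<mu>) Om"
  using measurable_add_dim[where I = "{..<n}" and i = i and M = "\<lambda>_. \<mu>"] assms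
  by (simp add: insert_absorb)

lemma resample1:
  assumes i: "i < n" and f: "f \<in> borel_measurable Om"
  shows "(\<integral>\<^sup>+\<xi>. f \<xi> \<partial>Om) = (\<integral>\<^sup>+\<xi>. \<integral>\<^sup>+y. f (\<xi>(i := y)) \<partial>\<mu> \<partial>Om)"
proof -
  let ?I = "{..<n} - {i}"
  have I: "finite ?I" "i \<notin> ?I" "{..<n} = insert i ?I" using i by auto
  have split: "(\<integral>\<^sup>+\<xi>. h \<xi> \<partial>Om) = (\<integral>\<^sup>+x. \<integral>\<^sup>+y. h (x(i := y)) \<partial>\<mu> \<partial>Pi\<^sub>M ?I (\<lambda>_. \<mu>))"
    if "h \<in> borel_measurable Om" for h
    using Pr.product_nn_integral_insert[OF I(1,2), of h] that I(3) by simp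
  define g where "g = (\<lambda>\<xi>. \<integral>\<^sup>+y. f (\<xi>(i := y)) \<partial>\<mu>)"
  have "(\<lambda>(\<xi>, y). f (\<xi>(i := y))) \<in> borel_measurable (Om \<Otimes>\<^sub>M \<mu>)"
    using measurable_compose[OF upd_measurable[OF i] f] by (simp add: case_prod_beta')
  then have gm: "g \<in> borel_measurable Om"
    unfolding g_def by (intro borel_measurable_nn_integral) (simp add: case_prod_beta')
  have "(\<integral>\<^sup>+\<xi>. g \<xi> \<partial>Om) = (\<integral>\<^sup>+x. \<integral>\<^sup>+y. g (x(i := y)) \<partial>\<mu> \<partial>Pi\<^sub>M ?I (\<lambda>_. \<mu>))"
    by (rule split[OF gm])
  also have "\<dots> = (\<integral>\<^sup>+x. g x \<partial>Pi\<^sub>M ?I (\<lambda>_. \<mu>))"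
    by (simp add: g_def emeasure_space_1)
  also have "\<dots> = (\<integral>\<^sup>+\<xi>. f \<xi> \<partial>Om)" unfolding g_def by (rule split[OF f, symmetric])
  finally show ?thesis by (simp add: g_def)
qed

definition mix :: "nat set \<Rightarrow> (nat \<Rightarrow> 'x) \<Rightarrow> (nat \<Rightarrow> 'x) \<Rightarrow> nat \<Rightarrow> 'x" where
  "mix J \<xi> \<xi>' = (\<lambda>i. if i \<in> J then \<xi>' i else \<xi> i)"

lemma mix_measurable:
  assumes "J \<subseteq> {..<n}"
  shows "(\<lambda>(\<xi>, \<xi>'). mix J \<xi> \<xi>') \<in> measurable (Om \<Otimes>\<^sub>M Om) Om"
proof -
  have "(\<lambda>(\<xi>, \<xi>'). \<lambda>i\<in>{..<n}. if i \<in> J then \<xi>' i else \<xi> i) \<in> measurable (Om \<Otimes>\<^sub>M Om) Om"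
    unfolding case_prod_beta' by (intro measurable_restrict) (auto split: if_splits)
  moreover have "(\<lambda>(\<xi>, \<xi>'). mix J \<xi> \<xi>') z = (\<lambda>(\<xi>, \<xi>'). \<lambda>i\<in>{..<n}. if i \<in> J then \<xi>' i else \<xi> i) z"
    if "z \<in> space (Om \<Otimes>\<^sub>M Om)" for z
    using that assms by (auto simp: space_pair_measure space_PiM mix_def fun_eq_iff PiE_def extensional_def split: prod.splits)
  ultimately show ?thesis by (simp cong: measurable_cong)
qed

text \<open>This is how conditioning is expressed: the coordinates in \<open>J\<close> are redrawn
  independently, and in the inner integral the coordinates outside \<open>J\<close> are
  constants.\<close>

lemma resample:
  assumes J: "J \<subseteq> {..<n}" and f: "f \<in> borel_measurable Om"
  shows "(\<integral>\<^sup>+\<xi>. f \<xi> \<partial>Om) = (\<integral>\<^sup>+\<xi>. \<integral>\<^sup>+\<xi>'. f (mix J \<xi> \<xi>') \<partial>Om \<partial>Om)"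
proof -
  have "finite J" using J finite_subset by blast
  then show ?thesis using J
  proof (induction J rule: finite_induct)
    case empty
    then show ?case by (simp add: mix_def Om.emeasure_space_1)
  next
    case (insert i J)
    then have i: "i < n" and J: "J \<subseteq> {..<n}" by auto
    have m2: "(\<lambda>(\<xi>, \<xi>'). f (mix J \<xi> \<xi>')) \<in> borel_measurable (Om \<Otimes>\<^sub>M Om)"
      using measurable_compose[OF mix_measurable[OF J] f] by (simp add: case_prod_beta')
    have up: "(\<lambda>\<xi>'. (\<xi>' (i := y))) \<in> measurable Om Om" if "y \<in> space \<mu>" for y
      using measurable_compose[OF measurable_Pair[OF measurable_ident measurable_const[OF that]] upd_measurable[OF i]] by simp
    define h where "h = (\<lambda>\<xi>. \<integral>\<^sup>+\<xi>'. f (mix J \<xi> \<xi>') \<partial>Om)"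
    have hm: "h \<in> borel_measurable Om"
      unfolding h_def using m2 by (intro Om.borel_measurable_nn_integral) (simp add: case_prod_beta')
    have "(\<integral>\<^sup>+\<xi>. f \<xi> \<partial>Om) = (\<integral>\<^sup>+\<xi>. h \<xi> \<partial>Om)"
      using insert.IH J by (simp add: h_def)
    also have "\<dots> = (\<integral>\<^sup>+\<xi>. \<integral>\<^sup>+y. h (\<xi>(i := y)) \<partial>\<mu> \<partial>Om)" by (rule resample1[OF i hm])
    also have "\<dots> = (\<integral>\<^sup>+\<xi>. \<integral>\<^sup>+\<xi>'. f (mix (insert i J) \<xi> \<xi>') \<partial>Om \<partial>Om)"
    proof (intro nn_integral_cong)
      fix \<xi> assume \<xi>: "\<xi> \<in> space Om"
      have fm: "(\<lambda>\<xi>'. f (mix (insert i J) \<xi> \<xi>')) \<in> borel_measurable Om"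
        using measurable_compose[OF measurable_Pair[OF measurable_const[OF \<xi>] measurable_ident]
          measurable_compose[OF mix_measurable[OF insert.prems] f]] by simp
      have fm2: "(\<lambda>(y, \<xi>'). f (mix J (\<xi>(i := y)) \<xi>')) \<in> borel_measurable (\<mu> \<Otimes>\<^sub>M Om)"
      proof -
        have "(\<lambda>z. \<xi>(i := fst z)) \<in> measurable (\<mu> \<Otimes>\<^sub>M Om) Om"
          using measurable_compose[OF measurable_Pair[OF measurable_const[OF \<xi>] measurable_fst] upd_measurable[OF i]] by simp
        from measurable_compose[OF measurable_Pair[OF this measurable_snd] m2]
        show ?thesis by (simp add: case_prod_beta')
      qed
      interpret P: pair_sigma_finite \<mu> Om ..
      have "(\<integral>\<^sup>+y. h (\<xi>(i := y)) \<partial>\<mu>) = (\<integral>\<^sup>+\<xi>'. \<integral>\<^sup>+y. f (mix J (\<xi>(i := y)) \<xi>') \<partial>\<mu> \<partial>Om)"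
        unfolding h_def using P.Fubini'[OF fm2] by simp
      also have "\<dots> = (\<integral>\<^sup>+\<xi>'. \<integral>\<^sup>+y. f (mix (insert i J) \<xi> (\<xi>'(i := y))) \<partial>\<mu> \<partial>Om)"
      proof -
        have "mix J (\<xi>(i := y)) \<xi>' = mix (insert i J) \<xi> (\<xi>'(i := y))" for y \<xi>'
          using insert.hyps by (auto simp: mix_def fun_eq_iff)
        then show ?thesis by simp
      qed
      also have "\<dots> = (\<integral>\<^sup>+\<xi>'. f (mix (insert i J) \<xi> \<xi>') \<partial>Om)"
        by (rule resample1[OF i fm, symmetric])
      finally show "(\<integral>\<^sup>+y. h (\<xi>(i := y)) \<partial>\<mu>) = (\<integral>\<^sup>+\<xi>'. f (mix (insert i J) \<xi> \<xi>') \<partial>Om)" .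
    qed
    finally show ?case .
  qed
qed

section \<open>Trace moments of sums of independent positive semidefinite matrices\<close>

text \<open>A Gram factorization of \<open>B\<close> turns the trace into a sum of quadratic forms
  of \<open>P\<close>, so a hypothesis about single vectors \<open>u\<close> suffices.\<close>

lemma trace_mult_integral:
  assumes fin: "finite I" and B: "psd I B"
    and Pm: "\<And>i j. i \<in> I \<Longrightarrow> j \<in> I \<Longrightarrow> (\<lambda>y. P y i j) \<in> borel_measurable \<mu>"
    and P: "\<And>y. psd I (P y)"
    and \<rho>m: "\<rho> \<in> borel_measurable \<mu>" and \<rho>0: "\<And>y. 0 \<le> \<rho> y"
    and hyp: "\<And>u. (\<integral>\<^sup>+y. ennreal (\<rho> y ^ t * quad I (P y) u) \<partial>\<mu>) \<le> ennreal (c * sqn I u)" and c: "0 \<le> c"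
  shows "(\<integral>\<^sup>+y. ennreal (\<rho> y ^ t * mtr I (mm I (P y) B)) \<partial>\<mu>) \<le> ennreal (c * mtr I B)"
proof -
  obtain k L where L: "\<forall>i\<in>I. \<forall>j\<in>I. B i j = (\<Sum>r<(k::nat). L r i * L r j)"
    using psd_cholesky[OF fin B] by blast
  have qm: "(\<lambda>y. quad I (P y) u) \<in> borel_measurable \<mu>" for u
    unfolding quad_def using Pm by (auto intro!: borel_measurable_sum borel_measurable_times)
  have q0: "0 \<le> quad I (P y) u" for y u using P by (simp add: psd_def)
  have "(\<integral>\<^sup>+y. ennreal (\<rho> y ^ t * mtr I (mm I (P y) B)) \<partial>\<mu>) = (\<integral>\<^sup>+y. (\<Sum>r<k. ennreal (\<rho> y ^ t * quad I (P y) (L r))) \<partial>\<mu>)"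
  proof (intro nn_integral_cong)
    fix y
    have "mtr I (mm I (P y) B) = (\<Sum>r<k. quad I (P y) (L r))" using L by (intro mtr_mm_gram) auto
    then show "ennreal (\<rho> y ^ t * mtr I (mm I (P y) B)) = (\<Sum>r<k. ennreal (\<rho> y ^ t * quad I (P y) (L r)))"
      using q0 \<rho>0 by (subst sum_ennreal) (auto simp: sum_distrib_left)
  qed
  also have "\<dots> = (\<Sum>r<k. \<integral>\<^sup>+y. ennreal (\<rho> y ^ t * quad I (P y) (L r)) \<partial>\<mu>)"
    using qm \<rho>m by (intro nn_integral_sum) auto
  also have "\<dots> \<le> (\<Sum>r<k. ennreal (c * sqn I (L r)))" by (intro sum_mono hyp)
  also have "\<dots> = ennreal (c * (\<Sum>r<k. sqn I (L r)))"
    using c by (subst sum_ennreal) (auto simp: sum_distrib_left)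
  also have "(\<Sum>r<k. sqn I (L r)) = mtr I B"
    using L by (simp add: mtr_def sqn_def power2_eq_square) (rule sum.swap)
  finally show ?thesis .
qed

lemma sum_P_measurable:
  assumes "J \<subseteq> {..<n}" "(\<lambda>y. P y i j) \<in> borel_measurable \<mu>"
  shows "(\<lambda>\<xi>. \<Sum>a\<in>J. P (\<xi> a) i j :: real) \<in> borel_measurable Om"
proof (intro borel_measurable_sum)
  fix a assume "a \<in> J"
  then have "(\<lambda>\<xi>. \<xi> a) \<in> measurable Om \<mu>" using assms by (intro measurable_component_singleton) auto
  from measurable_compose[OF this assms(2)] show "(\<lambda>\<xi>. P (\<xi> a) i j) \<in> borel_measurable Om" .
qed

lemma psd_sum: "(\<And>a. a \<in> J \<Longrightarrow> psd I (G a)) \<Longrightarrow> psd I (\<lambda>i j. \<Sum>a\<in>J. G a i j)"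
proof -
  assume h: "\<And>a. a \<in> J \<Longrightarrow> psd I (G a)"
  have "quad I (\<lambda>i j. \<Sum>a\<in>J. G a i j) u = (\<Sum>a\<in>J. quad I (G a) u)" for u
  proof -
    have "quad I (\<lambda>i j. \<Sum>a\<in>J. G a i j) u = (\<Sum>i\<in>I. \<Sum>j\<in>I. \<Sum>a\<in>J. u i * G a i j * u j)"
      by (simp add: quad_def sum_distrib_left sum_distrib_right)
    also have "\<dots> = (\<Sum>i\<in>I. \<Sum>a\<in>J. \<Sum>j\<in>I. u i * G a i j * u j)" by (intro sum.cong refl sum.swap)
    also have "\<dots> = (\<Sum>a\<in>J. \<Sum>i\<in>I. \<Sum>j\<in>I. u i * G a i j * u j)" by (rule sum.swap)
    finally show ?thesis by (simp add: quad_def)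
  qed
  then show ?thesis using h unfolding psd_def by (auto intro!: sum_nonneg sum.cong)
qed

text \<open>One factor of the power is expanded into its \<open>n\<close> summands, and the summand is then separated from
  the other factors by the perturbation bound, so that it is independent of what remains.\<close>

lemma psd_moment_aux:
  fixes P :: "'x \<Rightarrow> 'i \<Rightarrow> 'i \<Rightarrow> real"
  assumes fin: "finite I"
    and Pm: "\<And>i j. i \<in> I \<Longrightarrow> j \<in> I \<Longrightarrow> (\<lambda>y. P y i j) \<in> borel_measurable \<mu>"
    and P: "\<And>y. psd I (P y)" "\<And>y. msupp I (P y)"
    and \<rho>m: "\<rho> \<in> borel_measurable \<mu>" and \<rho>0: "\<And>y. 0 \<le> \<rho> y"
    and \<rho>: "\<And>y u. quad I (P y) u \<le> \<rho> y * sqn I u"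
    and hyp: "\<And>t u. t < q \<Longrightarrow> (\<integral>\<^sup>+y. ennreal (\<rho> y ^ t * quad I (P y) u) \<partial>\<mu>) \<le> ennreal (v * r ^ t * sqn I u)"
    and v: "0 \<le> v" and r: "0 \<le> r" and L: "0 < L" "4 * real n * v \<le> L" "2 * real q * r \<le> L"
    and J: "J \<subseteq> {..<n}" and m: "m \<le> q"
  shows "(\<integral>\<^sup>+\<xi>. ennreal (mtr I (mpow I (\<lambda>i j. \<Sum>a\<in>J. P (\<xi> a) i j) m)) \<partial>Om) \<le> ennreal (real (card I) * L ^ m)"
  using J m
\<comment> \<open>\<open>J\<close> varies because separating the summand of index \<open>a\<close>
  leaves the sum over \<open>J - {a}\<close>, to which the hypothesis is applied with the smaller
  exponents \<open>k - t\<close>.\<close>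
proof (induction m arbitrary: J rule: less_induct)
  case (less m)
  define S :: "nat set \<Rightarrow> (nat \<Rightarrow> 'x) \<Rightarrow> 'i \<Rightarrow> 'i \<Rightarrow> real" where "S = (\<lambda>J \<xi>. (\<lambda>i j. \<Sum>a\<in>J. P (\<xi> a) i j))"
  have Ss: "msupp I (S J \<xi>)" for J \<xi> using P(2) by (simp add: S_def msupp_def)
  have Sp: "psd I (S J \<xi>)" for J \<xi> unfolding S_def by (intro psd_sum P)
  show ?case
  proof (cases m)
    case 0
    have "mtr I (mone I) = real (card I)" by (simp add: mtr_def mone_def)
    then show ?thesis by (simp add: 0 Om.emeasure_space_1)
  next
    case (Suc k)
    have kq: "k < q" using Suc less.prems by simp
    have finJ: "finite J" using less.prems finite_subset by blast
    have Sm: "(\<lambda>\<xi>. S J' \<xi> i j) \<in> borel_measurable Om" if "J' \<subseteq> J" "i \<in> I" "j \<in> I" for J' i j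
      unfolding S_def using that less.prems by (intro sum_P_measurable Pm) auto
    have cm: "(\<lambda>\<xi>. \<xi> a) \<in> measurable Om \<mu>" if "a \<in> J" for a
      using that less.prems by (intro measurable_component_singleton) auto
    have Pam: "(\<lambda>\<xi>. P (\<xi> a) i j) \<in> borel_measurable Om" if "a \<in> J" "i \<in> I" "j \<in> I" for a i j
      using measurable_compose[OF cm[OF that(1)] Pm[OF that(2,3)]] .
    have tm: "(\<lambda>\<xi>. mtr I (mm I (P (\<xi> a)) (mpow I (S J' \<xi>) s))) \<in> borel_measurable Om"
      if "J' \<subseteq> J" "a \<in> J" for J' s a
      unfolding mtr_def mm_def using that fin
      by (intro borel_measurable_sum borel_measurable_times Pam mpow_measurable Sm) auto
    have tn: "0 \<le> mtr I (mm I (P y) (mpow I (S J' \<xi>) s))" for y J' \<xi> s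
      by (intro mtr_psd_mult_nonneg psd_mpow fin P Sp Ss)
    define D where "D = real (card I)"
    have D: "0 \<le> D" by (simp add: D_def)
    have each: "(\<integral>\<^sup>+\<xi>. ennreal (mtr I (mm I (P (\<xi> a)) (mpow I (S J \<xi>) k))) \<partial>Om) \<le> ennreal (4 * v * D * L ^ k)"
      if a: "a \<in> J" for a
    proof -
      have an: "a < n" using a less.prems by auto
      let ?T = "\<lambda>t y \<xi>. 2 * (real q * \<rho> y) ^ t * mtr I (mm I (P y) (mpow I (S (J - {a}) \<xi>) (k - t)))"
      have "mtr I (mm I (P (\<xi> a)) (mpow I (S J \<xi>) k)) \<le> (\<Sum>t\<le>k. ?T t (\<xi> a) \<xi>)" for \<xi>
      proof (rule trace_pert_iterated)
        show "S J \<xi> = (\<lambda>i j. S (J - {a}) \<xi> i j + P (\<xi> a) i j)"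
          using a finJ by (simp add: S_def sum.remove fun_eq_iff add.commute)
      qed (use kq fin P Sp Ss \<rho> \<rho>0 in auto)
      then have "(\<integral>\<^sup>+\<xi>. ennreal (mtr I (mm I (P (\<xi> a)) (mpow I (S J \<xi>) k))) \<partial>Om)
          \<le> (\<integral>\<^sup>+\<xi>. ennreal (\<Sum>t\<le>k. ?T t (\<xi> a) \<xi>) \<partial>Om)"
        by (intro nn_integral_mono ennreal_leI)
      also have "\<dots> = (\<integral>\<^sup>+\<xi>. (\<Sum>t\<le>k. ennreal (?T t (\<xi> a) \<xi>)) \<partial>Om)"
        using \<rho>0 tn by (intro nn_integral_cong) (subst sum_ennreal, auto intro!: mult_nonneg_nonneg zero_le_power)
      also have "\<dots> = (\<Sum>t\<le>k. \<integral>\<^sup>+\<xi>. ennreal (?T t (\<xi> a) \<xi>) \<partial>Om)"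
        using measurable_compose[OF cm[OF a] \<rho>m] tm[of "J - {a}" a] a by (intro nn_integral_sum) auto
      \<comment> \<open>Each factor \<open>q r\<close> is at most \<open>L / 2\<close>. So the
        powers of \<open>L\<close> add up to \<open>k\<close> for every \<open>t\<close>, and the
        terms decay geometrically; the remaining factor of \<open>L\<close> comes from
        \<open>4 n v <= L\<close> when the sum over \<open>a\<close> is taken.\<close>
      also have "\<dots> \<le> (\<Sum>t\<le>k. ennreal (2 * v * D * L ^ k * (1 / 2) ^ t))"
      proof (intro sum_mono)
        fix t assume "t \<in> {..k}"
        then have t: "t \<le> k" by simp
        have fm: "(\<lambda>\<xi>. ennreal (?T t (\<xi> a) \<xi>)) \<in> borel_measurable Om"
          using measurable_compose[OF cm[OF a] \<rho>m] tm[of "J - {a}" a] a by auto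
        have "(\<integral>\<^sup>+\<xi>. ennreal (?T t (\<xi> a) \<xi>) \<partial>Om) = (\<integral>\<^sup>+\<xi>. \<integral>\<^sup>+y. ennreal (?T t y (\<xi>(a := y))) \<partial>\<mu> \<partial>Om)"
          using resample1[OF an fm] by simp
        also have "\<dots> = (\<integral>\<^sup>+\<xi>. \<integral>\<^sup>+y. ennreal (?T t y \<xi>) \<partial>\<mu> \<partial>Om)"
        proof -
          have "S (J - {a}) (\<xi>(a := y)) = S (J - {a}) \<xi>" for \<xi> y
            by (simp add: S_def)
          then show ?thesis by simp
        qed
        also have "\<dots> \<le> (\<integral>\<^sup>+\<xi>. ennreal (2 * real q ^ t * (v * r ^ t)) * ennreal (mtr I (mpow I (S (J - {a}) \<xi>) (k - t))) \<partial>Om)"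
        proof (intro nn_integral_mono)
          fix \<xi>
          let ?B = "mpow I (S (J - {a}) \<xi>) (k - t)"
          have Bp: "psd I ?B" by (intro psd_mpow fin Sp Ss)
          have "(\<integral>\<^sup>+y. ennreal (?T t y \<xi>) \<partial>\<mu>) = (\<integral>\<^sup>+y. ennreal (2 * real q ^ t) * ennreal (\<rho> y ^ t * mtr I (mm I (P y) ?B)) \<partial>\<mu>)"
            using \<rho>0 tn by (intro nn_integral_cong) (simp add: ennreal_mult[symmetric] power_mult_distrib mult.assoc)
          also have "\<dots> = ennreal (2 * real q ^ t) * (\<integral>\<^sup>+y. ennreal (\<rho> y ^ t * mtr I (mm I (P y) ?B)) \<partial>\<mu>)"
          proof (intro nn_integral_cmult)
            have "(\<lambda>y. mtr I (mm I (P y) ?B)) \<in> borel_measurable \<mu>"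
              unfolding mtr_def mm_def using Pm by (intro borel_measurable_sum borel_measurable_times) auto
            then show "(\<lambda>y. ennreal (\<rho> y ^ t * mtr I (mm I (P y) ?B))) \<in> borel_measurable \<mu>"
              using \<rho>m by simp
          qed
          also have "\<dots> \<le> ennreal (2 * real q ^ t) * ennreal (v * r ^ t * mtr I ?B)"
            using t kq v r by (intro mult_left_mono trace_mult_integral fin Bp Pm P \<rho>m \<rho>0 hyp) auto
          also have "\<dots> = ennreal (2 * real q ^ t * (v * r ^ t)) * ennreal (mtr I ?B)"
            using v r mtr_nonneg[OF fin Bp] by (simp add: ennreal_mult[symmetric] mult.assoc)
          finally show "(\<integral>\<^sup>+y. ennreal (?T t y \<xi>) \<partial>\<mu>) \<le> \<dots>" .
        qed
        also have "\<dots> = ennreal (2 * real q ^ t * (v * r ^ t)) * (\<integral>\<^sup>+\<xi>. ennreal (mtr I (mpow I (S (J - {a}) \<xi>) (k - t))) \<partial>Om)"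
        proof (intro nn_integral_cmult)
          have "(\<lambda>\<xi>. mtr I (mpow I (S (J - {a}) \<xi>) (k - t))) \<in> borel_measurable Om"
            using fin Sm[of "J - {a}"] by (intro mtr_mpow_measurable) auto
          then show "(\<lambda>\<xi>. ennreal (mtr I (mpow I (S (J - {a}) \<xi>) (k - t)))) \<in> borel_measurable Om" by simp
        qed
        also have "\<dots> \<le> ennreal (2 * real q ^ t * (v * r ^ t)) * ennreal (D * L ^ (k - t))"
        proof (intro mult_left_mono)
          have "k - t < m" "J - {a} \<subseteq> {..<n}" "k - t \<le> q" using Suc less.prems by auto
          from less.IH[OF this] show "(\<integral>\<^sup>+\<xi>. ennreal (mtr I (mpow I (S (J - {a}) \<xi>) (k - t))) \<partial>Om) \<le> ennreal (D * L ^ (k - t))"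
            unfolding S_def D_def .
        qed simp
        also have "\<dots> = ennreal (2 * v * D * L ^ (k - t) * (real q * r) ^ t)"
          using v r D L by (simp add: ennreal_mult[symmetric] power_mult_distrib mult_ac)
        also have "\<dots> \<le> ennreal (2 * v * D * L ^ (k - t) * (L / 2) ^ t)"
          using v r D L by (intro ennreal_leI mult_left_mono power_mono) auto
        also have "2 * v * D * L ^ (k - t) * (L / 2) ^ t = 2 * v * D * L ^ k * (1 / 2) ^ t"
          using t by (simp add: power_divide power_add[symmetric])
        finally show "(\<integral>\<^sup>+\<xi>. ennreal (?T t (\<xi> a) \<xi>) \<partial>Om) \<le> ennreal (2 * v * D * L ^ k * (1 / 2) ^ t)" .
      qed
      also have "\<dots> = ennreal (2 * v * D * L ^ k * (\<Sum>t\<le>k. (1 / 2) ^ t))"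
        using v D L by (subst sum_ennreal) (auto simp: sum_distrib_left)
      also have "\<dots> \<le> ennreal (2 * v * D * L ^ k * 2)"
      proof (intro ennreal_leI mult_left_mono)
        have "(\<Sum>t\<le>k. (1 / 2) ^ t) = (1 - (1/2) ^ Suc k) / (1 - 1/2 :: real)"
          unfolding lessThan_Suc_atMost[symmetric] by (subst sum_gp_strict) auto
        then show "(\<Sum>t\<le>k. (1 / 2 :: real) ^ t) \<le> 2" by simp
      qed (use v D L in auto)
      finally show ?thesis by (simp add: mult_ac)
    qed
    have "(\<integral>\<^sup>+\<xi>. ennreal (mtr I (mpow I (S J \<xi>) m)) \<partial>Om)
        = (\<integral>\<^sup>+\<xi>. (\<Sum>a\<in>J. ennreal (mtr I (mm I (P (\<xi> a)) (mpow I (S J \<xi>) k)))) \<partial>Om)"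
    proof (intro nn_integral_cong)
      fix \<xi>
      have "mtr I (mpow I (S J \<xi>) m) = (\<Sum>a\<in>J. mtr I (mm I (P (\<xi> a)) (mpow I (S J \<xi>) k)))"
        unfolding Suc mpow.simps by (subst (1) S_def, unfold mm_sum_left mtr_sum) (simp add: S_def)
      then show "ennreal (mtr I (mpow I (S J \<xi>) m)) = (\<Sum>a\<in>J. ennreal (mtr I (mm I (P (\<xi> a)) (mpow I (S J \<xi>) k))))"
        using tn by (subst sum_ennreal) auto
    qed
    also have "\<dots> = (\<Sum>a\<in>J. \<integral>\<^sup>+\<xi>. ennreal (mtr I (mm I (P (\<xi> a)) (mpow I (S J \<xi>) k))) \<partial>Om)"
      using tm by (intro nn_integral_sum) auto
    also have "\<dots> \<le> (\<Sum>a\<in>J. ennreal (4 * v * D * L ^ k))" by (intro sum_mono each)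
    also have "\<dots> = ennreal (real (card J) * (4 * v * D * L ^ k))"
      using v D L by (subst sum_ennreal) auto
    also have "\<dots> \<le> ennreal (real n * (4 * v * D * L ^ k))"
      using v D L card_mono[of "{..<n}" J] less.prems by (intro ennreal_leI mult_right_mono) auto
    also have "\<dots> = ennreal ((4 * real n * v) * (D * L ^ k))" by (simp add: mult_ac)
    also have "\<dots> \<le> ennreal (L * (D * L ^ k))"
      using L D by (intro ennreal_leI mult_right_mono) auto
    finally show ?thesis by (simp add: S_def D_def Suc mult_ac)
  qed
qed

text \<open>Derives the mixed hypothesis of \<open>psd_moment_aux\<close> from two separate ones.
  The inequality of arithmetic and geometric means splits \<open>\<rho>^t\<close> times the form
  into \<open>\<rho>^(2t)\<close> and the square of the form, each on its own scale; this doubles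
  the moment order of \<open>\<rho>\<close> and the variance parameter.\<close>

lemma psd_moment:
  fixes P :: "'x \<Rightarrow> 'i \<Rightarrow> 'i \<Rightarrow> real"
  assumes fin: "finite I"
    and Pm: "\<And>i j. i \<in> I \<Longrightarrow> j \<in> I \<Longrightarrow> (\<lambda>y. P y i j) \<in> borel_measurable \<mu>"
    and P: "\<And>y. psd I (P y)"
    and \<rho>m: "\<rho> \<in> borel_measurable \<mu>" and \<rho>0: "\<And>y. 0 \<le> \<rho> y"
    and \<rho>: "\<And>y u. quad I (P y) u \<le> \<rho> y * sqn I u"
    and sq: "\<And>u. (\<integral>\<^sup>+y. ennreal ((quad I (P y) u)\<^sup>2) \<partial>\<mu>) \<le> ennreal ((v * sqn I u)\<^sup>2)"
    and r: "(\<integral>\<^sup>+y. ennreal (\<rho> y ^ (2 * q)) \<partial>\<mu>) \<le> ennreal (r ^ (2 * q))" "0 < r"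
    and v: "0 \<le> v" and J: "J \<subseteq> {..<n}"
  shows "(\<integral>\<^sup>+\<xi>. ennreal (mtr I (mpow I (\<lambda>i j. \<Sum>a\<in>J. P (\<xi> a) i j) q)) \<partial>Om)
    \<le> ennreal (real (card I) * (8 * real n * v + 2 * real q * r) ^ q)"
proof -
  have qm: "(\<lambda>y. quad I (P y) u) \<in> borel_measurable \<mu>" for u
    unfolding quad_def using Pm by (auto intro!: borel_measurable_sum borel_measurable_times)
  have q0: "0 \<le> quad I (P y) u" for y u using P by (simp add: psd_def)
  have low: "(\<integral>\<^sup>+y. ennreal ((\<rho> y / r) ^ (2 * t)) \<partial>\<mu>) \<le> 2" if "t \<le> q" for t
  proof -
    have pw: "x ^ (2 * t) \<le> 1 + x ^ (2 * q)" if "0 \<le> x" for x :: real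
    proof (cases "x \<le> 1")
      case True then show ?thesis using that by (simp add: power_le_one add_increasing2)
    next
      case False
      then have "x ^ (2 * t) \<le> x ^ (2 * q)" using \<open>t \<le> q\<close> by (intro power_increasing) auto
      then show ?thesis by simp
    qed
    have "(\<integral>\<^sup>+y. ennreal ((\<rho> y / r) ^ (2 * t)) \<partial>\<mu>) \<le> (\<integral>\<^sup>+y. 1 + ennreal (1 / r ^ (2 * q)) * ennreal (\<rho> y ^ (2 * q)) \<partial>\<mu>)"
    proof (intro nn_integral_mono)
      fix y
      have "ennreal ((\<rho> y / r) ^ (2 * t)) \<le> ennreal (1 + (\<rho> y / r) ^ (2 * q))"
        using pw[of "\<rho> y / r"] \<rho>0[of y] r by (intro ennreal_leI) auto
      also have "\<dots> = 1 + ennreal (1 / r ^ (2 * q)) * ennreal (\<rho> y ^ (2 * q))"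
        using \<rho>0[of y] r by (subst ennreal_plus) (auto simp: ennreal_mult[symmetric] power_divide)
      finally show "ennreal ((\<rho> y / r) ^ (2 * t)) \<le> \<dots>" .
    qed
    also have "\<dots> = 1 + ennreal (1 / r ^ (2 * q)) * (\<integral>\<^sup>+y. ennreal (\<rho> y ^ (2 * q)) \<partial>\<mu>)"
      using \<rho>m by (simp add: nn_integral_add nn_integral_cmult emeasure_space_1)
    also have "\<dots> \<le> 1 + ennreal (1 / r ^ (2 * q)) * ennreal (r ^ (2 * q))"
      using r by (intro add_left_mono mult_left_mono) auto
    also have "\<dots> = 2" using r by (simp add: ennreal_mult[symmetric])
    finally show ?thesis .
  qed
  have hyp: "(\<integral>\<^sup>+y. ennreal (\<rho> y ^ t * quad I (P y) u) \<partial>\<mu>) \<le> ennreal (2 * v * r ^ t * sqn I u)" if t: "t \<le> q" for t u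
  \<comment> \<open>The scale \<open>b\<close> of the other case would be zero here; instead the
    vanishing second moment makes the form zero almost everywhere.\<close>
  proof (cases "v * sqn I u = 0")
    case True
    then have "(\<integral>\<^sup>+y. ennreal ((quad I (P y) u)\<^sup>2) \<partial>\<mu>) = 0" using sq[of u] unfolding True by simp
    then have "AE y in \<mu>. ennreal ((quad I (P y) u)\<^sup>2) = 0"
      using qm by (subst (asm) nn_integral_0_iff_AE) auto
    then have "AE y in \<mu>. ennreal (\<rho> y ^ t * quad I (P y) u) = 0" by eventually_elim auto
    then have "(\<integral>\<^sup>+y. ennreal (\<rho> y ^ t * quad I (P y) u) \<partial>\<mu>) = 0"
      using qm \<rho>m by (subst nn_integral_0_iff_AE) auto
    then show ?thesis by simp
  next
    case False
    define b where "b = v * sqn I u"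
    have b: "0 < b" using False v sqn_nonneg[of I u] mult_nonneg_nonneg[of v "sqn I u"] unfolding b_def by linarith
    have bb: "0 \<le> b * r ^ t / 2" "0 \<le> b * r ^ t / 2 / b\<^sup>2"
      using b r by (intro divide_nonneg_nonneg mult_nonneg_nonneg zero_le_power; simp)+
    have "(\<integral>\<^sup>+y. ennreal (\<rho> y ^ t * quad I (P y) u) \<partial>\<mu>)
      \<le> (\<integral>\<^sup>+y. ennreal (b * r ^ t / 2) * ennreal ((\<rho> y / r) ^ (2 * t)) + ennreal (b * r ^ t / 2 / b\<^sup>2) * ennreal ((quad I (P y) u)\<^sup>2) \<partial>\<mu>)"
    proof (intro nn_integral_mono)
      fix y
      have am: "x * z \<le> (x\<^sup>2 + z\<^sup>2) / 2" for x z :: real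
        using sum_squares_bound[of x z] by simp
      have "\<rho> y ^ t * quad I (P y) u = (b * r ^ t) * ((\<rho> y / r) ^ t * (quad I (P y) u / b))"
        using b r by (simp add: power_divide)
      also have "\<dots> \<le> (b * r ^ t) * ((((\<rho> y / r) ^ t)\<^sup>2 + (quad I (P y) u / b)\<^sup>2) / 2)"
        using b r by (intro mult_left_mono am) auto
      also have "\<dots> = b * r ^ t / 2 * (\<rho> y / r) ^ (2 * t) + b * r ^ t / 2 / b\<^sup>2 * (quad I (P y) u)\<^sup>2"
      proof -
        have "c * ((X + (Q / b)\<^sup>2) / 2) = c / 2 * X + c / 2 / b\<^sup>2 * Q\<^sup>2" for c X Q :: real
          by (simp add: power_divide add_divide_distrib distrib_left)
        then show ?thesis unfolding power_even_eq .
      qed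
      finally have "ennreal (\<rho> y ^ t * quad I (P y) u) \<le> ennreal \<dots>" by (rule ennreal_leI)
      also have "\<dots> = ennreal (b * r ^ t / 2) * ennreal ((\<rho> y / r) ^ (2 * t)) + ennreal (b * r ^ t / 2 / b\<^sup>2) * ennreal ((quad I (P y) u)\<^sup>2)"
      proof -
        have "0 \<le> (\<rho> y / r) ^ (2 * t)" using r \<rho>0[of y] by simp
        then show ?thesis
          by (simp only: bb ennreal_plus ennreal_mult mult_nonneg_nonneg zero_le_power2)
      qed
      finally show "ennreal (\<rho> y ^ t * quad I (P y) u) \<le> \<dots>" .
    qed
    also have "\<dots> = ennreal (b * r ^ t / 2) * (\<integral>\<^sup>+y. ennreal ((\<rho> y / r) ^ (2 * t)) \<partial>\<mu>)
       + ennreal (b * r ^ t / 2 / b\<^sup>2) * (\<integral>\<^sup>+y. ennreal ((quad I (P y) u)\<^sup>2) \<partial>\<mu>)"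
      using qm \<rho>m by (simp add: nn_integral_add nn_integral_cmult)
    also have "\<dots> \<le> ennreal (b * r ^ t / 2) * 2 + ennreal (b * r ^ t / 2 / b\<^sup>2) * ennreal (b\<^sup>2)"
      using sq[of u] low[OF t] by (intro add_mono mult_left_mono) (auto simp: b_def)
    also have "\<dots> = ennreal (b * r ^ t / 2 * 2 + b * r ^ t / 2 / b\<^sup>2 * b\<^sup>2)"
    proof -
      note nn = bb
      have "ennreal (b * r ^ t / 2) * 2 = ennreal (b * r ^ t / 2 * 2)"
        using ennreal_mult[OF nn(1), of 2] by simp
      moreover have "ennreal (b * r ^ t / 2 / b\<^sup>2) * ennreal (b\<^sup>2) = ennreal (b * r ^ t / 2 / b\<^sup>2 * b\<^sup>2)"
        using ennreal_mult[OF nn(2), of "b\<^sup>2"] by simp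
      ultimately show ?thesis
        using nn by (simp only: ennreal_plus mult_nonneg_nonneg zero_le_power2 zero_le_numeral)
    qed
    also have "\<dots> \<le> ennreal (2 * v * r ^ t * sqn I u)"
    proof (intro ennreal_leI)
      have "b * r ^ t / 2 * 2 + b * r ^ t / 2 / b\<^sup>2 * b\<^sup>2 = 3 / 2 * (b * r ^ t)" using b by simp
      also have "\<dots> \<le> 2 * (b * r ^ t)" using bb(1) by simp
      finally show "b * r ^ t / 2 * 2 + b * r ^ t / 2 / b\<^sup>2 * b\<^sup>2 \<le> 2 * v * r ^ t * sqn I u"
        by (simp add: b_def mult_ac)
    qed
    finally show ?thesis .
  qed
  show ?thesis
  proof (cases "8 * real n * v + 2 * real q * r = 0")
    case True
    then have "q = 0" using v r by (simp add: add_nonneg_eq_0_iff)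
    then show ?thesis by (simp add: mtr_def mone_def Om.emeasure_space_1)
  next
    case False
    then have L: "0 < 8 * real n * v + 2 * real q * r" using v r
      by (metis add_nonneg_nonneg less_eq_real_def mult_nonneg_nonneg of_nat_0_le_iff zero_le_numeral)
    have "(\<integral>\<^sup>+\<xi>. ennreal (mtr I (mpow I (\<lambda>i j. \<Sum>a\<in>J. mres I (P (\<xi> a)) i j) q)) \<partial>Om)
        \<le> ennreal (real (card I) * (8 * real n * v + 2 * real q * r) ^ q)"
    proof (rule psd_moment_aux[where \<rho> = \<rho> and v = "2 * v" and r = r and q = q])
      show "(\<lambda>y. mres I (P y) i j) \<in> borel_measurable \<mu>" if "i \<in> I" "j \<in> I" for i j
        using Pm[OF that] that by (simp add: mres_def)
    qed (use assms hyp L in auto)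
    moreover have "(\<lambda>i j. \<Sum>a\<in>J. mres I (P (\<xi> a)) i j) = mres I (\<lambda>i j. \<Sum>a\<in>J. P (\<xi> a) i j)" for \<xi>
      by (auto simp: mres_def fun_eq_iff)
    ultimately show ?thesis using fin by (simp add: mtr_mpow_mres)
  qed
qed

end

section \<open>Moment bounds\<close>

text \<open>The shape is stable under what the estimates do to it: squaring and doubling the order
  double \<open>c\<close>, and factors \<open>(a q)^q\<close> or \<open>N^a\<close> add
  \<open>a\<close> to it.\<close>

definition Kf :: "nat \<Rightarrow> nat \<Rightarrow> nat \<Rightarrow> real" where
  "Kf N c q = real N ^ c * real (c * q) ^ (c * q)"

lemma one_le_real_mult: "1 \<le> a \<Longrightarrow> 1 \<le> b \<Longrightarrow> 1 \<le> real (a * b)"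
  using of_nat_mono[OF mult_le_mono[of 1 a 1 b], where 'a = real] by simp

lemma Kf_mono:
  assumes "1 \<le> N" "1 \<le> c" "c \<le> c'" "1 \<le> q"
  shows "Kf N c q \<le> Kf N c' q"
proof -
  have "real (c * q) ^ (c * q) \<le> real (c' * q) ^ (c * q)"
    using assms by (intro power_mono) auto
  also have "\<dots> \<le> real (c' * q) ^ (c' * q)"
    using assms by (intro power_increasing one_le_real_mult) auto
  finally show ?thesis unfolding Kf_def using assms
    by (intro mult_mono power_increasing) auto
qed

lemma Kf_ge1: "1 \<le> N \<Longrightarrow> 1 \<le> c \<Longrightarrow> 1 \<le> q \<Longrightarrow> 1 \<le> Kf N c q"
  unfolding Kf_def using mult_mono[OF one_le_power[of "real N" c] one_le_power[OF one_le_real_mult[of c q], of "c * q"]]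
  by simp

lemma Kf_nonneg [simp]: "0 \<le> Kf N c q"
  by (simp add: Kf_def)

lemma Kf_double:
  assumes "1 \<le> N" shows "Kf N c (2 * q) \<le> Kf N (2 * c) q"
proof -
  have e: "c * (2 * q) = 2 * c * q" by simp
  show ?thesis unfolding Kf_def e using assms by (intro mult_right_mono power_increasing) auto
qed

lemma Kf_square:
  assumes "1 \<le> N" shows "Kf N c q * Kf N c q \<le> Kf N (2 * c) q"
proof -
  have "Kf N c q * Kf N c q = real N ^ (2 * c) * real (c * q) ^ (2 * c * q)"
  proof -
    have "x ^ (2 * c * q) = x ^ (c * q) * x ^ (c * q)" "x ^ (2 * c) = x ^ c * x ^ c" for x :: real
      by (metis mult.assoc mult_2 power_add)+
    then show ?thesis unfolding Kf_def by (simp only: mult_ac)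
  qed
  also have "\<dots> \<le> Kf N (2 * c) q"
    unfolding Kf_def by (intro mult_left_mono power_mono) auto
  finally show ?thesis .
qed

lemma Kf_mult_power:
  assumes "1 \<le> N" "1 \<le> c" "1 \<le> a" "1 \<le> q"
  shows "real (a * q) ^ q * Kf N c q \<le> Kf N (c + a) q"
proof -
  have "real (a * q) ^ q * real (c * q) ^ (c * q) \<le> real ((c + a) * q) ^ q * real ((c + a) * q) ^ (c * q)"
    using assms by (intro mult_mono power_mono) auto
  also have "\<dots> = real ((c + a) * q) ^ ((c + 1) * q)" by (simp add: power_add[symmetric] algebra_simps)
  also have "\<dots> \<le> real ((c + a) * q) ^ ((c + a) * q)"
    using assms by (intro power_increasing mult_right_mono one_le_real_mult) auto
  finally have "real N ^ c * (real (a * q) ^ q * real (c * q) ^ (c * q)) \<le> real N ^ (c + a) * real ((c + a) * q) ^ ((c + a) * q)"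
    using assms by (intro mult_mono power_increasing) auto
  then show ?thesis by (simp add: Kf_def mult_ac)
qed

lemma Kf_mult_N: "1 \<le> N \<Longrightarrow> 1 \<le> c \<Longrightarrow> 1 \<le> q \<Longrightarrow> real N ^ a * Kf N c q \<le> Kf N (c + a) q"
proof (induction a)
  case (Suc a)
  have "real N * Kf N (c + a) q \<le> Kf N (c + Suc a) q"
  proof -
    have "real ((c + a) * q) ^ ((c + a) * q) \<le> real ((c + Suc a) * q) ^ ((c + Suc a) * q)"
    proof -
      have "real ((c + a) * q) ^ ((c + a) * q) \<le> real ((c + Suc a) * q) ^ ((c + a) * q)"
        by (intro power_mono) auto
      also have "\<dots> \<le> real ((c + Suc a) * q) ^ ((c + Suc a) * q)"
        using Suc.prems by (intro power_increasing one_le_real_mult) auto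
      finally show ?thesis .
    qed
    then have "real N ^ (c + Suc a) * real ((c + a) * q) ^ ((c + a) * q) \<le> real N ^ (c + Suc a) * real ((c + Suc a) * q) ^ ((c + Suc a) * q)"
      by (intro mult_left_mono) auto
    then show ?thesis by (simp add: Kf_def mult_ac)
  qed
  moreover have "real N ^ Suc a * Kf N c q \<le> real N * Kf N (c + a) q"
    using Suc by (simp add: mult.assoc)
  ultimately show ?case by linarith
qed simp

text \<open>\<open>mb N c M Z z\<close> says that the nonnegative variable \<open>Z\<close> has size \<open>z\<close> up to factors polynomial in
  the order of the moment; the factor \<open>N ^ c\<close> does not depend on the order, so that it disappears when a
  high moment is used.\<close>

definition mb :: "nat \<Rightarrow> nat \<Rightarrow> 'a measure \<Rightarrow> ('a \<Rightarrow> real) \<Rightarrow> real \<Rightarrow> bool" where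
  "mb N c M Z z \<longleftrightarrow> 2 \<le> N \<and> 1 \<le> c \<and> 0 < z \<and> Z \<in> borel_measurable M \<and> (\<forall>x. 0 \<le> Z x) \<and>
     (\<forall>q\<ge>1. (\<integral>\<^sup>+x. ennreal (Z x ^ q) \<partial>M) \<le> ennreal (Kf N c q * z ^ q))"

lemma mbD:
  assumes "mb N c M Z z"
  shows "2 \<le> N" "1 \<le> N" "1 \<le> c" "0 < z" "Z \<in> borel_measurable M" "0 \<le> Z x"
    "1 \<le> q \<Longrightarrow> (\<integral>\<^sup>+x. ennreal (Z x ^ q) \<partial>M) \<le> ennreal (Kf N c q * z ^ q)"
  using assms by (auto simp: mb_def)

lemma mb_normalized:
  assumes "mb N c M Z z" "1 \<le> q"
  shows "(\<integral>\<^sup>+x. ennreal ((Z x / z) ^ q) \<partial>M) \<le> ennreal (Kf N c q)"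
proof -
  note D = mbD[OF assms(1)]
  have "(\<integral>\<^sup>+x. ennreal ((Z x / z) ^ q) \<partial>M) = (\<integral>\<^sup>+x. ennreal (1 / z ^ q) * ennreal (Z x ^ q) \<partial>M)"
    using D by (intro nn_integral_cong) (simp add: ennreal_mult[symmetric] power_divide)
  also have "\<dots> = ennreal (1 / z ^ q) * (\<integral>\<^sup>+x. ennreal (Z x ^ q) \<partial>M)"
    using D(5) by (intro nn_integral_cmult) simp
  also have "\<dots> \<le> ennreal (1 / z ^ q) * ennreal (Kf N c q * z ^ q)"
    by (intro mult_left_mono D(7) assms) simp
  also have "\<dots> = ennreal (Kf N c q)" using D(4) by (simp add: ennreal_mult[symmetric])
  finally show ?thesis .
qed

lemma mbI_normalized:
  assumes "2 \<le> N" "1 \<le> c" "0 < z" "Z \<in> borel_measurable M" "\<And>x. 0 \<le> Z x"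
    and "\<And>q. 1 \<le> q \<Longrightarrow> (\<integral>\<^sup>+x. ennreal ((Z x / z) ^ q) \<partial>M) \<le> ennreal (Kf N c q)"
  shows "mb N c M Z z"
  unfolding mb_def
proof (intro conjI allI impI)
  fix q :: nat assume q: "1 \<le> q"
  have "(\<integral>\<^sup>+x. ennreal (Z x ^ q) \<partial>M) = (\<integral>\<^sup>+x. ennreal (z ^ q) * ennreal ((Z x / z) ^ q) \<partial>M)"
    using assms by (intro nn_integral_cong) (simp add: ennreal_mult[symmetric] power_divide)
  also have "\<dots> = ennreal (z ^ q) * (\<integral>\<^sup>+x. ennreal ((Z x / z) ^ q) \<partial>M)"
    using assms(4) by (intro nn_integral_cmult) simp
  also have "\<dots> \<le> ennreal (z ^ q) * ennreal (Kf N c q)"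
    by (intro mult_left_mono assms q) simp
  also have "\<dots> = ennreal (Kf N c q * z ^ q)" using assms(3) by (simp add: ennreal_mult[symmetric] mult.commute)
  finally show "(\<integral>\<^sup>+x. ennreal (Z x ^ q) \<partial>M) \<le> ennreal (Kf N c q * z ^ q)" .
qed (use assms in auto)

lemma mb_mono:
  assumes "mb N c M Z z" "Y \<in> borel_measurable M" "\<And>x. 0 \<le> Y x" "\<And>x. Y x \<le> Z x" "z \<le> y" "c \<le> c'"
  shows "mb N c' M Y y"
proof -
  note D = mbD[OF assms(1)]
  show ?thesis unfolding mb_def
  proof (intro conjI allI impI)
    fix q :: nat assume q: "1 \<le> q"
    have "(\<integral>\<^sup>+x. ennreal (Y x ^ q) \<partial>M) \<le> (\<integral>\<^sup>+x. ennreal (Z x ^ q) \<partial>M)"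
      using assms by (intro nn_integral_mono ennreal_leI power_mono) auto
    also have "\<dots> \<le> ennreal (Kf N c q * z ^ q)" by (rule D(7)[OF q])
    also have "\<dots> \<le> ennreal (Kf N c' q * y ^ q)"
      using D(2-4) assms q by (intro ennreal_leI mult_mono Kf_mono power_mono) auto
    finally show "(\<integral>\<^sup>+x. ennreal (Y x ^ q) \<partial>M) \<le> ennreal (Kf N c' q * y ^ q)" .
  qed (use assms(2,3,5,6) D(1,3,4) in auto)
qed

lemma mb_weaken: "mb N c M Z z \<Longrightarrow> c \<le> c' \<Longrightarrow> z \<le> z' \<Longrightarrow> mb N c' M Z z'"
  by (rule mb_mono[where Z = Z and z = z]) (auto dest: mbD)

text \<open>Cauchy-Schwarz for the normalized variables; the doubled moment order is paid for by
  \<open>2 * c\<close>.\<close>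

lemma mb_mult:
  assumes X: "mb N c M X x" and Y: "mb N c M Y y"
  shows "mb N (2 * c) M (\<lambda>a. X a * Y a) (x * y)"
proof (rule mbI_normalized)
  note D = mbD[OF X] and E = mbD[OF Y]
  show "(\<lambda>a. X a * Y a) \<in> borel_measurable M" using D(5) E(5) by simp
  fix q :: nat assume q: "1 \<le> q"
  have am: "s * t \<le> (s\<^sup>2 + t\<^sup>2) / 2" for s t :: real using sum_squares_bound[of s t] by simp
  have "(\<integral>\<^sup>+a. ennreal ((X a * Y a / (x * y)) ^ q) \<partial>M) \<le>
    (\<integral>\<^sup>+a. ennreal (1/2) * ennreal ((X a / x) ^ (2 * q)) + ennreal (1/2) * ennreal ((Y a / y) ^ (2 * q)) \<partial>M)"
  proof (intro nn_integral_mono)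
    fix a
    have "(X a * Y a / (x * y)) ^ q = (X a / x) ^ q * (Y a / y) ^ q" by (simp add: power_mult_distrib power_divide)
    also have "\<dots> \<le> 1/2 * (X a / x) ^ (2 * q) + 1/2 * (Y a / y) ^ (2 * q)"
      using am[of "(X a / x) ^ q" "(Y a / y) ^ q"] unfolding power_even_eq by simp
    finally have "ennreal ((X a * Y a / (x * y)) ^ q) \<le> ennreal \<dots>" by (rule ennreal_leI)
    moreover have "0 \<le> (X a / x) ^ (2 * q)" "0 \<le> (Y a / y) ^ (2 * q)" by auto
    ultimately show "ennreal ((X a * Y a / (x * y)) ^ q) \<le>
       ennreal (1/2) * ennreal ((X a / x) ^ (2 * q)) + ennreal (1/2) * ennreal ((Y a / y) ^ (2 * q))"
      by (simp only: ennreal_plus ennreal_mult mult_nonneg_nonneg zero_le_divide_1_iff zero_le_numeral)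
  qed
  also have "\<dots> = ennreal (1/2) * (\<integral>\<^sup>+a. ennreal ((X a / x) ^ (2 * q)) \<partial>M) + ennreal (1/2) * (\<integral>\<^sup>+a. ennreal ((Y a / y) ^ (2 * q)) \<partial>M)"
    using D(5) E(5) by (simp add: nn_integral_add nn_integral_cmult)
  also have "\<dots> \<le> ennreal (1/2) * ennreal (Kf N c (2 * q)) + ennreal (1/2) * ennreal (Kf N c (2 * q))"
    using q by (intro add_mono mult_left_mono mb_normalized[OF X] mb_normalized[OF Y]) auto
  also have "\<dots> = ennreal (1/2 * Kf N c (2 * q) + 1/2 * Kf N c (2 * q))"
    by (simp only: ennreal_plus ennreal_mult mult_nonneg_nonneg zero_le_divide_1_iff zero_le_numeral Kf_nonneg)
  also have "\<dots> \<le> ennreal (Kf N (2 * c) q)" using Kf_double[OF D(2)] by (intro ennreal_leI) simp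
  finally show "(\<integral>\<^sup>+a. ennreal ((X a * Y a / (x * y)) ^ q) \<partial>M) \<le> ennreal (Kf N (2 * c) q)" .
qed (use mbD(1,3,4,6)[OF X] mbD(1,3,4,6)[OF Y] in auto)

lemma convex_power: "convex_on {0::real..} (\<lambda>x. x ^ n)"
  by (cases "even n") (auto intro: convex_power_odd convex_on_subset[OF convex_power_even])

text \<open>Convexity of the \<open>q\<close>-th power with the weights \<open>z i / s\<close>. The
  number of summands costs nothing, which permits averages over all \<open>2^n\<close> subsets
  later.\<close>

lemma mb_sum:
  assumes fin: "finite I" "I \<noteq> {}" and Z: "\<And>i. i \<in> I \<Longrightarrow> mb N c M (Z i) (z i)"
  shows "mb N c M (\<lambda>x. \<Sum>i\<in>I. Z i x) (\<Sum>i\<in>I. z i)"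
proof (rule mbI_normalized)
  obtain i0 where i0: "i0 \<in> I" using fin by auto
  note D = mbD[OF Z]
  define s where "s = (\<Sum>i\<in>I. z i)"
  have s: "0 < s" unfolding s_def using fin D(4) by (intro sum_pos) auto
  then show "0 < (\<Sum>i\<in>I. z i)" by (simp add: s_def)
  show "2 \<le> N" "1 \<le> c" using D(1,3)[OF i0] by auto
  show "(\<lambda>x. \<Sum>i\<in>I. Z i x) \<in> borel_measurable M" using D(5) by (intro borel_measurable_sum)
  show "0 \<le> (\<Sum>i\<in>I. Z i x)" for x using D(6) by (intro sum_nonneg)
  fix q :: nat assume q: "1 \<le> q"
  have "(\<integral>\<^sup>+x. ennreal (((\<Sum>i\<in>I. Z i x) / (\<Sum>i\<in>I. z i)) ^ q) \<partial>M)
    \<le> (\<integral>\<^sup>+x. (\<Sum>i\<in>I. ennreal (z i / s) * ennreal ((Z i x / z i) ^ q)) \<partial>M)"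
  proof (intro nn_integral_mono)
    fix x
    have "(\<Sum>i\<in>I. Z i x) / s = (\<Sum>i\<in>I. (z i / s) *\<^sub>R (Z i x / z i))"
      unfolding sum_divide_distrib using D(4) by (intro sum.cong) (auto simp: less_imp_neq[symmetric])
    then have "((\<Sum>i\<in>I. Z i x) / s) ^ q \<le> (\<Sum>i\<in>I. (z i / s) * (Z i x / z i) ^ q)"
      using fin D(4,6) s by (simp only:) (intro convex_on_sum[OF _ _ convex_power], auto simp: sum_divide_distrib[symmetric] s_def less_imp_le intro!: divide_nonneg_nonneg)
    then have "ennreal (((\<Sum>i\<in>I. Z i x) / s) ^ q) \<le> ennreal (\<Sum>i\<in>I. (z i / s) * (Z i x / z i) ^ q)"
      by (rule ennreal_leI)
    also have "\<dots> = (\<Sum>i\<in>I. ennreal ((z i / s) * (Z i x / z i) ^ q))"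
      using D(4,6) s by (subst sum_ennreal) (auto intro!: mult_nonneg_nonneg divide_nonneg_nonneg zero_le_power simp: less_imp_le)
    also have "\<dots> = (\<Sum>i\<in>I. ennreal (z i / s) * ennreal ((Z i x / z i) ^ q))"
      using D(4,6) s by (intro sum.cong refl ennreal_mult) (auto intro!: divide_nonneg_nonneg zero_le_power simp: less_imp_le)
    finally show "ennreal (((\<Sum>i\<in>I. Z i x) / (\<Sum>i\<in>I. z i)) ^ q) \<le> \<dots>" by (simp add: s_def)
  qed
  also have "\<dots> = (\<Sum>i\<in>I. ennreal (z i / s) * (\<integral>\<^sup>+x. ennreal ((Z i x / z i) ^ q) \<partial>M))"
    using D(5) by (simp add: nn_integral_sum nn_integral_cmult)
  also have "\<dots> \<le> (\<Sum>i\<in>I. ennreal (z i / s) * ennreal (Kf N c q))"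
    using q by (intro sum_mono mult_left_mono mb_normalized[OF Z]) auto
  also have "\<dots> = ennreal (\<Sum>i\<in>I. (z i / s) * Kf N c q)"
  proof -
    have "ennreal (z i / s) * ennreal (Kf N c q) = ennreal ((z i / s) * Kf N c q)" "0 \<le> (z i / s) * Kf N c q" if "i \<in> I" for i
      using D(4)[OF that] s by (simp_all add: ennreal_mult[symmetric])
    then show ?thesis by (simp only: sum_ennreal cong: sum.cong)
  qed
  also have "(\<Sum>i\<in>I. (z i / s) * Kf N c q) = Kf N c q"
    using s by (simp add: sum_distrib_right[symmetric] sum_divide_distrib[symmetric]) (simp add: s_def)
  finally show "(\<integral>\<^sup>+x. ennreal (((\<Sum>i\<in>I. Z i x) / (\<Sum>i\<in>I. z i)) ^ q) \<partial>M) \<le> ennreal (Kf N c q)" .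
qed

lemma mb_add:
  assumes "mb N c M X x" "mb N c M Y y"
  shows "mb N c M (\<lambda>a. X a + Y a) (x + y)"
proof -
  have "mb N c M (\<lambda>a. \<Sum>i\<in>{0,1::nat}. (if i = 0 then X else Y) a) (\<Sum>i\<in>{0,1::nat}. if i = 0 then x else y)"
    by (rule mb_sum) (use assms in \<open>simp_all split: if_split\<close>)
  then show ?thesis by simp
qed

lemma mb_const:
  assumes "prob_space M" "2 \<le> N" "1 \<le> c" "0 \<le> k" "k \<le> z" "0 < z"
  shows "mb N c M (\<lambda>_. k) z"
  unfolding mb_def
proof (intro conjI allI impI)
  fix q :: nat assume q: "1 \<le> q"
  have "1 * k ^ q \<le> Kf N c q * z ^ q" using assms q by (intro mult_mono Kf_ge1 power_mono) auto
  then show "(\<integral>\<^sup>+x. ennreal (k ^ q) \<partial>M) \<le> ennreal (Kf N c q * z ^ q)"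
    using prob_space.emeasure_space_1[OF assms(1)] by (simp add: ennreal_leI)
qed (rule assms borel_measurable_const)+

lemma mb_scale:
  assumes "mb N c M Z z" "0 < k"
  shows "mb N c M (\<lambda>x. k * Z x) (k * z)"
proof (rule mbI_normalized)
  note D = mbD[OF assms(1)]
  show "(\<lambda>x. k * Z x) \<in> borel_measurable M" using D(5) by simp
  fix q :: nat assume "1 \<le> q"
  have "k * Z x / (k * z) = Z x / z" for x using assms(2) by simp
  then show "(\<integral>\<^sup>+x. ennreal ((k * Z x / (k * z)) ^ q) \<partial>M) \<le> ennreal (Kf N c q)"
    using mb_normalized[OF assms(1) \<open>1 \<le> q\<close>] by (simp only:)
qed (use mbD(1,3,4,6)[OF assms(1)] assms(2) in auto)

lemma mb_sqrt:
  assumes "prob_space M" "mb N c M Z (z\<^sup>2)" "0 < z"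
  shows "mb N c M (\<lambda>x. sqrt (Z x)) z"
proof (rule mbI_normalized)
  interpret prob_space M by fact
  note D = mbD[OF assms(2)]
  show "(\<lambda>x. sqrt (Z x)) \<in> borel_measurable M" using D(5) by simp
  fix q :: nat assume q: "1 \<le> q"
  have "(\<integral>\<^sup>+x. ennreal ((sqrt (Z x) / z) ^ q) \<partial>M) \<le> (\<integral>\<^sup>+x. ennreal (1/2) + ennreal (1/2) * ennreal ((Z x / z\<^sup>2) ^ q) \<partial>M)"
  proof (intro nn_integral_mono)
    fix x
    define a where "a = sqrt (Z x) / z"
    have "a\<^sup>2 = Z x / z\<^sup>2" using D(6)[of x] by (simp add: a_def power_divide)
    then have a2: "(a ^ q)\<^sup>2 = (Z x / z\<^sup>2) ^ q" by (metis power_mult mult.commute)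
    have "2 * a ^ q \<le> 1 + (a ^ q)\<^sup>2" using sum_squares_bound[of 1 "a ^ q"] by simp
    then have "a ^ q \<le> 1/2 + 1/2 * (Z x / z\<^sup>2) ^ q" unfolding a2 by linarith
    then have "ennreal ((sqrt (Z x) / z) ^ q) \<le> ennreal (1/2 + 1/2 * (Z x / z\<^sup>2) ^ q)"
      unfolding a_def by (rule ennreal_leI)
    moreover have "0 \<le> (Z x / z\<^sup>2) ^ q" using D(6) by simp
    ultimately show "ennreal ((sqrt (Z x) / z) ^ q) \<le> ennreal (1/2) + ennreal (1/2) * ennreal ((Z x / z\<^sup>2) ^ q)"
      by (simp only: ennreal_plus ennreal_mult mult_nonneg_nonneg zero_le_divide_1_iff zero_le_numeral)
  qed
  also have "\<dots> = ennreal (1/2) + ennreal (1/2) * (\<integral>\<^sup>+x. ennreal ((Z x / z\<^sup>2) ^ q) \<partial>M)"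
    using D(5) by (simp add: nn_integral_add nn_integral_cmult emeasure_space_1)
  also have "\<dots> \<le> ennreal (1/2) + ennreal (1/2) * ennreal (Kf N c q)"
    using q by (intro add_left_mono mult_left_mono mb_normalized[OF assms(2)]) auto
  also have "\<dots> = ennreal (1/2 + 1/2 * Kf N c q)"
    by (simp only: ennreal_plus ennreal_mult mult_nonneg_nonneg zero_le_divide_1_iff zero_le_numeral Kf_nonneg)
  also have "\<dots> \<le> ennreal (Kf N c q)"
    using Kf_ge1[OF D(2,3) q] by (intro ennreal_leI) simp
  finally show "(\<integral>\<^sup>+x. ennreal ((sqrt (Z x) / z) ^ q) \<partial>M) \<le> ennreal (Kf N c q)" .
qed (use mbD(1,3,4,6)[OF assms(2)] assms(3) in auto)

text \<open>The sum over \<open>I\<close> dominates the maximum, and its \<open>card I\<close> terms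
  cost a factor \<open>N^a\<close> that does not depend on the moment order.\<close>

lemma mb_Max:
  assumes fin: "finite I" "I \<noteq> {}" "card I \<le> N ^ a" and Z: "\<And>i. i \<in> I \<Longrightarrow> mb N c M (Z i) z"
    and Ym: "Y \<in> borel_measurable M" and Y: "\<And>x. 0 \<le> Y x" "\<And>x. \<exists>i\<in>I. Y x \<le> Z i x"
  shows "mb N (c + a) M Y z"
proof (rule mbI_normalized)
  obtain i0 where i0: "i0 \<in> I" using fin by auto
  note D = mbD[OF Z]
  show "2 \<le> N" "1 \<le> c + a" "0 < z" using D(1,3,4)[OF i0] by auto
  fix q :: nat assume q: "1 \<le> q"
  have z: "0 < z" using D(4)[OF i0] .
  have "(\<integral>\<^sup>+x. ennreal ((Y x / z) ^ q) \<partial>M) \<le> (\<integral>\<^sup>+x. (\<Sum>i\<in>I. ennreal ((Z i x / z) ^ q)) \<partial>M)"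
  proof (intro nn_integral_mono)
    fix x
    obtain i where i: "i \<in> I" "Y x \<le> Z i x" using Y(2) by blast
    have "ennreal ((Y x / z) ^ q) \<le> ennreal ((Z i x / z) ^ q)"
      using i Y(1)[of x] z by (intro ennreal_leI power_mono divide_right_mono divide_nonneg_nonneg) auto
    also have "\<dots> \<le> (\<Sum>i\<in>I. ennreal ((Z i x / z) ^ q))"
      using fin i by (intro member_le_sum) auto
    finally show "ennreal ((Y x / z) ^ q) \<le> \<dots>" .
  qed
  also have "\<dots> = (\<Sum>i\<in>I. \<integral>\<^sup>+x. ennreal ((Z i x / z) ^ q) \<partial>M)"
    using D(5) by (intro nn_integral_sum) simp
  also have "\<dots> \<le> (\<Sum>i\<in>I. ennreal (Kf N c q))" using q by (intro sum_mono mb_normalized[OF Z])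
  also have "\<dots> = ennreal (real (card I) * Kf N c q)" by (subst sum_ennreal) auto
  also have "\<dots> \<le> ennreal (real N ^ a * Kf N c q)"
    using fin(3) by (intro ennreal_leI mult_right_mono) (auto simp: of_nat_power[symmetric] simp del: of_nat_power)
  also have "\<dots> \<le> ennreal (Kf N (c + a) q)" using D(2,3)[OF i0] q by (intro ennreal_leI Kf_mult_N)
  finally show "(\<integral>\<^sup>+x. ennreal ((Y x / z) ^ q) \<partial>M) \<le> ennreal (Kf N (c + a) q)" .
qed (use Ym Y in auto)

text \<open>The moment of order \<open>2 c p\<close> carries the factor \<open>N^c\<close>, of which
  its root of order \<open>2 c\<close> keeps only \<open>sqrt N\<close>. The root is taken by
  scaling: \<open>\<Lambda>^(2c)\<close> is the constant of that moment, and
  \<open>x <= 1 + x^(2c)\<close>.\<close>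

lemma mb_lyapunov:
  assumes "prob_space M" "mb N c M Z z" "1 \<le> p"
  shows "(\<integral>\<^sup>+x. ennreal (Z x ^ p) \<partial>M) \<le> ennreal (2 * sqrt (real N) * real (2 * c\<^sup>2 * p) ^ (c * p) * z ^ p)"
proof -
  interpret prob_space M by fact
  note D = mbD[OF assms(2)]
  define \<Lambda> where "\<Lambda> = sqrt (real N) * real (2 * c\<^sup>2 * p) ^ (c * p)"
  have \<Lambda>: "0 < \<Lambda>" using D(1,3) assms(3) by (simp add: \<Lambda>_def)
  have \<Lambda>p: "\<Lambda> ^ (2 * c) = Kf N c (2 * c * p)"
  proof -
    have "sqrt (real N) ^ (2 * c) = real N ^ c" by (simp add: power_mult)
    moreover have "(real (2 * c\<^sup>2 * p) ^ (c * p)) ^ (2 * c) = real (c * (2 * c * p)) ^ (c * (2 * c * p))"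
      by (simp add: power_mult[symmetric] power2_eq_square mult_ac)
    ultimately show ?thesis by (simp add: \<Lambda>_def Kf_def power_mult_distrib)
  qed
  have one: "x \<le> 1 + x ^ (2 * c)" if "0 \<le> x" for x :: real
  proof (cases "x \<le> 1")
    case False
    then have "x ^ 1 \<le> x ^ (2 * c)" using D(3) by (intro power_increasing) auto
    then show ?thesis by simp
  qed (use that in \<open>simp add: add_increasing2\<close>)
  have "(\<integral>\<^sup>+x. ennreal (Z x ^ p) \<partial>M) \<le> (\<integral>\<^sup>+x. ennreal (\<Lambda> * z ^ p) * (1 + ennreal (1 / \<Lambda> ^ (2 * c)) * ennreal ((Z x / z) ^ (2 * c * p))) \<partial>M)"
  proof (intro nn_integral_mono)
    fix x
    define y where "y = Z x / z"
    have y0: "0 \<le> y" using D(4) D(6)[of x] by (simp add: y_def)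
    have "Z x ^ p = (y * z) ^ p" using D(4) by (simp add: y_def)
    also have "\<dots> = \<Lambda> * z ^ p * (y ^ p / \<Lambda>)" using \<Lambda> by (simp add: power_mult_distrib)
    also have "\<dots> \<le> \<Lambda> * z ^ p * (1 + (y ^ p / \<Lambda>) ^ (2 * c))"
      using \<Lambda> D(4) y0 by (intro mult_left_mono one) auto
    finally have le: "Z x ^ p \<le> \<Lambda> * z ^ p * (1 + (y ^ p / \<Lambda>) ^ (2 * c))" .
    have "(y ^ p / \<Lambda>) ^ (2 * c) = (y ^ p) ^ (2 * c) / \<Lambda> ^ (2 * c)" by (rule power_divide)
    moreover have "(y ^ p) ^ (2 * c) = y ^ (2 * c * p)" by (metis power_mult mult.commute)
    ultimately have eq: "(y ^ p / \<Lambda>) ^ (2 * c) = 1 / \<Lambda> ^ (2 * c) * y ^ (2 * c * p)" by simp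
    have "ennreal (Z x ^ p) \<le> ennreal (\<Lambda> * z ^ p * (1 + 1 / \<Lambda> ^ (2 * c) * (Z x / z) ^ (2 * c * p)))"
      using le unfolding eq unfolding y_def by (rule ennreal_leI)
    also have "\<dots> = ennreal (\<Lambda> * z ^ p) * (1 + ennreal (1 / \<Lambda> ^ (2 * c)) * ennreal ((Z x / z) ^ (2 * c * p)))"
    proof -
      have nn: "0 \<le> \<Lambda> * z ^ p" "0 \<le> 1 / \<Lambda> ^ (2 * c)" "0 \<le> (Z x / z) ^ (2 * c * p)" using \<Lambda> D(4,6) by auto
      show ?thesis
        by (simp only: ennreal_mult'[OF nn(1)] ennreal_plus[OF zero_le_one mult_nonneg_nonneg[OF nn(2,3)]] ennreal_mult[OF nn(2,3)] ennreal_1)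
    qed
    finally show "ennreal (Z x ^ p) \<le> \<dots>" .
  qed
  also have "\<dots> = ennreal (\<Lambda> * z ^ p) * (1 + ennreal (1 / \<Lambda> ^ (2 * c)) * (\<integral>\<^sup>+x. ennreal ((Z x / z) ^ (2 * c * p)) \<partial>M))"
    using D(5) by (simp add: nn_integral_add nn_integral_cmult emeasure_space_1)
  also have "\<dots> \<le> ennreal (\<Lambda> * z ^ p) * (1 + ennreal (1 / \<Lambda> ^ (2 * c)) * ennreal (\<Lambda> ^ (2 * c)))"
    using mb_normalized[OF assms(2), of "2 * c * p"] D(3) assms(3) unfolding \<Lambda>p
    by (intro mult_left_mono add_left_mono) auto
  also have "\<dots> = ennreal (\<Lambda> * z ^ p) * 2" using \<Lambda> by (simp add: ennreal_mult[symmetric])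
  also have "\<dots> = ennreal (2 * sqrt (real N) * real (2 * c\<^sup>2 * p) ^ (c * p) * z ^ p)"
  proof -
    have "ennreal (\<Lambda> * z ^ p) * 2 = ennreal (\<Lambda> * z ^ p * 2)" using \<Lambda> D(4) by (simp add: ennreal_mult)
    then show ?thesis by (simp add: \<Lambda>_def mult_ac)
  qed
  finally show ?thesis .
qed

lemma mb_fst:
  assumes "prob_space M'" "mb N c M Z z"
  shows "mb N c (M \<Otimes>\<^sub>M M') (\<lambda>x. Z (fst x)) z"
proof -
  interpret prob_space M' by fact
  note D = mbD[OF assms(2)]
  have "(\<integral>\<^sup>+x. ennreal (Z (fst x) ^ q) \<partial>(M \<Otimes>\<^sub>M M')) = (\<integral>\<^sup>+x. ennreal (Z x ^ q) \<partial>M)" for q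
    using D(5) by (subst nn_integral_fst[symmetric]) (auto simp: emeasure_space_1)
  then show ?thesis using assms(2) measurable_compose[OF measurable_fst D(5)] unfolding mb_def by simp
qed

lemma mb_snd:
  assumes "prob_space M" "sigma_finite_measure M'" "mb N c M' Z z"
  shows "mb N c (M \<Otimes>\<^sub>M M') (\<lambda>x. Z (snd x)) z"
proof -
  interpret prob_space M by fact
  interpret M': sigma_finite_measure M' by fact
  note D = mbD[OF assms(3)]
  have "(\<integral>\<^sup>+x. ennreal (Z (snd x) ^ q) \<partial>(M \<Otimes>\<^sub>M M')) = (\<integral>\<^sup>+x. ennreal (Z x ^ q) \<partial>M')" for q
    using D(5) by (subst M'.nn_integral_fst[symmetric]) (auto simp: emeasure_space_1)
  then show ?thesis using assms(3) measurable_compose[OF measurable_snd D(5)] unfolding mb_def by simp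
qed

text \<open>Given the first variable the size \<open>z y\<close> is itself random. Integrating it
  out multiplies two constants of the form \<open>Kf N c q\<close>, hence
  \<open>2 * c\<close>.\<close>

lemma mb_fixed:
  assumes "prob_space M" "prob_space M'" "\<And>y. mb N c M' (Z y) (z y)"
    and m: "(\<lambda>x. Z (fst x) (snd x)) \<in> borel_measurable (M \<Otimes>\<^sub>M M')" and z: "mb N c M z z0"
  shows "mb N (2 * c) (M \<Otimes>\<^sub>M M') (\<lambda>x. Z (fst x) (snd x)) z0"
proof -
  interpret M': prob_space M' by fact
  note D = mbD[OF assms(3)] and E = mbD[OF z]
  show ?thesis unfolding mb_def
  proof (intro conjI allI impI)
    fix q :: nat assume q: "1 \<le> q"
    have "(\<integral>\<^sup>+x. ennreal (Z (fst x) (snd x) ^ q) \<partial>(M \<Otimes>\<^sub>M M')) = (\<integral>\<^sup>+y. \<integral>\<^sup>+x. ennreal (Z y x ^ q) \<partial>M' \<partial>M)"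
      using m by (subst M'.nn_integral_fst[symmetric]) auto
    also have "\<dots> \<le> (\<integral>\<^sup>+y. ennreal (Kf N c q) * ennreal (z y ^ q) \<partial>M)"
      using D(7)[OF q] D(4) by (intro nn_integral_mono) (simp add: ennreal_mult[symmetric] less_imp_le)
    also have "\<dots> = ennreal (Kf N c q) * (\<integral>\<^sup>+y. ennreal (z y ^ q) \<partial>M)"
      using E(5) by (intro nn_integral_cmult) simp
    also have "\<dots> \<le> ennreal (Kf N c q) * ennreal (Kf N c q * z0 ^ q)"
      by (intro mult_left_mono E(7) q) simp
    also have "\<dots> = ennreal (Kf N c q * Kf N c q * z0 ^ q)" using E(4) by (simp add: ennreal_mult[symmetric] mult.assoc)
    also have "\<dots> \<le> ennreal (Kf N (2 * c) q * z0 ^ q)"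
      using E(2,4) by (intro ennreal_leI mult_right_mono Kf_square) auto
    finally show "(\<integral>\<^sup>+x. ennreal (Z (fst x) (snd x) ^ q) \<partial>(M \<Otimes>\<^sub>M M')) \<le> ennreal (Kf N (2 * c) q * z0 ^ q)" .
  qed (use D(1,3,6) E(4) m in auto)
qed

section \<open>Moment bounds for random matrices conditionally on part of the sample\<close>

context samples
begin

text \<open>Lets a sample itself play the role of the free vector \<open>y\<close>: the second
  argument of \<open>Z\<close> is not read at \<open>i\<close>, so \<open>\<xi> i\<close> may be
  redrawn independently.\<close>

lemma mb_coord:
  assumes i: "i < n" and mb: "mb N c (\<mu> \<Otimes>\<^sub>M Om) (\<lambda>x. Z (fst x) (snd x)) z"
    and loc: "\<And>y y' \<xi>. Z y (\<xi>(i := y')) = Z y \<xi>"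
  shows "mb N c Om (\<lambda>\<xi>. Z (\<xi> i) \<xi>) z"
proof -
  note D = mbD[OF mb]
  have cm: "(\<lambda>\<xi>. (\<xi> i, \<xi>)) \<in> measurable Om (\<mu> \<Otimes>\<^sub>M Om)"
    using i by (intro measurable_Pair measurable_component_singleton) auto
  have Zm: "(\<lambda>\<xi>. Z (\<xi> i) \<xi>) \<in> borel_measurable Om" using measurable_compose[OF cm D(5)] by simp
  show ?thesis unfolding mb_def
  proof (intro conjI allI impI)
    fix q :: nat assume q: "1 \<le> q"
    interpret P: pair_sigma_finite \<mu> Om ..
    have "(\<integral>\<^sup>+\<xi>. ennreal (Z (\<xi> i) \<xi> ^ q) \<partial>Om) = (\<integral>\<^sup>+\<xi>. \<integral>\<^sup>+y. ennreal (Z y \<xi> ^ q) \<partial>\<mu> \<partial>Om)"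
      using resample1[OF i, of "\<lambda>\<xi>. ennreal (Z (\<xi> i) \<xi> ^ q)"] Zm by (simp add: loc)
    also have "\<dots> = (\<integral>\<^sup>+x. ennreal (Z (fst x) (snd x) ^ q) \<partial>(\<mu> \<Otimes>\<^sub>M Om))"
      using P.nn_integral_snd[of "\<lambda>x. ennreal (Z (fst x) (snd x) ^ q)"] D(5) by simp
    also have "\<dots> \<le> ennreal (Kf N c q * z ^ q)" by (rule D(7)[OF q])
    finally show "(\<integral>\<^sup>+\<xi>. ennreal (Z (\<xi> i) \<xi> ^ q) \<partial>Om) \<le> ennreal (Kf N c q * z ^ q)" .
  next
    fix x show "0 \<le> Z (x i) x" using D(6)[of "(x i, x)"] by simp
  qed (use D(1,3,4) Zm in auto)
qed

text \<open>The conditional form of \<open>psd_moment\<close>: given the coordinates outside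
  \<open>J\<close>, the summands are independent. In the resulting size \<open>n v\<close> is the
  accumulated variance and \<open>r0\<close> the norm of a single summand.\<close>

lemma psd_sum_mb:
  fixes P :: "'x \<Rightarrow> (nat \<Rightarrow> 'x) \<Rightarrow> 'i \<Rightarrow> 'i \<Rightarrow> real"
  assumes fin: "finite I" "I \<noteq> {}" "card I \<le> n ^ 4" and J: "J \<subseteq> {..<n}"
    and Pm: "\<And>i j. i \<in> I \<Longrightarrow> j \<in> I \<Longrightarrow> (\<lambda>x. P (fst x) (snd x) i j) \<in> borel_measurable (\<mu> \<Otimes>\<^sub>M Om)"
    and P: "\<And>y \<xi>. psd I (P y \<xi>)"
    and loc: "\<And>y \<xi> \<xi>'. (\<And>i. i \<notin> J \<Longrightarrow> \<xi> i = \<xi>' i) \<Longrightarrow> P y \<xi> = P y \<xi>'"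
    and \<rho>: "mb n c (\<mu> \<Otimes>\<^sub>M Om) (\<lambda>x. \<rho> (fst x) (snd x)) r0"
    and \<rho>P: "\<And>y \<xi> u. quad I (P y \<xi>) u \<le> \<rho> y \<xi> * sqn I u"
    and V: "mb n c Om V v"
    and sq: "\<And>\<xi> u. (\<integral>\<^sup>+y. ennreal ((quad I (P y \<xi>) u)\<^sup>2) \<partial>\<mu>) \<le> ennreal ((V \<xi> * sqn I u)\<^sup>2)"
  shows "mb n (2 * c + 22) Om (\<lambda>\<xi>. nrm I (\<lambda>i j. \<Sum>a\<in>J. P (\<xi> a) \<xi> i j)) (real n * v + r0)"
proof -
  note R = mbD[OF \<rho>] and W = mbD[OF V]
  have n2: "2 \<le> n" "1 \<le> n" using R(1) by auto
  have finJ: "finite J" using J finite_subset by blast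
  define D where "D = real (card I)"
  have D: "0 < D" "D \<le> real n ^ 4"
    using fin by (auto simp: D_def card_gt_0_iff of_nat_power[symmetric] simp del: of_nat_power)
  have cm: "(\<lambda>\<xi>. (\<xi> a, \<xi>)) \<in> measurable Om (\<mu> \<Otimes>\<^sub>M Om)" if "a \<in> J" for a
    using that J by (intro measurable_Pair measurable_component_singleton) auto
  have Sm: "(\<lambda>\<xi>. \<Sum>a\<in>J. P (\<xi> a) \<xi> i j) \<in> borel_measurable Om" if "i \<in> I" "j \<in> I" for i j
  proof (intro borel_measurable_sum)
    fix a assume "a \<in> J"
    from measurable_compose[OF cm[OF this] Pm[OF that]] show "(\<lambda>\<xi>. P (\<xi> a) \<xi> i j) \<in> borel_measurable Om" by simp
  qed
  have Sp: "psd I (\<lambda>i j. \<Sum>a\<in>J. P (\<xi> a) \<xi> i j)" for \<xi> by (intro psd_sum P)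
  have sec: "(\<lambda>y. f (y, \<xi>)) \<in> borel_measurable \<mu>" if "f \<in> borel_measurable (\<mu> \<Otimes>\<^sub>M Om)" "\<xi> \<in> space Om" for f :: "_ \<Rightarrow> real" and \<xi>
    using measurable_compose[OF measurable_Pair[OF measurable_ident measurable_const[OF that(2)]] that(1)] by simp
  interpret Pp: pair_sigma_finite \<mu> Om ..
  show ?thesis unfolding mb_def
  proof (intro conjI allI impI)
    show "2 \<le> n" "1 \<le> 2 * c + 22" "0 < real n * v + r0" using R(4) W(4) n2 by (auto intro!: add_pos_pos)
    show "(\<lambda>\<xi>. nrm I (\<lambda>i j. \<Sum>a\<in>J. P (\<xi> a) \<xi> i j)) \<in> borel_measurable Om"
      using fin(1) Sm by (rule nrm_measurable)
    show "0 \<le> nrm I (\<lambda>i j. \<Sum>a\<in>J. P (\<xi> a) \<xi> i j)" for \<xi> using fin(1) Sp by (rule nrm_nonneg)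
    fix q :: nat assume q: "1 \<le> q"
    \<comment> \<open>The conditional moment of \<open>\<rho>\<close> depends on
      \<open>\<xi>\<close> and has no pointwise bound; it is carried along and integrated at the
      end.\<close>
    define e where "e = (\<lambda>\<xi>. \<integral>\<^sup>+y. ennreal ((\<rho> y \<xi> / r0) ^ (2 * q)) \<partial>\<mu>)"
    have em: "e \<in> borel_measurable Om"
    proof -
      have "(\<lambda>x. \<rho> (snd x) (fst x)) \<in> borel_measurable (Om \<Otimes>\<^sub>M \<mu>)"
        using measurable_compose[OF measurable_pair_swap' R(5)] by (simp add: case_prod_beta')
      then show ?thesis unfolding e_def by (intro borel_measurable_nn_integral) (simp add: case_prod_beta')
    qed
    define \<alpha> where "\<alpha> = D * (16 * real n) ^ q"
    define \<beta> where "\<beta> = D * (4 * real q * r0) ^ q"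
    have \<alpha>: "0 \<le> \<alpha>" and \<beta>: "0 < \<beta>" using D q R(4) by (auto simp: \<alpha>_def \<beta>_def)
    have inner: "(\<integral>\<^sup>+\<xi>'. ennreal (mtr I (mpow I (\<lambda>i j. \<Sum>a\<in>J. P (\<xi>' a) \<xi> i j) q)) \<partial>Om)
      \<le> ennreal \<alpha> * ennreal (V \<xi> ^ q) + ennreal \<beta> * (1 + e \<xi>)" if \<xi>: "\<xi> \<in> space Om" for \<xi>
    proof (cases "e \<xi> = \<top>")
      case True
      then show ?thesis using \<beta> by (simp add: ennreal_mult_eq_top_iff)
    next
      case False
      then obtain x where x: "0 \<le> x" "e \<xi> = ennreal x" by (cases "e \<xi>") auto
      \<comment> \<open>\<open>r0 * y\<close> is a valid scale for the conditional moment, and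
        \<open>y >= 1\<close> allows \<open>y^q\<close> to be replaced by
        \<open>y^(2q) = 1 + x\<close>, which is linear in \<open>e\<close>.\<close>
      define y where "y = root (2 * q) (1 + x)"
      have y1: "1 \<le> y" using x q by (simp add: y_def)
      have y2: "y ^ (2 * q) = 1 + x" using x q by (simp add: y_def)
      have "(\<integral>\<^sup>+\<xi>'. ennreal (mtr I (mpow I (\<lambda>i j. \<Sum>a\<in>J. P (\<xi>' a) \<xi> i j) q)) \<partial>Om)
        \<le> ennreal (D * (8 * real n * V \<xi> + 2 * real q * (r0 * y)) ^ q)"
        unfolding D_def
      proof (rule psd_moment[where \<rho> = "\<lambda>z. \<rho> z \<xi>"])
        show "(\<lambda>y. P y \<xi> i j) \<in> borel_measurable \<mu>" if "i \<in> I" "j \<in> I" for i j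
          using sec[OF Pm[OF that] \<xi>] by simp
        show rm: "(\<lambda>z. \<rho> z \<xi>) \<in> borel_measurable \<mu>" using sec[OF R(5) \<xi>] by simp
        show "0 \<le> \<rho> y \<xi>" for y using R(6)[of "(y, \<xi>)"] by simp
        show "0 < r0 * y" using R(4) y1 by simp
        have "(\<integral>\<^sup>+z. ennreal (\<rho> z \<xi> ^ (2 * q)) \<partial>\<mu>) = (\<integral>\<^sup>+z. ennreal (r0 ^ (2 * q)) * ennreal ((\<rho> z \<xi> / r0) ^ (2 * q)) \<partial>\<mu>)"
          using R(4) R(6)[of "(_, \<xi>)"] by (intro nn_integral_cong) (simp add: ennreal_mult[symmetric] power_divide)
        also have "\<dots> = ennreal (r0 ^ (2 * q)) * e \<xi>"
          unfolding e_def using rm by (intro nn_integral_cmult) simp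
        also have "\<dots> \<le> ennreal ((r0 * y) ^ (2 * q))"
          using x R(4) unfolding power_mult_distrib y2 x(2) by (simp add: ennreal_mult[symmetric] mult_left_mono)
        finally show "(\<integral>\<^sup>+z. ennreal (\<rho> z \<xi> ^ (2 * q)) \<partial>\<mu>) \<le> ennreal ((r0 * y) ^ (2 * q))" .
        show "0 \<le> V \<xi>" by (rule W(6))
      qed (use fin P \<rho>P sq J in auto)
      also have "\<dots> \<le> ennreal (\<alpha> * V \<xi> ^ q + \<beta> * (1 + x))"
      proof (intro ennreal_leI)
        have mx: "(a + b) ^ q \<le> (2 * a) ^ q + (2 * b) ^ q" if "0 \<le> a" "0 \<le> b" for a b :: real
        proof (cases "a \<le> b")
          case True
          then have "(a + b) ^ q \<le> (2 * b) ^ q" using that by (intro power_mono) auto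
          then show ?thesis using that by (simp add: add_increasing)
        next
          case False
          then have "(a + b) ^ q \<le> (2 * a) ^ q" using that by (intro power_mono) auto
          then show ?thesis using that by (simp add: add_increasing2)
        qed
        have "(8 * real n * V \<xi> + 2 * real q * (r0 * y)) ^ q \<le> (2 * (8 * real n * V \<xi>)) ^ q + (2 * (2 * real q * (r0 * y))) ^ q"
          using W(6) R(4) y1 by (intro mx) auto
        also have "\<dots> = (16 * real n) ^ q * V \<xi> ^ q + (4 * real q * r0) ^ q * y ^ q"
        proof -
          have "2 * (8 * real n * V \<xi>) = (16 * real n) * V \<xi>" "2 * (2 * real q * (r0 * y)) = (4 * real q * r0) * y" by simp_all
          then show ?thesis by (simp only: power_mult_distrib)
        qed
        also have "\<dots> \<le> (16 * real n) ^ q * V \<xi> ^ q + (4 * real q * r0) ^ q * (1 + x)"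
        proof (intro add_left_mono mult_left_mono)
          have "y ^ q \<le> y ^ (2 * q)" using y1 by (intro power_increasing) auto
          then show "y ^ q \<le> 1 + x" using y2 by simp
        qed (use R(4) in auto)
        finally have "D * (8 * real n * V \<xi> + 2 * real q * (r0 * y)) ^ q \<le> D * \<dots>" using D by (intro mult_left_mono) auto
        then show "D * (8 * real n * V \<xi> + 2 * real q * (r0 * y)) ^ q \<le> \<alpha> * V \<xi> ^ q + \<beta> * (1 + x)"
          by (simp add: \<alpha>_def \<beta>_def distrib_left mult.assoc)
      qed
      also have "\<dots> = ennreal \<alpha> * ennreal (V \<xi> ^ q) + ennreal \<beta> * (1 + e \<xi>)"
      proof -
        have nn: "0 \<le> V \<xi> ^ q" "0 \<le> 1 + x" "0 \<le> \<beta>" using W(6) x \<beta> by auto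
        have "1 + e \<xi> = ennreal (1 + x)" using x by simp
        then show ?thesis
          by (simp only: ennreal_mult[OF \<alpha> nn(1)] ennreal_mult[OF nn(3,2)] ennreal_plus[OF mult_nonneg_nonneg[OF \<alpha> nn(1)] mult_nonneg_nonneg[OF nn(3,2)]])
      qed
      finally show ?thesis .
    qed
    have "(\<integral>\<^sup>+\<xi>. ennreal (nrm I (\<lambda>i j. \<Sum>a\<in>J. P (\<xi> a) \<xi> i j) ^ q) \<partial>Om)
      \<le> (\<integral>\<^sup>+\<xi>. ennreal (mtr I (mpow I (\<lambda>i j. \<Sum>a\<in>J. P (\<xi> a) \<xi> i j) q)) \<partial>Om)"
      using nrm_power_le[OF fin(1) Sp q] by (intro nn_integral_mono ennreal_leI)
    also have "\<dots> = (\<integral>\<^sup>+\<xi>. \<integral>\<^sup>+\<xi>'. ennreal (mtr I (mpow I (\<lambda>i j. \<Sum>a\<in>J. P (mix J \<xi> \<xi>' a) (mix J \<xi> \<xi>') i j) q)) \<partial>Om \<partial>Om)"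
      using mtr_mpow_measurable[OF fin(1) Sm] by (intro resample J) simp
    also have "\<dots> = (\<integral>\<^sup>+\<xi>. \<integral>\<^sup>+\<xi>'. ennreal (mtr I (mpow I (\<lambda>i j. \<Sum>a\<in>J. P (\<xi>' a) \<xi> i j) q)) \<partial>Om \<partial>Om)"
    proof -
      have "P y (mix J \<xi> \<xi>') = P y \<xi>" for y \<xi> \<xi>' by (rule loc) (simp add: mix_def)
      then have "(\<Sum>a\<in>J. P (mix J \<xi> \<xi>' a) (mix J \<xi> \<xi>') i j) = (\<Sum>a\<in>J. P (\<xi>' a) \<xi> i j)" for \<xi> \<xi>' i j
        by (intro sum.cong) (auto simp: mix_def)
      then show ?thesis by simp
    qed
    also have "\<dots> \<le> (\<integral>\<^sup>+\<xi>. ennreal \<alpha> * ennreal (V \<xi> ^ q) + ennreal \<beta> * (1 + e \<xi>) \<partial>Om)"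
      by (intro nn_integral_mono inner)
    also have "\<dots> = ennreal \<alpha> * (\<integral>\<^sup>+\<xi>. ennreal (V \<xi> ^ q) \<partial>Om) + ennreal \<beta> * (1 + (\<integral>\<^sup>+\<xi>. e \<xi> \<partial>Om))"
      using W(5) em by (simp add: nn_integral_add nn_integral_cmult Om.emeasure_space_1)
    also have "(\<integral>\<^sup>+\<xi>. e \<xi> \<partial>Om) = (\<integral>\<^sup>+x. ennreal ((\<rho> (fst x) (snd x) / r0) ^ (2 * q)) \<partial>(\<mu> \<Otimes>\<^sub>M Om))"
      unfolding e_def using Pp.nn_integral_snd[of "\<lambda>x. ennreal ((\<rho> (fst x) (snd x) / r0) ^ (2 * q))"] R(5) by simp
    also have "ennreal \<alpha> * (\<integral>\<^sup>+\<xi>. ennreal (V \<xi> ^ q) \<partial>Om) + ennreal \<beta> * (1 + \<dots>)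
      \<le> ennreal \<alpha> * ennreal (Kf n c q * v ^ q) + ennreal \<beta> * (1 + ennreal (Kf n c (2 * q)))"
      using q by (intro add_mono mult_left_mono W(7) mb_normalized[OF \<rho>] order_refl) auto
    also have "\<dots> = ennreal (\<alpha> * (Kf n c q * v ^ q) + \<beta> * (1 + Kf n c (2 * q)))"
    proof -
      have nn: "0 \<le> Kf n c q * v ^ q" "0 \<le> 1 + Kf n c (2 * q)" "0 \<le> \<beta>" using W(4) \<beta> by (auto simp: add_nonneg_nonneg)
      have "1 + ennreal (Kf n c (2 * q)) = ennreal (1 + Kf n c (2 * q))" by simp
      then show ?thesis
        by (simp only: ennreal_mult[OF \<alpha> nn(1)] ennreal_mult[OF nn(3,2)] ennreal_plus[OF mult_nonneg_nonneg[OF \<alpha> nn(1)] mult_nonneg_nonneg[OF nn(3,2)]])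
    qed
    \<comment> \<open>\<open>2 * c\<close> stems from the moment of order \<open>2 q\<close>; the
      factor \<open>(16 q)^q\<close> adds 16, and \<open>3 * card I <= n^6\<close> adds 6.\<close>
    also have "\<dots> \<le> ennreal (Kf n (2 * c + 22) q * (real n * v + r0) ^ q)"
    proof (intro ennreal_leI)
      define z where "z = (real n * v + r0) ^ q"
      define k where "k = Kf n (2 * c) q"
      have k1: "Kf n c q \<le> k" unfolding k_def using R(2,3) q by (intro Kf_mono) auto
      have k2: "Kf n c (2 * q) \<le> k" unfolding k_def using R(2) by (rule Kf_double)
      have k3: "1 \<le> k" unfolding k_def using R(2,3) q by (intro Kf_ge1) auto
      have z1: "(real n * v) ^ q \<le> z" and z2: "r0 ^ q \<le> z" and z0: "0 \<le> z"
        unfolding z_def using R(4) W(4) by (auto intro!: power_mono)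
      have q16: "(16::real) ^ q \<le> real (16 * q) ^ q" and q4: "(4 * real q) ^ q \<le> real (16 * q) ^ q"
        using q by (auto intro!: power_mono)
      have "(16 * real n) ^ q * (Kf n c q * v ^ q) = 16 ^ q * ((real n * v) ^ q * Kf n c q)" by (simp add: power_mult_distrib)
      also have "\<dots> \<le> real (16 * q) ^ q * (z * k)"
        using q16 z1 k1 W(4) z0 by (intro mult_mono) auto
      finally have a: "(16 * real n) ^ q * (Kf n c q * v ^ q) \<le> real (16 * q) ^ q * (z * k)" .
      have "(4 * real q * r0) ^ q * (1 + Kf n c (2 * q)) = (4 * real q) ^ q * (r0 ^ q * (1 + Kf n c (2 * q)))"
        by (simp add: power_mult_distrib)
      also have "\<dots> \<le> real (16 * q) ^ q * (z * (k + k))"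
        using q4 z2 k2 k3 R(4) z0 by (intro mult_mono add_mono) auto
      finally have b: "(4 * real q * r0) ^ q * (1 + Kf n c (2 * q)) \<le> real (16 * q) ^ q * (z * (k + k))" .
      have "\<alpha> * (Kf n c q * v ^ q) + \<beta> * (1 + Kf n c (2 * q))
        = D * ((16 * real n) ^ q * (Kf n c q * v ^ q) + (4 * real q * r0) ^ q * (1 + Kf n c (2 * q)))"
        by (simp add: \<alpha>_def \<beta>_def algebra_simps)
      also have "\<dots> \<le> D * (real (16 * q) ^ q * (z * k) + real (16 * q) ^ q * (z * (k + k)))"
        using a b D by (intro mult_left_mono add_mono) auto
      also have "\<dots> = 3 * D * (z * (real (16 * q) ^ q * k))" by (simp add: algebra_simps)
      also have "\<dots> \<le> real n ^ 6 * (z * Kf n (2 * c + 16) q)"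
      proof (intro mult_mono)
        have "3 * D \<le> real n ^ 2 * real n ^ 4"
        proof (intro mult_mono)
          have "real 2 ^ 2 \<le> real n ^ 2" using n2 by (intro power_mono) auto
          then show "3 \<le> real n ^ 2" by simp
        qed (use D in auto)
        then show "3 * D \<le> real n ^ 6" by (simp add: power_add[symmetric])
        show "real (16 * q) ^ q * k \<le> Kf n (2 * c + 16) q"
          unfolding k_def using R(2,3) q by (intro Kf_mult_power) auto
      qed (use z0 k3 in auto)
      also have "\<dots> = z * (real n ^ 6 * Kf n (2 * c + 16) q)" by simp
      also have "\<dots> \<le> z * Kf n (2 * c + 22) q"
        using Kf_mult_N[of n "2 * c + 16" q 6] n2 q z0 by (intro mult_left_mono) (auto simp: add.assoc)
      finally show "\<alpha> * (Kf n c q * v ^ q) + \<beta> * (1 + Kf n c (2 * q)) \<le> Kf n (2 * c + 22) q * (real n * v + r0) ^ q"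
        by (simp add: z_def mult.commute)
    qed
    finally show "(\<integral>\<^sup>+\<xi>. ennreal (nrm I (\<lambda>i j. \<Sum>a\<in>J. P (\<xi> a) \<xi> i j) ^ q) \<partial>Om) \<le> ennreal (Kf n (2 * c + 22) q * (real n * v + r0) ^ q)" .
  qed
qed

end

lemma card_between:
  assumes "finite U" "P \<subseteq> U" "Q \<subseteq> U" "P \<inter> Q = {}"
  shows "card {\<kappa> \<in> Pow U. P \<subseteq> \<kappa> \<and> \<kappa> \<inter> Q = {}} * 2 ^ (card P + card Q) = 2 ^ card U"
proof -
  have fin: "finite P" "finite Q" using assms by (auto intro: finite_subset)
  have "bij_betw (\<lambda>\<kappa>. \<kappa> - P) {\<kappa> \<in> Pow U. P \<subseteq> \<kappa> \<and> \<kappa> \<inter> Q = {}} (Pow (U - (P \<union> Q)))"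
    by (rule bij_betwI[where g = "\<lambda>\<kappa>. \<kappa> \<union> P"]) (use assms in blast)+
  then have "card {\<kappa> \<in> Pow U. P \<subseteq> \<kappa> \<and> \<kappa> \<inter> Q = {}} = 2 ^ card (U - (P \<union> Q))"
    using assms by (simp add: bij_betw_same_card card_Pow)
  moreover have "card (U - (P \<union> Q)) + (card P + card Q) = card U"
    using assms fin card_mono[of U "P \<union> Q"] by (simp add: card_Diff_subset card_Un_disjoint)
  ultimately show ?thesis by (metis power_add)
qed

lemma sum_if_swap:
  assumes "finite U"
  shows "(\<Sum>\<kappa>\<in>Pow U. \<Sum>x\<in>A. if R \<kappa> x then F x else (0::'a::comm_ring_1)) = (\<Sum>x\<in>A. of_nat (card {\<kappa>\<in>Pow U. R \<kappa> x}) * F x)"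
proof -
  have "(\<Sum>\<kappa>\<in>Pow U. if R \<kappa> x then F x else 0) = of_nat (card {\<kappa>\<in>Pow U. R \<kappa> x}) * F x" for x
  proof -
    have "(\<Sum>\<kappa>\<in>Pow U. if R \<kappa> x then F x else 0) = (\<Sum>\<kappa>\<in>{\<kappa>\<in>Pow U. R \<kappa> x}. F x)"
      using assms by (intro sum.inter_filter[symmetric]) simp
    then show ?thesis by simp
  qed
  then show ?thesis by (subst sum.swap) simp
qed

section \<open>Decoupling and Gaussian moments\<close>

text \<open>Decoupling: a pair (quadruple) of distinct indices is separated by a uniformly random set with
  probability \<open>1/4\<close> (\<open>1/16\<close>).\<close>

lemma decouple2:
  fixes F :: "'b \<Rightarrow> 'b \<Rightarrow> 'a::comm_ring_1"
  assumes U: "finite U"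
  shows "4 * (\<Sum>\<kappa>\<in>Pow U. \<Sum>a\<in>\<kappa>. \<Sum>b\<in>U - \<kappa>. F a b) = 2 ^ card U * (\<Sum>a\<in>U. \<Sum>b\<in>U - {a}. F a b)"
proof -
  let ?A = "SIGMA a:U. U - {a}"
  let ?R = "\<lambda>\<kappa> x. fst x \<in> \<kappa> \<and> snd x \<notin> \<kappa>"
  have "(\<Sum>a\<in>\<kappa>. \<Sum>b\<in>U - \<kappa>. F a b) = (\<Sum>x\<in>?A. if ?R \<kappa> x then F (fst x) (snd x) else 0)" if "\<kappa> \<in> Pow U" for \<kappa>
  proof -
    have f: "finite \<kappa>" using that U finite_subset by auto
    have "(\<Sum>a\<in>\<kappa>. \<Sum>b\<in>U - \<kappa>. F a b) = (\<Sum>x\<in>\<kappa> \<times> (U - \<kappa>). F (fst x) (snd x))"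
      using f U by (simp add: sum.cartesian_product case_prod_beta')
    also have "\<dots> = (\<Sum>x\<in>?A. if ?R \<kappa> x then F (fst x) (snd x) else 0)"
      using U that by (subst sum.inter_filter[symmetric]) (auto intro!: sum.cong)
    finally show ?thesis .
  qed
  then have "(\<Sum>\<kappa>\<in>Pow U. \<Sum>a\<in>\<kappa>. \<Sum>b\<in>U - \<kappa>. F a b) = (\<Sum>\<kappa>\<in>Pow U. \<Sum>x\<in>?A. if ?R \<kappa> x then F (fst x) (snd x) else 0)"
    by (intro sum.cong) auto
  also have "\<dots> = (\<Sum>x\<in>?A. of_nat (card {\<kappa>\<in>Pow U. ?R \<kappa> x}) * F (fst x) (snd x))"
    by (rule sum_if_swap[OF U])
  finally have "4 * (\<Sum>\<kappa>\<in>Pow U. \<Sum>a\<in>\<kappa>. \<Sum>b\<in>U - \<kappa>. F a b) = (\<Sum>x\<in>?A. of_nat (card {\<kappa>\<in>Pow U. ?R \<kappa> x} * 4) * F (fst x) (snd x))"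
    by (simp add: sum_distrib_left mult_ac)
  also have "\<dots> = (\<Sum>x\<in>?A. 2 ^ card U * F (fst x) (snd x))"
  proof (intro sum.cong refl)
    fix x assume x: "x \<in> ?A"
    have "{\<kappa>\<in>Pow U. ?R \<kappa> x} = {\<kappa>\<in>Pow U. {fst x} \<subseteq> \<kappa> \<and> \<kappa> \<inter> {snd x} = {}}" by auto
    moreover have "{fst x} \<subseteq> U" "{snd x} \<subseteq> U" "{fst x} \<inter> {snd x} = {}" using x by auto
    ultimately have "card {\<kappa>\<in>Pow U. ?R \<kappa> x} * 4 = 2 ^ card U"
      using card_between[OF U, of "{fst x}" "{snd x}"] by simp
    then show "of_nat (card {\<kappa>\<in>Pow U. ?R \<kappa> x} * 4) * F (fst x) (snd x) = 2 ^ card U * F (fst x) (snd x)"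
      by (simp only:) simp
  qed
  also have "\<dots> = 2 ^ card U * (\<Sum>a\<in>U. \<Sum>b\<in>U - {a}. F a b)"
    using U by (simp add: sum.Sigma sum_distrib_left case_prod_beta')
  finally show ?thesis .
qed

lemma decouple4:
  fixes F :: "'b \<Rightarrow> 'b \<Rightarrow> 'b \<Rightarrow> 'b \<Rightarrow> 'a::comm_ring_1"
  assumes U: "finite U" and ST: "S \<subseteq> U" "T \<subseteq> U" "S \<inter> T = {}"
  shows "16 * (\<Sum>\<kappa>\<in>Pow U. \<Sum>i\<in>S \<inter> \<kappa>. \<Sum>k\<in>S - \<kappa>. \<Sum>j\<in>T \<inter> \<kappa>. \<Sum>l\<in>T - \<kappa>. F i k j l)
    = 2 ^ card U * (\<Sum>i\<in>S. \<Sum>k\<in>S - {i}. \<Sum>j\<in>T. \<Sum>l\<in>T - {j}. F i k j l)"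
proof -
  have fST: "finite S" "finite T" using ST U by (auto intro: finite_subset)
  let ?A = "(SIGMA i:S. S - {i}) \<times> (SIGMA j:T. T - {j})"
  let ?R = "\<lambda>\<kappa> x. fst (fst x) \<in> \<kappa> \<and> snd (fst x) \<notin> \<kappa> \<and> fst (snd x) \<in> \<kappa> \<and> snd (snd x) \<notin> \<kappa>"
  let ?F = "\<lambda>x. F (fst (fst x)) (snd (fst x)) (fst (snd x)) (snd (snd x))"
  have e: "(\<Sum>i\<in>A. \<Sum>k\<in>B i. \<Sum>j\<in>C. \<Sum>l\<in>D j. F i k j l) = (\<Sum>x\<in>(SIGMA i:A. B i) \<times> (SIGMA j:C. D j). ?F x)"
    if "finite A" "\<And>i. finite (B i)" "finite C" "\<And>j. finite (D j)" for A B C D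
  proof -
    have "(\<Sum>i\<in>A. \<Sum>k\<in>B i. \<Sum>j\<in>C. \<Sum>l\<in>D j. F i k j l) = (\<Sum>i\<in>A. \<Sum>k\<in>B i. \<Sum>y\<in>(SIGMA j:C. D j). F i k (fst y) (snd y))"
      using that by (simp add: sum.Sigma case_prod_beta')
    also have "\<dots> = (\<Sum>z\<in>(SIGMA i:A. B i). \<Sum>y\<in>(SIGMA j:C. D j). F (fst z) (snd z) (fst y) (snd y))"
      using that(1,2) by (subst sum.Sigma) (simp_all add: case_prod_beta')
    finally show ?thesis by (simp add: sum.cartesian_product case_prod_beta')
  qed
  have "(\<Sum>i\<in>S \<inter> \<kappa>. \<Sum>k\<in>S - \<kappa>. \<Sum>j\<in>T \<inter> \<kappa>. \<Sum>l\<in>T - \<kappa>. F i k j l) = (\<Sum>x\<in>?A. if ?R \<kappa> x then ?F x else 0)" if "\<kappa> \<in> Pow U" for \<kappa>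
  proof -
    have "(\<Sum>i\<in>S \<inter> \<kappa>. \<Sum>k\<in>S - \<kappa>. \<Sum>j\<in>T \<inter> \<kappa>. \<Sum>l\<in>T - \<kappa>. F i k j l) = (\<Sum>x\<in>(SIGMA i:S \<inter> \<kappa>. S - \<kappa>) \<times> (SIGMA j:T \<inter> \<kappa>. T - \<kappa>). ?F x)"
      using fST by (intro e) auto
    also have "\<dots> = (\<Sum>x\<in>?A. if ?R \<kappa> x then ?F x else 0)"
      using fST by (subst sum.inter_filter[symmetric]) (auto intro!: sum.cong)
    finally show ?thesis .
  qed
  then have "(\<Sum>\<kappa>\<in>Pow U. \<Sum>i\<in>S \<inter> \<kappa>. \<Sum>k\<in>S - \<kappa>. \<Sum>j\<in>T \<inter> \<kappa>. \<Sum>l\<in>T - \<kappa>. F i k j l) = (\<Sum>\<kappa>\<in>Pow U. \<Sum>x\<in>?A. if ?R \<kappa> x then ?F x else 0)"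
    by (intro sum.cong) auto
  also have "\<dots> = (\<Sum>x\<in>?A. of_nat (card {\<kappa>\<in>Pow U. ?R \<kappa> x}) * ?F x)"
    by (rule sum_if_swap[OF U])
  finally have "16 * (\<Sum>\<kappa>\<in>Pow U. \<Sum>i\<in>S \<inter> \<kappa>. \<Sum>k\<in>S - \<kappa>. \<Sum>j\<in>T \<inter> \<kappa>. \<Sum>l\<in>T - \<kappa>. F i k j l) = (\<Sum>x\<in>?A. of_nat (card {\<kappa>\<in>Pow U. ?R \<kappa> x} * 16) * ?F x)"
    by (simp add: sum_distrib_left mult_ac)
  also have "\<dots> = (\<Sum>x\<in>?A. 2 ^ card U * ?F x)"
  proof (intro sum.cong refl)
    fix x assume x: "x \<in> ?A"
    let ?P = "{fst (fst x), fst (snd x)}" and ?Q = "{snd (fst x), snd (snd x)}"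
    have "{\<kappa>\<in>Pow U. ?R \<kappa> x} = {\<kappa>\<in>Pow U. ?P \<subseteq> \<kappa> \<and> \<kappa> \<inter> ?Q = {}}" by auto
    moreover have "card ?P = 2" "card ?Q = 2" "?P \<subseteq> U" "?Q \<subseteq> U" "?P \<inter> ?Q = {}"
      using x ST by (auto simp: card_insert_if)
    ultimately have "card {\<kappa>\<in>Pow U. ?R \<kappa> x} * 16 = 2 ^ card U"
      using card_between[OF U, of ?P ?Q] by simp
    then show "of_nat (card {\<kappa>\<in>Pow U. ?R \<kappa> x} * 16) * ?F x = 2 ^ card U * ?F x"
      by (simp only:) simp
  qed
  also have "\<dots> = 2 ^ card U * (\<Sum>i\<in>S. \<Sum>k\<in>S - {i}. \<Sum>j\<in>T. \<Sum>l\<in>T - {j}. F i k j l)"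
    using fST by (subst e) (auto simp: sum_distrib_left)
  finally show ?thesis .
qed

section \<open>Exponential moments of a standard normal variable\<close>

lemma nn_integral_normal_density:
  assumes "0 < \<sigma>" shows "(\<integral>\<^sup>+x. ennreal (normal_density m \<sigma> x) \<partial>lborel) = 1"
proof -
  interpret prob_space "density lborel (normal_density m \<sigma>)" by (rule prob_space_normal_density[OF assms])
  have "emeasure (density lborel (normal_density m \<sigma>)) (space (density lborel (normal_density m \<sigma>))) = 1" by (rule emeasure_space_1)
  then show ?thesis by (subst (asm) emeasure_density) auto
qed

lemma std_normal_exp:
  "(\<integral>\<^sup>+x. ennreal (exp (c * x)) \<partial>std_normal_distribution) = ennreal (exp (c\<^sup>2 / 2))"
proof -
  have e: "std_normal_density x * exp (c * x) = exp (c\<^sup>2 / 2) * normal_density c 1 x" for x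
    by (simp add: normal_density_def mult_exp_exp[symmetric] exp_add[symmetric] power2_eq_square algebra_simps add_divide_distrib diff_divide_distrib)
  have "(\<integral>\<^sup>+x. ennreal (exp (c * x)) \<partial>std_normal_distribution) = (\<integral>\<^sup>+x. ennreal (exp (c\<^sup>2 / 2)) * ennreal (normal_density c 1 x) \<partial>lborel)"
    by (subst nn_integral_density) (auto simp: ennreal_mult[symmetric] e)
  also have "\<dots> = ennreal (exp (c\<^sup>2 / 2))"
    by (simp add: nn_integral_cmult nn_integral_normal_density)
  finally show ?thesis .
qed

lemma std_normal_exp_square:
  assumes "2 * l < 1"
  shows "(\<integral>\<^sup>+x. ennreal (exp (l * x\<^sup>2)) \<partial>std_normal_distribution) = ennreal (1 / sqrt (1 - 2 * l))"
proof -
  define s where "s = 1 / sqrt (1 - 2 * l)"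
  have s: "0 < s" "s\<^sup>2 = 1 / (1 - 2 * l)" using assms by (auto simp: s_def power_divide)
  have e: "std_normal_density x * exp (l * x\<^sup>2) = s * normal_density 0 s x" for x
  proof -
    have "sqrt (2 * pi * s\<^sup>2) = sqrt (2 * pi) * s" using s(1) by (simp add: real_sqrt_mult)
    moreover have "- x\<^sup>2 / (2 * s\<^sup>2) = - x\<^sup>2 / 2 + l * x\<^sup>2" unfolding s(2) by (simp add: field_simps)
    then have "exp (- x\<^sup>2 / (2 * s\<^sup>2)) = exp (- x\<^sup>2 / 2) * exp (l * x\<^sup>2)" by (simp only: exp_add)
    ultimately show ?thesis using s(1) unfolding normal_density_def by simp
  qed
  have "(\<integral>\<^sup>+x. ennreal (exp (l * x\<^sup>2)) \<partial>std_normal_distribution) = (\<integral>\<^sup>+x. ennreal s * ennreal (normal_density 0 s x) \<partial>lborel)"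
    using s(1) by (subst nn_integral_density) (auto simp: ennreal_mult[symmetric] e)
  also have "\<dots> = ennreal s" using s(1) by (simp add: nn_integral_cmult nn_integral_normal_density)
  finally show ?thesis by (simp add: s_def)
qed

lemma std_normal_exp_centered_square:
  assumes "\<bar>l\<bar> \<le> 1 / 4"
  shows "(\<integral>\<^sup>+x. ennreal (exp (l * (x\<^sup>2 - 1))) \<partial>std_normal_distribution) \<le> ennreal (exp (4 * l\<^sup>2))"
proof -
  have l: "2 * l < 1" using assms by auto
  have "(\<integral>\<^sup>+x. ennreal (exp (l * (x\<^sup>2 - 1))) \<partial>std_normal_distribution) = (\<integral>\<^sup>+x. ennreal (exp (- l)) * ennreal (exp (l * x\<^sup>2)) \<partial>std_normal_distribution)"
    by (intro nn_integral_cong) (simp add: ennreal_mult[symmetric] exp_add[symmetric] algebra_simps)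
  also have "\<dots> = ennreal (exp (- l)) * ennreal (1 / sqrt (1 - 2 * l))"
    by (simp add: nn_integral_cmult std_normal_exp_square[OF l])
  also have "\<dots> = ennreal (exp (- l) / sqrt (1 - 2 * l))" using l by (simp add: ennreal_mult[symmetric])
  also have "\<dots> \<le> ennreal (exp (4 * l\<^sup>2))"
  proof (intro ennreal_leI)
    \<comment> \<open>The second order bound for the logarithm at \<open>- 2 l\<close>, which lies
      between \<open>- 1/2\<close> and \<open>1/2\<close>, has error \<open>8 l^2\<close>; the
      square root halves it.\<close>
    have "\<bar>ln (1 + (- 2 * l)) - (- 2 * l)\<bar> \<le> 2 * (- 2 * l)\<^sup>2"
      using assms by (intro abs_ln_one_plus_x_minus_x_bound) auto
    then have "- (4 * l\<^sup>2) \<le> ln (1 - 2 * l) / 2 + l" by (simp add: power2_eq_square abs_le_iff)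
    then have "- l - ln (1 - 2 * l) / 2 \<le> 4 * l\<^sup>2" by simp
    moreover have "exp (- l) / sqrt (1 - 2 * l) = exp (- l - ln (1 - 2 * l) / 2)"
      using l by (simp add: exp_diff ln_sqrt[symmetric])
    ultimately show "exp (- l) / sqrt (1 - 2 * l) \<le> exp (4 * l\<^sup>2)" by simp
  qed
  finally show ?thesis .
qed

text \<open>\<open>|t|^k / k!\<close> is one term of the series of \<open>exp |t|\<close>, and
  \<open>exp |t| <= exp t + exp (- t)\<close>.\<close>

lemma moment_from_exp:
  assumes Z: "Z \<in> borel_measurable M"
    and p: "(\<integral>\<^sup>+x. ennreal (exp (Z x)) \<partial>M) \<le> ennreal K" and m: "(\<integral>\<^sup>+x. ennreal (exp (- Z x)) \<partial>M) \<le> ennreal K" and "0 \<le> K"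
  shows "(\<integral>\<^sup>+x. ennreal (\<bar>Z x\<bar> ^ k) \<partial>M) \<le> ennreal (2 * K * fact k)"
proof -
  have pt: "\<bar>t\<bar> ^ k \<le> fact k * exp t + fact k * exp (- t)" for t :: real
  proof -
    have "\<bar>t\<bar> ^ k / fact k \<le> exp \<bar>t\<bar>"
    proof -
      have "(\<Sum>n\<in>{k}. \<bar>t\<bar> ^ n /\<^sub>R fact n) \<le> suminf (\<lambda>n. \<bar>t\<bar> ^ n /\<^sub>R fact n)"
        by (rule sum_le_suminf[OF summable_exp_generic]) auto
      also have "\<dots> = exp \<bar>t\<bar>" by (simp add: exp_def)
      finally have "(\<Sum>n\<in>{k}. \<bar>t\<bar> ^ n /\<^sub>R fact n) \<le> exp \<bar>t\<bar>" .
      then show ?thesis by (simp add: divide_inverse mult.commute)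
    qed
    also have "\<dots> \<le> exp t + exp (- t)" by (cases "0 \<le> t") auto
    finally show ?thesis by (simp add: field_simps)
  qed
  have "(\<integral>\<^sup>+x. ennreal (\<bar>Z x\<bar> ^ k) \<partial>M) \<le> (\<integral>\<^sup>+x. ennreal (fact k) * ennreal (exp (Z x)) + ennreal (fact k) * ennreal (exp (- Z x)) \<partial>M)"
    using pt by (intro nn_integral_mono) (simp add: ennreal_mult[symmetric] ennreal_plus[symmetric] ennreal_leI del: ennreal_plus)
  also have "\<dots> = ennreal (fact k) * (\<integral>\<^sup>+x. ennreal (exp (Z x)) \<partial>M) + ennreal (fact k) * (\<integral>\<^sup>+x. ennreal (exp (- Z x)) \<partial>M)"
    using Z by (simp add: nn_integral_add nn_integral_cmult)
  also have "\<dots> \<le> ennreal (fact k) * ennreal K + ennreal (fact k) * ennreal K"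
    by (intro add_mono mult_left_mono p m) auto
  also have "\<dots> = ennreal (2 * K * fact k)"
    using \<open>0 \<le> K\<close> by (simp add: ennreal_mult[symmetric] ennreal_plus[symmetric] mult_ac del: ennreal_plus)
  finally show ?thesis .
qed

text \<open>The triangle inequality in \<open>L^2\<close> for the squares, proved by Cauchy-Schwarz
  with the weights \<open>b m\<close>. Terms with \<open>b m = 0\<close> vanish almost everywhere
  and are removed first, since the weights are divided by.\<close>

lemma nn_integral_sum_squares:
  fixes z :: "'b \<Rightarrow> 'a \<Rightarrow> real"
  assumes I: "finite I" and zm: "\<And>m. m \<in> I \<Longrightarrow> z m \<in> borel_measurable M" and b: "\<And>m. m \<in> I \<Longrightarrow> 0 \<le> b m" and C: "0 \<le> C"
    and z: "\<And>m. m \<in> I \<Longrightarrow> (\<integral>\<^sup>+x. ennreal (z m x ^ 4) \<partial>M) \<le> ennreal (C * (b m)\<^sup>2)"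
  shows "(\<integral>\<^sup>+x. ennreal ((\<Sum>m\<in>I. (z m x)\<^sup>2)\<^sup>2) \<partial>M) \<le> ennreal (C * (\<Sum>m\<in>I. b m)\<^sup>2)"
proof -
  define I' where "I' = {m \<in> I. b m > 0}"
  define s where "s = (\<Sum>m\<in>I'. b m)"
  have I': "finite I'" "I' \<subseteq> I" using I by (auto simp: I'_def)
  have sI: "(\<Sum>m\<in>I. b m) = s" unfolding s_def I'_def using I b
    by (intro sum.mono_neutral_right) (auto simp: less_le)
  have "AE x in M. \<forall>m\<in>I - I'. z m x = 0"
  proof (intro AE_finite_allI)
    show "finite (I - I')" using I by simp
    fix m assume m: "m \<in> I - I'"
    then have "b m = 0" using b by (auto simp: I'_def less_le)
    then have "(\<integral>\<^sup>+x. ennreal (z m x ^ 4) \<partial>M) = 0" using z[of m] m by simp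
    then have "AE x in M. ennreal (z m x ^ 4) = 0"
      using zm m by (subst (asm) nn_integral_0_iff_AE) auto
    then show "AE x in M. z m x = 0" by eventually_elim (simp add: ennreal_eq_0_iff power_le_zero_eq_numeral | auto simp: ennreal_eq_0_iff dest: antisym)+
  qed
  then have "(\<integral>\<^sup>+x. ennreal ((\<Sum>m\<in>I. (z m x)\<^sup>2)\<^sup>2) \<partial>M) = (\<integral>\<^sup>+x. ennreal ((\<Sum>m\<in>I'. (z m x)\<^sup>2)\<^sup>2) \<partial>M)"
  proof (intro nn_integral_cong_AE, eventually_elim)
    fix x assume "\<forall>m\<in>I - I'. z m x = 0"
    then have "(\<Sum>m\<in>I. (z m x)\<^sup>2) = (\<Sum>m\<in>I'. (z m x)\<^sup>2)"
      using I I' by (intro sum.mono_neutral_right) auto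
    then show "ennreal ((\<Sum>m\<in>I. (z m x)\<^sup>2)\<^sup>2) = ennreal ((\<Sum>m\<in>I'. (z m x)\<^sup>2)\<^sup>2)" by simp
  qed
  also have "\<dots> \<le> (\<integral>\<^sup>+x. (\<Sum>m\<in>I'. ennreal (s / b m) * ennreal (z m x ^ 4)) \<partial>M)"
  proof (intro nn_integral_mono)
    fix x
    have "(\<Sum>m\<in>I'. (z m x)\<^sup>2)\<^sup>2 = (\<Sum>m\<in>I'. sqrt (b m) * ((z m x)\<^sup>2 / sqrt (b m)))\<^sup>2"
      by (intro arg_cong[where f = "\<lambda>x. x\<^sup>2"] sum.cong) (auto simp: I'_def)
    also have "\<dots> \<le> (\<Sum>m\<in>I'. (sqrt (b m))\<^sup>2) * (\<Sum>m\<in>I'. ((z m x)\<^sup>2 / sqrt (b m))\<^sup>2)"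
      by (rule Cauchy_Schwarz_ineq_sum)
    also have "\<dots> = s * (\<Sum>m\<in>I'. z m x ^ 4 / b m)"
      unfolding s_def by (intro arg_cong2[where f = "(*)"] sum.cong) (auto simp: I'_def power_divide power_mult[symmetric])
    also have "\<dots> = (\<Sum>m\<in>I'. s / b m * z m x ^ 4)" by (simp add: sum_distrib_left)
    finally have "ennreal ((\<Sum>m\<in>I'. (z m x)\<^sup>2)\<^sup>2) \<le> ennreal (\<Sum>m\<in>I'. s / b m * z m x ^ 4)" by (rule ennreal_leI)
    also have "\<dots> = (\<Sum>m\<in>I'. ennreal (s / b m * z m x ^ 4))"
      using b I' by (subst sum_ennreal) (auto simp: s_def I'_def intro!: mult_nonneg_nonneg divide_nonneg_nonneg sum_nonneg)
    also have "\<dots> = (\<Sum>m\<in>I'. ennreal (s / b m) * ennreal (z m x ^ 4))"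
      using b I' by (intro sum.cong refl ennreal_mult) (auto simp: s_def I'_def intro!: divide_nonneg_nonneg sum_nonneg)
    finally show "ennreal ((\<Sum>m\<in>I'. (z m x)\<^sup>2)\<^sup>2) \<le> \<dots>" .
  qed
  also have "\<dots> = (\<Sum>m\<in>I'. ennreal (s / b m) * (\<integral>\<^sup>+x. ennreal (z m x ^ 4) \<partial>M))"
    using zm I' by (subst nn_integral_sum) (auto intro!: sum.cong nn_integral_cmult)
  also have "\<dots> \<le> (\<Sum>m\<in>I'. ennreal (s / b m) * ennreal (C * (b m)\<^sup>2))"
    using z I' by (intro sum_mono mult_left_mono) auto
  also have "\<dots> = (\<Sum>m\<in>I'. ennreal (s * C * b m))"
    using C b I' by (intro sum.cong refl, subst ennreal_mult[symmetric]) (auto simp: s_def I'_def power2_eq_square mult_ac intro!: divide_nonneg_nonneg sum_nonneg)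
  also have "\<dots> = ennreal (\<Sum>m\<in>I'. s * C * b m)"
    using C b I' by (subst sum_ennreal) (auto simp: s_def I'_def intro!: mult_nonneg_nonneg sum_nonneg)
  also have "(\<Sum>m\<in>I'. s * C * b m) = C * s\<^sup>2" by (simp add: sum_distrib_left[symmetric] s_def power2_eq_square)
  finally show ?thesis by (simp add: sI)
qed


section \<open>Moments of linear and quadratic forms in a Gaussian vector\<close>

interpretation gauss: samples std_normal_distribution d for d
  by (simp add: samples_def prob_space_normal_density)

abbreviation gvec :: "nat \<Rightarrow> (nat \<Rightarrow> real) measure" where
  "gvec d \<equiv> (\<Pi>\<^sub>M a\<in>{..<d}. std_normal_distribution)"

lemma coord_measurable [measurable]: "a < d \<Longrightarrow> (\<lambda>y. y a) \<in> borel_measurable (gvec d)"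
  using measurable_component_singleton[of a "{..<d}" "\<lambda>_. std_normal_distribution"] by simp

lemma nn_integral_exp_sum:
  assumes A: "A \<subseteq> {..<d}" and f: "\<And>a. a \<in> A \<Longrightarrow> f a \<in> borel_measurable borel"
  shows "(\<integral>\<^sup>+y. ennreal (exp (\<Sum>a\<in>A. f a (y a))) \<partial>gvec d) = (\<Prod>a\<in>A. \<integral>\<^sup>+x. ennreal (exp (f a x)) \<partial>std_normal_distribution)"
proof -
  define g where "g = (\<lambda>a x. if a \<in> A then ennreal (exp (f a x)) else 1)"
  have fin: "finite A" using A finite_subset by blast
  have "(\<Prod>a\<in>{..<d}. g a (y a)) = ennreal (exp (\<Sum>a\<in>A. f a (y a)))" for y
  proof -
    have "(\<Prod>a\<in>{..<d}. g a (y a)) = (\<Prod>a\<in>A. ennreal (exp (f a (y a))))"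
      using A by (intro prod.mono_neutral_cong_right) (auto simp: g_def)
    also have "\<dots> = ennreal (\<Prod>a\<in>A. exp (f a (y a)))" by (rule prod_ennreal) simp
    finally show ?thesis using fin by (simp add: exp_sum)
  qed
  then have "(\<integral>\<^sup>+y. ennreal (exp (\<Sum>a\<in>A. f a (y a))) \<partial>gvec d) = (\<integral>\<^sup>+y. (\<Prod>a\<in>{..<d}. g a (y a)) \<partial>gvec d)" by simp
  also have "\<dots> = (\<Prod>a\<in>{..<d}. \<integral>\<^sup>+x. g a x \<partial>std_normal_distribution)"
  proof (intro gauss.Pr.product_nn_integral_prod)
    show "g a \<in> borel_measurable std_normal_distribution" for a
      using f[of a] by (cases "a \<in> A") (simp_all add: g_def)
  qed simp
  also have "\<dots> = (\<Prod>a\<in>A. \<integral>\<^sup>+x. ennreal (exp (f a x)) \<partial>std_normal_distribution)"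
    using A prob_space.emeasure_space_1[OF prob_space_normal_density[of 1 0]]
    by (intro prod.mono_neutral_cong_right) (auto simp: g_def)
  finally show ?thesis .
qed

lemma prod_mono_ennreal_aux: "finite A \<Longrightarrow> (\<And>a. a \<in> A \<Longrightarrow> f a \<le> (g a :: ennreal)) \<Longrightarrow> prod f A \<le> prod g A"
  by (induction A rule: finite_induct) (auto intro: mult_mono)

lemma exp_half_le_2: "exp (1 / 2 :: real) \<le> 2"
proof -
  have "exp (1 / 2 :: real) \<le> 1 + 1 / 2 + (1 / 2)\<^sup>2" by (rule exp_bound) auto
  then show ?thesis by (simp add: power2_eq_square)
qed

lemma scaled_moment:
  assumes Z: "Z \<in> borel_measurable M" and s: "0 \<le> s" and s0: "s = 0 \<Longrightarrow> AE x in M. Z x = 0"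
    and p: "0 < s \<Longrightarrow> (\<integral>\<^sup>+x. ennreal (exp (Z x / s)) \<partial>M) \<le> ennreal K"
    and m: "0 < s \<Longrightarrow> (\<integral>\<^sup>+x. ennreal (exp (- (Z x / s))) \<partial>M) \<le> ennreal K" and K: "0 \<le> K" and k: "1 \<le> k"
  shows "(\<integral>\<^sup>+x. ennreal (\<bar>Z x\<bar> ^ k) \<partial>M) \<le> ennreal (2 * K * fact k * s ^ k)"
proof (cases "s = 0")
  case True
  have "AE x in M. ennreal (\<bar>Z x\<bar> ^ k) = 0"
    using s0[OF True] by eventually_elim (use k in \<open>simp add: power_0_left\<close>)
  then have "(\<integral>\<^sup>+x. ennreal (\<bar>Z x\<bar> ^ k) \<partial>M) = (\<integral>\<^sup>+x. 0 \<partial>M)"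
    by (rule nn_integral_cong_AE)
  then show ?thesis by simp
next
  case False
  then have s: "0 < s" using s by simp
  have "(\<integral>\<^sup>+x. ennreal (\<bar>Z x\<bar> ^ k) \<partial>M) = (\<integral>\<^sup>+x. ennreal (s ^ k) * ennreal (\<bar>Z x / s\<bar> ^ k) \<partial>M)"
    using s by (intro nn_integral_cong) (simp add: ennreal_mult[symmetric] power_divide abs_divide)
  also have "\<dots> = ennreal (s ^ k) * (\<integral>\<^sup>+x. ennreal (\<bar>Z x / s\<bar> ^ k) \<partial>M)"
    using Z by (intro nn_integral_cmult) simp
  also have "\<dots> \<le> ennreal (s ^ k) * ennreal (2 * K * fact k)"
    using Z p[OF s] m[OF s] K by (intro mult_left_mono moment_from_exp) auto
  also have "\<dots> = ennreal (2 * K * fact k * s ^ k)" using s K by (simp add: ennreal_mult[symmetric] mult.commute)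
  finally show ?thesis .
qed

lemma gauss_linear_moment:
  assumes A: "A \<subseteq> {..<d}" and k: "1 \<le> k"
  shows "(\<integral>\<^sup>+y. ennreal (\<bar>\<Sum>a\<in>A. c a * y a\<bar> ^ k) \<partial>gvec d) \<le> ennreal (4 * fact k * sqrt (\<Sum>a\<in>A. (c a)\<^sup>2) ^ k)"
proof -
  define s where "s = sqrt (\<Sum>a\<in>A. (c a)\<^sup>2)"
  have fin: "finite A" using A finite_subset by blast
  have s0: "0 \<le> s" by (simp add: s_def sum_nonneg)
  have ex: "(\<integral>\<^sup>+y. ennreal (exp (\<Sum>a\<in>A. e * c a / s * y a)) \<partial>gvec d) \<le> ennreal 2" if s: "0 < s" and e: "e\<^sup>2 = 1" for e
  proof -
    have "(\<integral>\<^sup>+y. ennreal (exp (\<Sum>a\<in>A. e * c a / s * y a)) \<partial>gvec d) = (\<Prod>a\<in>A. \<integral>\<^sup>+x. ennreal (exp (e * c a / s * x)) \<partial>std_normal_distribution)"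
      using A by (intro nn_integral_exp_sum) auto
    also have "\<dots> = (\<Prod>a\<in>A. ennreal (exp ((e * c a / s)\<^sup>2 / 2)))"
      by (simp only: std_normal_exp)
    also have "\<dots> = ennreal (exp (\<Sum>a\<in>A. (e * c a / s)\<^sup>2 / 2))"
      using fin by (simp add: prod_ennreal exp_sum)
    also have "(\<Sum>a\<in>A. (e * c a / s)\<^sup>2 / 2) = (\<Sum>a\<in>A. (c a)\<^sup>2) / s\<^sup>2 / 2"
      using e by (simp add: power_divide power_mult_distrib sum_divide_distrib)
    also have "\<dots> = 1 / 2" using s by (simp add: s_def sum_nonneg)
    finally show ?thesis using ennreal_leI[OF exp_half_le_2] by (simp only:)
  qed
  have "(\<integral>\<^sup>+y. ennreal (\<bar>\<Sum>a\<in>A. c a * y a\<bar> ^ k) \<partial>gvec d) \<le> ennreal (2 * 2 * fact k * s ^ k)"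
  proof (rule scaled_moment[OF _ s0])
    show "(\<lambda>y. \<Sum>a\<in>A. c a * y a) \<in> borel_measurable (gvec d)"
      using A by (intro borel_measurable_sum borel_measurable_times coord_measurable) auto
    show "AE y in gvec d. (\<Sum>a\<in>A. c a * y a) = 0" if "s = 0"
      using that fin by (simp add: s_def sum_nonneg_eq_0_iff)
    assume s: "0 < s"
    show "(\<integral>\<^sup>+y. ennreal (exp ((\<Sum>a\<in>A. c a * y a) / s)) \<partial>gvec d) \<le> ennreal 2"
      using ex[OF s, of 1] by (simp add: sum_divide_distrib)
    show "(\<integral>\<^sup>+y. ennreal (exp (- ((\<Sum>a\<in>A. c a * y a) / s))) \<partial>gvec d) \<le> ennreal 2"
      using ex[OF s, of "- 1"] by (simp add: sum_divide_distrib sum_negf[symmetric])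
  qed (use k in auto)
  then show ?thesis by (simp add: s_def)
qed

lemma gauss_diagonal_moment:
  assumes A: "A \<subseteq> {..<d}" and k: "1 \<le> k"
  shows "(\<integral>\<^sup>+y. ennreal (\<bar>\<Sum>a\<in>A. c a * ((y a)\<^sup>2 - 1)\<bar> ^ k) \<partial>gvec d) \<le> ennreal (4 * fact k * (4 * sqrt (\<Sum>a\<in>A. (c a)\<^sup>2)) ^ k)"
proof -
  define s where "s = sqrt (\<Sum>a\<in>A. (c a)\<^sup>2)"
  have fin: "finite A" using A finite_subset by blast
  have s0: "0 \<le> s" by (simp add: s_def sum_nonneg)
  have cs: "\<bar>c a\<bar> \<le> s" if "a \<in> A" for a
    unfolding s_def using that fin member_le_sum[of a A "\<lambda>a. (c a)\<^sup>2"] by (intro real_le_rsqrt) simp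
  \<comment> \<open>Division by \<open>4 s\<close> brings every coefficient into the range where
    \<open>std_normal_exp_centered_square\<close> holds.\<close>
  have ex: "(\<integral>\<^sup>+y. ennreal (exp (\<Sum>a\<in>A. e * c a / (4 * s) * ((y a)\<^sup>2 - 1))) \<partial>gvec d) \<le> ennreal 2" if s: "0 < s" and e: "e\<^sup>2 = 1" "\<bar>e\<bar> = 1" for e
  proof -
    have "(\<integral>\<^sup>+y. ennreal (exp (\<Sum>a\<in>A. e * c a / (4 * s) * ((y a)\<^sup>2 - 1))) \<partial>gvec d) = (\<Prod>a\<in>A. \<integral>\<^sup>+x. ennreal (exp (e * c a / (4 * s) * (x\<^sup>2 - 1))) \<partial>std_normal_distribution)"
      using A by (intro nn_integral_exp_sum) auto
    also have "\<dots> \<le> (\<Prod>a\<in>A. ennreal (exp (4 * (e * c a / (4 * s))\<^sup>2)))"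
    proof (intro prod_mono_ennreal_aux fin std_normal_exp_centered_square)
      show "\<bar>e * c a / (4 * s)\<bar> \<le> 1 / 4" if "a \<in> A" for a
        using cs[OF that] s e(2) by (simp add: abs_mult divide_le_eq)
    qed
    also have "\<dots> = ennreal (exp (\<Sum>a\<in>A. 4 * (e * c a / (4 * s))\<^sup>2))"
      using fin by (simp add: prod_ennreal exp_sum)
    also have "(\<Sum>a\<in>A. 4 * (e * c a / (4 * s))\<^sup>2) = (\<Sum>a\<in>A. (c a)\<^sup>2) / s\<^sup>2 / 4"
      using e by (simp add: power_divide power_mult_distrib sum_divide_distrib mult.commute)
    also have "\<dots> = 1 / 4" using s by (simp add: s_def sum_nonneg)
    also have "ennreal (exp (1 / 4)) \<le> ennreal 2"
    proof (intro ennreal_leI)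
      have "exp (1 / 4 :: real) \<le> exp (1 / 2)" by simp
      then show "exp (1 / 4 :: real) \<le> 2" using exp_half_le_2 by linarith
    qed
    finally show ?thesis .
  qed
  have "(\<integral>\<^sup>+y. ennreal (\<bar>\<Sum>a\<in>A. c a * ((y a)\<^sup>2 - 1)\<bar> ^ k) \<partial>gvec d) \<le> ennreal (2 * 2 * fact k * (4 * s) ^ k)"
  proof (rule scaled_moment)
    show "(\<lambda>y. \<Sum>a\<in>A. c a * ((y a)\<^sup>2 - 1)) \<in> borel_measurable (gvec d)"
      using A by (intro borel_measurable_sum borel_measurable_times borel_measurable_diff borel_measurable_power coord_measurable) auto
    show "AE y in gvec d. (\<Sum>a\<in>A. c a * ((y a)\<^sup>2 - 1)) = 0" if "4 * s = 0"
      using that fin by (simp add: s_def sum_nonneg_eq_0_iff)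
    assume "0 < 4 * s"
    then have s: "0 < s" by simp
    show "(\<integral>\<^sup>+y. ennreal (exp ((\<Sum>a\<in>A. c a * ((y a)\<^sup>2 - 1)) / (4 * s))) \<partial>gvec d) \<le> ennreal 2"
      using ex[OF s, of 1] by (simp add: sum_divide_distrib)
    show "(\<integral>\<^sup>+y. ennreal (exp (- ((\<Sum>a\<in>A. c a * ((y a)\<^sup>2 - 1)) / (4 * s)))) \<partial>gvec d) \<le> ennreal 2"
      using ex[OF s, of "- 1"] by (simp add: sum_divide_distrib sum_negf[symmetric])
  qed (use k s0 in auto)
  then show ?thesis by (simp add: s_def)
qed

definition YY :: "(nat \<Rightarrow> real) \<Rightarrow> nat \<Rightarrow> nat \<Rightarrow> real" where
  "YY y a b = y a * y b - (if a = b then 1 else 0)"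

text \<open>Given the coordinates outside \<open>A\<close>, the form is linear in those inside. The
  fourth moment of a linear form costs \<open>96 = 4 * 4!\<close>; it is used for both groups, and
  \<open>9216 = 96^2\<close>.\<close>

lemma gauss_offdiagonal_moment:
  assumes A: "A \<subseteq> {..<d}"
  shows "(\<integral>\<^sup>+y. ennreal ((\<Sum>a\<in>A. \<Sum>b\<in>{..<d} - A. c a b * y a * y b) ^ 4) \<partial>gvec d) \<le> ennreal (9216 * (\<Sum>a\<in>A. \<Sum>b\<in>{..<d} - A. (c a b)\<^sup>2)\<^sup>2)"
proof -
  let ?B = "{..<d} - A"
  have sqr: "sqrt t ^ 4 = t\<^sup>2" if "0 \<le> t" for t
    using that by (simp add: power4_eq_xxxx power2_eq_square)
  have e4: "\<bar>t\<bar> ^ 4 = t ^ 4" for t :: real by (simp add: power_even_abs_numeral)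
  have lin4: "(\<integral>\<^sup>+y. ennreal ((\<Sum>a\<in>C. v a * y a) ^ 4) \<partial>gvec d) \<le> ennreal (96 * (\<Sum>a\<in>C. (v a)\<^sup>2)\<^sup>2)" if "C \<subseteq> {..<d}" for C v
    using gauss_linear_moment[OF that, of 4 v] by (simp add: e4 sqr sum_nonneg fact_numeral)
  define f where "f = (\<lambda>y. ennreal ((\<Sum>a\<in>A. (\<Sum>b\<in>?B. c a b * y b) * y a) ^ 4))"
  have lm: "(\<lambda>y. \<Sum>b\<in>?B. c a b * y b) \<in> borel_measurable (gvec d)" for a
    by (intro borel_measurable_sum borel_measurable_times coord_measurable) auto
  have fm: "f \<in> borel_measurable (gvec d)"
    unfolding f_def using A lm by (intro measurable_compose[OF _ measurable_ennreal] borel_measurable_power borel_measurable_sum borel_measurable_times coord_measurable) auto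
  have "(\<integral>\<^sup>+y. ennreal ((\<Sum>a\<in>A. \<Sum>b\<in>?B. c a b * y a * y b) ^ 4) \<partial>gvec d) = (\<integral>\<^sup>+y. f y \<partial>gvec d)"
    by (simp add: f_def sum_distrib_right sum_distrib_left mult_ac)
  also have "\<dots> = (\<integral>\<^sup>+y. \<integral>\<^sup>+y'. f (gauss.mix A y y') \<partial>gvec d \<partial>gvec d)" by (rule gauss.resample[OF A fm])
  also have "\<dots> = (\<integral>\<^sup>+y. \<integral>\<^sup>+y'. ennreal ((\<Sum>a\<in>A. (\<Sum>b\<in>?B. c a b * y b) * y' a) ^ 4) \<partial>gvec d \<partial>gvec d)"
    unfolding f_def gauss.mix_def by (intro nn_integral_cong arg_cong[where f = ennreal] arg_cong[where f = "\<lambda>x. x ^ 4"] sum.cong arg_cong2[where f = "(*)"]) auto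
  also have "\<dots> \<le> (\<integral>\<^sup>+y. ennreal (96 * (\<Sum>a\<in>A. (\<Sum>b\<in>?B. c a b * y b)\<^sup>2)\<^sup>2) \<partial>gvec d)"
    by (intro nn_integral_mono lin4 A)
  also have "\<dots> = ennreal 96 * (\<integral>\<^sup>+y. ennreal ((\<Sum>a\<in>A. (\<Sum>b\<in>?B. c a b * y b)\<^sup>2)\<^sup>2) \<partial>gvec d)"
    using lm by (subst nn_integral_cmult[symmetric]) (auto simp: ennreal_mult)
  also have "\<dots> \<le> ennreal 96 * ennreal (96 * (\<Sum>a\<in>A. \<Sum>b\<in>?B. (c a b)\<^sup>2)\<^sup>2)"
    using A finite_subset[OF A] lm by (intro mult_left_mono nn_integral_sum_squares lin4) (auto intro: sum_nonneg)
  also have "\<dots> = ennreal (9216 * (\<Sum>a\<in>A. \<Sum>b\<in>?B. (c a b)\<^sup>2)\<^sup>2)"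
    by (subst ennreal_mult[symmetric]) auto
  finally show ?thesis .
qed

lemma sum_fourth_power: "(u + v) ^ 4 \<le> 8 * u ^ 4 + 8 * v ^ 4" for u v :: real
proof -
  have "convex_on UNIV (\<lambda>x::real. x ^ 4)" by (rule convex_power_even) simp
  then have "((1 - 1/2) *\<^sub>R u + (1/2) *\<^sub>R v) ^ 4 \<le> (1 - 1/2) * u ^ 4 + (1/2) * v ^ 4"
    by (rule convex_onD) auto
  moreover have "((1 - 1/2) *\<^sub>R u + (1/2) *\<^sub>R v) ^ 4 = (u + v) ^ 4 / 16"
  proof -
    have "(1 - 1/2) *\<^sub>R u + (1/2) *\<^sub>R v = (u + v) / 2" by simp
    then show ?thesis by (simp only: power_divide) simp
  qed
  ultimately show ?thesis by simp
qed

text \<open>Hypercontractivity in degree 2: the fourth moment is bounded by the square of the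
  variance scale. The diagonal is treated directly, the rest is an average over
  \<open>\<kappa>\<close> of forms that are bilinear in two disjoint groups, to which convexity of
  the fourth power applies.\<close>

lemma gauss_quadratic_moment:
  "(\<integral>\<^sup>+y. ennreal ((\<Sum>a<d. \<Sum>b<d. B a b * YY y a b) ^ 4) \<partial>gvec d) \<le> ennreal (20000000 * (\<Sum>a<d. \<Sum>b<d. (B a b)\<^sup>2)\<^sup>2)"
proof -
  define F where "F = (\<Sum>a<d. \<Sum>b<d. (B a b)\<^sup>2)"
  define D where "D = (\<lambda>y::nat \<Rightarrow> real. \<Sum>a<d. B a a * ((y a)\<^sup>2 - 1))"
  define Od where "Od = (\<lambda>\<kappa> (y::nat \<Rightarrow> real). \<Sum>a\<in>\<kappa>. \<Sum>b\<in>{..<d} - \<kappa>. B a b * y a * y b)"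
  have F0: "0 \<le> F" by (simp add: F_def sum_nonneg)
  have Odm: "Od \<kappa> \<in> borel_measurable (gvec d)" if "\<kappa> \<in> Pow {..<d}" for \<kappa>
    unfolding Od_def using that by (intro borel_measurable_sum borel_measurable_times coord_measurable) auto
  have Dm: "D \<in> borel_measurable (gvec d)"
    unfolding D_def by (intro borel_measurable_sum borel_measurable_times borel_measurable_diff borel_measurable_power coord_measurable) auto
  have split: "(\<Sum>a<d. \<Sum>b<d. B a b * YY y a b) = D y + (\<Sum>\<kappa>\<in>Pow {..<d}. (1 / 2 ^ d) *\<^sub>R (4 * Od \<kappa> y))" for y
  proof -
    have "(\<Sum>b<d. B a b * YY y a b) = B a a * ((y a)\<^sup>2 - 1) + (\<Sum>b\<in>{..<d} - {a}. B a b * y a * y b)" if "a < d" for a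
    proof -
      have "(\<Sum>b<d. B a b * YY y a b) = B a a * YY y a a + (\<Sum>b\<in>{..<d} - {a}. B a b * YY y a b)"
        using that by (simp add: sum.remove)
      then show ?thesis by (simp add: YY_def power2_eq_square mult.assoc)
    qed
    then have "(\<Sum>a<d. \<Sum>b<d. B a b * YY y a b) = D y + (\<Sum>a<d. \<Sum>b\<in>{..<d} - {a}. B a b * y a * y b)"
      by (simp add: D_def sum.distrib)
    moreover have "4 * (\<Sum>\<kappa>\<in>Pow {..<d}. Od \<kappa> y) = 2 ^ d * (\<Sum>a<d. \<Sum>b\<in>{..<d} - {a}. B a b * y a * y b)"
      using decouple2[of "{..<d}" "\<lambda>a b. B a b * y a * y b"] by (simp add: Od_def)
    moreover have "(\<Sum>\<kappa>\<in>Pow {..<d}. (1 / 2 ^ d) *\<^sub>R (4 * Od \<kappa> y)) = 4 * (\<Sum>\<kappa>\<in>Pow {..<d}. Od \<kappa> y) / 2 ^ d"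
      by (simp add: sum_distrib_left sum_divide_distrib)
    ultimately show ?thesis by simp
  qed
  have "((\<Sum>a<d. \<Sum>b<d. B a b * YY y a b) ^ 4) \<le> 8 * D y ^ 4 + (\<Sum>\<kappa>\<in>Pow {..<d}. 2048 / 2 ^ d * Od \<kappa> y ^ 4)" for y
  proof -
    have "(\<Sum>\<kappa>\<in>Pow {..<d}. (1 / 2 ^ d) *\<^sub>R (4 * Od \<kappa> y)) ^ 4 \<le> (\<Sum>\<kappa>\<in>Pow {..<d}. (1 / 2 ^ d) * (4 * Od \<kappa> y) ^ 4)"
      by (rule convex_on_sum[OF _ _ convex_power_even]) (auto simp: card_Pow)
    then show ?thesis
      using sum_fourth_power[of "D y" "\<Sum>\<kappa>\<in>Pow {..<d}. (1 / 2 ^ d) *\<^sub>R (4 * Od \<kappa> y)"]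
      unfolding split by (simp add: power_mult_distrib sum_distrib_left)
        (simp add: sum_distrib_left[symmetric] sum_divide_distrib[symmetric])
  qed
  then have "(\<integral>\<^sup>+y. ennreal ((\<Sum>a<d. \<Sum>b<d. B a b * YY y a b) ^ 4) \<partial>gvec d)
     \<le> (\<integral>\<^sup>+y. ennreal (8 * D y ^ 4 + (\<Sum>\<kappa>\<in>Pow {..<d}. 2048 / 2 ^ d * Od \<kappa> y ^ 4)) \<partial>gvec d)"
    by (intro nn_integral_mono ennreal_leI)
  also have "\<dots> = (\<integral>\<^sup>+y. ennreal 8 * ennreal (D y ^ 4) + (\<Sum>\<kappa>\<in>Pow {..<d}. ennreal (2048 / 2 ^ d) * ennreal (Od \<kappa> y ^ 4)) \<partial>gvec d)"
  proof (intro nn_integral_cong)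
    fix y
    have nn: "0 \<le> D y ^ 4" "0 \<le> Od \<kappa> y ^ 4" for \<kappa> by (simp_all add: zero_le_even_power)
    have "ennreal (\<Sum>\<kappa>\<in>Pow {..<d}. 2048 / 2 ^ d * Od \<kappa> y ^ 4) = (\<Sum>\<kappa>\<in>Pow {..<d}. ennreal (2048 / 2 ^ d * Od \<kappa> y ^ 4))"
      using nn by (subst sum_ennreal) auto
    also have "\<dots> = (\<Sum>\<kappa>\<in>Pow {..<d}. ennreal (2048 / 2 ^ d) * ennreal (Od \<kappa> y ^ 4))"
      by (intro sum.cong refl ennreal_mult nn) simp
    moreover have "ennreal (8 * D y ^ 4) = ennreal 8 * ennreal (D y ^ 4)" by (intro ennreal_mult nn) simp
    moreover have "0 \<le> (\<Sum>\<kappa>\<in>Pow {..<d}. 2048 / 2 ^ d * Od \<kappa> y ^ 4)" "0 \<le> 8 * D y ^ 4"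
      using nn by (auto intro!: sum_nonneg)
    ultimately show "ennreal (8 * D y ^ 4 + (\<Sum>\<kappa>\<in>Pow {..<d}. 2048 / 2 ^ d * Od \<kappa> y ^ 4)) = ennreal 8 * ennreal (D y ^ 4) + (\<Sum>\<kappa>\<in>Pow {..<d}. ennreal (2048 / 2 ^ d) * ennreal (Od \<kappa> y ^ 4))"
      by (simp only: ennreal_plus)
  qed
  also have "\<dots> = ennreal 8 * (\<integral>\<^sup>+y. ennreal (D y ^ 4) \<partial>gvec d) + (\<Sum>\<kappa>\<in>Pow {..<d}. ennreal (2048 / 2 ^ d) * (\<integral>\<^sup>+y. ennreal (Od \<kappa> y ^ 4) \<partial>gvec d))"
  proof -
    have "(\<integral>\<^sup>+y. (\<Sum>\<kappa>\<in>Pow {..<d}. ennreal (2048 / 2 ^ d) * ennreal (Od \<kappa> y ^ 4)) \<partial>gvec d) = (\<Sum>\<kappa>\<in>Pow {..<d}. ennreal (2048 / 2 ^ d) * (\<integral>\<^sup>+y. ennreal (Od \<kappa> y ^ 4) \<partial>gvec d))"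
      using Odm by (subst nn_integral_sum) (auto intro!: sum.cong nn_integral_cmult)
    moreover have "(\<lambda>y. \<Sum>\<kappa>\<in>Pow {..<d}. ennreal (2048 / 2 ^ d) * ennreal (Od \<kappa> y ^ 4)) \<in> borel_measurable (gvec d)"
      using Odm by (intro borel_measurable_sum) auto
    ultimately show ?thesis using Dm by (simp add: nn_integral_add nn_integral_cmult)
  qed
  also have "\<dots> \<le> ennreal 8 * ennreal (24576 * F\<^sup>2) + (\<Sum>\<kappa>\<in>Pow {..<d}. ennreal (2048 / 2 ^ d) * ennreal (9216 * F\<^sup>2))"
  proof (intro add_mono sum_mono mult_left_mono)
    have D2: "(\<Sum>a<d. (B a a)\<^sup>2) \<le> F"
      unfolding F_def using member_le_sum[of _ "{..<d}" "\<lambda>b. (B _ b)\<^sup>2"] by (intro sum_mono) auto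
    have sqr: "sqrt t ^ 4 = t\<^sup>2" if "0 \<le> t" for t
      using that by (simp add: power4_eq_xxxx power2_eq_square)
    have "(\<integral>\<^sup>+y. ennreal (D y ^ 4) \<partial>gvec d) \<le> ennreal (24576 * (\<Sum>a<d. (B a a)\<^sup>2)\<^sup>2)"
      using gauss_diagonal_moment[of "{..<d}" d 4 "\<lambda>a. B a a"]
      by (simp add: D_def power_even_abs_numeral fact_numeral power_mult_distrib sqr sum_nonneg)
    also have "\<dots> \<le> ennreal (24576 * F\<^sup>2)"
      using D2 by (intro ennreal_leI mult_left_mono power_mono) (auto intro: sum_nonneg)
    finally show "(\<integral>\<^sup>+y. ennreal (D y ^ 4) \<partial>gvec d) \<le> ennreal (24576 * F\<^sup>2)" .
    fix \<kappa> assume k: "\<kappa> \<in> Pow {..<d}"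
    have "(\<Sum>a\<in>\<kappa>. \<Sum>b\<in>{..<d} - \<kappa>. (B a b)\<^sup>2) \<le> (\<Sum>a\<in>\<kappa>. \<Sum>b<d. (B a b)\<^sup>2)"
      by (intro sum_mono sum_mono2) auto
    also have "\<dots> \<le> F" unfolding F_def using k by (intro sum_mono2) (auto intro: sum_nonneg)
    finally have "(\<Sum>a\<in>\<kappa>. \<Sum>b\<in>{..<d} - \<kappa>. (B a b)\<^sup>2)\<^sup>2 \<le> F\<^sup>2" by (intro power_mono sum_nonneg) auto
    then have "ennreal (9216 * (\<Sum>a\<in>\<kappa>. \<Sum>b\<in>{..<d} - \<kappa>. (B a b)\<^sup>2)\<^sup>2) \<le> ennreal (9216 * F\<^sup>2)"
      by (intro ennreal_leI mult_left_mono) simp_all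
    moreover have "(\<integral>\<^sup>+y. ennreal (Od \<kappa> y ^ 4) \<partial>gvec d) \<le> ennreal (9216 * (\<Sum>a\<in>\<kappa>. \<Sum>b\<in>{..<d} - \<kappa>. (B a b)\<^sup>2)\<^sup>2)"
      unfolding Od_def by (rule gauss_offdiagonal_moment) (use k in simp)
    ultimately show "(\<integral>\<^sup>+y. ennreal (Od \<kappa> y ^ 4) \<partial>gvec d) \<le> ennreal (9216 * F\<^sup>2)" by (rule order_trans[rotated])
  qed auto
  also have "\<dots> = ennreal (8 * (24576 * F\<^sup>2) + 2048 * (9216 * F\<^sup>2))"
  proof -
    have "(\<Sum>\<kappa>\<in>Pow {..<d}. ennreal (2048 / 2 ^ d) * ennreal (9216 * F\<^sup>2)) = (\<Sum>\<kappa>\<in>Pow {..<d}. ennreal (2048 / 2 ^ d * (9216 * F\<^sup>2)))"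
      by (intro sum.cong refl ennreal_mult[symmetric]) auto
    also have "\<dots> = ennreal (\<Sum>\<kappa>\<in>Pow {..<d}. 2048 / 2 ^ d * (9216 * F\<^sup>2))" by (intro sum_ennreal) auto
    also have "(\<Sum>\<kappa>\<in>Pow {..<d}. 2048 / 2 ^ d * (9216 * F\<^sup>2)) = 2048 * (9216 * F\<^sup>2)" by (simp add: card_Pow)
    moreover have "ennreal 8 * ennreal (24576 * F\<^sup>2) = ennreal (8 * (24576 * F\<^sup>2))" by (intro ennreal_mult[symmetric]) auto
    moreover have "0 \<le> 8 * (24576 * F\<^sup>2)" "0 \<le> 2048 * (9216 * F\<^sup>2)" by auto
    ultimately show ?thesis by (simp only: ennreal_plus)
  qed
  \<comment> \<open>\<open>24576 = 4 * 4! * 4^4\<close> from the diagonal and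
    \<open>2048 = 8 * 4^4\<close> from the splittings give
    \<open>8 * 24576 + 2048 * 9216 = 19070976\<close>.\<close>
  also have "\<dots> \<le> ennreal (20000000 * F\<^sup>2)"
    by (intro ennreal_leI) simp
  finally show ?thesis by (simp add: F_def)
qed

lemma gvec_prob_space: "prob_space (gvec d)"
  by (rule gauss.Om.prob_space_axioms)

lemma moment_le_Kf:
  assumes "2 \<le> N" "1 \<le> q"
  shows "4 * fact (2 * q) \<le> Kf N 4 q" "4 * fact q * 4 ^ q \<le> Kf N 4 q"
proof -
  have N: "4 \<le> real N ^ 4"
    using power_mono[of "2::real" "real N" 4] assms(1) by simp
  have "(fact (2 * q) :: real) \<le> real ((2 * q) ^ (2 * q))" by (rule fact_le_power)
  also have "\<dots> \<le> real (4 * q) ^ (2 * q)" unfolding of_nat_power by (intro power_mono) auto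
  also have "\<dots> \<le> real (4 * q) ^ (4 * q)" using assms(2) by (intro power_increasing one_le_real_mult) auto
  finally show "4 * fact (2 * q) \<le> Kf N 4 q"
    unfolding Kf_def using N by (intro mult_mono) auto
  have "(fact q :: real) * 4 ^ q \<le> real (q ^ q) * 4 ^ q" by (intro mult_right_mono fact_le_power) auto
  also have "\<dots> = real (4 * q) ^ q" by (simp add: power_mult_distrib mult.commute)
  also have "\<dots> \<le> real (4 * q) ^ (4 * q)" using assms(2) by (intro power_increasing one_le_real_mult) auto
  finally have "4 * (fact q * 4 ^ q) \<le> Kf N 4 q"
    unfolding Kf_def using N by (intro mult_mono) auto
  then show "4 * fact q * 4 ^ q \<le> Kf N 4 q" by (simp only: mult.assoc)
qed

lemma mb_linear:
  assumes N: "2 \<le> N" and z: "0 < z" "(\<Sum>a<d. (v a)\<^sup>2) \<le> z"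
  shows "mb N 4 (gvec d) (\<lambda>y. (\<Sum>a<d. v a * y a)\<^sup>2) z"
  unfolding mb_def
proof (intro conjI allI impI)
  show "(\<lambda>y. (\<Sum>a<d. v a * y a)\<^sup>2) \<in> borel_measurable (gvec d)"
    by (intro borel_measurable_power borel_measurable_sum borel_measurable_times coord_measurable) auto
  fix q :: nat assume q: "1 \<le> q"
  define s where "s = (\<Sum>a<d. (v a)\<^sup>2)"
  have s: "0 \<le> s" by (simp add: s_def sum_nonneg)
  have "(\<integral>\<^sup>+y. ennreal (((\<Sum>a<d. v a * y a)\<^sup>2) ^ q) \<partial>gvec d) = (\<integral>\<^sup>+y. ennreal (\<bar>\<Sum>a<d. v a * y a\<bar> ^ (2 * q)) \<partial>gvec d)"
    by (simp add: power_mult)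
  also have "\<dots> \<le> ennreal (4 * fact (2 * q) * sqrt s ^ (2 * q))"
    unfolding s_def using q by (intro gauss_linear_moment) auto
  also have "sqrt s ^ (2 * q) = s ^ q" using s by (simp add: power_mult)
  also have "ennreal (4 * fact (2 * q) * s ^ q) \<le> ennreal (Kf N 4 q * z ^ q)"
    using moment_le_Kf(1)[OF N q] s z by (intro ennreal_leI mult_mono power_mono) (auto simp: s_def)
  finally show "(\<integral>\<^sup>+y. ennreal (((\<Sum>a<d. v a * y a)\<^sup>2) ^ q) \<partial>gvec d) \<le> ennreal (Kf N 4 q * z ^ q)" .
qed (use N z in auto)

lemma mb_sqnorm:
  assumes N: "2 \<le> N" and d: "1 \<le> d"
  shows "mb N 4 (gvec d) (\<lambda>y. \<Sum>a<d. (y a)\<^sup>2) (real d)"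
proof -
  have "mb N 4 (gvec d) (\<lambda>y. \<Sum>a<d. (\<Sum>b<d. (if b = a then 1 else 0) * y b)\<^sup>2) (\<Sum>a<d. 1)"
  proof (intro mb_sum mb_linear N)
    have "(if b = a then 1 else 0 :: real)\<^sup>2 = (if b = a then 1 else 0)" for a b :: nat by simp
    then show "(\<Sum>b<d. (if b = a then 1 else 0 :: real)\<^sup>2) \<le> 1" for a by simp
    show "{..<d} \<noteq> {}" using d by (simp add: lessThan_empty_iff)
  qed auto
  moreover have "(\<Sum>b<d. (if b = a then 1 else 0) * y b) = y a" if "a < d" for a and y :: "nat \<Rightarrow> real"
    using that by (simp add: if_distrib if_distribR cong: if_cong)
  ultimately show ?thesis by simp
qed

lemma mb_sqnorm_deviation:
  assumes N: "2 \<le> N" and d: "1 \<le> d"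
  shows "mb N 4 (gvec d) (\<lambda>y. \<bar>(\<Sum>a<d. (y a)\<^sup>2) - real d\<bar>) (sqrt (real d))"
  unfolding mb_def
proof (intro conjI allI impI)
  show "(\<lambda>y. \<bar>(\<Sum>a<d. (y a)\<^sup>2) - real d\<bar>) \<in> borel_measurable (gvec d)"
    by (intro borel_measurable_abs borel_measurable_diff borel_measurable_power borel_measurable_sum coord_measurable) auto
  fix q :: nat assume q: "1 \<le> q"
  have "(\<integral>\<^sup>+y. ennreal (\<bar>(\<Sum>a<d. (y a)\<^sup>2) - real d\<bar> ^ q) \<partial>gvec d) \<le> ennreal (4 * fact q * (4 * sqrt (real d)) ^ q)"
    using gauss_diagonal_moment[of "{..<d}" d q "\<lambda>_. 1"] q by (simp add: sum_subtractf)
  also have "4 * fact q * (4 * sqrt (real d)) ^ q = 4 * fact q * 4 ^ q * sqrt (real d) ^ q" by (simp add: power_mult_distrib)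
  also have "ennreal \<dots> \<le> ennreal (Kf N 4 q * sqrt (real d) ^ q)"
    using moment_le_Kf(2)[OF N q] by (intro ennreal_leI mult_right_mono) auto
  finally show "(\<integral>\<^sup>+y. ennreal (\<bar>(\<Sum>a<d. (y a)\<^sup>2) - real d\<bar> ^ q) \<partial>gvec d) \<le> ennreal (Kf N 4 q * sqrt (real d) ^ q)" .
qed (use N d in auto)

section \<open>Spectral norms attached to a Gaussian sample\<close>

text \<open>\<open>L^T L\<close> and \<open>L L^T\<close> have the same norm, so a bound over
  \<open>I\<close> also controls combinations over \<open>B\<close>. With \<open>w = L^T u\<close>,
  Cauchy-Schwarz bounds \<open>|w|^4\<close> by \<open>|u|^2\<close> times the form at
  \<open>w\<close>, and one factor \<open>|w|^2\<close> cancels.\<close>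

lemma dual_norm_le:
  assumes fin: "finite I"
  shows "(\<Sum>i\<in>I. (\<Sum>b\<in>B. u b * L b i)\<^sup>2) \<le> nrm I (\<lambda>i j. \<Sum>b\<in>B. L b i * L b j) * (\<Sum>b\<in>B. (u b)\<^sup>2)"
proof -
  let ?G = "\<lambda>i j. \<Sum>b\<in>B. L b i * L b j"
  have p: "psd I ?G" by (rule psd_gram) simp
  define w where "w = (\<lambda>i. \<Sum>b\<in>B. u b * L b i)"
  define S where "S = sqn I w"
  define U where "U = (\<Sum>b\<in>B. (u b)\<^sup>2)"
  have S0: "0 \<le> S" and U0: "0 \<le> U" by (simp_all add: S_def U_def sum_nonneg)
  have "S = (\<Sum>i\<in>I. \<Sum>b\<in>B. u b * (L b i * w i))"
    by (simp add: S_def sqn_def power2_eq_square) (simp add: w_def sum_distrib_left sum_distrib_right mult_ac)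
  also have "\<dots> = (\<Sum>b\<in>B. u b * (\<Sum>i\<in>I. L b i * w i))"
    by (subst sum.swap) (simp add: sum_distrib_left)
  finally have "S\<^sup>2 \<le> U * (\<Sum>b\<in>B. (\<Sum>i\<in>I. L b i * w i)\<^sup>2)"
    unfolding U_def by (simp add: Cauchy_Schwarz_ineq_sum)
  also have "(\<Sum>b\<in>B. (\<Sum>i\<in>I. L b i * w i)\<^sup>2) = quad I ?G w" by (rule quad_gram[symmetric]) simp
  also have "U * quad I ?G w \<le> U * (nrm I ?G * S)"
    unfolding S_def by (intro mult_left_mono quad_le_nrm fin p U0)
  finally have h: "S * S \<le> S * (nrm I ?G * U)" by (simp add: power2_eq_square mult_ac)
  have "S \<le> nrm I ?G * U"
  proof (cases "S = 0")
    case True then show ?thesis using nrm_nonneg[OF fin p] U0 by simp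
  next
    case False then show ?thesis using h S0 by simp
  qed
  then show ?thesis by (simp add: S_def U_def sqn_def w_def)
qed

text \<open>The family is a Kronecker product; \<open>dual_norm_le\<close> is applied to one factor
  at a time while the index of the other is frozen.\<close>

lemma dual_norm_le2:
  assumes fin: "finite I" "finite J" "finite B" "finite E"
  shows "(\<Sum>i\<in>I. \<Sum>j\<in>J. (\<Sum>p\<in>B \<times> E. u p * (L (fst p) i * R (snd p) j))\<^sup>2)
    \<le> nrm I (\<lambda>i i'. \<Sum>b\<in>B. L b i * L b i') * nrm J (\<lambda>j j'. \<Sum>e\<in>E. R e j * R e j') * sqn (B \<times> E) u"
proof -
  let ?l = "nrm I (\<lambda>i i'. \<Sum>b\<in>B. L b i * L b i')" and ?r = "nrm J (\<lambda>j j'. \<Sum>e\<in>E. R e j * R e j')"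
  have l0: "0 \<le> ?l" by (intro nrm_nonneg fin psd_gram) simp
  have "(\<Sum>i\<in>I. \<Sum>j\<in>J. (\<Sum>p\<in>B \<times> E. u p * (L (fst p) i * R (snd p) j))\<^sup>2)
    = (\<Sum>j\<in>J. \<Sum>i\<in>I. (\<Sum>b\<in>B. (\<Sum>e\<in>E. u (b, e) * R e j) * L b i)\<^sup>2)"
  proof (subst sum.swap, intro sum.cong refl arg_cong[where f = "\<lambda>x. x\<^sup>2"])
    fix i j
    show "(\<Sum>p\<in>B \<times> E. u p * (L (fst p) i * R (snd p) j)) = (\<Sum>b\<in>B. (\<Sum>e\<in>E. u (b, e) * R e j) * L b i)"
      by (simp add: sum.cartesian_product[symmetric] sum_distrib_left sum_distrib_right mult_ac case_prod_beta')
        (simp add: sum.cartesian_product case_prod_beta' mult_ac)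
  qed
  also have "\<dots> \<le> (\<Sum>j\<in>J. ?l * (\<Sum>b\<in>B. (\<Sum>e\<in>E. u (b, e) * R e j)\<^sup>2))"
    by (intro sum_mono dual_norm_le fin)
  also have "\<dots> = ?l * (\<Sum>b\<in>B. \<Sum>j\<in>J. (\<Sum>e\<in>E. u (b, e) * R e j)\<^sup>2)"
    by (simp add: sum_distrib_left[symmetric]) (intro disjI2 sum.swap)
  also have "\<dots> \<le> ?l * (\<Sum>b\<in>B. ?r * (\<Sum>e\<in>E. (u (b, e))\<^sup>2))"
    by (intro mult_left_mono sum_mono dual_norm_le fin l0)
  also have "\<dots> = ?l * ?r * sqn (B \<times> E) u"
    by (simp add: sqn_def sum_distrib_left[symmetric] sum.cartesian_product)
  finally show ?thesis .
qed

lemma nrm_empty [simp]: "nrm {} G = 0"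
proof -
  have "(\<lambda>k. root k (mtr {} (mpow {} G k))) ` {1..} = {0}" by (auto simp: mtr_def intro!: image_eqI[of _ _ 1])
  then show ?thesis by (simp add: nrm_def)
qed

lemma nrm_cong:
  assumes "finite I" "\<And>i j. i \<in> I \<Longrightarrow> j \<in> I \<Longrightarrow> G i j = H i j"
  shows "nrm I G = nrm I H"
proof -
  have "mres I G = mres I H" using assms(2) by (auto simp: mres_def fun_eq_iff)
  then have "mtr I (mpow I G k) = mtr I (mpow I H k)" for k
    using mtr_mpow_mres[OF assms(1), of G k] mtr_mpow_mres[OF assms(1), of H k] by simp
  then show ?thesis by (simp add: nrm_def)
qed

text \<open>Adds the case of an empty index set, since the sets \<open>B\<close>, \<open>E\<close>
  arising from splittings may be empty, and asks for locality only on the entries in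
  \<open>I\<close>.\<close>

lemma (in samples) psd_sum_mb':
  fixes P :: "'x \<Rightarrow> (nat \<Rightarrow> 'x) \<Rightarrow> 'i \<Rightarrow> 'i \<Rightarrow> real"
  assumes fin: "finite I" "card I \<le> n ^ 4" and J: "J \<subseteq> {..<n}"
    and Pm: "\<And>i j. i \<in> I \<Longrightarrow> j \<in> I \<Longrightarrow> (\<lambda>x. P (fst x) (snd x) i j) \<in> borel_measurable (\<mu> \<Otimes>\<^sub>M Om)"
    and P: "\<And>y \<xi>. psd I (P y \<xi>)"
    and loc: "\<And>y \<xi> \<xi>' i j. (\<And>k. k \<notin> J \<Longrightarrow> \<xi> k = \<xi>' k) \<Longrightarrow> i \<in> I \<Longrightarrow> j \<in> I \<Longrightarrow> P y \<xi> i j = P y \<xi>' i j"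
    and \<rho>: "mb n c (\<mu> \<Otimes>\<^sub>M Om) (\<lambda>x. \<rho> (fst x) (snd x)) r0"
    and \<rho>P: "\<And>y \<xi> u. quad I (P y \<xi>) u \<le> \<rho> y \<xi> * sqn I u"
    and V: "mb n c Om V v"
    and sq: "\<And>\<xi> u. (\<integral>\<^sup>+y. ennreal ((quad I (P y \<xi>) u)\<^sup>2) \<partial>\<mu>) \<le> ennreal ((V \<xi> * sqn I u)\<^sup>2)"
    and z: "real n * v + r0 \<le> z"
  shows "mb n (2 * c + 22) Om (\<lambda>\<xi>. nrm I (\<lambda>i j. \<Sum>a\<in>J. P (\<xi> a) \<xi> i j)) z"
proof (cases "I = {}")
  case True
  have "0 < real n * v + r0" using mbD[OF \<rho>] mbD[OF V] by (intro add_nonneg_pos) (auto simp: less_imp_le)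
  then show ?thesis using True z mbD(1)[OF V] Om.prob_space_axioms by (simp add: mb_const)
next
  case False
  have "mb n (2 * c + 22) Om (\<lambda>\<xi>. nrm I (\<lambda>i j. \<Sum>a\<in>J. mres I (P (\<xi> a) \<xi>) i j)) (real n * v + r0)"
  proof (rule psd_sum_mb[where P = "\<lambda>y \<xi>. mres I (P y \<xi>)" and \<rho> = \<rho> and V = V, OF fin(1) False fin(2) J])
    show "(\<lambda>x. mres I (P (fst x) (snd x)) i j) \<in> borel_measurable (\<mu> \<Otimes>\<^sub>M Om)" if "i \<in> I" "j \<in> I" for i j
      using Pm[OF that] that by (simp add: mres_def)
    show "mres I (P y \<xi>) = mres I (P y \<xi>')" if "\<And>i. i \<notin> J \<Longrightarrow> \<xi> i = \<xi>' i" for y \<xi> \<xi>'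
      using loc[OF that] by (auto simp: mres_def fun_eq_iff)
  qed (use P \<rho> \<rho>P V sq in auto)
  moreover have "nrm I (\<lambda>i j. \<Sum>a\<in>J. mres I (P (\<xi> a) \<xi>) i j) = nrm I (\<lambda>i j. \<Sum>a\<in>J. P (\<xi> a) \<xi> i j)" for \<xi>
    using fin(1) by (intro nrm_cong) (auto simp: mres_def)
  ultimately show ?thesis using z by (simp add: mb_weaken)
qed

lemma (in samples) mb_comp:
  assumes "i < n" "mb n c \<mu> Z z"
  shows "mb n c Om (\<lambda>\<xi>. Z (\<xi> i)) z"
  using mb_coord[OF assms(1), where Z = "\<lambda>y _. Z y"] mb_fst[OF Om.prob_space_axioms assms(2)] by simp

section \<open>Products of the matrices \<open>Y_i\<close>, their traces, and the associated
  norms\<close>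

definition Yv :: "nat \<Rightarrow> (nat \<Rightarrow> real) \<Rightarrow> (nat \<Rightarrow> real) \<Rightarrow> nat \<Rightarrow> real" where
  "Yv d y v \<alpha> = (\<Sum>\<beta><d. YY y \<alpha> \<beta> * v \<beta>)"

definition ek :: "nat \<Rightarrow> nat \<Rightarrow> real" where
  "ek k = (\<lambda>\<beta>. if \<beta> = k then 1 else 0)"

lemma YY_sym: "YY y a b = YY y b a"
  by (auto simp: YY_def)

lemma Yv_eq: "\<alpha> < d \<Longrightarrow> Yv d y v \<alpha> = y \<alpha> * (\<Sum>\<beta><d. y \<beta> * v \<beta>) - v \<alpha>"
proof -
  assume a: "\<alpha> < d"
  have "Yv d y v \<alpha> = (\<Sum>\<beta><d. y \<alpha> * (y \<beta> * v \<beta>) - (if \<alpha> = \<beta> then v \<beta> else 0))"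
    unfolding Yv_def by (intro sum.cong) (auto simp: YY_def algebra_simps)
  then show ?thesis using a by (simp add: sum_subtractf sum_distrib_left)
qed

lemma Yv_ek: "k < d \<Longrightarrow> Yv d y (ek k) \<alpha> = YY y \<alpha> k"
proof -
  assume k: "k < d"
  have "Yv d y (ek k) \<alpha> = (\<Sum>\<beta><d. if \<beta> = k then YY y \<alpha> \<beta> else 0)"
    unfolding Yv_def by (intro sum.cong) (auto simp: ek_def)
  then show ?thesis using k by simp
qed

lemma YY_expand: "\<gamma> < d \<Longrightarrow> \<delta> < d \<Longrightarrow> YY y \<gamma> \<delta> = y \<gamma> * y \<delta> - (\<Sum>k<d. ek k \<gamma> * ek k \<delta>)"
proof -
  assume g: "\<gamma> < d" "\<delta> < d"
  have "(\<Sum>k<d. ek k \<gamma> * ek k \<delta>) = (\<Sum>k<d. if k = \<gamma> then (if \<gamma> = \<delta> then 1 else 0) else 0)"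
    by (intro sum.cong) (auto simp: ek_def)
  then show ?thesis using g by (simp add: YY_def)
qed

text \<open>An entry of the matrix product \<open>Y_b Y(y) Y_e\<close> with
  \<open>p = (b, e)\<close>. The pair is one argument because such pairs index the Gram matrices
  below.\<close>

definition Phi :: "nat \<Rightarrow> (nat \<Rightarrow> real) \<Rightarrow> (nat \<Rightarrow> nat \<Rightarrow> real) \<Rightarrow> nat \<Rightarrow> nat \<Rightarrow> nat \<times> nat \<Rightarrow> real" where
  "Phi d y \<xi> \<alpha> \<beta> p = (\<Sum>\<gamma><d. \<Sum>\<delta><d. YY (\<xi> (fst p)) \<alpha> \<gamma> * YY y \<gamma> \<delta> * YY (\<xi> (snd p)) \<delta> \<beta>)"

text \<open>With \<open>p = (b, e)\<close> this is \<open>tr (Y(y) Y_b Y_c Y_e)\<close>.\<close>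

definition Tt :: "nat \<Rightarrow> (nat \<Rightarrow> real) \<Rightarrow> (nat \<Rightarrow> nat \<Rightarrow> real) \<Rightarrow> nat \<Rightarrow> nat \<times> nat \<Rightarrow> real" where
  "Tt d y \<xi> c p = (\<Sum>\<alpha><d. \<Sum>\<beta><d. YY y \<alpha> \<beta> * Phi d (\<xi> c) \<xi> \<alpha> \<beta> p)"

lemma sum4_swap: "(\<Sum>a\<in>A. \<Sum>b\<in>B. \<Sum>c\<in>C. \<Sum>e\<in>D. F a b c e) = (\<Sum>c\<in>C. \<Sum>e\<in>D. \<Sum>a\<in>A. \<Sum>b\<in>B. F a b c e)"
proof -
  have "(\<Sum>a\<in>A. \<Sum>b\<in>B. \<Sum>c\<in>C. \<Sum>e\<in>D. F a b c e) = (\<Sum>a\<in>A. \<Sum>c\<in>C. \<Sum>b\<in>B. \<Sum>e\<in>D. F a b c e)"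
    by (intro sum.cong refl sum.swap)
  also have "\<dots> = (\<Sum>c\<in>C. \<Sum>a\<in>A. \<Sum>b\<in>B. \<Sum>e\<in>D. F a b c e)" by (rule sum.swap)
  also have "\<dots> = (\<Sum>c\<in>C. \<Sum>a\<in>A. \<Sum>e\<in>D. \<Sum>b\<in>B. F a b c e)" by (intro sum.cong refl sum.swap)
  also have "\<dots> = (\<Sum>c\<in>C. \<Sum>e\<in>D. \<Sum>a\<in>A. \<Sum>b\<in>B. F a b c e)" by (intro sum.cong refl sum.swap)
  finally show ?thesis .
qed

text \<open>By cyclicity and transposition the trace of four symmetric factors is unchanged when the
  opposite factors \<open>Y(y)\<close> and \<open>Y_c\<close> trade places.\<close>

lemma Tt_swap: "Tt d y \<xi> c p = (\<Sum>\<gamma><d. \<Sum>\<delta><d. YY (\<xi> c) \<gamma> \<delta> * Phi d y \<xi> \<gamma> \<delta> p)"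
proof -
  have "Tt d y \<xi> c p = (\<Sum>\<alpha><d. \<Sum>\<beta><d. \<Sum>\<gamma><d. \<Sum>\<delta><d. YY y \<alpha> \<beta> * (YY (\<xi> (fst p)) \<alpha> \<gamma> * YY (\<xi> c) \<gamma> \<delta> * YY (\<xi> (snd p)) \<delta> \<beta>))"
    by (simp add: Tt_def Phi_def sum_distrib_left)
  also have "\<dots> = (\<Sum>\<gamma><d. \<Sum>\<delta><d. \<Sum>\<alpha><d. \<Sum>\<beta><d. YY y \<alpha> \<beta> * (YY (\<xi> (fst p)) \<alpha> \<gamma> * YY (\<xi> c) \<gamma> \<delta> * YY (\<xi> (snd p)) \<delta> \<beta>))"
    by (rule sum4_swap)
  also have "\<dots> = (\<Sum>\<gamma><d. \<Sum>\<delta><d. \<Sum>\<alpha><d. \<Sum>\<beta><d. YY (\<xi> c) \<gamma> \<delta> * (YY (\<xi> (fst p)) \<gamma> \<alpha> * YY y \<alpha> \<beta> * YY (\<xi> (snd p)) \<beta> \<delta>))"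
  proof (intro sum.cong refl)
    fix \<gamma> \<delta> \<alpha> \<beta>
    show "YY y \<alpha> \<beta> * (YY (\<xi> (fst p)) \<alpha> \<gamma> * YY (\<xi> c) \<gamma> \<delta> * YY (\<xi> (snd p)) \<delta> \<beta>) = YY (\<xi> c) \<gamma> \<delta> * (YY (\<xi> (fst p)) \<gamma> \<alpha> * YY y \<alpha> \<beta> * YY (\<xi> (snd p)) \<beta> \<delta>)"
      unfolding YY_sym[of "\<xi> (fst p)" \<alpha> \<gamma>] YY_sym[of "\<xi> (snd p)" \<delta> \<beta>] by (simp only: mult_ac)
  qed
  finally show ?thesis by (simp add: Phi_def sum_distrib_left)
qed

text \<open>As \<open>Y(y)\<close> is \<open>y y^T\<close> minus the sum of the
  \<open>e_k e_k^T\<close>, the product is a combination of \<open>d + 1\<close> rank-one matrices.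
  In each of them \<open>b\<close> and \<open>e\<close> occur in separate factors, as
  \<open>dual_norm_le2\<close> requires.\<close>

lemma Phi_expand:
  assumes "\<alpha> < d" "\<beta> < d"
  shows "Phi d y \<xi> \<alpha> \<beta> p = Yv d (\<xi> (fst p)) y \<alpha> * Yv d (\<xi> (snd p)) y \<beta>
    - (\<Sum>k<d. Yv d (\<xi> (fst p)) (ek k) \<alpha> * Yv d (\<xi> (snd p)) (ek k) \<beta>)"
proof -
  let ?b = "YY (\<xi> (fst p))" and ?e = "YY (\<xi> (snd p))"
  have prod: "Yv d (\<xi> (fst p)) v \<alpha> * Yv d (\<xi> (snd p)) v \<beta> = (\<Sum>\<gamma><d. \<Sum>\<delta><d. ?b \<alpha> \<gamma> * (v \<gamma> * v \<delta>) * ?e \<delta> \<beta>)" for v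
    unfolding Yv_def sum_product by (intro sum.cong refl) (simp add: YY_sym[of "\<xi> (snd p)" _ \<beta>] mult_ac)
  have "Phi d y \<xi> \<alpha> \<beta> p = (\<Sum>\<gamma><d. \<Sum>\<delta><d. ?b \<alpha> \<gamma> * (y \<gamma> * y \<delta>) * ?e \<delta> \<beta> - (\<Sum>k<d. ?b \<alpha> \<gamma> * (ek k \<gamma> * ek k \<delta>) * ?e \<delta> \<beta>))"
    unfolding Phi_def
  proof (intro sum.cong refl)
    fix \<gamma> \<delta> assume "\<gamma> \<in> {..<d}" "\<delta> \<in> {..<d}"
    then show "?b \<alpha> \<gamma> * YY y \<gamma> \<delta> * ?e \<delta> \<beta> = ?b \<alpha> \<gamma> * (y \<gamma> * y \<delta>) * ?e \<delta> \<beta> - (\<Sum>k<d. ?b \<alpha> \<gamma> * (ek k \<gamma> * ek k \<delta>) * ?e \<delta> \<beta>)"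
      by (subst YY_expand[of \<gamma> d \<delta> y]) (auto simp: sum_distrib_left sum_distrib_right left_diff_distrib right_diff_distrib)
  qed
  also have "\<dots> = (\<Sum>\<gamma><d. \<Sum>\<delta><d. ?b \<alpha> \<gamma> * (y \<gamma> * y \<delta>) * ?e \<delta> \<beta>) - (\<Sum>\<gamma><d. \<Sum>\<delta><d. \<Sum>k<d. ?b \<alpha> \<gamma> * (ek k \<gamma> * ek k \<delta>) * ?e \<delta> \<beta>)"
    by (simp add: sum_subtractf)
  also have "(\<Sum>\<gamma><d. \<Sum>\<delta><d. \<Sum>k<d. ?b \<alpha> \<gamma> * (ek k \<gamma> * ek k \<delta>) * ?e \<delta> \<beta>) = (\<Sum>k<d. \<Sum>\<gamma><d. \<Sum>\<delta><d. ?b \<alpha> \<gamma> * (ek k \<gamma> * ek k \<delta>) * ?e \<delta> \<beta>)"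
  proof -
    have "(\<Sum>\<gamma><d. \<Sum>\<delta><d. \<Sum>k<d. ?b \<alpha> \<gamma> * (ek k \<gamma> * ek k \<delta>) * ?e \<delta> \<beta>) = (\<Sum>\<gamma><d. \<Sum>k<d. \<Sum>\<delta><d. ?b \<alpha> \<gamma> * (ek k \<gamma> * ek k \<delta>) * ?e \<delta> \<beta>)"
      by (intro sum.cong refl sum.swap)
    also have "\<dots> = (\<Sum>k<d. \<Sum>\<gamma><d. \<Sum>\<delta><d. ?b \<alpha> \<gamma> * (ek k \<gamma> * ek k \<delta>) * ?e \<delta> \<beta>)" by (rule sum.swap)
    finally show ?thesis .
  qed
  finally show ?thesis by (simp add: prod)
qed

text \<open>The norm of the sum of \<open>vec(Y_b) vec(Y_b)^T\<close>, a matrix of order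
  \<open>d^2\<close>.\<close>

definition nY :: "nat \<Rightarrow> nat set \<Rightarrow> (nat \<Rightarrow> nat \<Rightarrow> real) \<Rightarrow> real" where
  "nY d J \<xi> = nrm ({..<d} \<times> {..<d}) (\<lambda>p q. \<Sum>b\<in>J. YY (\<xi> b) (fst p) (snd p) * YY (\<xi> b) (fst q) (snd q))"

text \<open>The norm of the sum of \<open>(Y_b v) (Y_b v)^T\<close>, of order \<open>d\<close> only.
  The vector \<open>v\<close> will be a basis vector or a further sample.\<close>

definition phi :: "nat \<Rightarrow> nat set \<Rightarrow> (nat \<Rightarrow> real) \<Rightarrow> (nat \<Rightarrow> nat \<Rightarrow> real) \<Rightarrow> real" where
  "phi d J v \<xi> = nrm {..<d} (\<lambda>\<alpha> \<gamma>. \<Sum>b\<in>J. Yv d (\<xi> b) v \<alpha> * Yv d (\<xi> b) v \<gamma>)"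

definition Psi :: "nat \<Rightarrow> nat set \<Rightarrow> nat set \<Rightarrow> nat set \<Rightarrow> (nat \<Rightarrow> nat \<Rightarrow> real) \<Rightarrow> real" where
  "Psi d B E C \<xi> = nrm (B \<times> E) (\<lambda>p q. \<Sum>c\<in>C. \<Sum>\<alpha><d. \<Sum>\<beta><d. Phi d (\<xi> c) \<xi> \<alpha> \<beta> p * Phi d (\<xi> c) \<xi> \<alpha> \<beta> q)"

text \<open>The squared norm of the flattening of \<open>tr (Y_a Y_b Y_c Y_e)\<close> with rows
  \<open>(a, c)\<close> and columns \<open>(b, e)\<close>: opposite factors of the trace are
  grouped.\<close>

definition GA :: "nat \<Rightarrow> nat set \<Rightarrow> nat set \<Rightarrow> nat set \<Rightarrow> nat set \<Rightarrow> (nat \<Rightarrow> nat \<Rightarrow> real) \<Rightarrow> real" where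
  "GA d A B C E \<xi> = nrm (B \<times> E) (\<lambda>p q. \<Sum>a\<in>A. \<Sum>c\<in>C. Tt d (\<xi> a) \<xi> c p * Tt d (\<xi> a) \<xi> c q)"

text \<open>The terms follow \<open>Phi_expand\<close>: 2 comes from squaring a difference,
  \<open>d\<close> from Cauchy-Schwarz over the basis vectors.\<close>

definition rhoD :: "nat \<Rightarrow> nat set \<Rightarrow> nat set \<Rightarrow> (nat \<Rightarrow> real) \<Rightarrow> (nat \<Rightarrow> nat \<Rightarrow> real) \<Rightarrow> real" where
  "rhoD d B E y \<xi> = 2 * (phi d B y \<xi> * phi d E y \<xi>) + 2 * real d * (\<Sum>k<d. phi d B (ek k) \<xi> * phi d E (ek k) \<xi>)"

lemma phi_nonneg: "0 \<le> phi d J v \<xi>"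
  unfolding phi_def by (intro nrm_nonneg psd_gram) auto

lemma nY_nonneg: "0 \<le> nY d J \<xi>"
  unfolding nY_def by (intro nrm_nonneg psd_gram) auto

lemma phi_dual: "(\<Sum>\<alpha><d. (\<Sum>b\<in>J. u b * Yv d (\<xi> b) v \<alpha>)\<^sup>2) \<le> phi d J v \<xi> * (\<Sum>b\<in>J. (u b)\<^sup>2)"
  unfolding phi_def by (rule dual_norm_le) simp

lemma Phi_bound:
  assumes fin: "finite B" "finite E"
  shows "(\<Sum>\<alpha><d. \<Sum>\<beta><d. (\<Sum>p\<in>B \<times> E. u p * Phi d y \<xi> \<alpha> \<beta> p)\<^sup>2) \<le> rhoD d B E y \<xi> * sqn (B \<times> E) u"
proof -
  define H where "H = (\<lambda>v \<alpha> \<beta>. \<Sum>p\<in>B \<times> E. u p * (Yv d (\<xi> (fst p)) v \<alpha> * Yv d (\<xi> (snd p)) v \<beta>))"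
  have Hb: "(\<Sum>\<alpha><d. \<Sum>\<beta><d. (H v \<alpha> \<beta>)\<^sup>2) \<le> phi d B v \<xi> * phi d E v \<xi> * sqn (B \<times> E) u" for v
    unfolding H_def phi_def by (rule dual_norm_le2) (use fin in auto)
  have pt: "(\<Sum>p\<in>B \<times> E. u p * Phi d y \<xi> \<alpha> \<beta> p)\<^sup>2 \<le> 2 * (H y \<alpha> \<beta>)\<^sup>2 + 2 * real d * (\<Sum>k<d. (H (ek k) \<alpha> \<beta>)\<^sup>2)"
    if ab: "\<alpha> < d" "\<beta> < d" for \<alpha> \<beta>
  proof -
    have "(\<Sum>p\<in>B \<times> E. u p * Phi d y \<xi> \<alpha> \<beta> p) = H y \<alpha> \<beta> - (\<Sum>p\<in>B \<times> E. \<Sum>k<d. u p * (Yv d (\<xi> (fst p)) (ek k) \<alpha> * Yv d (\<xi> (snd p)) (ek k) \<beta>))"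
      by (simp add: Phi_expand[OF ab] H_def right_diff_distrib sum_subtractf sum_distrib_left)
    also have "\<dots> = H y \<alpha> \<beta> - (\<Sum>k<d. H (ek k) \<alpha> \<beta>)"
      unfolding H_def by (subst sum.swap) simp
    finally have "(\<Sum>p\<in>B \<times> E. u p * Phi d y \<xi> \<alpha> \<beta> p)\<^sup>2 \<le> 2 * (H y \<alpha> \<beta>)\<^sup>2 + 2 * (\<Sum>k<d. 1 * H (ek k) \<alpha> \<beta>)\<^sup>2"
      using sum_squares_bound[of "H y \<alpha> \<beta>" "- (\<Sum>k<d. H (ek k) \<alpha> \<beta>)"] by (simp add: power2_diff)
    also have "\<dots> \<le> 2 * (H y \<alpha> \<beta>)\<^sup>2 + 2 * ((\<Sum>k<d. 1\<^sup>2) * (\<Sum>k<d. (H (ek k) \<alpha> \<beta>)\<^sup>2))"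
      by (intro add_left_mono mult_left_mono Cauchy_Schwarz_ineq_sum) simp
    finally show ?thesis by simp
  qed
  have "(\<Sum>\<alpha><d. \<Sum>\<beta><d. (\<Sum>p\<in>B \<times> E. u p * Phi d y \<xi> \<alpha> \<beta> p)\<^sup>2)
    \<le> (\<Sum>\<alpha><d. \<Sum>\<beta><d. 2 * (H y \<alpha> \<beta>)\<^sup>2 + 2 * real d * (\<Sum>k<d. (H (ek k) \<alpha> \<beta>)\<^sup>2))"
    by (intro sum_mono pt) auto
  also have "\<dots> = 2 * (\<Sum>\<alpha><d. \<Sum>\<beta><d. (H y \<alpha> \<beta>)\<^sup>2) + 2 * real d * (\<Sum>\<alpha><d. \<Sum>\<beta><d. \<Sum>k<d. (H (ek k) \<alpha> \<beta>)\<^sup>2)"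
    by (simp add: sum.distrib sum_distrib_left)
  also have "(\<Sum>\<alpha><d. \<Sum>\<beta><d. \<Sum>k<d. (H (ek k) \<alpha> \<beta>)\<^sup>2) = (\<Sum>k<d. \<Sum>\<alpha><d. \<Sum>\<beta><d. (H (ek k) \<alpha> \<beta>)\<^sup>2)"
  proof -
    have "(\<Sum>\<alpha><d. \<Sum>\<beta><d. \<Sum>k<d. (H (ek k) \<alpha> \<beta>)\<^sup>2) = (\<Sum>\<alpha><d. \<Sum>k<d. \<Sum>\<beta><d. (H (ek k) \<alpha> \<beta>)\<^sup>2)"
      by (intro sum.cong refl sum.swap)
    also have "\<dots> = (\<Sum>k<d. \<Sum>\<alpha><d. \<Sum>\<beta><d. (H (ek k) \<alpha> \<beta>)\<^sup>2)" by (rule sum.swap)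
    finally show ?thesis .
  qed
  also have "2 * (\<Sum>\<alpha><d. \<Sum>\<beta><d. (H y \<alpha> \<beta>)\<^sup>2) + 2 * real d * (\<Sum>k<d. \<Sum>\<alpha><d. \<Sum>\<beta><d. (H (ek k) \<alpha> \<beta>)\<^sup>2)
    \<le> 2 * (phi d B y \<xi> * phi d E y \<xi> * sqn (B \<times> E) u) + 2 * real d * (\<Sum>k<d. phi d B (ek k) \<xi> * phi d E (ek k) \<xi> * sqn (B \<times> E) u)"
    by (intro add_mono mult_left_mono sum_mono Hb) auto
  also have "\<dots> = rhoD d B E y \<xi> * sqn (B \<times> E) u"
    by (simp add: rhoD_def algebra_simps sum_distrib_left)
  finally show ?thesis .
qed

lemma quad_sum_gram:
  "quad I (\<lambda>p q. \<Sum>\<alpha>\<in>X. \<Sum>\<beta>\<in>Z. L \<alpha> \<beta> p * L \<alpha> \<beta> q) u = (\<Sum>\<alpha>\<in>X. \<Sum>\<beta>\<in>Z. (\<Sum>p\<in>I. u p * L \<alpha> \<beta> p)\<^sup>2)"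
proof -
  have "quad I (\<lambda>p q. \<Sum>\<alpha>\<in>X. \<Sum>\<beta>\<in>Z. L \<alpha> \<beta> p * L \<alpha> \<beta> q) u = (\<Sum>r\<in>X \<times> Z. (\<Sum>p\<in>I. L (fst r) (snd r) p * u p)\<^sup>2)"
    by (rule quad_gram) (simp add: sum.cartesian_product case_prod_beta')
  then show ?thesis by (simp add: sum.cartesian_product case_prod_beta' mult.commute)
qed

lemma psd_sum_gram: "psd I (\<lambda>p q. \<Sum>\<alpha>\<in>X. \<Sum>\<beta>\<in>Z. L \<alpha> \<beta> p * L \<alpha> \<beta> q)"
  by (rule psd_gram[where R = "X \<times> Z" and L = "\<lambda>r. L (fst r) (snd r)"]) (simp add: sum.cartesian_product case_prod_beta')

lemma quad_gram1: "quad I (\<lambda>p q. \<Sum>c\<in>C. L c p * L c q) u = (\<Sum>c\<in>C. (\<Sum>p\<in>I. u p * L c p)\<^sup>2)"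
  by (subst quad_gram[where R = C and L = L]) (auto simp: mult.commute)

lemma Tt_sum: "(\<Sum>p\<in>I. u p * Tt d y \<xi> c p) = (\<Sum>\<alpha><d. \<Sum>\<beta><d. (\<Sum>p\<in>I. u p * Phi d (\<xi> c) \<xi> \<alpha> \<beta> p) * YY y \<alpha> \<beta>)"
proof -
  have "(\<Sum>p\<in>I. u p * Tt d y \<xi> c p) = (\<Sum>p\<in>I. \<Sum>\<alpha><d. \<Sum>\<beta><d. u p * Phi d (\<xi> c) \<xi> \<alpha> \<beta> p * YY y \<alpha> \<beta>)"
    by (simp add: Tt_def sum_distrib_left mult_ac)
  also have "\<dots> = (\<Sum>\<alpha><d. \<Sum>p\<in>I. \<Sum>\<beta><d. u p * Phi d (\<xi> c) \<xi> \<alpha> \<beta> p * YY y \<alpha> \<beta>)" by (rule sum.swap)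
  also have "\<dots> = (\<Sum>\<alpha><d. \<Sum>\<beta><d. \<Sum>p\<in>I. u p * Phi d (\<xi> c) \<xi> \<alpha> \<beta> p * YY y \<alpha> \<beta>)" by (intro sum.cong refl sum.swap)
  finally show ?thesis by (simp add: sum_distrib_right)
qed

text \<open>After \<open>Tt_swap\<close> the trace is linear in \<open>Y_c\<close> with coefficients
  free of \<open>c\<close>; the sum over \<open>C\<close> costs \<open>nY\<close>, and
  \<open>Phi_bound\<close> handles the coefficients.\<close>

lemma Tt_bound:
  assumes fin: "finite B" "finite E"
  shows "(\<Sum>c\<in>C. (\<Sum>p\<in>B \<times> E. u p * Tt d y \<xi> c p)\<^sup>2) \<le> nY d C \<xi> * rhoD d B E y \<xi> * sqn (B \<times> E) u"
proof -
  define W where "W = (\<lambda>r. \<Sum>p\<in>B \<times> E. u p * Phi d y \<xi> (fst r) (snd r) p)"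
  let ?I = "{..<d} \<times> {..<d}"
  have "(\<Sum>p\<in>B \<times> E. u p * Tt d y \<xi> c p) = (\<Sum>r\<in>?I. W r * YY (\<xi> c) (fst r) (snd r))" for c
  proof -
    have "(\<Sum>p\<in>B \<times> E. u p * Tt d y \<xi> c p) = (\<Sum>p\<in>B \<times> E. \<Sum>r\<in>?I. u p * Phi d y \<xi> (fst r) (snd r) p * YY (\<xi> c) (fst r) (snd r))"
      by (simp add: Tt_swap sum.cartesian_product case_prod_beta' sum_distrib_left mult_ac)
    also have "\<dots> = (\<Sum>r\<in>?I. \<Sum>p\<in>B \<times> E. u p * Phi d y \<xi> (fst r) (snd r) p * YY (\<xi> c) (fst r) (snd r))" by (rule sum.swap)
    finally show ?thesis by (simp add: W_def sum_distrib_right)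
  qed
  then have "(\<Sum>c\<in>C. (\<Sum>p\<in>B \<times> E. u p * Tt d y \<xi> c p)\<^sup>2) = quad ?I (\<lambda>p q. \<Sum>c\<in>C. YY (\<xi> c) (fst p) (snd p) * YY (\<xi> c) (fst q) (snd q)) W"
    by (simp add: quad_gram1)
  also have "\<dots> \<le> nY d C \<xi> * sqn ?I W"
    unfolding nY_def by (intro quad_le_nrm psd_gram) auto
  also have "sqn ?I W = (\<Sum>\<alpha><d. \<Sum>\<beta><d. (\<Sum>p\<in>B \<times> E. u p * Phi d y \<xi> \<alpha> \<beta> p)\<^sup>2)"
    by (simp add: sqn_def W_def sum.cartesian_product case_prod_beta')
  also have "nY d C \<xi> * \<dots> \<le> nY d C \<xi> * (rhoD d B E y \<xi> * sqn (B \<times> E) u)"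
    by (intro mult_left_mono Phi_bound fin nY_nonneg)
  finally show ?thesis by (simp add: mult.assoc)
qed

lemma gauss_sum_quadratic:
  assumes fin: "finite R"
  shows "(\<integral>\<^sup>+y. ennreal ((\<Sum>r\<in>R. (\<Sum>\<alpha><d. \<Sum>\<beta><d. B r \<alpha> \<beta> * YY y \<alpha> \<beta>)\<^sup>2)\<^sup>2) \<partial>gvec d)
    \<le> ennreal ((5000 * (\<Sum>r\<in>R. \<Sum>\<alpha><d. \<Sum>\<beta><d. (B r \<alpha> \<beta>)\<^sup>2))\<^sup>2)"
proof -
  have "(\<integral>\<^sup>+y. ennreal ((\<Sum>r\<in>R. (\<Sum>\<alpha><d. \<Sum>\<beta><d. B r \<alpha> \<beta> * YY y \<alpha> \<beta>)\<^sup>2)\<^sup>2) \<partial>gvec d)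
    \<le> ennreal (20000000 * (\<Sum>r\<in>R. \<Sum>\<alpha><d. \<Sum>\<beta><d. (B r \<alpha> \<beta>)\<^sup>2)\<^sup>2)"
  proof (rule nn_integral_sum_squares[OF fin])
    show "(\<lambda>y. \<Sum>\<alpha><d. \<Sum>\<beta><d. B r \<alpha> \<beta> * YY y \<alpha> \<beta>) \<in> borel_measurable (gvec d)" for r
      unfolding YY_def by (intro borel_measurable_sum borel_measurable_times borel_measurable_diff coord_measurable borel_measurable_const) auto
  qed (auto intro!: gauss_quadratic_moment sum_nonneg)
  \<comment> \<open>\<open>5000^2 = 25000000\<close> exceeds the constant of
    \<open>gauss_quadratic_moment\<close>.\<close>
  also have "\<dots> \<le> ennreal ((5000 * (\<Sum>r\<in>R. \<Sum>\<alpha><d. \<Sum>\<beta><d. (B r \<alpha> \<beta>)\<^sup>2))\<^sup>2)"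
    by (intro ennreal_leI) (simp add: power_mult_distrib mult_right_mono)
  finally show ?thesis .
qed

definition vm :: "nat \<Rightarrow> 'a measure \<Rightarrow> ('a \<Rightarrow> nat \<Rightarrow> real) \<Rightarrow> bool" where
  "vm d M f \<longleftrightarrow> (\<forall>a<d. (\<lambda>x. f x a) \<in> borel_measurable M)"

lemma vm_const: "vm d M (\<lambda>_. v)"
  by (simp add: vm_def)

lemma YY_m: "vm d M f \<Longrightarrow> a < d \<Longrightarrow> b < d \<Longrightarrow> (\<lambda>x. YY (f x) a b) \<in> borel_measurable M"
  unfolding YY_def vm_def by (intro borel_measurable_diff borel_measurable_times borel_measurable_const) auto

lemma Yv_m: "vm d M f \<Longrightarrow> vm d M v \<Longrightarrow> a < d \<Longrightarrow> (\<lambda>x. Yv d (f x) (v x) a) \<in> borel_measurable M"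
  unfolding Yv_def by (intro borel_measurable_sum borel_measurable_times YY_m) (auto simp: vm_def)

lemma Phi_m: "vm d M y \<Longrightarrow> vm d M (\<lambda>x. \<xi> x (fst p)) \<Longrightarrow> vm d M (\<lambda>x. \<xi> x (snd p)) \<Longrightarrow> a < d \<Longrightarrow> b < d \<Longrightarrow>
    (\<lambda>x. Phi d (y x) (\<xi> x) a b p) \<in> borel_measurable M"
  unfolding Phi_def by (intro borel_measurable_sum borel_measurable_times YY_m) auto

lemma Tt_m: "vm d M y \<Longrightarrow> vm d M (\<lambda>x. \<xi> x c) \<Longrightarrow> vm d M (\<lambda>x. \<xi> x (fst p)) \<Longrightarrow> vm d M (\<lambda>x. \<xi> x (snd p)) \<Longrightarrow>
    (\<lambda>x. Tt d (y x) (\<xi> x) c p) \<in> borel_measurable M"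
  unfolding Tt_def by (intro borel_measurable_sum borel_measurable_times YY_m Phi_m) auto

lemma phi_m:
  assumes "\<And>b. b \<in> J \<Longrightarrow> vm d M (\<lambda>x. \<xi> x b)" "vm d M v"
  shows "(\<lambda>x. phi d J (v x) (\<xi> x)) \<in> borel_measurable M"
  unfolding phi_def by (intro nrm_measurable borel_measurable_sum borel_measurable_times Yv_m assms) auto

lemma sum_square_diff_le:
  fixes f g :: "'a \<Rightarrow> real"
  shows "(\<Sum>i\<in>I. (f i - g i)\<^sup>2) \<le> 2 * (\<Sum>i\<in>I. (f i)\<^sup>2) + 2 * (\<Sum>i\<in>I. (g i)\<^sup>2)"
proof -
  have "(f i - g i)\<^sup>2 \<le> 2 * (f i)\<^sup>2 + 2 * (g i)\<^sup>2" for i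
    using sum_squares_bound[of "f i" "- g i"] by (simp add: power2_diff)
  then have "(\<Sum>i\<in>I. (f i - g i)\<^sup>2) \<le> (\<Sum>i\<in>I. 2 * (f i)\<^sup>2 + 2 * (g i)\<^sup>2)" by (intro sum_mono)
  then show ?thesis by (simp add: sum.distrib sum_distrib_left)
qed

lemma Yv_sq_le: "(\<Sum>\<alpha><d. (Yv d y v \<alpha>)\<^sup>2) \<le> 2 * ((\<Sum>a<d. (y a)\<^sup>2) * (\<Sum>a<d. v a * y a)\<^sup>2) + 2 * (\<Sum>a<d. (v a)\<^sup>2)"
proof -
  define t where "t = (\<Sum>\<beta><d. y \<beta> * v \<beta>)"
  have "(\<Sum>\<alpha><d. (Yv d y v \<alpha>)\<^sup>2) = (\<Sum>\<alpha><d. (y \<alpha> * t - v \<alpha>)\<^sup>2)" by (simp add: Yv_eq t_def)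
  also have "\<dots> \<le> 2 * (\<Sum>\<alpha><d. (y \<alpha> * t)\<^sup>2) + 2 * (\<Sum>a<d. (v a)\<^sup>2)" by (rule sum_square_diff_le)
  also have "(\<Sum>\<alpha><d. (y \<alpha> * t)\<^sup>2) = (\<Sum>a<d. (y a)\<^sup>2) * t\<^sup>2" by (simp add: power_mult_distrib sum_distrib_right)
  finally show ?thesis by (simp add: t_def mult.commute)
qed

lemma YY_sq_le: "(\<Sum>\<alpha><d. \<Sum>\<beta><d. (YY y \<alpha> \<beta>)\<^sup>2) \<le> 2 * ((\<Sum>a<d. (y a)\<^sup>2) * (\<Sum>a<d. (y a)\<^sup>2)) + 2 * real d"
proof -
  have "(\<Sum>\<alpha><d. \<Sum>\<beta><d. (YY y \<alpha> \<beta>)\<^sup>2) \<le> (\<Sum>\<alpha><d. 2 * (\<Sum>\<beta><d. (y \<alpha> * y \<beta>)\<^sup>2) + 2 * (\<Sum>\<beta><d. (if \<alpha> = \<beta> then 1 else 0)\<^sup>2))"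
    unfolding YY_def by (intro sum_mono sum_square_diff_le)
  also have "\<dots> = (\<Sum>\<alpha><d. 2 * ((y \<alpha>)\<^sup>2 * (\<Sum>\<beta><d. (y \<beta>)\<^sup>2)) + 2)"
  proof (intro sum.cong refl)
    fix \<alpha> assume "\<alpha> \<in> {..<d}"
    moreover have "(\<Sum>\<beta><d. (if \<alpha> = \<beta> then 1 else 0 :: real)\<^sup>2) = (\<Sum>\<beta><d. if \<alpha> = \<beta> then 1 else 0)"
      by (intro sum.cong) auto
    ultimately show "2 * (\<Sum>\<beta><d. (y \<alpha> * y \<beta>)\<^sup>2) + 2 * (\<Sum>\<beta><d. (if \<alpha> = \<beta> then 1 else 0)\<^sup>2) = 2 * ((y \<alpha>)\<^sup>2 * (\<Sum>\<beta><d. (y \<beta>)\<^sup>2)) + 2"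
      by (simp add: power_mult_distrib sum_distrib_left)
  qed
  also have "\<dots> = 2 * ((\<Sum>a<d. (y a)\<^sup>2) * (\<Sum>a<d. (y a)\<^sup>2)) + 2 * real d"
    by (simp add: sum.distrib sum_distrib_left[symmetric] sum_distrib_right[symmetric])
  finally show ?thesis .
qed

section \<open>Sizes of the spectral norms when \<open>d <= n <= d^2\<close>\<close>

locale cov_model =
  fixes n d :: nat
  assumes n2: "2 \<le> n" and dn: "d \<le> n" and nd: "n \<le> d\<^sup>2"
begin

sublocale S: samples "gvec d" n
  by (simp add: samples_def gvec_prob_space)

abbreviation "Pm \<equiv> gvec d \<Otimes>\<^sub>M S.Om"

lemma d1: "1 \<le> d" using n2 nd by (cases d) auto

lemma n1: "1 \<le> n" using n2 by simp

lemma real_bounds: "1 \<le> real d" "1 \<le> real n" "real d \<le> real n" "real n \<le> (real d)\<^sup>2"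
  using d1 n1 dn nd by (simp_all del: of_nat_power add: of_nat_power[symmetric])

lemma vm_S: "i < n \<Longrightarrow> vm d S.Om (\<lambda>\<xi>. \<xi> i)"
  unfolding vm_def
proof (intro allI impI)
  fix a assume a: "i < n" "a < d"
  have "(\<lambda>\<xi>. \<xi> i) \<in> measurable S.Om (gvec d)" using a by (intro measurable_component_singleton) auto
  from measurable_compose[OF this coord_measurable[OF a(2)]] show "(\<lambda>\<xi>. \<xi> i a) \<in> borel_measurable S.Om" .
qed

lemma vm_fst: "vm d Pm fst"
  unfolding vm_def using measurable_compose[OF measurable_fst coord_measurable] by blast

lemma vm_snd: "i < n \<Longrightarrow> vm d Pm (\<lambda>x. snd x i)"
  using vm_S[of i] measurable_compose[OF measurable_snd] unfolding vm_def by blast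

text \<open>In a unit direction a summand has variance scale \<open>z\<close>, while its norm is of
  order \<open>d z\<close>; since \<open>d <= n\<close>, the accumulated \<open>n z\<close>
  dominates.\<close>

lemma phi_mb_fixed:
  assumes J: "J \<subseteq> {..<n}" and z: "0 < z" "(\<Sum>a<d. (v a)\<^sup>2) \<le> z"
  shows "mb n 38 S.Om (phi d J v) (5004 * real n * z)"
proof -
  define \<rho> where "\<rho> = (\<lambda>y::nat \<Rightarrow> real. 2 * ((\<Sum>a<d. (y a)\<^sup>2) * (\<Sum>a<d. v a * y a)\<^sup>2) + 2 * z)"
  have \<rho>mb: "mb n 8 (gvec d) \<rho> (2 * (real d * z) + 2 * z)"
    unfolding \<rho>_def using mb_mult[OF mb_sqnorm[OF n2 d1] mb_linear[OF n2 z]] z n2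
    by (intro mb_add mb_scale mb_const gvec_prob_space) auto
  have "mb n (2 * 8 + 22) S.Om (\<lambda>\<xi>. nrm {..<d} (\<lambda>i j. \<Sum>a\<in>J. Yv d (\<xi> a) v i * Yv d (\<xi> a) v j)) (5004 * real n * z)"
  proof (rule S.psd_sum_mb'[where P = "\<lambda>y \<xi> i j. Yv d y v i * Yv d y v j" and \<rho> = "\<lambda>y \<xi>. \<rho> y" and V = "\<lambda>_. 5000 * z" and v = "5000 * z"
      and ?r0.0 = "2 * (real d * z) + 2 * z"])
    have "d \<le> n ^ 4" using dn n1 self_le_power[of n 4] by linarith
    then show "card {..<d} \<le> n ^ 4" by simp
    show "(\<lambda>x. Yv d (fst x) v i * Yv d (fst x) v j) \<in> borel_measurable Pm" if "i \<in> {..<d}" "j \<in> {..<d}" for i j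
      using that by (intro borel_measurable_times Yv_m vm_fst vm_const) auto
    show "psd {..<d} (\<lambda>i j. Yv d y v i * Yv d y v j)" for y
      by (rule psd_gram[where R = "{()}" and L = "\<lambda>_. Yv d y v"]) simp
    have qe: "quad {..<d} (\<lambda>i j. Yv d y v i * Yv d y v j) u = (\<Sum>i<d. u i * Yv d y v i)\<^sup>2" for y u
      using quad_gram1[where C = "{()}" and L = "\<lambda>_. Yv d y v"] by simp
    show "quad {..<d} (\<lambda>i j. Yv d y v i * Yv d y v j) u \<le> \<rho> y * sqn {..<d} u" for y u
    proof -
      have "(\<Sum>i<d. u i * Yv d y v i)\<^sup>2 \<le> sqn {..<d} u * (\<Sum>i<d. (Yv d y v i)\<^sup>2)"
        unfolding sqn_def by (rule Cauchy_Schwarz_ineq_sum)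
      also have "\<dots> \<le> sqn {..<d} u * \<rho> y"
        using Yv_sq_le[of d y v] z unfolding \<rho>_def by (intro mult_left_mono) auto
      finally show ?thesis unfolding qe by (simp add: mult.commute)
    qed
    show "mb n 8 Pm (\<lambda>x. \<rho> (fst x)) (2 * (real d * z) + 2 * z)"
      by (rule mb_fst[OF S.Om.prob_space_axioms \<rho>mb])
    show "mb n 8 S.Om (\<lambda>_. 5000 * z) (5000 * z)"
      using z n2 by (intro mb_const S.Om.prob_space_axioms) auto
    show "(\<integral>\<^sup>+y. ennreal ((quad {..<d} (\<lambda>i j. Yv d y v i * Yv d y v j) u)\<^sup>2) \<partial>gvec d) \<le> ennreal ((5000 * z * sqn {..<d} u)\<^sup>2)" for u
    proof -
      have "(\<Sum>i<d. u i * Yv d y v i) = (\<Sum>\<alpha><d. \<Sum>\<beta><d. (u \<alpha> * v \<beta>) * YY y \<alpha> \<beta>)" for y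
        by (simp add: Yv_def sum_distrib_left mult_ac)
      then have "(\<integral>\<^sup>+y. ennreal ((quad {..<d} (\<lambda>i j. Yv d y v i * Yv d y v j) u)\<^sup>2) \<partial>gvec d)
        \<le> ennreal ((5000 * (\<Sum>\<alpha><d. \<Sum>\<beta><d. (u \<alpha> * v \<beta>)\<^sup>2))\<^sup>2)"
        unfolding qe using gauss_sum_quadratic[of "{()}" d "\<lambda>_ \<alpha> \<beta>. u \<alpha> * v \<beta>"] by simp
      also have "(\<Sum>\<alpha><d. \<Sum>\<beta><d. (u \<alpha> * v \<beta>)\<^sup>2) = sqn {..<d} u * (\<Sum>a<d. (v a)\<^sup>2)"
        by (simp add: sqn_def sum_product power_mult_distrib)
      also have "ennreal ((5000 * (sqn {..<d} u * (\<Sum>a<d. (v a)\<^sup>2)))\<^sup>2) \<le> ennreal ((5000 * z * sqn {..<d} u)\<^sup>2)"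
      proof (intro ennreal_leI power_mono)
        have "sqn {..<d} u * (\<Sum>a<d. (v a)\<^sup>2) \<le> sqn {..<d} u * z" using z by (intro mult_left_mono) auto
        then show "5000 * (sqn {..<d} u * (\<Sum>a<d. (v a)\<^sup>2)) \<le> 5000 * z * sqn {..<d} u" by (simp add: mult_ac)
        show "0 \<le> 5000 * (sqn {..<d} u * (\<Sum>a<d. (v a)\<^sup>2))" by (intro mult_nonneg_nonneg sum_nonneg) auto
      qed
      finally show ?thesis .
    qed
    have "real d * z \<le> real n * z" "z \<le> real n * z" using z real_bounds by (auto intro: mult_right_mono simp: mult_le_cancel_right1)
    then show "real n * (5000 * z) + (2 * (real d * z) + 2 * z) \<le> 5004 * real n * z" by (simp add: algebra_simps)
  qed (use J in auto)
  then show ?thesis by (simp add: phi_def[abs_def])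
qed

text \<open>The accumulated variance is of order \<open>n\<close> and a single summand has norm of
  order \<open>d^2\<close>; by \<open>n <= d^2\<close> the latter dominates.\<close>

lemma nY_mb:
  assumes J: "J \<subseteq> {..<n}"
  shows "mb n 38 S.Om (nY d J) (5004 * (real d)\<^sup>2)"
proof -
  let ?I = "{..<d} \<times> {..<d}"
  define \<rho> where "\<rho> = (\<lambda>y::nat \<Rightarrow> real. 2 * ((\<Sum>a<d. (y a)\<^sup>2) * (\<Sum>a<d. (y a)\<^sup>2)) + 2 * real d)"
  have \<rho>mb: "mb n 8 (gvec d) \<rho> (2 * (real d * real d) + 2 * real d)"
    unfolding \<rho>_def using mb_mult[OF mb_sqnorm[OF n2 d1] mb_sqnorm[OF n2 d1]] d1 n2
    by (intro mb_add mb_scale mb_const gvec_prob_space) auto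
  have "mb n (2 * 8 + 22) S.Om (\<lambda>\<xi>. nrm ?I (\<lambda>p q. \<Sum>a\<in>J. YY (\<xi> a) (fst p) (snd p) * YY (\<xi> a) (fst q) (snd q))) (5004 * (real d)\<^sup>2)"
  proof (rule S.psd_sum_mb'[where P = "\<lambda>y \<xi> p q. YY y (fst p) (snd p) * YY y (fst q) (snd q)" and \<rho> = "\<lambda>y \<xi>. \<rho> y" and V = "\<lambda>_. 5000" and v = 5000
      and ?r0.0 = "2 * (real d * real d) + 2 * real d"])
    have "d * d \<le> n * n" using dn by (intro mult_mono) auto
    also have "\<dots> \<le> n ^ 4" using n1 power_increasing[of 2 4 n] by (simp add: power2_eq_square)
    finally show "card ?I \<le> n ^ 4" by simp
    show "(\<lambda>x. YY (fst x) (fst p) (snd p) * YY (fst x) (fst q) (snd q)) \<in> borel_measurable Pm" if "p \<in> ?I" "q \<in> ?I" for p q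
      using that by (intro borel_measurable_times YY_m[OF vm_fst]) auto
    show "psd ?I (\<lambda>p q. YY y (fst p) (snd p) * YY y (fst q) (snd q))" for y
      by (rule psd_gram[where R = "{()}" and L = "\<lambda>_ p. YY y (fst p) (snd p)"]) simp
    have qe: "quad ?I (\<lambda>p q. YY y (fst p) (snd p) * YY y (fst q) (snd q)) u = (\<Sum>p\<in>?I. u p * YY y (fst p) (snd p))\<^sup>2" for y u
      using quad_gram1[where C = "{()}" and L = "\<lambda>_ p. YY y (fst p) (snd p)"] by simp
    show "quad ?I (\<lambda>p q. YY y (fst p) (snd p) * YY y (fst q) (snd q)) u \<le> \<rho> y * sqn ?I u" for y u
    proof -
      have "(\<Sum>p\<in>?I. u p * YY y (fst p) (snd p))\<^sup>2 \<le> sqn ?I u * (\<Sum>p\<in>?I. (YY y (fst p) (snd p))\<^sup>2)"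
        unfolding sqn_def by (rule Cauchy_Schwarz_ineq_sum)
      also have "(\<Sum>p\<in>?I. (YY y (fst p) (snd p))\<^sup>2) = (\<Sum>\<alpha><d. \<Sum>\<beta><d. (YY y \<alpha> \<beta>)\<^sup>2)"
        by (simp add: sum.cartesian_product case_prod_beta')
      also have "sqn ?I u * \<dots> \<le> sqn ?I u * \<rho> y"
        using YY_sq_le[of y d] unfolding \<rho>_def by (intro mult_left_mono) auto
      finally show ?thesis unfolding qe by (simp add: mult.commute)
    qed
    show "mb n 8 Pm (\<lambda>x. \<rho> (fst x)) (2 * (real d * real d) + 2 * real d)"
      by (rule mb_fst[OF S.Om.prob_space_axioms \<rho>mb])
    show "mb n 8 S.Om (\<lambda>_. 5000) 5000"
      using n2 by (intro mb_const S.Om.prob_space_axioms) auto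
    show "(\<integral>\<^sup>+y. ennreal ((quad ?I (\<lambda>p q. YY y (fst p) (snd p) * YY y (fst q) (snd q)) u)\<^sup>2) \<partial>gvec d) \<le> ennreal ((5000 * sqn ?I u)\<^sup>2)" for u
    proof -
      have "(\<Sum>p\<in>?I. u p * YY y (fst p) (snd p)) = (\<Sum>\<alpha><d. \<Sum>\<beta><d. u (\<alpha>, \<beta>) * YY y \<alpha> \<beta>)" for y
        by (simp add: sum.cartesian_product case_prod_beta')
      then have "(\<integral>\<^sup>+y. ennreal ((quad ?I (\<lambda>p q. YY y (fst p) (snd p) * YY y (fst q) (snd q)) u)\<^sup>2) \<partial>gvec d)
        \<le> ennreal ((5000 * (\<Sum>\<alpha><d. \<Sum>\<beta><d. (u (\<alpha>, \<beta>))\<^sup>2))\<^sup>2)"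
        unfolding qe using gauss_sum_quadratic[of "{()}" d "\<lambda>_ \<alpha> \<beta>. u (\<alpha>, \<beta>)"] by simp
      also have "(\<Sum>\<alpha><d. \<Sum>\<beta><d. (u (\<alpha>, \<beta>))\<^sup>2) = sqn ?I u"
        by (simp add: sqn_def sum.cartesian_product case_prod_beta')
      finally show ?thesis .
    qed
    have "real d \<le> (real d)\<^sup>2" using real_bounds(1) by (simp add: power2_eq_square)
    then show "real n * 5000 + (2 * (real d * real d) + 2 * real d) \<le> 5004 * (real d)\<^sup>2"
      using real_bounds(4) by (simp add: power2_eq_square)
  qed (use J in auto)
  then show ?thesis by (simp add: nY_def[abs_def])
qed

lemma phi_mb_pair:
  assumes J: "J \<subseteq> {..<n}"
  shows "mb n 76 Pm (\<lambda>x. phi d J (fst x) (snd x)) (10008 * real n * real d)"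
proof -
  have "mb n (2 * 38) Pm (\<lambda>x. phi d J (fst x) (snd x)) (10008 * real n * real d)"
  proof (rule mb_fixed[OF gvec_prob_space S.Om.prob_space_axioms])
    \<comment> \<open>The added 1 keeps the size positive at \<open>y = 0\<close>, as
      \<open>mb\<close> demands.\<close>
    show "mb n 38 S.Om (phi d J y) (5004 * real n * ((\<Sum>a<d. (y a)\<^sup>2) + 1))" for y
    proof (rule phi_mb_fixed[OF J])
      show "0 < (\<Sum>a<d. (y a)\<^sup>2) + 1" by (intro add_nonneg_pos sum_nonneg) auto
    qed simp
    show "(\<lambda>x. phi d J (fst x) (snd x)) \<in> borel_measurable Pm"
      using J by (intro phi_m vm_fst vm_snd) auto
    have "mb n 4 (gvec d) (\<lambda>y. 5004 * real n * ((\<Sum>a<d. (y a)\<^sup>2) + 1)) (5004 * real n * (real d + 1))"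
      using n1 n2 d1 by (intro mb_scale mb_add mb_sqnorm mb_const gvec_prob_space) auto
    then show "mb n 38 (gvec d) (\<lambda>y. 5004 * real n * ((\<Sum>a<d. (y a)\<^sup>2) + 1)) (10008 * real n * real d)"
    proof (rule mb_weaken)
      have "real n * 1 \<le> real n * real d" using real_bounds by (intro mult_left_mono) auto
      then show "5004 * real n * (real d + 1) \<le> 10008 * real n * real d" by (simp add: algebra_simps)
    qed simp
  qed
  then show ?thesis by simp
qed

lemma phi_ek_mb:
  assumes J: "J \<subseteq> {..<n}" and k: "k < d"
  shows "mb n 38 S.Om (phi d J (ek k)) (5004 * real n)"
proof -
  have "(\<Sum>a<d. (ek k a)\<^sup>2) = (\<Sum>a<d. if a = k then 1 else 0)" by (intro sum.cong) (auto simp: ek_def)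
  then show ?thesis using phi_mb_fixed[OF J, of 1 "ek k"] k by simp
qed

lemma rhoD_mb:
  assumes B: "B \<subseteq> {..<n}" and E: "E \<subseteq> {..<n}"
  shows "mb n 152 Pm (\<lambda>x. rhoD d B E (fst x) (snd x)) (300000000 * (real n)\<^sup>2 * (real d)\<^sup>2)"
proof -
  have a: "mb n 152 Pm (\<lambda>x. phi d B (fst x) (snd x) * phi d E (fst x) (snd x)) ((10008 * real n * real d) * (10008 * real n * real d))"
    using mb_mult[OF phi_mb_pair[OF B] phi_mb_pair[OF E]] by simp
  have sf: "sigma_finite_measure S.Om" by (rule S.Om.sigma_finite_measure_axioms)
  have "mb n 152 Pm (\<lambda>x. \<Sum>k<d. phi d B (ek k) (snd x) * phi d E (ek k) (snd x)) (\<Sum>k<d. (5004 * real n) * (5004 * real n))"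
  proof (intro mb_sum)
    fix k assume "k \<in> {..<d}"
    then have k: "k < d" by simp
    have "mb n 76 S.Om (\<lambda>\<xi>. phi d B (ek k) \<xi> * phi d E (ek k) \<xi>) ((5004 * real n) * (5004 * real n))"
      using mb_mult[OF phi_ek_mb[OF B k] phi_ek_mb[OF E k]] by simp
    from mb_snd[OF gvec_prob_space sf this]
    show "mb n 152 Pm (\<lambda>x. phi d B (ek k) (snd x) * phi d E (ek k) (snd x)) ((5004 * real n) * (5004 * real n))"
      by (rule mb_weaken) auto
  qed (use d1 in \<open>auto simp: lessThan_empty_iff\<close>)
  then have b0: "mb n 152 Pm (\<lambda>x. \<Sum>k<d. phi d B (ek k) (snd x) * phi d E (ek k) (snd x)) (real d * ((5004 * real n) * (5004 * real n)))"
    by (simp only: sum_constant card_lessThan)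
  have b: "mb n 152 Pm (\<lambda>x. 2 * real d * (\<Sum>k<d. phi d B (ek k) (snd x) * phi d E (ek k) (snd x))) (2 * real d * (real d * ((5004 * real n) * (5004 * real n))))"
    by (rule mb_scale[OF b0]) (use d1 in simp)
  have "mb n 152 Pm (\<lambda>x. rhoD d B E (fst x) (snd x)) (2 * ((10008 * real n * real d) * (10008 * real n * real d)) + 2 * real d * (real d * ((5004 * real n) * (5004 * real n))))"
    unfolding rhoD_def by (intro mb_add mb_scale a b) auto
  then show ?thesis by (rule mb_weaken) (simp_all add: power2_eq_square mult_ac mult_right_mono)
qed

text \<open>Here the group \<open>C\<close> is random and \<open>B\<close>, \<open>E\<close> are
  fixed. The product \<open>Y_b Y(y) Y_e\<close> depends linearly on \<open>Y(y)\<close> through a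
  Kronecker product, so its variance is at most the product of two norms \<open>nY\<close>. The norm
  of one summand contributes \<open>n^2 d^2\<close>, at most \<open>n d^4\<close> by
  \<open>n <= d^2\<close>.\<close>

lemma Psi_mb:
  assumes B: "B \<subseteq> {..<n}" and E: "E \<subseteq> {..<n}" and C: "C \<subseteq> {..<n}" and disj: "B \<inter> C = {}" "E \<inter> C = {}"
  shows "mb n 326 S.Om (Psi d B E C) (200000000000 * real n * real d ^ 4)"
proof -
  have fin: "finite B" "finite E" using B E finite_subset by (auto intro: finite_subset[of _ "{..<n}"])
  define V where "V = (\<lambda>\<xi>. 5000 * (nY d B \<xi> * nY d E \<xi>))"
  have Vmb: "mb n 152 S.Om V (5000 * ((5004 * (real d)\<^sup>2) * (5004 * (real d)\<^sup>2)))"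
    unfolding V_def using mb_mult[OF nY_mb[OF B] nY_mb[OF E]]
    by (intro mb_scale) (auto intro: mb_weaken)
  have "mb n (2 * 152 + 22) S.Om (\<lambda>\<xi>. nrm (B \<times> E) (\<lambda>p q. \<Sum>c\<in>C. \<Sum>\<alpha><d. \<Sum>\<beta><d. Phi d (\<xi> c) \<xi> \<alpha> \<beta> p * Phi d (\<xi> c) \<xi> \<alpha> \<beta> q)) (200000000000 * real n * real d ^ 4)"
  proof (rule S.psd_sum_mb'[where P = "\<lambda>y \<xi> p q. \<Sum>\<alpha><d. \<Sum>\<beta><d. Phi d y \<xi> \<alpha> \<beta> p * Phi d y \<xi> \<alpha> \<beta> q" and \<rho> = "rhoD d B E" and V = V
      and v = "5000 * ((5004 * (real d)\<^sup>2) * (5004 * (real d)\<^sup>2))" and ?r0.0 = "300000000 * (real n)\<^sup>2 * (real d)\<^sup>2"])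
    show "finite (B \<times> E)" using fin by simp
    have "card B * card E \<le> n * n" using B E card_mono[of "{..<n}" B] card_mono[of "{..<n}" E] by (intro mult_mono) auto
    also have "\<dots> \<le> n ^ 4" using n1 power_increasing[of 2 4 n] by (simp add: power2_eq_square)
    finally show "card (B \<times> E) \<le> n ^ 4" using fin by (simp add: card_cartesian_product)
    show "(\<lambda>x. \<Sum>\<alpha><d. \<Sum>\<beta><d. Phi d (fst x) (snd x) \<alpha> \<beta> p * Phi d (fst x) (snd x) \<alpha> \<beta> q) \<in> borel_measurable Pm"
      if "p \<in> B \<times> E" "q \<in> B \<times> E" for p q
      using that B E by (intro borel_measurable_sum borel_measurable_times Phi_m vm_fst vm_snd) auto
    show "(\<Sum>\<alpha><d. \<Sum>\<beta><d. Phi d y \<xi> \<alpha> \<beta> p * Phi d y \<xi> \<alpha> \<beta> q) = (\<Sum>\<alpha><d. \<Sum>\<beta><d. Phi d y \<xi>' \<alpha> \<beta> p * Phi d y \<xi>' \<alpha> \<beta> q)"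
      if eq: "\<And>k. k \<notin> C \<Longrightarrow> \<xi> k = \<xi>' k" and pq: "p \<in> B \<times> E" "q \<in> B \<times> E" for y \<xi> \<xi>' p q
    proof -
      have "\<xi> (fst p) = \<xi>' (fst p)" "\<xi> (snd p) = \<xi>' (snd p)" "\<xi> (fst q) = \<xi>' (fst q)" "\<xi> (snd q) = \<xi>' (snd q)"
        using pq disj by (auto intro!: eq)
      then show ?thesis by (simp add: Phi_def)
    qed
    show "(\<integral>\<^sup>+y. ennreal ((quad (B \<times> E) (\<lambda>p q. \<Sum>\<alpha><d. \<Sum>\<beta><d. Phi d y \<xi> \<alpha> \<beta> p * Phi d y \<xi> \<alpha> \<beta> q) u)\<^sup>2) \<partial>gvec d) \<le> ennreal ((V \<xi> * sqn (B \<times> E) u)\<^sup>2)" for \<xi> u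
    proof -
      define R where "R = {..<d} \<times> {..<d}"
      define M where "M = (\<lambda>r \<gamma> \<delta>. \<Sum>p\<in>B \<times> E. u p * (YY (\<xi> (fst p)) (fst r) \<gamma> * YY (\<xi> (snd p)) \<delta> (snd r)))"
      have sR: "(\<Sum>r\<in>R. F r) = (\<Sum>\<alpha><d. \<Sum>\<beta><d. F (\<alpha>, \<beta>))" for F :: "nat \<times> nat \<Rightarrow> real"
        by (simp add: R_def sum.cartesian_product case_prod_unfold)
      have e1: "(\<Sum>p\<in>B \<times> E. u p * Phi d y \<xi> \<alpha> \<beta> p) = (\<Sum>\<gamma><d. \<Sum>\<delta><d. M (\<alpha>, \<beta>) \<gamma> \<delta> * YY y \<gamma> \<delta>)" for y \<alpha> \<beta>
      proof -
        have "(\<Sum>p\<in>B \<times> E. u p * Phi d y \<xi> \<alpha> \<beta> p) = (\<Sum>p\<in>B \<times> E. \<Sum>\<gamma><d. \<Sum>\<delta><d. u p * (YY (\<xi> (fst p)) \<alpha> \<gamma> * YY (\<xi> (snd p)) \<delta> \<beta>) * YY y \<gamma> \<delta>)"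
          by (simp add: Phi_def sum_distrib_left mult_ac)
        also have "\<dots> = (\<Sum>\<gamma><d. \<Sum>p\<in>B \<times> E. \<Sum>\<delta><d. u p * (YY (\<xi> (fst p)) \<alpha> \<gamma> * YY (\<xi> (snd p)) \<delta> \<beta>) * YY y \<gamma> \<delta>)" by (rule sum.swap)
        also have "\<dots> = (\<Sum>\<gamma><d. \<Sum>\<delta><d. \<Sum>p\<in>B \<times> E. u p * (YY (\<xi> (fst p)) \<alpha> \<gamma> * YY (\<xi> (snd p)) \<delta> \<beta>) * YY y \<gamma> \<delta>)" by (intro sum.cong refl sum.swap)
        finally show ?thesis by (simp add: M_def sum_distrib_right)
      qed
      have "(\<integral>\<^sup>+y. ennreal ((quad (B \<times> E) (\<lambda>p q. \<Sum>\<alpha><d. \<Sum>\<beta><d. Phi d y \<xi> \<alpha> \<beta> p * Phi d y \<xi> \<alpha> \<beta> q) u)\<^sup>2) \<partial>gvec d)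
        = (\<integral>\<^sup>+y. ennreal ((\<Sum>r\<in>R. (\<Sum>\<gamma><d. \<Sum>\<delta><d. M r \<gamma> \<delta> * YY y \<gamma> \<delta>)\<^sup>2)\<^sup>2) \<partial>gvec d)"
        unfolding quad_sum_gram e1 sR ..
      also have "\<dots> \<le> ennreal ((5000 * (\<Sum>r\<in>R. \<Sum>\<gamma><d. \<Sum>\<delta><d. (M r \<gamma> \<delta>)\<^sup>2))\<^sup>2)"
        by (rule gauss_sum_quadratic) (simp add: R_def)
      also have "\<dots> \<le> ennreal ((V \<xi> * sqn (B \<times> E) u)\<^sup>2)"
      proof (intro ennreal_leI power_mono)
        show "0 \<le> 5000 * (\<Sum>r\<in>R. \<Sum>\<gamma><d. \<Sum>\<delta><d. (M r \<gamma> \<delta>)\<^sup>2)" by (intro mult_nonneg_nonneg sum_nonneg) auto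
        have "(\<Sum>r\<in>R. \<Sum>\<gamma><d. \<Sum>\<delta><d. (M r \<gamma> \<delta>)\<^sup>2) = (\<Sum>\<alpha><d. \<Sum>\<beta><d. \<Sum>\<gamma><d. \<Sum>\<delta><d. (M (\<alpha>, \<beta>) \<gamma> \<delta>)\<^sup>2)"
          unfolding sR ..
        \<comment> \<open>Regroups the indices so that \<open>(\<alpha>, \<gamma>)\<close> belongs
          to the factor from \<open>B\<close> and \<open>(\<delta>, \<beta>)\<close> to the factor
          from \<open>E\<close>.\<close>
        also have "\<dots> = (\<Sum>\<alpha><d. \<Sum>\<gamma><d. \<Sum>\<beta><d. \<Sum>\<delta><d. (M (\<alpha>, \<beta>) \<gamma> \<delta>)\<^sup>2)"
          by (intro sum.cong refl sum.swap)
        also have "\<dots> = (\<Sum>\<alpha><d. \<Sum>\<gamma><d. \<Sum>\<delta><d. \<Sum>\<beta><d. (M (\<alpha>, \<beta>) \<gamma> \<delta>)\<^sup>2)"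
          by (intro sum.cong refl sum.swap)
        also have "\<dots> = (\<Sum>r\<in>R. \<Sum>t\<in>R. (\<Sum>p\<in>B \<times> E. u p * (YY (\<xi> (fst p)) (fst r) (snd r) * YY (\<xi> (snd p)) (fst t) (snd t)))\<^sup>2)"
          by (simp add: M_def sR)
        also have "\<dots> \<le> nY d B \<xi> * nY d E \<xi> * sqn (B \<times> E) u"
          unfolding nY_def R_def[symmetric]
          by (rule dual_norm_le2[where L = "\<lambda>b p. YY (\<xi> b) (fst p) (snd p)" and R = "\<lambda>b p. YY (\<xi> b) (fst p) (snd p)"]) (use fin in \<open>auto simp: R_def\<close>)
        finally show "5000 * (\<Sum>r\<in>R. \<Sum>\<gamma><d. \<Sum>\<delta><d. (M r \<gamma> \<delta>)\<^sup>2) \<le> V \<xi> * sqn (B \<times> E) u"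
          by (simp add: V_def)
      qed
      finally show ?thesis .
    qed
    have "real n * real n * (real d)\<^sup>2 \<le> real n * (real d)\<^sup>2 * (real d)\<^sup>2"
      using real_bounds by (intro mult_right_mono mult_left_mono) auto
    moreover have "real n * (5000 * ((5004 * (real d)\<^sup>2) * (5004 * (real d)\<^sup>2))) + 300000000 * (real n)\<^sup>2 * (real d)\<^sup>2
      = 125200080000 * (real n * (real d)\<^sup>2 * (real d)\<^sup>2) + 300000000 * (real n * real n * (real d)\<^sup>2)"
      by (simp add: power2_eq_square mult_ac)
    moreover have "200000000000 * real n * real d ^ 4 = 200000000000 * (real n * (real d)\<^sup>2 * (real d)\<^sup>2)"
      by (simp add: power2_eq_square power4_eq_xxxx mult_ac)
    moreover have "0 \<le> real n * (real d)\<^sup>2 * (real d)\<^sup>2" by simp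
    ultimately show "real n * (5000 * ((5004 * (real d)\<^sup>2) * (5004 * (real d)\<^sup>2))) + 300000000 * (real n)\<^sup>2 * (real d)\<^sup>2 \<le> 200000000000 * real n * real d ^ 4"
      by linarith
  next
    show "quad (B \<times> E) (\<lambda>p q. \<Sum>\<alpha><d. \<Sum>\<beta><d. Phi d y \<xi> \<alpha> \<beta> p * Phi d y \<xi> \<alpha> \<beta> q) u \<le> rhoD d B E y \<xi> * sqn (B \<times> E) u" for y \<xi> u
      unfolding quad_sum_gram by (rule Phi_bound[OF fin])
    show "mb n 152 Pm (\<lambda>x. rhoD d B E (fst x) (snd x)) (300000000 * (real n)\<^sup>2 * (real d)\<^sup>2)"
      by (rule rhoD_mb[OF B E])
    show "mb n 152 S.Om V (5000 * ((5004 * (real d)\<^sup>2) * (5004 * (real d)\<^sup>2)))" by (rule Vmb)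
  qed (rule C psd_sum_gram)+
  then show ?thesis by (simp add: Psi_def[abs_def])
qed

text \<open>The last layer of conditioning: the group \<open>A\<close> is random, \<open>Psi\<close>
  gives the variance and \<open>Tt_bound\<close> the norm of one summand. Both contributions have
  size \<open>n^2 d^4\<close>. Disjointness of the groups supplies the locality hypotheses.\<close>

lemma GA_mb:
  assumes sub: "A \<subseteq> {..<n}" "B \<subseteq> {..<n}" "C \<subseteq> {..<n}" "E \<subseteq> {..<n}"
    and disj: "B \<inter> C = {}" "E \<inter> C = {}" "A \<inter> B = {}" "A \<inter> C = {}" "A \<inter> E = {}"
  shows "mb n 674 S.Om (GA d A B C E) (2000000000000000 * (real n)\<^sup>2 * real d ^ 4)"
proof -
  have fin: "finite B" "finite E" "finite C" using sub by (auto intro: finite_subset[of _ "{..<n}"])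
  define V where "V = (\<lambda>\<xi>. 5000 * Psi d B E C \<xi>)"
  have Vmb: "mb n 326 S.Om V (5000 * (200000000000 * real n * real d ^ 4))"
    unfolding V_def by (intro mb_scale Psi_mb sub disj) auto
  define \<rho> where "\<rho> = (\<lambda>y \<xi>. nY d C \<xi> * rhoD d B E y \<xi>)"
  have "mb n 38 Pm (\<lambda>x. nY d C (snd x)) (5004 * (real d)\<^sup>2)"
    by (rule mb_snd[OF gvec_prob_space S.Om.sigma_finite_measure_axioms nY_mb[OF sub(3)]])
  then have "mb n 152 Pm (\<lambda>x. nY d C (snd x)) (5004 * (real d)\<^sup>2)" by (rule mb_weaken) auto
  from mb_mult[OF this rhoD_mb[OF sub(2,4)]]
  have \<rho>mb: "mb n 326 Pm (\<lambda>x. \<rho> (fst x) (snd x)) ((5004 * (real d)\<^sup>2) * (300000000 * (real n)\<^sup>2 * (real d)\<^sup>2))"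
    unfolding \<rho>_def by (rule mb_weaken) auto
  have "mb n (2 * 326 + 22) S.Om (\<lambda>\<xi>. nrm (B \<times> E) (\<lambda>p q. \<Sum>a\<in>A. \<Sum>c\<in>C. Tt d (\<xi> a) \<xi> c p * Tt d (\<xi> a) \<xi> c q)) (2000000000000000 * (real n)\<^sup>2 * real d ^ 4)"
  proof (rule S.psd_sum_mb'[where P = "\<lambda>y \<xi> p q. \<Sum>c\<in>C. Tt d y \<xi> c p * Tt d y \<xi> c q" and \<rho> = \<rho> and V = V
      and v = "5000 * (200000000000 * real n * real d ^ 4)" and ?r0.0 = "(5004 * (real d)\<^sup>2) * (300000000 * (real n)\<^sup>2 * (real d)\<^sup>2)"])
    show "finite (B \<times> E)" using fin by simp
    have "card B * card E \<le> n * n" using sub card_mono[of "{..<n}" B] card_mono[of "{..<n}" E] by (intro mult_mono) auto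
    also have "\<dots> \<le> n ^ 4" using n1 power_increasing[of 2 4 n] by (simp add: power2_eq_square)
    finally show "card (B \<times> E) \<le> n ^ 4" using fin by (simp add: card_cartesian_product)
    show "(\<lambda>x. \<Sum>c\<in>C. Tt d (fst x) (snd x) c p * Tt d (fst x) (snd x) c q) \<in> borel_measurable Pm"
      if "p \<in> B \<times> E" "q \<in> B \<times> E" for p q
      using that sub by (intro borel_measurable_sum borel_measurable_times Tt_m vm_fst vm_snd) auto
    show "(\<Sum>c\<in>C. Tt d y \<xi> c p * Tt d y \<xi> c q) = (\<Sum>c\<in>C. Tt d y \<xi>' c p * Tt d y \<xi>' c q)"
      if eq: "\<And>k. k \<notin> A \<Longrightarrow> \<xi> k = \<xi>' k" and pq: "p \<in> B \<times> E" "q \<in> B \<times> E" for y \<xi> \<xi>' p q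
    proof -
      have e: "\<xi> (fst p) = \<xi>' (fst p)" "\<xi> (snd p) = \<xi>' (snd p)" "\<xi> (fst q) = \<xi>' (fst q)" "\<xi> (snd q) = \<xi>' (snd q)"
        using pq disj by (auto intro!: eq)
      have "\<xi> c = \<xi>' c" if "c \<in> C" for c using that disj by (intro eq) auto
      then show ?thesis using e by (simp add: Tt_def Phi_def)
    qed
    show "psd (B \<times> E) (\<lambda>p q. \<Sum>c\<in>C. Tt d y \<xi> c p * Tt d y \<xi> c q)" for y \<xi>
      by (rule psd_gram) simp
    show "quad (B \<times> E) (\<lambda>p q. \<Sum>c\<in>C. Tt d y \<xi> c p * Tt d y \<xi> c q) u \<le> \<rho> y \<xi> * sqn (B \<times> E) u" for y \<xi> u
      unfolding quad_gram1 \<rho>_def by (rule Tt_bound[OF fin(1,2)])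
    show "(\<integral>\<^sup>+y. ennreal ((quad (B \<times> E) (\<lambda>p q. \<Sum>c\<in>C. Tt d y \<xi> c p * Tt d y \<xi> c q) u)\<^sup>2) \<partial>gvec d) \<le> ennreal ((V \<xi> * sqn (B \<times> E) u)\<^sup>2)" for \<xi> u
    proof -
      define M where "M = (\<lambda>c \<alpha> \<beta>. \<Sum>p\<in>B \<times> E. u p * Phi d (\<xi> c) \<xi> \<alpha> \<beta> p)"
      have "(\<integral>\<^sup>+y. ennreal ((quad (B \<times> E) (\<lambda>p q. \<Sum>c\<in>C. Tt d y \<xi> c p * Tt d y \<xi> c q) u)\<^sup>2) \<partial>gvec d)
        = (\<integral>\<^sup>+y. ennreal ((\<Sum>c\<in>C. (\<Sum>\<alpha><d. \<Sum>\<beta><d. M c \<alpha> \<beta> * YY y \<alpha> \<beta>)\<^sup>2)\<^sup>2) \<partial>gvec d)"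
        unfolding quad_gram1 Tt_sum M_def ..
      also have "\<dots> \<le> ennreal ((5000 * (\<Sum>c\<in>C. \<Sum>\<alpha><d. \<Sum>\<beta><d. (M c \<alpha> \<beta>)\<^sup>2))\<^sup>2)"
        by (rule gauss_sum_quadratic[OF fin(3)])
      also have "\<dots> \<le> ennreal ((V \<xi> * sqn (B \<times> E) u)\<^sup>2)"
      proof (intro ennreal_leI power_mono)
        show "0 \<le> 5000 * (\<Sum>c\<in>C. \<Sum>\<alpha><d. \<Sum>\<beta><d. (M c \<alpha> \<beta>)\<^sup>2)" by (intro mult_nonneg_nonneg sum_nonneg) auto
        let ?G = "\<lambda>p q. \<Sum>c\<in>C. \<Sum>\<alpha><d. \<Sum>\<beta><d. Phi d (\<xi> c) \<xi> \<alpha> \<beta> p * Phi d (\<xi> c) \<xi> \<alpha> \<beta> q"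
        have G: "?G p q = (\<Sum>c\<in>C. \<Sum>r\<in>{..<d}\<times>{..<d}. Phi d (\<xi> c) \<xi> (fst r) (snd r) p * Phi d (\<xi> c) \<xi> (fst r) (snd r) q)" for p q
          by (simp add: sum.cartesian_product case_prod_unfold)
        have "(\<Sum>c\<in>C. \<Sum>\<alpha><d. \<Sum>\<beta><d. (M c \<alpha> \<beta>)\<^sup>2) = quad (B \<times> E) ?G u"
          unfolding G quad_sum_gram[where X = C] M_def by (simp add: sum.cartesian_product case_prod_unfold)
        also have "\<dots> \<le> Psi d B E C \<xi> * sqn (B \<times> E) u"
          unfolding Psi_def using fin by (intro quad_le_nrm) (auto simp: G intro: psd_sum_gram)
        finally show "5000 * (\<Sum>c\<in>C. \<Sum>\<alpha><d. \<Sum>\<beta><d. (M c \<alpha> \<beta>)\<^sup>2) \<le> V \<xi> * sqn (B \<times> E) u"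
          by (simp add: V_def)
      qed
      finally show ?thesis .
    qed
    have "0 \<le> (real n)\<^sup>2 * real d ^ 4" by simp
    then show "real n * (5000 * (200000000000 * real n * real d ^ 4)) + (5004 * (real d)\<^sup>2) * (300000000 * (real n)\<^sup>2 * (real d)\<^sup>2) \<le> 2000000000000000 * (real n)\<^sup>2 * real d ^ 4"
      by (simp add: power2_eq_square power4_eq_xxxx mult_ac)
    show "mb n 326 Pm (\<lambda>x. \<rho> (fst x) (snd x)) ((5004 * (real d)\<^sup>2) * (300000000 * (real n)\<^sup>2 * (real d)\<^sup>2))" by (rule \<rho>mb)
    show "mb n 326 S.Om V (5000 * (200000000000 * real n * real d ^ 4))" by (rule Vmb)
  qed (use sub in auto)
  then show ?thesis by (simp add: GA_def[abs_def])
qed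

text \<open>\<open>n d^2\<close> is the size of the square root; adding it keeps
  \<open>alpha\<close> positive, because \<open>Pr_alpha\<close> divides by it.\<close>

definition alpha :: "nat set \<Rightarrow> nat set \<Rightarrow> nat set \<Rightarrow> nat set \<Rightarrow> (nat \<Rightarrow> nat \<Rightarrow> real) \<Rightarrow> real" where
  "alpha A B C E \<xi> = sqrt (GA d A B C E \<xi>) + real n * (real d)\<^sup>2"

lemma alpha_mb:
  assumes "A \<subseteq> {..<n}" "B \<subseteq> {..<n}" "C \<subseteq> {..<n}" "E \<subseteq> {..<n}"
    and "B \<inter> C = {}" "E \<inter> C = {}" "A \<inter> B = {}" "A \<inter> C = {}" "A \<inter> E = {}"
  shows "mb n 674 S.Om (alpha A B C E) (50000001 * (real n * (real d)\<^sup>2))"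
proof -
  have z: "0 < real n * (real d)\<^sup>2" using real_bounds by simp
  have "mb n 674 S.Om (GA d A B C E) ((50000000 * (real n * (real d)\<^sup>2))\<^sup>2)"
    by (rule mb_weaken[OF GA_mb[OF assms]]) (simp_all add: power2_eq_square power4_eq_xxxx mult_ac)
  then have "mb n 674 S.Om (\<lambda>\<xi>. sqrt (GA d A B C E \<xi>)) (50000000 * (real n * (real d)\<^sup>2))"
    using z by (intro mb_sqrt S.Om.prob_space_axioms) auto
  then have "mb n 674 S.Om (alpha A B C E) (50000000 * (real n * (real d)\<^sup>2) + real n * (real d)\<^sup>2)"
    unfolding alpha_def[abs_def] using z n2 by (intro mb_add mb_const S.Om.prob_space_axioms) auto
  then show ?thesis by (rule mb_weaken) auto
qed

section \<open>Bounds for coinciding indices\<close>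

text \<open>From \<open>Y_i Y_j = x_i (Y_j x_i)^T - Y_j\<close>: the first term bounds the rank-one
  part, the second bounds the rest column by column. Removing \<open>i\<close> from \<open>J\<close>
  makes \<open>phi\<close> independent of \<open>\<xi> i\<close>.\<close>

definition nu :: "nat set \<Rightarrow> nat \<Rightarrow> (nat \<Rightarrow> nat \<Rightarrow> real) \<Rightarrow> real" where
  "nu J i \<xi> = 2 * ((\<Sum>a<d. (\<xi> i a)\<^sup>2) * phi d (J - {i}) (\<xi> i) \<xi>) + 2 * (\<Sum>k<d. phi d (J - {i}) (ek k) \<xi>)"

lemma phi_upd: "i \<notin> J \<Longrightarrow> phi d J v (\<xi>(i := y)) = phi d J v \<xi>"
proof -
  assume "i \<notin> J"
  then have "(\<Sum>b\<in>J. Yv d ((\<xi>(i := y)) b) v \<alpha> * Yv d ((\<xi>(i := y)) b) v \<gamma>) = (\<Sum>b\<in>J. Yv d (\<xi> b) v \<alpha> * Yv d (\<xi> b) v \<gamma>)" for \<alpha> \<gamma>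
    by (intro sum.cong) auto
  then show ?thesis unfolding phi_def by simp
qed

lemma nu_mb:
  assumes J: "J \<subseteq> {..<n}" and i: "i < n"
  shows "mb n 152 S.Om (nu J i) (40032 * (real n * (real d)\<^sup>2))"
proof -
  let ?J = "J - {i}"
  have J': "?J \<subseteq> {..<n}" using J by auto
  define Z where "Z = (\<lambda>y \<xi>. 2 * ((\<Sum>a<d. (y a)\<^sup>2) * phi d ?J y \<xi>) + 2 * (\<Sum>k<d. phi d ?J (ek k) \<xi>))"
  have a: "mb n 76 Pm (\<lambda>x. \<Sum>a<d. (fst x a)\<^sup>2) (real d)"
    using mb_fst[OF S.Om.prob_space_axioms mb_sqnorm[OF n2 d1]] by (rule mb_weaken) auto
  have b: "mb n 152 Pm (\<lambda>x. (\<Sum>a<d. (fst x a)\<^sup>2) * phi d ?J (fst x) (snd x)) (real d * (10008 * real n * real d))"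
    using mb_mult[OF a phi_mb_pair[OF J']] by simp
  have "mb n 38 S.Om (\<lambda>\<xi>. \<Sum>k<d. phi d ?J (ek k) \<xi>) (\<Sum>k<d. 5004 * real n)"
    using d1 by (intro mb_sum phi_ek_mb J') (auto simp: lessThan_empty_iff)
  from mb_snd[OF gvec_prob_space S.Om.sigma_finite_measure_axioms this]
  have c: "mb n 152 Pm (\<lambda>x. \<Sum>k<d. phi d ?J (ek k) (snd x)) (real d * (5004 * real n))"
    by (rule mb_weaken) auto
  have "mb n 152 Pm (\<lambda>x. Z (fst x) (snd x)) (2 * (real d * (10008 * real n * real d)) + 2 * (real d * (5004 * real n)))"
    unfolding Z_def by (intro mb_add mb_scale b c) auto
  then have "mb n 152 S.Om (\<lambda>\<xi>. Z (\<xi> i) \<xi>) (2 * (real d * (10008 * real n * real d)) + 2 * (real d * (5004 * real n)))"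
    by (rule S.mb_coord[OF i]) (simp add: Z_def phi_upd del: fun_upd_apply)
  then have "mb n 152 S.Om (nu J i) (2 * (real d * (10008 * real n * real d)) + 2 * (real d * (5004 * real n)))"
    by (simp add: Z_def nu_def[abs_def])
  then show ?thesis
  proof (rule mb_weaken)
    have "real d * real n \<le> real d * real n * real d" using mult_left_mono[of 1 "real d" "real d * real n"] real_bounds by simp
    moreover have "0 \<le> real d * real n * real d" by simp
    moreover have "2 * (real d * (10008 * real n * real d)) + 2 * (real d * (5004 * real n)) = 20016 * (real d * real n * real d) + 10008 * (real d * real n)"
      by simp
    moreover have "40032 * (real n * (real d)\<^sup>2) = 40032 * (real d * real n * real d)" by (simp add: power2_eq_square)
    ultimately show "2 * (real d * (10008 * real n * real d)) + 2 * (real d * (5004 * real n)) \<le> 40032 * (real n * (real d)\<^sup>2)"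
      by linarith
  qed simp
qed

text \<open>\<open>Y^2 = (|y|^2 - 2) y y^T + I\<close>, so \<open>eps y\<close> is the coefficient
  of \<open>y y^T\<close> left after subtracting \<open>d y y^T + I\<close>. It is of order
  \<open>sqrt d\<close>.\<close>

definition eps :: "(nat \<Rightarrow> real) \<Rightarrow> real" where
  "eps y = (\<Sum>a<d. (y a)\<^sup>2) - 2 - real d"

lemma eps_mb: "mb n 4 (gvec d) (\<lambda>y. \<bar>eps y\<bar>) (3 * sqrt (real d))"
proof -
  have s: "1 \<le> sqrt (real d)" using real_bounds(1) by simp
  have "mb n 4 (gvec d) (\<lambda>y. \<bar>(\<Sum>a<d. (y a)\<^sup>2) - real d\<bar> + 2) (sqrt (real d) + 2)"
    using n2 by (intro mb_add mb_sqnorm_deviation mb_const gvec_prob_space d1) auto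
  then show ?thesis
  proof (rule mb_mono)
    show "(\<lambda>y. \<bar>eps y\<bar>) \<in> borel_measurable (gvec d)"
      unfolding eps_def by (intro borel_measurable_abs borel_measurable_diff borel_measurable_sum borel_measurable_power coord_measurable) auto
  qed (use s in \<open>auto simp: eps_def\<close>)
qed

text \<open>The squared Frobenius norm of \<open>eps(x_i) x_i x_i^T\<close>, of order
  \<open>d^3\<close>.\<close>

definition kap1 :: "nat \<Rightarrow> (nat \<Rightarrow> nat \<Rightarrow> real) \<Rightarrow> real" where
  "kap1 i \<xi> = (\<bar>eps (\<xi> i)\<bar> * \<bar>eps (\<xi> i)\<bar>) * ((\<Sum>a<d. (\<xi> i a)\<^sup>2) * (\<Sum>a<d. (\<xi> i a)\<^sup>2))"

lemma kap1_mb: "i < n \<Longrightarrow> mb n 16 S.Om (kap1 i) (9 * real d ^ 3)"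
proof -
  assume i: "i < n"
  have a: "mb n 8 (gvec d) (\<lambda>y. \<bar>eps y\<bar> * \<bar>eps y\<bar>) ((3 * sqrt (real d)) * (3 * sqrt (real d)))"
    using mb_mult[OF eps_mb eps_mb] by simp
  have b: "mb n 8 (gvec d) (\<lambda>y. (\<Sum>a<d. (y a)\<^sup>2) * (\<Sum>a<d. (y a)\<^sup>2)) (real d * real d)"
    using mb_mult[OF mb_sqnorm[OF n2 d1] mb_sqnorm[OF n2 d1]] by simp
  have "mb n 16 (gvec d) (\<lambda>y. (\<bar>eps y\<bar> * \<bar>eps y\<bar>) * ((\<Sum>a<d. (y a)\<^sup>2) * (\<Sum>a<d. (y a)\<^sup>2))) (((3 * sqrt (real d)) * (3 * sqrt (real d))) * (real d * real d))"
    using mb_mult[OF a b] by simp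
  then have "mb n 16 (gvec d) (\<lambda>y. (\<bar>eps y\<bar> * \<bar>eps y\<bar>) * ((\<Sum>a<d. (y a)\<^sup>2) * (\<Sum>a<d. (y a)\<^sup>2))) (9 * real d ^ 3)"
    by (rule mb_weaken) (simp_all add: power3_eq_cube)
  from S.mb_comp[OF i this] show ?thesis by (simp add: kap1_def[abs_def])
qed

text \<open>Bounds the inner product of two such matrices. Independent samples are nearly
  orthogonal, so their squared inner product has order \<open>d\<close> instead of
  \<open>d^2\<close> and the total is only \<open>d^2\<close>.\<close>

definition kap2 :: "nat \<Rightarrow> nat \<Rightarrow> (nat \<Rightarrow> nat \<Rightarrow> real) \<Rightarrow> real" where
  "kap2 i j \<xi> = (\<bar>eps (\<xi> i)\<bar> * \<bar>eps (\<xi> j)\<bar>) * (\<Sum>a<d. \<xi> i a * \<xi> j a)\<^sup>2"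

lemma kap2_mb:
  assumes i: "i < n" and j: "j < n" and ij: "i \<noteq> j"
  shows "mb n 16 S.Om (kap2 i j) (18 * (real d)\<^sup>2)"
proof -
  define Z where "Z = (\<lambda>y \<xi>. (\<bar>eps y\<bar> * \<bar>eps (\<xi> j)\<bar>) * (\<Sum>a<d. y a * \<xi> j a)\<^sup>2)"
  have sf: "sigma_finite_measure S.Om" by (rule S.Om.sigma_finite_measure_axioms)
  have e1: "mb n 4 Pm (\<lambda>x. \<bar>eps (fst x)\<bar>) (3 * sqrt (real d))"
    using mb_fst[OF S.Om.prob_space_axioms eps_mb] by simp
  have e2: "mb n 4 Pm (\<lambda>x. \<bar>eps (snd x j)\<bar>) (3 * sqrt (real d))"
    using mb_snd[OF gvec_prob_space sf S.mb_comp[OF j eps_mb]] by simp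
  have a: "mb n 8 Pm (\<lambda>x. \<bar>eps (fst x)\<bar> * \<bar>eps (snd x j)\<bar>) ((3 * sqrt (real d)) * (3 * sqrt (real d)))"
    using mb_mult[OF e1 e2] by simp
  have "mb n (2 * 4) Pm (\<lambda>x. (\<Sum>a<d. fst x a * snd x j a)\<^sup>2) (2 * real d)"
  proof (rule mb_fixed[OF gvec_prob_space S.Om.prob_space_axioms])
    show "mb n 4 S.Om (\<lambda>\<xi>. (\<Sum>a<d. y a * \<xi> j a)\<^sup>2) ((\<Sum>a<d. (y a)\<^sup>2) + 1)" for y
    proof (rule S.mb_comp[OF j mb_linear[OF n2]])
      show "0 < (\<Sum>a<d. (y a)\<^sup>2) + 1" by (intro add_nonneg_pos sum_nonneg) auto
    qed simp
    show "(\<lambda>x. (\<Sum>a<d. fst x a * snd x j a)\<^sup>2) \<in> borel_measurable Pm"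
      using vm_fst vm_snd[OF j] unfolding vm_def by (intro borel_measurable_power borel_measurable_sum borel_measurable_times) auto
    have "mb n 4 (gvec d) (\<lambda>y. (\<Sum>a<d. (y a)\<^sup>2) + 1) (real d + 1)"
      using n2 by (intro mb_add mb_sqnorm mb_const gvec_prob_space d1) auto
    then show "mb n 4 (gvec d) (\<lambda>y. (\<Sum>a<d. (y a)\<^sup>2) + 1) (2 * real d)"
      using real_bounds(1) by (rule_tac mb_weaken) auto
  qed
  then have b: "mb n 8 Pm (\<lambda>x. (\<Sum>a<d. fst x a * snd x j a)\<^sup>2) (2 * real d)" by simp
  have "mb n 16 Pm (\<lambda>x. Z (fst x) (snd x)) (((3 * sqrt (real d)) * (3 * sqrt (real d))) * (2 * real d))"
    unfolding Z_def using mb_mult[OF a b] by simp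
  then have "mb n 16 S.Om (\<lambda>\<xi>. Z (\<xi> i) \<xi>) (((3 * sqrt (real d)) * (3 * sqrt (real d))) * (2 * real d))"
    by (rule S.mb_coord[OF i]) (use ij in \<open>simp add: Z_def\<close>)
  then have "mb n 16 S.Om (kap2 i j) (((3 * sqrt (real d)) * (3 * sqrt (real d))) * (2 * real d))"
    by (simp add: Z_def kap2_def[abs_def])
  then show ?thesis by (rule mb_weaken) (simp_all add: power2_eq_square)
qed

section \<open>Maxima over the indices and the random bound of the certificate\<close>

definition nuM :: "nat set \<Rightarrow> (nat \<Rightarrow> nat \<Rightarrow> real) \<Rightarrow> real" where
  "nuM J \<xi> = Max ((\<lambda>i. nu J i \<xi>) ` {..<n})"

definition kM1 :: "(nat \<Rightarrow> nat \<Rightarrow> real) \<Rightarrow> real" where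
  "kM1 \<xi> = Max ((\<lambda>i. kap1 i \<xi>) ` {..<n})"

definition kM2 :: "(nat \<Rightarrow> nat \<Rightarrow> real) \<Rightarrow> real" where
  "kM2 \<xi> = Max ((\<lambda>p. if fst p = snd p then 0 else kap2 (fst p) (snd p) \<xi>) ` ({..<n} \<times> {..<n}))"

lemma mb_Max':
  assumes "finite I" "I \<noteq> {}" "card I \<le> n ^ a" "\<And>i. i \<in> I \<Longrightarrow> mb n c S.Om (Z i) z"
  shows "mb n (c + a) S.Om (\<lambda>\<xi>. Max ((\<lambda>i. Z i \<xi>) ` I)) z"
proof (rule mb_Max[OF assms])
  show "(\<lambda>\<xi>. Max ((\<lambda>i. Z i \<xi>) ` I)) \<in> borel_measurable S.Om"
    using assms mbD(5)[OF assms(4)] by (intro borel_measurable_Max) auto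
  fix \<xi>
  have "Max ((\<lambda>i. Z i \<xi>) ` I) \<in> (\<lambda>i. Z i \<xi>) ` I" using assms by (intro Max_in) auto
  then obtain i where i: "i \<in> I" "Max ((\<lambda>i. Z i \<xi>) ` I) = Z i \<xi>" by auto
  then show "\<exists>i\<in>I. Max ((\<lambda>i. Z i \<xi>) ` I) \<le> Z i \<xi>" by auto
  show "0 \<le> Max ((\<lambda>i. Z i \<xi>) ` I)" using i mbD(6)[OF assms(4)[OF i(1)]] by simp
qed

lemma n_nonempty: "{..<n} \<noteq> {}" using n1 by (auto simp: lessThan_empty_iff)

lemma nuM_mb: "J \<subseteq> {..<n} \<Longrightarrow> mb n 153 S.Om (nuM J) (40032 * (real n * (real d)\<^sup>2))"
  using mb_Max'[of "{..<n}" 1 152 "nu J"] nu_mb n_nonempty by (simp add: nuM_def[abs_def])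

lemma kM1_mb: "mb n 17 S.Om kM1 (9 * real d ^ 3)"
  using mb_Max'[of "{..<n}" 1 16 kap1] kap1_mb n_nonempty by (simp add: kM1_def[abs_def])

lemma kM2_mb: "mb n 18 S.Om kM2 (18 * (real d)\<^sup>2)"
proof -
  have "mb n (16 + 2) S.Om (\<lambda>\<xi>. Max ((\<lambda>p. if fst p = snd p then 0 else kap2 (fst p) (snd p) \<xi>) ` ({..<n} \<times> {..<n}))) (18 * (real d)\<^sup>2)"
  proof (rule mb_Max')
    fix p assume p: "p \<in> {..<n} \<times> {..<n}"
    show "mb n 16 S.Om (\<lambda>\<xi>. if fst p = snd p then 0 else kap2 (fst p) (snd p) \<xi>) (18 * (real d)\<^sup>2)"
    proof (cases "fst p = snd p")
      case True
      have "mb n 16 S.Om (\<lambda>\<xi>. 0) (18 * (real d)\<^sup>2)" using n2 d1 by (intro mb_const S.Om.prob_space_axioms) auto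
      then show ?thesis using True by simp
    next
      case False
      then show ?thesis using kap2_mb[of "fst p" "snd p"] p by auto
    qed
  qed (use n_nonempty in \<open>auto simp: power2_eq_square\<close>)
  then show ?thesis by (simp add: kM2_def[abs_def])
qed

text \<open>The four groups hold the indices \<open>i, j, m, k\<close> of
  \<open>tr (Y_i Y_j Y_m Y_k)\<close>, in this order: \<open>\<kappa>\<close> separates
  \<open>i, k\<close> from \<open>j, m\<close>, and \<open>l\<close> separates \<open>i\<close> from
  \<open>k\<close> and \<open>j\<close> from \<open>m\<close>.\<close>

definition alphaA :: "(nat \<Rightarrow> nat \<Rightarrow> real) \<Rightarrow> nat set \<Rightarrow> nat set \<Rightarrow> real" where
  "alphaA \<xi> \<kappa> l = alpha (\<kappa> \<inter> l) (({..<n} - \<kappa>) \<inter> l) (({..<n} - \<kappa>) - l) (\<kappa> - l) \<xi>"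

definition fsplit :: "(nat \<Rightarrow> nat \<Rightarrow> real) \<Rightarrow> nat set \<Rightarrow> real" where
  "fsplit \<xi> \<kappa> = nuM \<kappa> \<xi> + nuM ({..<n} - \<kappa>) \<xi> + 16 * (\<Sum>l\<in>Pow {..<n}. 1 / 2 ^ n * alphaA \<xi> \<kappa> l)"

text \<open>The three summands bound the off-diagonal part of \<open>h(M)\<close> and the repeated and distinct pairs
  of indices in the square of its diagonal part; the weights turn bounds in terms of \<open>\<eta> n\<close> into
  multiples of \<open>T\<^sup>2\<close>.\<close>

definition fcert :: "real \<Rightarrow> (nat \<Rightarrow> nat \<Rightarrow> real) \<Rightarrow> real" where
  "fcert T \<xi> = 3 * T\<^sup>2 * (16 / (real n * (real d)\<^sup>2) * (\<Sum>\<kappa>\<in>Pow {..<n}. 1 / 2 ^ n * fsplit \<xi> \<kappa>)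
     + 1 / real d ^ 3 * kM1 \<xi> + 1 / (real d)\<^sup>2 * kM2 \<xi>)"

lemma mb_average:
  assumes "\<And>\<kappa>. \<kappa> \<in> Pow {..<n} \<Longrightarrow> mb n c S.Om (\<lambda>\<xi>. Z \<xi> \<kappa>) z"
  shows "mb n c S.Om (\<lambda>\<xi>. \<Sum>\<kappa>\<in>Pow {..<n}. 1 / 2 ^ n * Z \<xi> \<kappa>) z"
proof -
  have "mb n c S.Om (\<lambda>\<xi>. \<Sum>\<kappa>\<in>Pow {..<n}. 1 / 2 ^ n * Z \<xi> \<kappa>) (\<Sum>\<kappa>\<in>Pow {..<n}. 1 / 2 ^ n * z)"
    using assms by (intro mb_sum mb_scale) auto
  moreover have "(\<Sum>\<kappa>\<in>Pow {..<n}. 1 / 2 ^ n * z) = z" by (simp add: card_Pow)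
  ultimately show ?thesis by simp
qed

text \<open>Every part is divided by its own size, which leaves an absolute multiple of
  \<open>T^2\<close>. The constant 680 dominates those of all parts, the largest being 674 for
  \<open>alpha\<close>.\<close>

lemma fcert_mb:
  assumes T: "0 < T"
  shows "mb n 680 S.Om (fcert T) (40000000000 * T\<^sup>2)"
proof -
  define Q where "Q = real n * (real d)\<^sup>2"
  have Q: "0 < Q" using real_bounds by (simp add: Q_def)
  have d0: "0 < real d" using real_bounds by simp
  have al: "mb n 680 S.Om (\<lambda>\<xi>. \<Sum>l\<in>Pow {..<n}. 1 / 2 ^ n * alphaA \<xi> \<kappa> l) (50000001 * Q)" if "\<kappa> \<in> Pow {..<n}" for \<kappa>
  proof (rule mb_average)
    fix l assume "l \<in> Pow {..<n}"
    have "mb n 674 S.Om (\<lambda>\<xi>. alphaA \<xi> \<kappa> l) (50000001 * Q)"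
      unfolding alphaA_def Q_def by (rule alpha_mb) (use that in auto)
    then show "mb n 680 S.Om (\<lambda>\<xi>. alphaA \<xi> \<kappa> l) (50000001 * Q)" by (rule mb_weaken) auto
  qed
  have nm: "mb n 680 S.Om (nuM J) (40032 * Q)" if "J \<subseteq> {..<n}" for J
    using nuM_mb[OF that] unfolding Q_def by (rule mb_weaken) auto
  have fs: "mb n 680 S.Om (\<lambda>\<xi>. fsplit \<xi> \<kappa>) (40032 * Q + 40032 * Q + 16 * (50000001 * Q))" if "\<kappa> \<in> Pow {..<n}" for \<kappa>
    unfolding fsplit_def using that by (intro mb_add mb_scale al nm) auto
  have k1: "mb n 680 S.Om kM1 (9 * real d ^ 3)" by (rule mb_weaken[OF kM1_mb]) auto
  have k2: "mb n 680 S.Om kM2 (18 * (real d)\<^sup>2)" by (rule mb_weaken[OF kM2_mb]) auto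
  have "mb n 680 S.Om (fcert T) (3 * T\<^sup>2 * (16 / Q * (40032 * Q + 40032 * Q + 16 * (50000001 * Q))
     + 1 / real d ^ 3 * (9 * real d ^ 3) + 1 / (real d)\<^sup>2 * (18 * (real d)\<^sup>2)))"
    unfolding fcert_def Q_def[symmetric] using Q d0 T
    by (intro mb_scale mb_add mb_average fs k1 k2) auto
  then show ?thesis
  proof (rule mb_weaken)
    have e: "16 / Q * (40032 * Q + 40032 * Q + 16 * (50000001 * Q)) + 1 / real d ^ 3 * (9 * real d ^ 3) + 1 / (real d)\<^sup>2 * (18 * (real d)\<^sup>2) = 12801281307"
      using Q d0 by (simp add: field_simps)
    show "3 * T\<^sup>2 * (16 / Q * (40032 * Q + 40032 * Q + 16 * (50000001 * Q)) + 1 / real d ^ 3 * (9 * real d ^ 3) + 1 / (real d)\<^sup>2 * (18 * (real d)\<^sup>2)) \<le> 40000000000 * T\<^sup>2"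
      unfolding e by simp
  qed simp
qed

lemma fcert_moment:
  assumes T: "0 < T" and p: "1 \<le> p"
  shows "(\<integral>\<^sup>+\<xi>. ennreal (fcert T \<xi> ^ p) \<partial>S.Om) \<le> ennreal (2 * real d * real (924800 * p) ^ (680 * p) * (40000000000 * T\<^sup>2) ^ p)"
proof -
  have "(\<integral>\<^sup>+\<xi>. ennreal (fcert T \<xi> ^ p) \<partial>S.Om) \<le> ennreal (2 * sqrt (real n) * real (924800 * p) ^ (680 * p) * (40000000000 * T\<^sup>2) ^ p)"
    using mb_lyapunov[OF S.Om.prob_space_axioms fcert_mb[OF T] p] by simp
  also have "\<dots> \<le> ennreal (2 * real d * real (924800 * p) ^ (680 * p) * (40000000000 * T\<^sup>2) ^ p)"
  proof (intro ennreal_leI mult_right_mono mult_left_mono)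
    show "sqrt (real n) \<le> real d" using real_bounds by (intro real_le_lsqrt) auto
  qed auto
  finally show ?thesis .
qed

end

section \<open>Sum-of-squares proofs\<close>

definition mdeg :: "(nat \<Rightarrow>\<^sub>0 nat) \<Rightarrow> nat" where
  "mdeg m = (\<Sum>i\<in>Poly_Mapping.keys m. Poly_Mapping.lookup m i)"

lemma mdeg_superset:
  assumes "finite F" "Poly_Mapping.keys m \<subseteq> F"
  shows "mdeg m = (\<Sum>i\<in>F. Poly_Mapping.lookup m i)"
  unfolding mdeg_def using assms by (intro sum.mono_neutral_left) (auto simp: in_keys_iff)

lemma mdeg_add: "mdeg (m + m') = mdeg m + mdeg m'"
proof -
  let ?F = "Poly_Mapping.keys m \<union> Poly_Mapping.keys m'"
  have "mdeg (m + m') = (\<Sum>i\<in>?F. Poly_Mapping.lookup (m + m') i)"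
    using Poly_Mapping.keys_add[of m m'] by (intro mdeg_superset) auto
  also have "\<dots> = mdeg m + mdeg m'"
    by (simp add: lookup_add sum.distrib mdeg_superset[of ?F])
  finally show ?thesis .
qed

lemma total_degree_le_iff: "total_degree P \<le> D \<longleftrightarrow> (\<forall>m\<in>Poly_Mapping.keys P. mdeg m \<le> D)"
  unfolding total_degree_def mdeg_def by (subst Max_le_iff) auto

lemma total_degree_add: "total_degree P \<le> D \<Longrightarrow> total_degree Q \<le> D \<Longrightarrow> total_degree (P + Q) \<le> D"
  using Poly_Mapping.keys_add[of P Q] by (auto simp: total_degree_le_iff)

lemma total_degree_mult: "total_degree P \<le> D \<Longrightarrow> total_degree Q \<le> E \<Longrightarrow> total_degree (P * Q) \<le> D + E"
  using Poly_Mapping.keys_mult[of P Q] by (fastforce simp: total_degree_le_iff mdeg_add intro: add_mono)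

definition pol :: "nat set \<Rightarrow> nat \<Rightarrow> rpoly \<Rightarrow> bool" where
  "pol V D P \<longleftrightarrow> P \<in> polys_in V \<and> total_degree P \<le> D"

lemma pol_add: "pol V D P \<Longrightarrow> pol V D Q \<Longrightarrow> pol V D (P + Q)"
  using Poly_Mapping.keys_add[of P Q] by (auto simp: pol_def polys_in_def intro: total_degree_add)

lemma pol_mult: "pol V D P \<Longrightarrow> pol V E Q \<Longrightarrow> pol V (D + E) (P * Q)"
  unfolding pol_def polys_in_def
proof (intro conjI)
  assume h: "P \<in> {P. \<forall>m\<in>Poly_Mapping.keys P. Poly_Mapping.keys m \<subseteq> V} \<and> total_degree P \<le> D"
     "Q \<in> {P. \<forall>m\<in>Poly_Mapping.keys P. Poly_Mapping.keys m \<subseteq> V} \<and> total_degree Q \<le> E"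
  show "total_degree (P * Q) \<le> D + E" using h by (intro total_degree_mult) auto
  show "P * Q \<in> {P. \<forall>m\<in>Poly_Mapping.keys P. Poly_Mapping.keys m \<subseteq> V}"
  proof (clarsimp)
    fix m x assume m: "m \<in> Poly_Mapping.keys (P * Q)" and x: "x \<in> Poly_Mapping.keys m"
    obtain a b where ab: "m = a + b" "a \<in> Poly_Mapping.keys P" "b \<in> Poly_Mapping.keys Q"
      using Poly_Mapping.keys_mult[of P Q] m by blast
    then show "x \<in> V" using h x Poly_Mapping.keys_add[of a b] by blast
  qed
qed

lemma pol_mono: "pol V D P \<Longrightarrow> D \<le> E \<Longrightarrow> pol V E P"
  by (auto simp: pol_def)

lemma pol_0 [simp]: "pol V D 0"
  by (simp add: pol_def polys_in_def total_degree_le_iff)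

lemma pol_const [simp]: "pol V D (pconst c)"
  by (auto simp: pol_def polys_in_def pconst_def total_degree_le_iff mdeg_def)

lemma pconst_hom: "pconst (a + b) = pconst a + pconst b" "pconst (a * b) = pconst a * pconst b"
  "pconst 0 = 0" "pconst 1 = 1" "pconst (- a) = - pconst a" "pconst (a - b) = pconst a - pconst b" "pconst (a ^ k) = pconst a ^ k"
proof -
  show add: "pconst (a + b) = pconst a + pconst b" for a b by (simp add: pconst_def single_add)
  show mult: "pconst (a * b) = pconst a * pconst b" for a b by (simp add: pconst_def mult_single)
  show z: "pconst 0 = 0" by (simp add: pconst_def)
  show one: "pconst 1 = 1" by (simp add: pconst_def)
  show neg: "pconst (- a) = - pconst a" for a using add[of a "- a"] z by (simp add: eq_neg_iff_add_eq_0 add.commute)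
  show "pconst (a - b) = pconst a - pconst b" using add[of a "- b"] neg[of b] by simp
  show "pconst (a ^ k) = pconst a ^ k" by (induction k) (auto simp: mult one)
qed

lemma pconst_sum: "pconst (\<Sum>i\<in>I. f i) = (\<Sum>i\<in>I. pconst (f i))"
  by (induction I rule: infinite_finite_induct) (auto simp: pconst_hom)

lemma pconst_numeral: "pconst (numeral k) = numeral k"
  by (induction k) (simp_all only: numeral.simps pconst_hom)

lemma pol_uminus: "pol V D P \<Longrightarrow> pol V D (- P)"
  by (auto simp: pol_def polys_in_def total_degree_le_iff)

lemma pol_diff: "pol V D P \<Longrightarrow> pol V D Q \<Longrightarrow> pol V D (P - Q)"
  using pol_add[of V D P "- Q"] pol_uminus[of V D Q] by simp

lemma pol_var: "i \<in> V \<Longrightarrow> 1 \<le> D \<Longrightarrow> pol V D (pvar i)"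
  by (auto simp: pol_def polys_in_def pvar_def total_degree_le_iff mdeg_def)

lemma pol_sum: "(\<And>i. i \<in> I \<Longrightarrow> pol V D (f i)) \<Longrightarrow> pol V D (\<Sum>i\<in>I. f i)"
  by (induction I rule: infinite_finite_induct) (auto intro: pol_add)

lemma pol_cmult: "pol V D P \<Longrightarrow> pol V D (pconst c * P)"
  using pol_mult[of V 0 "pconst c" D P] by simp

lemma pol_mult2: "pol V D P \<Longrightarrow> pol V E Q \<Longrightarrow> D + E \<le> F \<Longrightarrow> pol V F (P * Q)"
  using pol_mult pol_mono by blast

lemma pol_1 [simp]: "pol V D 1"
  using pol_const[of V D 1] by (simp add: pconst_hom)

lemma pol_prod: "(\<And>i. i \<in> S \<Longrightarrow> f i \<in> polys_in V) \<Longrightarrow> (\<Prod>i\<in>S. f i) \<in> polys_in V"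
proof (induction S rule: infinite_finite_induct)
  case (insert x F)
  have "pol V (total_degree (f x) + total_degree (prod f F)) (f x * prod f F)"
    using insert by (intro pol_mult) (auto simp: pol_def)
  then show ?case using insert by (simp add: pol_def)
qed (use pol_1[of V 0] in \<open>simp_all add: pol_def\<close>)

text \<open>The provable polynomials, generated one summand at a time: in contrast to the coefficient functions
  in the definition of \<^const>\<open>sos_proves\<close>, this form is visibly closed under products.\<close>

inductive pc :: "nat set \<Rightarrow> rpoly list \<Rightarrow> nat \<Rightarrow> rpoly \<Rightarrow> bool" for V qs t where
  pc0: "pc V qs t 0"
| pcS: "pc V qs t P \<Longrightarrow> f \<in> polys_in V \<Longrightarrow> S \<subseteq> {..<length qs} \<Longrightarrow>
    total_degree (f ^ 2 * (\<Prod>i\<in>S. qs ! i)) \<le> t \<Longrightarrow> pc V qs t (f ^ 2 * (\<Prod>i\<in>S. qs ! i) + P)"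

lemma sos_proves_insert:
  assumes P: "sos_proves V t qs P" and f: "f \<in> polys_in V" and S: "S \<subseteq> {..<length qs}"
    and deg: "real (total_degree (f ^ 2 * (\<Prod>i\<in>S. qs ! i))) \<le> t"
  shows "sos_proves V t qs (f ^ 2 * (\<Prod>i\<in>S. qs ! i) + P)"
proof -
  obtain b where b: "\<And>U. U \<subseteq> {..<length qs} \<Longrightarrow> is_sos V (b U)"
      "\<And>U. U \<subseteq> {..<length qs} \<Longrightarrow> real (total_degree (b U * (\<Prod>i\<in>U. qs ! i))) \<le> t"
      "P = (\<Sum>U\<in>Pow {..<length qs}. b U * (\<Prod>i\<in>U. qs ! i))"
    using P unfolding sos_proves_def by auto
  define b' where "b' = b(S := f ^ 2 + b S)"
  have "is_sos V (b' U) \<and> real (total_degree (b' U * (\<Prod>i\<in>U. qs ! i))) \<le> t" if U: "U \<subseteq> {..<length qs}" for U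
  proof (cases "U = S")
    case True
    obtain fs where fs: "set fs \<subseteq> polys_in V" "b S = (\<Sum>g\<leftarrow>fs. g ^ 2)" using b(1)[OF S] by (auto simp: is_sos_def)
    have "is_sos V (f ^ 2 + b S)"
      unfolding is_sos_def by (rule exI[of _ "f # fs"]) (use fs f in auto)
    moreover have "total_degree (f ^ 2 * (\<Prod>i\<in>S. qs ! i) + b S * (\<Prod>i\<in>S. qs ! i))
        \<le> max (total_degree (f ^ 2 * (\<Prod>i\<in>S. qs ! i))) (total_degree (b S * (\<Prod>i\<in>S. qs ! i)))"
      by (intro total_degree_add) auto
    then have "real (total_degree (f ^ 2 * (\<Prod>i\<in>S. qs ! i) + b S * (\<Prod>i\<in>S. qs ! i))) \<le> t"
      using deg b(2)[OF S] by (simp add: max_def split: if_splits)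
    ultimately show ?thesis using True by (simp add: b'_def distrib_right)
  next
    case False then show ?thesis using b(1,2)[OF U] by (simp add: b'_def)
  qed
  moreover have "f ^ 2 * (\<Prod>i\<in>S. qs ! i) + P = (\<Sum>U\<in>Pow {..<length qs}. b' U * (\<Prod>i\<in>U. qs ! i))"
  proof -
    have S': "S \<in> Pow {..<length qs}" "finite (Pow {..<length qs})" using S by auto
    have "(\<Sum>U\<in>Pow {..<length qs}. b' U * (\<Prod>i\<in>U. qs ! i)) = b' S * (\<Prod>i\<in>S. qs ! i) + (\<Sum>U\<in>Pow {..<length qs} - {S}. b U * (\<Prod>i\<in>U. qs ! i))"
      using S' by (simp add: sum.remove[OF S'(2,1)] b'_def)
    also have "\<dots> = f ^ 2 * (\<Prod>i\<in>S. qs ! i) + P"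
      unfolding b(3) sum.remove[OF S'(2,1)] by (simp add: b'_def distrib_right add.assoc)
    finally show ?thesis by simp
  qed
  ultimately show ?thesis unfolding sos_proves_def by blast
qed

lemma pc_sos_proves: "pc V qs t P \<Longrightarrow> sos_proves V (real t) qs P"
proof (induction rule: pc.induct)
  case pc0
  show ?case unfolding sos_proves_def
    by (rule exI[of _ "\<lambda>_. 0"]) (auto simp: is_sos_def total_degree_def intro!: exI[of _ "[]"])
next
  case (pcS P f S)
  then show ?case by (intro sos_proves_insert) auto
qed

lemma pc_add: "pc V qs t P \<Longrightarrow> pc V qs t Q \<Longrightarrow> pc V qs t (P + Q)"
  by (induction rule: pc.induct) (auto simp: add.assoc intro: pc.intros)

lemma pc_mono: "pc V qs t P \<Longrightarrow> t \<le> t' \<Longrightarrow> pc V qs t' P"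
  by (induction rule: pc.induct) (auto intro: pc.intros)

lemma pc_sum: "(\<And>i. i \<in> I \<Longrightarrow> pc V qs t (f i)) \<Longrightarrow> pc V qs t (\<Sum>i\<in>I. f i)"
  by (induction I rule: infinite_finite_induct) (auto intro: pc_add pc0)

lemma pc_gen: "f \<in> polys_in V \<Longrightarrow> S \<subseteq> {..<length qs} \<Longrightarrow> total_degree (f ^ 2 * (\<Prod>i\<in>S. qs ! i)) \<le> t \<Longrightarrow> pc V qs t (f ^ 2 * (\<Prod>i\<in>S. qs ! i))"
  using pcS[OF pc0] by fastforce

lemma pc_square: "pol V D f \<Longrightarrow> 2 * D \<le> t \<Longrightarrow> pc V qs t (f ^ 2)"
  using pc_gen[of f V "{}" qs t] pol_mult[of V D f D f] by (auto simp: pol_def power2_eq_square mult_2)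

lemma pc_axiom:
  assumes "q \<in> set qs" "total_degree q \<le> t" shows "pc V qs t q"
proof -
  obtain i where i: "i < length qs" "qs ! i = q" using assms(1) by (auto simp: in_set_conv_nth)
  show ?thesis using pc_gen[of 1 V "{i}" qs t] i assms(2) pol_1[of V 0] by (simp add: pol_def)
qed

lemma pc_const: "0 \<le> c \<Longrightarrow> pc V qs t (pconst c)"
  using pc_square[of V 0 "pconst (sqrt c)" t qs] by (simp add: pconst_hom(7)[symmetric])

lemma prod_symdiff:
  fixes g :: "'a \<Rightarrow> 'b::comm_ring_1"
  assumes "finite S" "finite T"
  shows "(\<Prod>i\<in>S. g i) * (\<Prod>i\<in>T. g i) = (\<Prod>i\<in>S \<inter> T. g i) ^ 2 * (\<Prod>i\<in>(S - T) \<union> (T - S). g i)"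
proof -
  have "(\<Prod>i\<in>S. g i) = (\<Prod>i\<in>S \<inter> T. g i) * (\<Prod>i\<in>S - T. g i)"
    using assms by (metis prod.Int_Diff)
  moreover have "(\<Prod>i\<in>T. g i) = (\<Prod>i\<in>S \<inter> T. g i) * (\<Prod>i\<in>T - S. g i)"
    using assms by (metis prod.Int_Diff Int_commute)
  moreover have "(\<Prod>i\<in>(S - T) \<union> (T - S). g i) = (\<Prod>i\<in>S - T. g i) * (\<Prod>i\<in>T - S. g i)"
    using assms by (intro prod.union_disjoint) auto
  ultimately show ?thesis by (simp add: power2_eq_square mult_ac)
qed

text \<open>Multiplying two summands repeats the constraints in \<open>S \<inter> T\<close>; their
  squares join the square multiplier and the symmetric difference remains as constraint set. The
  product is thus again a single summand, and degrees add.\<close>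

lemma pc_mult:
  assumes qs: "set qs \<subseteq> polys_in V"
  shows "pc V qs t P \<Longrightarrow> pc V qs t' Q \<Longrightarrow> pc V qs (t + t') (P * Q)"
proof (induction rule: pc.induct)
  case pc0 then show ?case by (simp add: pc.pc0)
next
  case (pcS P f S)
  have "pc V qs (t + t') ((f ^ 2 * (\<Prod>i\<in>S. qs ! i)) * Q)" using pcS(6)
  proof (induction rule: pc.induct)
    case pc0 then show ?case by (simp add: pc.pc0)
  next
    case (pcS Q' g T)
    let ?h = "f * g * (\<Prod>i\<in>S \<inter> T. qs ! i)" and ?U = "(S - T) \<union> (T - S)"
    have fin: "finite S" "finite T" using \<open>S \<subseteq> _\<close> pcS(3) by (auto intro: finite_subset)
    have e: "(f ^ 2 * (\<Prod>i\<in>S. qs ! i)) * (g ^ 2 * (\<Prod>i\<in>T. qs ! i)) = ?h ^ 2 * (\<Prod>i\<in>?U. qs ! i)"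
    proof -
      have "(f ^ 2 * (\<Prod>i\<in>S. qs ! i)) * (g ^ 2 * (\<Prod>i\<in>T. qs ! i)) = (f * g) ^ 2 * ((\<Prod>i\<in>S. qs ! i) * (\<Prod>i\<in>T. qs ! i))"
        by (simp add: power_mult_distrib mult_ac)
      then show ?thesis unfolding prod_symdiff[OF fin] by (simp add: power_mult_distrib mult_ac)
    qed
    have "?h \<in> polys_in V"
    proof -
      have "(\<Prod>i\<in>S \<inter> T. qs ! i) \<in> polys_in V" using qs pcS(3) by (intro pol_prod) (auto simp: subset_eq)
      then show ?thesis
        using pol_mult[of V "total_degree (f * g)" "f * g" "total_degree (\<Prod>i\<in>S \<inter> T. qs ! i)" "\<Prod>i\<in>S \<inter> T. qs ! i"]
          pol_mult[of V "total_degree f" f "total_degree g" g] \<open>f \<in> _\<close> pcS(2) by (simp add: pol_def)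
    qed
    moreover have "?U \<subseteq> {..<length qs}" using \<open>S \<subseteq> _\<close> pcS(3) by auto
    moreover have "total_degree (?h ^ 2 * (\<Prod>i\<in>?U. qs ! i)) \<le> t + t'"
      unfolding e[symmetric] using \<open>total_degree (f\<^sup>2 * (\<Prod>i\<in>S. qs ! i)) \<le> t\<close> pcS(4) by (rule total_degree_mult)
    ultimately have "pc V qs (t + t') ((f ^ 2 * (\<Prod>i\<in>S. qs ! i)) * (g ^ 2 * (\<Prod>i\<in>T. qs ! i)))"
      unfolding e by (rule pc_gen)
    then show ?case using pcS.IH by (simp add: distrib_left pc_add)
  qed
  then show ?case using pcS by (simp add: distrib_right pc_add)
qed

lemma pc_gram:
  assumes "finite I" "psd I G" and p: "\<And>i. i \<in> I \<Longrightarrow> pol V D (p i)" and t: "2 * D \<le> t"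
  shows "pc V qs t (\<Sum>i\<in>I. \<Sum>j\<in>I. pconst (G i j) * (p i * p j))"
proof -
  obtain k L where L: "\<forall>i\<in>I. \<forall>j\<in>I. G i j = (\<Sum>r<(k::nat). L r i * L r j)"
    using psd_cholesky[OF assms(1,2)] by blast
  have "(\<Sum>i\<in>I. \<Sum>j\<in>I. pconst (G i j) * (p i * p j)) = (\<Sum>i\<in>I. \<Sum>j\<in>I. \<Sum>r<k. (pconst (L r i) * p i) * (pconst (L r j) * p j))"
    using L by (intro sum.cong refl) (simp add: pconst_sum pconst_hom sum_distrib_left sum_distrib_right mult_ac)
  also have "\<dots> = (\<Sum>i\<in>I. \<Sum>r<k. \<Sum>j\<in>I. (pconst (L r i) * p i) * (pconst (L r j) * p j))" by (intro sum.cong refl sum.swap)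
  also have "\<dots> = (\<Sum>r<k. \<Sum>i\<in>I. \<Sum>j\<in>I. (pconst (L r i) * p i) * (pconst (L r j) * p j))" by (rule sum.swap)
  also have "\<dots> = (\<Sum>r<k. (\<Sum>i\<in>I. pconst (L r i) * p i) ^ 2)" by (simp add: power2_eq_square sum_product)
  finally show ?thesis using t p by (auto intro!: pc_sum pc_square[of V D] pol_sum pol_cmult)
qed

lemma pc_gram_le:
  assumes fin: "finite I" and G: "psd I G" and c: "\<And>u. quad I G u \<le> c * sqn I u"
    and p: "\<And>i. i \<in> I \<Longrightarrow> pol V D (p i)" and t: "2 * D \<le> t"
  shows "pc V qs t (pconst c * (\<Sum>i\<in>I. (p i)\<^sup>2) - (\<Sum>i\<in>I. \<Sum>j\<in>I. pconst (G i j) * (p i * p j)))"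
proof -
  define H where "H = (\<lambda>i j. (if i = j then c else 0) - G i j)"
  have "quad I H u = c * sqn I u - quad I G u" for u
  proof -
    have "(\<Sum>j\<in>I. u i * H i j * u j) = c * (u i)\<^sup>2 - (\<Sum>j\<in>I. u i * G i j * u j)" if "i \<in> I" for i
    proof -
      have "(\<Sum>j\<in>I. u i * H i j * u j) = (\<Sum>j\<in>I. (if i = j then c * (u i)\<^sup>2 else 0) - u i * G i j * u j)"
        by (intro sum.cong) (auto simp: H_def power2_eq_square algebra_simps)
      then show ?thesis using that fin by (simp add: sum_subtractf)
    qed
    then show ?thesis by (simp add: quad_def sqn_def sum_subtractf sum_distrib_left)
  qed
  then have "psd I H" using G c unfolding psd_def by (auto simp: H_def)
  from pc_gram[OF fin this p t, where qs = qs]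
  have "pc V qs t (\<Sum>i\<in>I. \<Sum>j\<in>I. pconst (H i j) * (p i * p j))" .
  moreover have "(\<Sum>i\<in>I. \<Sum>j\<in>I. pconst (H i j) * (p i * p j)) = pconst c * (\<Sum>i\<in>I. (p i)\<^sup>2) - (\<Sum>i\<in>I. \<Sum>j\<in>I. pconst (G i j) * (p i * p j))"
  proof -
    have "(\<Sum>j\<in>I. pconst (H i j) * (p i * p j)) = pconst c * (p i)\<^sup>2 - (\<Sum>j\<in>I. pconst (G i j) * (p i * p j))" if "i \<in> I" for i
    proof -
      have "(\<Sum>j\<in>I. pconst (H i j) * (p i * p j)) = (\<Sum>j\<in>I. (if i = j then pconst c * (p i)\<^sup>2 else 0) - pconst (G i j) * (p i * p j))"
        by (intro sum.cong) (auto simp: H_def pconst_hom power2_eq_square algebra_simps)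
      then show ?thesis using that fin by (simp add: sum_subtractf)
    qed
    then show ?thesis by (simp add: sum_subtractf sum_distrib_left)
  qed
  ultimately show ?thesis by simp
qed

section \<open>The certificate of degree 4\<close>

text \<open>Inclusion-exclusion for the coincidences \<open>i = k\<close> and
  \<open>j = m\<close>.\<close>

lemma sum_quad_split:
  fixes F :: "'b \<Rightarrow> 'b \<Rightarrow> 'b \<Rightarrow> 'b \<Rightarrow> 'a::comm_ring_1"
  assumes fin: "finite S" "finite T"
  shows "(\<Sum>i\<in>S. \<Sum>k\<in>S. \<Sum>j\<in>T. \<Sum>m\<in>T. F i k j m)
    = (\<Sum>i\<in>S. \<Sum>j\<in>T. \<Sum>m\<in>T. F i i j m) + (\<Sum>j\<in>T. \<Sum>i\<in>S. \<Sum>k\<in>S. F i k j j)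
      - (\<Sum>i\<in>S. \<Sum>j\<in>T. F i i j j) + (\<Sum>i\<in>S. \<Sum>k\<in>S - {i}. \<Sum>j\<in>T. \<Sum>m\<in>T - {j}. F i k j m)"
proof -
  have a: "(\<Sum>k\<in>S. \<Sum>j\<in>T. \<Sum>m\<in>T. F i k j m) = (\<Sum>j\<in>T. \<Sum>m\<in>T. F i i j m)
      + ((\<Sum>k\<in>S. \<Sum>j\<in>T. F i k j j) - (\<Sum>j\<in>T. F i i j j)) + (\<Sum>k\<in>S - {i}. \<Sum>j\<in>T. \<Sum>m\<in>T - {j}. F i k j m)"
    if i: "i \<in> S" for i
  proof -
    have r: "(\<Sum>k\<in>S. f k) = f i + (\<Sum>k\<in>S - {i}. f k)" for f :: "'b \<Rightarrow> 'a"
      using fin(1) i by (rule sum.remove)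
    have "(\<Sum>j\<in>T. \<Sum>m\<in>T. F i k j m) = (\<Sum>j\<in>T. F i k j j) + (\<Sum>j\<in>T. \<Sum>m\<in>T - {j}. F i k j m)" for k
      unfolding sum.distrib[symmetric] using fin(2) by (intro sum.cong refl sum.remove)
    then have "(\<Sum>k\<in>S - {i}. \<Sum>j\<in>T. \<Sum>m\<in>T. F i k j m) = (\<Sum>k\<in>S - {i}. \<Sum>j\<in>T. F i k j j) + (\<Sum>k\<in>S - {i}. \<Sum>j\<in>T. \<Sum>m\<in>T - {j}. F i k j m)"
      by (simp add: sum.distrib)
    then show ?thesis using r[of "\<lambda>k. \<Sum>j\<in>T. \<Sum>m\<in>T. F i k j m"] r[of "\<lambda>k. \<Sum>j\<in>T. F i k j j"] by simp
  qed
  have b: "(\<Sum>i\<in>S. \<Sum>k\<in>S. \<Sum>j\<in>T. F i k j j) = (\<Sum>j\<in>T. \<Sum>i\<in>S. \<Sum>k\<in>S. F i k j j)"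
  proof -
    have "(\<Sum>i\<in>S. \<Sum>k\<in>S. \<Sum>j\<in>T. F i k j j) = (\<Sum>i\<in>S. \<Sum>j\<in>T. \<Sum>k\<in>S. F i k j j)" by (intro sum.cong refl sum.swap)
    also have "\<dots> = (\<Sum>j\<in>T. \<Sum>i\<in>S. \<Sum>k\<in>S. F i k j j)" by (rule sum.swap)
    finally show ?thesis .
  qed
  have "(\<Sum>i\<in>S. \<Sum>k\<in>S. \<Sum>j\<in>T. \<Sum>m\<in>T. F i k j m) = (\<Sum>i\<in>S. (\<Sum>j\<in>T. \<Sum>m\<in>T. F i i j m)
      + ((\<Sum>k\<in>S. \<Sum>j\<in>T. F i k j j) - (\<Sum>j\<in>T. F i i j j)) + (\<Sum>k\<in>S - {i}. \<Sum>j\<in>T. \<Sum>m\<in>T - {j}. F i k j m))"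
    by (intro sum.cong refl a)
  also have "\<dots> = (\<Sum>i\<in>S. \<Sum>j\<in>T. \<Sum>m\<in>T. F i i j m) + ((\<Sum>i\<in>S. \<Sum>k\<in>S. \<Sum>j\<in>T. F i k j j)
      - (\<Sum>i\<in>S. \<Sum>j\<in>T. F i i j j)) + (\<Sum>i\<in>S. \<Sum>k\<in>S - {i}. \<Sum>j\<in>T. \<Sum>m\<in>T - {j}. F i k j m)"
    by (simp only: sum.distrib sum_subtractf)
  finally show ?thesis unfolding b by simp
qed

text \<open>The doubly diagonal part \<open>v\<close> is subtracted in the split. Moved to the other
  side it becomes a nonnegative term, certified separately against 0.\<close>

lemma sum_quad_split_le:
  fixes N1 :: "'a::comm_ring_1"
  shows "N1 + N2 + N3 - (p + q - v + z) = N1 + N2 + v + N3 - (p + q + 0 + z)"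
  by simp

lemma sum_square_expand:
  fixes q :: "'i \<Rightarrow> rpoly"
  shows "(\<Sum>r\<in>R. (\<Sum>i\<in>I. pconst (c i r) * q i)\<^sup>2) = (\<Sum>i\<in>I. \<Sum>j\<in>I. pconst (\<Sum>r\<in>R. c i r * c j r) * (q i * q j))"
proof -
  have "(\<Sum>r\<in>R. (\<Sum>i\<in>I. pconst (c i r) * q i)\<^sup>2) = (\<Sum>r\<in>R. \<Sum>i\<in>I. \<Sum>j\<in>I. pconst (c i r * c j r) * (q i * q j))"
    by (simp add: power2_eq_square sum_product pconst_hom mult_ac)
  also have "\<dots> = (\<Sum>i\<in>I. \<Sum>r\<in>R. \<Sum>j\<in>I. pconst (c i r * c j r) * (q i * q j))" by (rule sum.swap)
  also have "\<dots> = (\<Sum>i\<in>I. \<Sum>j\<in>I. \<Sum>r\<in>R. pconst (c i r * c j r) * (q i * q j))" by (intro sum.cong refl sum.swap)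
  finally show ?thesis by (simp add: pconst_sum sum_distrib_right)
qed

section \<open>Proofs from the Boolean and cardinality constraints for an arbitrary fixed
  sample\<close>

locale cert = cov_model n d for n d +
  fixes \<eta> :: real and x :: "nat \<Rightarrow> nat \<Rightarrow> real"
  assumes \<eta>0: "0 \<le> \<eta>" and \<eta>1: "\<eta> \<le> 1"
begin

abbreviation "qs \<equiv> sparse_system n \<eta>"
abbreviation "Pr t P \<equiv> pc {..<n} qs t P"
abbreviation "s \<equiv> \<eta> * real n"

lemma s_nonneg: "0 \<le> s" using \<eta>0 by simp

lemma qs_pol: "q \<in> set qs \<Longrightarrow> pol {..<n} 2 q"
  by (auto simp: sparse_system_def eq_constraint_def le_constraint_def power2_eq_square
      intro!: pol_diff pol_mult2[of _ 1 _ 1] pol_var pol_sum)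

lemma qs_polys: "set qs \<subseteq> polys_in {..<n}"
  using qs_pol by (auto simp: pol_def)

lemmas Pr_mult0 = pc_mult[OF qs_polys]

lemma Pr_mult: "Pr t P \<Longrightarrow> Pr t' Q \<Longrightarrow> t + t' \<le> u \<Longrightarrow> Pr u (P * Q)"
  using Pr_mult0 pc_mono by blast

lemma Pr_scale: "0 \<le> c \<Longrightarrow> Pr t P \<Longrightarrow> Pr t (pconst c * P)"
  using Pr_mult0[OF pc_const[of c "{..<n}" qs 0], of t P] by simp

lemma Pr_le_trans: "Pr t (q - p) \<Longrightarrow> Pr t (r - q) \<Longrightarrow> Pr t (r - p)"
  using pc_add[of _ _ t "r - q" "q - p"] by simp

lemma Pr_le_sum: "(\<And>i. i \<in> I \<Longrightarrow> Pr t (g i - f i)) \<Longrightarrow> Pr t ((\<Sum>i\<in>I. g i) - (\<Sum>i\<in>I. f i))"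
  unfolding sum_subtractf[symmetric] by (rule pc_sum)

lemma Pr_le_add: "Pr t (g - f) \<Longrightarrow> Pr t (g' - f') \<Longrightarrow> Pr t ((g + g') - (f + f'))"
  using pc_add[of _ _ t "g - f" "g' - f'"] by (simp add: algebra_simps)

lemma Pr_le_scale: "0 \<le> c \<Longrightarrow> Pr t (g - f) \<Longrightarrow> Pr t (pconst c * g - pconst c * f)"
  using Pr_scale[of c t "g - f"] by (simp add: algebra_simps)

lemma Pr_bool: assumes "i < n" shows "Pr 2 ((pvar i)\<^sup>2 - pvar i)" "Pr 2 (pvar i - (pvar i)\<^sup>2)"
proof -
  have "(pvar i)\<^sup>2 - pvar i \<in> set qs" "pvar i - (pvar i)\<^sup>2 \<in> set qs"
    using assms by (auto simp: sparse_system_def eq_constraint_def)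
  then show "Pr 2 ((pvar i)\<^sup>2 - pvar i)" "Pr 2 (pvar i - (pvar i)\<^sup>2)"
    using qs_pol by (auto intro!: pc_axiom simp: pol_def)
qed

lemma Pr_budget: "Pr 2 (pconst s - (\<Sum>i<n. pvar i))"
proof -
  have "pconst s - (\<Sum>i<n. pvar i) \<in> set qs" by (auto simp: sparse_system_def le_constraint_def)
  then show ?thesis using qs_pol by (auto intro!: pc_axiom simp: pol_def)
qed

lemma Pr_sq: "pol {..<n} 1 f \<Longrightarrow> Pr 2 (f\<^sup>2)" "pol {..<n} 2 f \<Longrightarrow> Pr 4 (f\<^sup>2)"
  by (rule pc_square, assumption, simp)+

lemma pol_w: "i < n \<Longrightarrow> pol {..<n} 1 (pvar i)" "i < n \<Longrightarrow> j < n \<Longrightarrow> pol {..<n} 2 (pvar i * pvar j)"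
  by (auto intro!: pol_var pol_mult2[of _ 1 _ 1])

lemma Pr_w: "i < n \<Longrightarrow> Pr 2 (pvar i)"
  using pc_add[OF Pr_bool(2) Pr_sq(1)[OF pol_w(1)], of i i] by simp

lemma Pr_w2: "U \<subseteq> {..<n} \<Longrightarrow> Pr 2 (\<Sum>i\<in>U. (pvar i)\<^sup>2)"
  by (intro pc_sum Pr_sq(1) pol_w) auto

lemma Pr_sum_w2: assumes "U \<subseteq> {..<n}" shows "Pr 2 (pconst s - (\<Sum>i\<in>U. (pvar i)\<^sup>2))"
proof -
  have "Pr 2 ((\<Sum>i\<in>U. pvar i) - (\<Sum>i\<in>U. (pvar i)\<^sup>2))" using assms by (intro Pr_le_sum Pr_bool) auto
  moreover have "Pr 2 ((\<Sum>i<n. pvar i) - (\<Sum>i\<in>U. pvar i))"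
  proof -
    have "(\<Sum>i<n. pvar i) - (\<Sum>i\<in>U. pvar i) = (\<Sum>i\<in>{..<n} - U. pvar i)"
      using assms by (subst sum_diff) auto
    then show ?thesis by (auto intro!: pc_sum Pr_w)
  qed
  ultimately show ?thesis using Pr_budget Pr_le_trans by blast
qed

lemma Pr_prod_w2:
  assumes "U \<subseteq> {..<n}" "U' \<subseteq> {..<n}"
  shows "Pr 4 (pconst (s\<^sup>2) - (\<Sum>i\<in>U. \<Sum>j\<in>U'. (pvar i * pvar j)\<^sup>2))"
proof -
  let ?A = "\<Sum>i\<in>U. (pvar i)\<^sup>2" and ?B = "\<Sum>i\<in>U'. (pvar i)\<^sup>2"
  have "(\<Sum>i\<in>U. \<Sum>j\<in>U'. (pvar i * pvar j)\<^sup>2) = ?A * ?B"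
    by (simp add: sum_product power_mult_distrib)
  \<comment> \<open>Telescopes \<open>s^2 - A B\<close> into two products of certified
    factors.\<close>
  moreover have "Pr 4 ((pconst s - ?A) * ?B + pconst s * (pconst s - ?B))"
    by (rule pc_add[OF Pr_mult[OF Pr_sum_w2 Pr_w2] Pr_mult[OF pc_const[of _ _ _ 2] Pr_sum_w2]]) (use assms s_nonneg in auto)
  moreover have "(pconst s - ?A) * ?B + pconst s * (pconst s - ?B) = pconst (s\<^sup>2) - ?A * ?B"
    by (simp add: pconst_hom power2_eq_square algebra_simps)
  ultimately show ?thesis by simp
qed

definition YP :: "nat \<Rightarrow> nat \<Rightarrow> nat \<times> nat \<Rightarrow> real" where
  "YP i j r = (\<Sum>c<d. YY (x i) (fst r) c * YY (x j) c (snd r))"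

abbreviation "DD \<equiv> {..<d} \<times> {..<d}"

lemma sum_DD: "(\<Sum>r\<in>DD. f r) = (\<Sum>a<d. \<Sum>b<d. f (a, b))"
  by (simp add: sum.cartesian_product case_prod_unfold)

lemma YP_swap: "YP i j (a, b) = YP j i (b, a)"
  by (simp add: YP_def YY_sym[of _ a] YY_sym[of _ _ b] mult.commute)

lemma nu_bound: "(\<Sum>r\<in>DD. (\<Sum>j\<in>J - {i}. u j * YP i j r)\<^sup>2) \<le> nu J i x * (\<Sum>j\<in>J - {i}. (u j)\<^sup>2)"
proof -
  let ?J = "J - {i}"
  define Z where "Z = (\<lambda>a b. \<Sum>j\<in>?J. u j * YY (x j) a b)"
  define U where "U = (\<Sum>j\<in>?J. (u j)\<^sup>2)"
  define N where "N = (\<Sum>a<d. (x i a)\<^sup>2)"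
  have N0: "0 \<le> N" by (auto simp: N_def intro: sum_nonneg)
  have Zv: "(\<Sum>c<d. v c * Z c b) = (\<Sum>j\<in>?J. u j * Yv d (x j) v b)" for v b
  proof -
    have "(\<Sum>c<d. v c * Z c b) = (\<Sum>c<d. \<Sum>j\<in>?J. u j * (YY (x j) b c * v c))"
      by (simp add: Z_def sum_distrib_left YY_sym[of _ b] mult_ac)
    also have "\<dots> = (\<Sum>j\<in>?J. \<Sum>c<d. u j * (YY (x j) b c * v c))" by (rule sum.swap)
    finally show ?thesis by (simp add: Yv_def sum_distrib_left)
  qed
  \<comment> \<open>With the symmetric matrix \<open>Z\<close>, the sum of the
    \<open>u_j Y_j\<close>, this reads \<open>Y_i Z = x_i (Z x_i)^T - Z\<close>.\<close>
  have e: "(\<Sum>j\<in>?J. u j * YP i j (a, b)) = x i a * (\<Sum>c<d. x i c * Z c b) - Z a b" if "a < d" for a b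
  proof -
    have "(\<Sum>j\<in>?J. u j * YP i j (a, b)) = (\<Sum>j\<in>?J. \<Sum>c<d. YY (x i) a c * (u j * YY (x j) c b))"
      by (simp add: YP_def sum_distrib_left mult_ac)
    also have "\<dots> = (\<Sum>c<d. YY (x i) a c * Z c b)"
      by (subst sum.swap) (simp add: Z_def sum_distrib_left)
    also have "\<dots> = Yv d (x i) (\<lambda>c. Z c b) a" by (simp add: Yv_def)
    finally show ?thesis using Yv_eq[OF that] by simp
  qed
  have "(\<Sum>r\<in>DD. (\<Sum>j\<in>?J. u j * YP i j r)\<^sup>2) = (\<Sum>r\<in>DD. (x i (fst r) * (\<Sum>c<d. x i c * Z c (snd r)) - Z (fst r) (snd r))\<^sup>2)"
    using e by (intro sum.cong) auto
  also have "\<dots> \<le> 2 * (\<Sum>r\<in>DD. (x i (fst r) * (\<Sum>c<d. x i c * Z c (snd r)))\<^sup>2) + 2 * (\<Sum>r\<in>DD. (Z (fst r) (snd r))\<^sup>2)"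
    by (rule sum_square_diff_le)
  also have "(\<Sum>r\<in>DD. (x i (fst r) * (\<Sum>c<d. x i c * Z c (snd r)))\<^sup>2) = N * (\<Sum>b<d. (\<Sum>j\<in>?J. u j * Yv d (x j) (x i) b)\<^sup>2)"
    by (simp only: sum_DD fst_conv snd_conv power_mult_distrib N_def sum_product Zv)
  also have "(\<Sum>r\<in>DD. (Z (fst r) (snd r))\<^sup>2) = (\<Sum>b<d. \<Sum>a<d. (\<Sum>j\<in>?J. u j * Yv d (x j) (ek b) a)\<^sup>2)"
    unfolding sum_DD by (subst sum.swap) (auto simp: Z_def Yv_ek intro!: sum.cong)
  also have "2 * (N * (\<Sum>b<d. (\<Sum>j\<in>?J. u j * Yv d (x j) (x i) b)\<^sup>2)) + 2 * (\<Sum>b<d. \<Sum>a<d. (\<Sum>j\<in>?J. u j * Yv d (x j) (ek b) a)\<^sup>2)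
    \<le> 2 * (N * (phi d ?J (x i) x * U)) + 2 * (\<Sum>b<d. phi d ?J (ek b) x * U)"
    unfolding U_def using N0 by (intro add_mono mult_left_mono sum_mono phi_dual) auto
  also have "\<dots> = nu J i x * U" by (simp add: nu_def N_def sum_distrib_left algebra_simps)
  finally show ?thesis by (simp add: U_def)
qed

lemma nu_bound': "(\<Sum>r\<in>DD. (\<Sum>j\<in>J - {i}. u j * YP j i r)\<^sup>2) \<le> nu J i x * (\<Sum>j\<in>J - {i}. (u j)\<^sup>2)"
proof -
  have "(\<Sum>r\<in>DD. (\<Sum>j\<in>J - {i}. u j * YP j i r)\<^sup>2) = (\<Sum>r\<in>DD. (\<Sum>j\<in>J - {i}. u j * YP i j r)\<^sup>2)"
    unfolding sum_DD by (subst sum.swap) (simp add: YP_swap[of i])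
  then show ?thesis using nu_bound by simp
qed

lemma nuM_ge: "i < n \<Longrightarrow> nu J i x \<le> nuM J x"
  unfolding nuM_def by (intro Max_ge) auto

lemma nu_nonneg: "0 \<le> nu J i x"
  unfolding nu_def by (intro add_nonneg_nonneg mult_nonneg_nonneg sum_nonneg phi_nonneg) auto

lemma nuM_nonneg: "0 \<le> nuM J x"
  using nuM_ge[of 0 J] nu_nonneg[of J 0] n1 by linarith

text \<open>The part of the decoupled sum in which one of the two factors of the product is repeated.\<close>

lemma Pr_diag:
  assumes U: "U \<subseteq> {..<n}" "J \<subseteq> {..<n}" "U \<inter> J = {}"
    and c: "\<And>i u. i \<in> U \<Longrightarrow> (\<Sum>r\<in>DD. (\<Sum>j\<in>J - {i}. u j * c i j r)\<^sup>2) \<le> nu J i x * (\<Sum>j\<in>J - {i}. (u j)\<^sup>2)"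
  shows "Pr 4 (pconst (nuM J x * s\<^sup>2) - (\<Sum>i\<in>U. \<Sum>j\<in>J. \<Sum>m\<in>J. pconst (\<Sum>r\<in>DD. c i j r * c i m r) * ((pvar i * pvar j) * (pvar i * pvar m))))"
proof -
  have fJ: "finite J" using finite_subset[OF U(2)] by simp
  have "Pr 4 (pconst (nuM J x) * (\<Sum>j\<in>J. (pvar i * pvar j)\<^sup>2) - (\<Sum>j\<in>J. \<Sum>m\<in>J. pconst (\<Sum>r\<in>DD. c i j r * c i m r) * ((pvar i * pvar j) * (pvar i * pvar m))))"
    if i: "i \<in> U" for i
  proof (rule pc_gram_le[OF fJ, where D = 2])
    have Ji: "J - {i} = J" using i U by auto
    show "psd J (\<lambda>j m. \<Sum>r\<in>DD. c i j r * c i m r)" by (rule psd_gram[where R = DD and L = "\<lambda>r j. c i j r"]) simp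
    have in': "i < n" using i U by auto
    show "quad J (\<lambda>j m. \<Sum>r\<in>DD. c i j r * c i m r) u \<le> nuM J x * sqn J u" for u
    proof -
      have "quad J (\<lambda>j m. \<Sum>r\<in>DD. c i j r * c i m r) u \<le> nu J i x * sqn J u"
        using c[OF i, of u] quad_gram1[of J "\<lambda>r j. c i j r" DD u] unfolding Ji by (simp add: sqn_def)
      also have "\<dots> \<le> nuM J x * sqn J u"
        using in' by (intro mult_right_mono nuM_ge) (auto simp: sqn_def sum_nonneg)
      finally show ?thesis .
    qed
  qed (use i U in \<open>auto intro!: pol_w\<close>)
  then have "Pr 4 ((\<Sum>i\<in>U. pconst (nuM J x) * (\<Sum>j\<in>J. (pvar i * pvar j)\<^sup>2)) - (\<Sum>i\<in>U. \<Sum>j\<in>J. \<Sum>m\<in>J. pconst (\<Sum>r\<in>DD. c i j r * c i m r) * ((pvar i * pvar j) * (pvar i * pvar m))))"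
    by (rule Pr_le_sum)
  moreover have "Pr 4 (pconst (nuM J x * s\<^sup>2) - (\<Sum>i\<in>U. pconst (nuM J x) * (\<Sum>j\<in>J. (pvar i * pvar j)\<^sup>2)))"
    unfolding pconst_hom(2) sum_distrib_left[symmetric] by (intro Pr_le_scale nuM_nonneg Pr_prod_w2 U)
  ultimately show ?thesis using Pr_le_trans by blast
qed

text \<open>The inner product of \<open>Y_i Y_j\<close> and \<open>Y_k Y_m\<close> is
  \<open>tr (Y_i Y_j Y_m Y_k)\<close>, in which \<open>i, m\<close> and \<open>j, k\<close> are the
  pairs of opposite factors.\<close>

lemma Tt_YP: "(\<Sum>r\<in>DD. YP i j r * YP k m r) = Tt d (x i) x m (j, k)"
proof -
  have "(\<Sum>r\<in>DD. YP i j r * YP k m r) = (\<Sum>a<d. \<Sum>b<d. \<Sum>c<d. \<Sum>e<d. YY (x i) a c * YY (x j) c b * (YY (x k) a e * YY (x m) e b))"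
    by (simp add: sum_DD YP_def sum_product)
  also have "\<dots> = (\<Sum>a<d. \<Sum>c<d. \<Sum>b<d. \<Sum>e<d. YY (x i) a c * YY (x j) c b * (YY (x k) a e * YY (x m) e b))"
    by (intro sum.cong refl sum.swap)
  also have "\<dots> = (\<Sum>c<d. \<Sum>a<d. \<Sum>b<d. \<Sum>e<d. YY (x i) a c * YY (x j) c b * (YY (x k) a e * YY (x m) e b))"
    by (rule sum.swap)
  also have "\<dots> = (\<Sum>c<d. \<Sum>a<d. \<Sum>b<d. \<Sum>e<d. YY (x i) c a * (YY (x j) c b * YY (x m) b e * YY (x k) e a))"
    by (intro sum.cong refl) (simp add: YY_sym mult_ac)
  also have "\<dots> = Tt d (x i) x m (j, k)"
    by (simp add: Tt_def Phi_def sum_distrib_left mult_ac)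
  finally show ?thesis .
qed

text \<open>With rows \<open>(i, m)\<close> and columns \<open>(j, k)\<close> this is the bilinear
  form of the flattening behind \<open>GA\<close>. It is split by
  \<open>2 q L <= \<alpha> q^2 + L^2 / \<alpha>\<close>, where the sum of the \<open>L^2\<close> is
  at most \<open>\<alpha>^2\<close> times that of the \<open>q^2\<close> because
  \<open>\<alpha>\<close> is at least the root of \<open>GA\<close>.\<close>

lemma Pr_alpha:
  assumes A: "A \<subseteq> {..<n}" "B \<subseteq> {..<n}" "C \<subseteq> {..<n}" "E \<subseteq> {..<n}"
  shows "Pr 4 (pconst (s\<^sup>2 * alpha A B C E x) - (\<Sum>i\<in>A. \<Sum>k\<in>E. \<Sum>j\<in>B. \<Sum>m\<in>C. pconst (\<Sum>r\<in>DD. YP i j r * YP k m r) * ((pvar i * pvar m) * (pvar j * pvar k))))"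
proof -
  define \<alpha> where "\<alpha> = alpha A B C E x"
  let ?P = "B \<times> E" and ?R = "A \<times> C"
  define \<tau> where "\<tau> = (\<lambda>r p. Tt d (x (fst r)) x (snd r) p)"
  define q where "q = (\<lambda>r::nat \<times> nat. pvar (fst r) * pvar (snd r))"
  define L where "L = (\<lambda>r. \<Sum>p\<in>?P. pconst (\<tau> r p) * q p)"
  have fin: "finite A" "finite B" "finite C" "finite E" using A by (auto intro: finite_subset)
  let ?G = "\<lambda>p p'. \<Sum>a\<in>A. \<Sum>c\<in>C. Tt d (x a) x c p * Tt d (x a) x c p'"
  have psd: "psd ?P ?G" by (rule psd_sum_gram)
  have G0: "0 \<le> GA d A B C E x" unfolding GA_def by (intro nrm_nonneg psd) (use fin in auto)
  have n0: "0 < real n * (real d)\<^sup>2" using real_bounds by simp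
  have \<alpha>0: "0 < \<alpha>" unfolding \<alpha>_def alpha_def using n0 G0 by (intro add_nonneg_pos) auto
  have "sqrt (GA d A B C E x) \<le> \<alpha>" unfolding \<alpha>_def alpha_def using n0 by simp
  then have G\<alpha>: "GA d A B C E x \<le> \<alpha>\<^sup>2" using \<alpha>0 real_sqrt_le_iff[of "GA d A B C E x" "\<alpha>\<^sup>2"] by simp
  have qpol: "pol {..<n} 2 (q p)" if "p \<in> ?P \<or> p \<in> ?R" for p
    using that A by (auto simp: q_def intro!: pol_w)
  have gram: "Pr 4 (pconst (\<alpha>\<^sup>2) * (\<Sum>p\<in>?P. (q p)\<^sup>2) - (\<Sum>p\<in>?P. \<Sum>p'\<in>?P. pconst (?G p p') * (q p * q p')))"
  proof (rule pc_gram_le[OF _ psd, where D = 2])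
    fix u show "quad ?P ?G u \<le> \<alpha>\<^sup>2 * sqn ?P u"
    proof -
      have "quad ?P ?G u \<le> GA d A B C E x * sqn ?P u" unfolding GA_def by (intro quad_le_nrm psd) (use fin in auto)
      also have "\<dots> \<le> \<alpha>\<^sup>2 * sqn ?P u" by (intro mult_right_mono G\<alpha>) (auto simp: sqn_def sum_nonneg)
      finally show ?thesis .
    qed
  qed (use fin qpol in auto)
  have L2: "(\<Sum>p\<in>?P. \<Sum>p'\<in>?P. pconst (?G p p') * (q p * q p')) = (\<Sum>r\<in>?R. (L r)\<^sup>2)"
  proof -
    have "?G p p' = (\<Sum>r\<in>?R. \<tau> r p * \<tau> r p')" for p p' by (simp add: \<tau>_def sum.cartesian_product case_prod_unfold)
    then show ?thesis unfolding L_def using sum_square_expand[of "\<lambda>p r. \<tau> r p" q ?P ?R] by simp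
  qed
  have "Pr 4 (pconst (1 / \<alpha>) * (pconst (\<alpha>\<^sup>2) * (\<Sum>p\<in>?P. (q p)\<^sup>2) - (\<Sum>r\<in>?R. (L r)\<^sup>2)) + (\<Sum>r\<in>?R. pconst (1 / \<alpha>) * (pconst \<alpha> * q r - L r)\<^sup>2))"
    using \<alpha>0 gram[unfolded L2]
    by (intro pc_add pc_sum Pr_scale Pr_sq) (auto simp: L_def intro!: pol_diff pol_cmult pol_sum qpol)
  also have "pconst (1 / \<alpha>) * (pconst (\<alpha>\<^sup>2) * (\<Sum>p\<in>?P. (q p)\<^sup>2) - (\<Sum>r\<in>?R. (L r)\<^sup>2)) + (\<Sum>r\<in>?R. pconst (1 / \<alpha>) * (pconst \<alpha> * q r - L r)\<^sup>2)
      = pconst \<alpha> * (\<Sum>p\<in>?P. (q p)\<^sup>2) + pconst \<alpha> * (\<Sum>r\<in>?R. (q r)\<^sup>2) - 2 * (\<Sum>r\<in>?R. q r * L r)"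
  proof -
    have k: "pconst (1 / \<alpha>) * (pconst \<alpha> * z) = z" for z
      using \<alpha>0 by (simp add: mult.assoc[symmetric] pconst_hom(2)[symmetric] pconst_hom(4))
    have "pconst (1 / \<alpha>) * (pconst \<alpha> * q r - L r)\<^sup>2 = pconst \<alpha> * (q r)\<^sup>2 - 2 * (q r * L r) + pconst (1 / \<alpha>) * (L r)\<^sup>2" for r
    proof -
      have "pconst (1 / \<alpha>) * (pconst \<alpha> * q r - L r)\<^sup>2 = pconst (1 / \<alpha>) * (pconst \<alpha> * (pconst \<alpha> * (q r)\<^sup>2)) - 2 * (pconst (1 / \<alpha>) * (pconst \<alpha> * (q r * L r))) + pconst (1 / \<alpha>) * (L r)\<^sup>2"
        by (simp add: power2_eq_square algebra_simps)
      then show ?thesis by (simp only: k)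
    qed
    moreover have "pconst (1 / \<alpha>) * (pconst (\<alpha>\<^sup>2) * z - y) = pconst \<alpha> * z - pconst (1 / \<alpha>) * y" for z y
      by (simp add: power2_eq_square pconst_hom(2) right_diff_distrib mult.assoc k)
    ultimately show ?thesis
      by (simp add: sum.distrib sum_subtractf sum_distrib_left[symmetric])
  qed
  finally have a: "Pr 4 (pconst \<alpha> * (\<Sum>p\<in>?P. (q p)\<^sup>2) + pconst \<alpha> * (\<Sum>r\<in>?R. (q r)\<^sup>2) - 2 * (\<Sum>r\<in>?R. q r * L r))" .
  have qq: "(\<Sum>r\<in>U \<times> U'. (q r)\<^sup>2) = (\<Sum>i\<in>U. \<Sum>j\<in>U'. (pvar i * pvar j)\<^sup>2)" for U U'
    by (simp add: q_def sum.cartesian_product case_prod_unfold)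
  have "Pr 4 ((pconst \<alpha> * pconst (s\<^sup>2) + pconst \<alpha> * pconst (s\<^sup>2)) - (pconst \<alpha> * (\<Sum>p\<in>?P. (q p)\<^sup>2) + pconst \<alpha> * (\<Sum>r\<in>?R. (q r)\<^sup>2)))"
    unfolding qq using \<alpha>0 A by (intro Pr_le_add Pr_le_scale Pr_prod_w2) auto
  from Pr_le_trans[OF a this]
  have "Pr 4 (pconst (1 / 2) * ((pconst \<alpha> * pconst (s\<^sup>2) + pconst \<alpha> * pconst (s\<^sup>2)) - 2 * (\<Sum>r\<in>?R. q r * L r)))"
    by (rule Pr_scale[rotated]) simp
  also have "pconst (1 / 2) * ((pconst \<alpha> * pconst (s\<^sup>2) + pconst \<alpha> * pconst (s\<^sup>2)) - 2 * (\<Sum>r\<in>?R. q r * L r)) = pconst (s\<^sup>2 * \<alpha>) - (\<Sum>r\<in>?R. q r * L r)"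
  proof -
    have "pconst (1 / 2) * (2 * z) = z" for z
      using pconst_numeral[of "num.Bit0 num.One"] by (simp add: mult.assoc[symmetric] pconst_hom(2,4)[symmetric] flip: pconst_numeral)
    from this[of "pconst \<alpha> * pconst (s\<^sup>2) - (\<Sum>r\<in>?R. q r * L r)"] show ?thesis
      by (simp add: pconst_hom(2) algebra_simps)
  qed
  also have "(\<Sum>r\<in>?R. q r * L r) = (\<Sum>i\<in>A. \<Sum>m\<in>C. \<Sum>j\<in>B. \<Sum>k\<in>E. pconst (\<Sum>r\<in>DD. YP i j r * YP k m r) * ((pvar i * pvar m) * (pvar j * pvar k)))"
  proof -
    have e: "(\<Sum>r\<in>U \<times> U'. f r) = (\<Sum>i\<in>U. \<Sum>j\<in>U'. f (i, j))" for U U' and f :: "nat \<times> nat \<Rightarrow> rpoly"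
      by (simp add: sum.cartesian_product case_prod_unfold)
    show ?thesis
      unfolding L_def q_def \<tau>_def Tt_YP e fst_conv snd_conv sum_distrib_left
      by (intro sum.cong refl) (simp only: mult_ac)
  qed
  also have "\<dots> = (\<Sum>i\<in>A. \<Sum>k\<in>E. \<Sum>j\<in>B. \<Sum>m\<in>C. pconst (\<Sum>r\<in>DD. YP i j r * YP k m r) * ((pvar i * pvar m) * (pvar j * pvar k)))"
  proof (rule sum.cong[OF refl])
    fix i
    have "(\<Sum>m\<in>C. \<Sum>j\<in>B. \<Sum>k\<in>E. f m j k) = (\<Sum>k\<in>E. \<Sum>j\<in>B. \<Sum>m\<in>C. f m j k)" for f :: "nat \<Rightarrow> nat \<Rightarrow> nat \<Rightarrow> rpoly"
    proof -
      have "(\<Sum>m\<in>C. \<Sum>j\<in>B. \<Sum>k\<in>E. f m j k) = (\<Sum>m\<in>C. \<Sum>k\<in>E. \<Sum>j\<in>B. f m j k)" by (intro sum.cong refl sum.swap)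
      also have "\<dots> = (\<Sum>k\<in>E. \<Sum>m\<in>C. \<Sum>j\<in>B. f m j k)" by (rule sum.swap)
      also have "\<dots> = (\<Sum>k\<in>E. \<Sum>j\<in>B. \<Sum>m\<in>C. f m j k)" by (intro sum.cong refl sum.swap)
      finally show ?thesis .
    qed
    then show "(\<Sum>m\<in>C. \<Sum>j\<in>B. \<Sum>k\<in>E. pconst (\<Sum>r\<in>DD. YP i j r * YP k m r) * ((pvar i * pvar m) * (pvar j * pvar k))) = (\<Sum>k\<in>E. \<Sum>j\<in>B. \<Sum>m\<in>C. pconst (\<Sum>r\<in>DD. YP i j r * YP k m r) * ((pvar i * pvar m) * (pvar j * pvar k)))" .
  qed
  finally show ?thesis unfolding \<alpha>_def .
qed

section \<open>The off-diagonal part of the certificate\<close>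

definition Wk :: "nat set \<Rightarrow> nat \<times> nat \<Rightarrow> rpoly" where
  "Wk \<kappa> r = (\<Sum>i\<in>\<kappa>. \<Sum>j\<in>{..<n} - \<kappa>. pconst (YP i j r) * (pvar i * pvar j))"

lemma Wk_pol: "\<kappa> \<subseteq> {..<n} \<Longrightarrow> pol {..<n} 2 (Wk \<kappa> r)"
  unfolding Wk_def by (intro pol_sum pol_cmult pol_w) auto

lemma Wk_square_sum:
  assumes "\<kappa> \<subseteq> {..<n}"
  shows "(\<Sum>r\<in>DD. (Wk \<kappa> r)\<^sup>2) = (\<Sum>i\<in>\<kappa>. \<Sum>k\<in>\<kappa>. \<Sum>j\<in>{..<n} - \<kappa>. \<Sum>m\<in>{..<n} - \<kappa>.
    pconst (\<Sum>r\<in>DD. YP i j r * YP k m r) * ((pvar i * pvar j) * (pvar k * pvar m)))"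
proof -
  let ?P = "\<kappa> \<times> ({..<n} - \<kappa>)"
  define c where "c = (\<lambda>p r. YP (fst p) (snd p) r)"
  define q :: "nat \<times> nat \<Rightarrow> rpoly" where "q = (\<lambda>p. pvar (fst p) * pvar (snd p))"
  have W: "Wk \<kappa> r = (\<Sum>p\<in>?P. pconst (c p r) * q p)" for r
    by (simp add: Wk_def c_def q_def sum.cartesian_product case_prod_unfold)
  have e: "(\<Sum>p\<in>?P. f p) = (\<Sum>i\<in>\<kappa>. \<Sum>j\<in>{..<n} - \<kappa>. f (i, j))" for f :: "nat \<times> nat \<Rightarrow> rpoly"
    by (simp add: sum.cartesian_product case_prod_unfold)
  have "(\<Sum>r\<in>DD. (Wk \<kappa> r)\<^sup>2) = (\<Sum>p\<in>?P. \<Sum>p'\<in>?P. pconst (\<Sum>r\<in>DD. c p r * c p' r) * (q p * q p'))"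
    unfolding W by (rule sum_square_expand)
  also have "\<dots> = (\<Sum>i\<in>\<kappa>. \<Sum>j\<in>{..<n} - \<kappa>. \<Sum>k\<in>\<kappa>. \<Sum>m\<in>{..<n} - \<kappa>.
    pconst (\<Sum>r\<in>DD. YP i j r * YP k m r) * ((pvar i * pvar j) * (pvar k * pvar m)))"
    by (simp only: e c_def q_def fst_conv snd_conv)
  also have "\<dots> = (\<Sum>i\<in>\<kappa>. \<Sum>k\<in>\<kappa>. \<Sum>j\<in>{..<n} - \<kappa>. \<Sum>m\<in>{..<n} - \<kappa>.
    pconst (\<Sum>r\<in>DD. YP i j r * YP k m r) * ((pvar i * pvar j) * (pvar k * pvar m)))"
    by (intro sum.cong refl sum.swap)
  finally show ?thesis .
qed

lemma Wk_bound:
  assumes \<kappa>: "\<kappa> \<subseteq> {..<n}"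
  shows "Pr 4 (pconst (s\<^sup>2 * fsplit x \<kappa>) - (\<Sum>r\<in>DD. (Wk \<kappa> r)\<^sup>2))"
proof -
  let ?T = "{..<n} - \<kappa>"
  define F where "F = (\<lambda>i k j m. pconst (\<Sum>r\<in>DD. YP i j r * YP k m r) * ((pvar i * pvar j) * (pvar k * pvar m)))"
  have fin: "finite \<kappa>" "finite ?T" using \<kappa> by (auto intro: finite_subset)
  have T: "?T \<subseteq> {..<n}" "\<kappa> \<inter> ?T = {}" "?T \<inter> \<kappa> = {}" by auto
  have b1: "Pr 4 (pconst (nuM ?T x * s\<^sup>2) - (\<Sum>i\<in>\<kappa>. \<Sum>j\<in>?T. \<Sum>m\<in>?T. F i i j m))"
    unfolding F_def by (rule Pr_diag[OF \<kappa> T(1,2), where c = YP]) (rule nu_bound)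
  have b2: "Pr 4 (pconst (nuM \<kappa> x * s\<^sup>2) - (\<Sum>j\<in>?T. \<Sum>i\<in>\<kappa>. \<Sum>k\<in>\<kappa>. F i k j j))"
  proof -
    have e: "F i k j j = pconst (\<Sum>r\<in>DD. YP i j r * YP k j r) * ((pvar j * pvar i) * (pvar j * pvar k))" for i k j
      by (simp only: F_def mult_ac)
    show ?thesis unfolding e by (rule Pr_diag[OF T(1) \<kappa> T(3), where c = "\<lambda>j i. YP i j"]) (rule nu_bound')
  qed
  have b3: "Pr 4 ((\<Sum>i\<in>\<kappa>. \<Sum>j\<in>?T. F i i j j) - 0)"
  proof -
    have "Pr 4 (pconst (\<Sum>r\<in>DD. YP i j r * YP i j r) * (pvar i * pvar j)\<^sup>2)" if "i \<in> \<kappa>" "j \<in> ?T" for i j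
      using that \<kappa> by (intro Pr_scale Pr_sq pol_w sum_nonneg) auto
    then show ?thesis by (auto simp: F_def power2_eq_square intro!: pc_sum)
  qed
  define al where "al = (\<lambda>l. alphaA x \<kappa> l)"
  \<comment> \<open>A second average, over \<open>l\<close>, separates \<open>i\<close> from
    \<open>k\<close> and \<open>j\<close> from \<open>m\<close>, so that the four groups are
    disjoint; \<open>decouple4\<close> supplies the 16.\<close>
  have b4: "Pr 4 (pconst (s\<^sup>2 * (16 * (\<Sum>l\<in>Pow {..<n}. 1 / 2 ^ n * al l))) - (\<Sum>i\<in>\<kappa>. \<Sum>k\<in>\<kappa> - {i}. \<Sum>j\<in>?T. \<Sum>m\<in>?T - {j}. F i k j m))"
  proof -
    define Z where "Z = (\<lambda>l. \<Sum>i\<in>\<kappa> \<inter> l. \<Sum>k\<in>\<kappa> - l. \<Sum>j\<in>?T \<inter> l. \<Sum>m\<in>?T - l. F i k j m)"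
    have "Pr 4 (pconst (s\<^sup>2 * al l) - Z l)" for l
    proof -
      have FZ: "F i k j m = pconst (\<Sum>r\<in>DD. YP i j r * YP k m r) * ((pvar i * pvar m) * (pvar j * pvar k))" for i k j m
        by (simp add: F_def mult_ac)
      show ?thesis unfolding Z_def al_def alphaA_def FZ by (rule Pr_alpha) (use \<kappa> in auto)
    qed
    then have "Pr 4 ((\<Sum>l\<in>Pow {..<n}. pconst (16 / 2 ^ n) * pconst (s\<^sup>2 * al l)) - (\<Sum>l\<in>Pow {..<n}. pconst (16 / 2 ^ n) * Z l))"
      by (intro Pr_le_sum Pr_le_scale) auto
    moreover have "(\<Sum>l\<in>Pow {..<n}. pconst (16 / 2 ^ n) * Z l) = (\<Sum>i\<in>\<kappa>. \<Sum>k\<in>\<kappa> - {i}. \<Sum>j\<in>?T. \<Sum>m\<in>?T - {j}. F i k j m)"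
    proof -
      have "16 * (\<Sum>l\<in>Pow {..<n}. Z l) = 2 ^ n * (\<Sum>i\<in>\<kappa>. \<Sum>k\<in>\<kappa> - {i}. \<Sum>j\<in>?T. \<Sum>m\<in>?T - {j}. F i k j m)"
        using decouple4[OF _ \<kappa> T(1,2), of F] by (simp add: Z_def)
      then have "pconst (1 / 2 ^ n) * (pconst 16 * (\<Sum>l\<in>Pow {..<n}. Z l)) = pconst (1 / 2 ^ n) * (pconst (2 ^ n) * (\<Sum>i\<in>\<kappa>. \<Sum>k\<in>\<kappa> - {i}. \<Sum>j\<in>?T. \<Sum>m\<in>?T - {j}. F i k j m))"
        by (simp add: pconst_numeral pconst_hom)
      then show ?thesis
        by (simp add: mult.assoc[symmetric] pconst_hom(2)[symmetric] pconst_hom(4) sum_distrib_left)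
    qed
    moreover have "(\<Sum>l\<in>Pow {..<n}. pconst (16 / 2 ^ n) * pconst (s\<^sup>2 * al l)) = pconst (s\<^sup>2 * (16 * (\<Sum>l\<in>Pow {..<n}. 1 / 2 ^ n * al l)))"
      unfolding pconst_hom(2)[symmetric] pconst_sum[symmetric]
      by (rule arg_cong[where f = pconst]) (simp add: sum_distrib_left mult_ac)
    ultimately show ?thesis by simp
  qed
  have w: "(\<Sum>r\<in>DD. (Wk \<kappa> r)\<^sup>2) = ((\<Sum>i\<in>\<kappa>. \<Sum>j\<in>?T. \<Sum>m\<in>?T. F i i j m) + (\<Sum>j\<in>?T. \<Sum>i\<in>\<kappa>. \<Sum>k\<in>\<kappa>. F i k j j))
      - (\<Sum>i\<in>\<kappa>. \<Sum>j\<in>?T. F i i j j) + (\<Sum>i\<in>\<kappa>. \<Sum>k\<in>\<kappa> - {i}. \<Sum>j\<in>?T. \<Sum>m\<in>?T - {j}. F i k j m)"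
    using sum_quad_split[OF fin, of F] unfolding Wk_square_sum[OF \<kappa>] by (simp only: F_def)
  have P: "Pr 4 (pconst (nuM ?T x * s\<^sup>2) + pconst (nuM \<kappa> x * s\<^sup>2) + (\<Sum>i\<in>\<kappa>. \<Sum>j\<in>?T. F i i j j) + pconst (s\<^sup>2 * (16 * (\<Sum>l\<in>Pow {..<n}. 1 / 2 ^ n * al l)))
     - ((\<Sum>i\<in>\<kappa>. \<Sum>j\<in>?T. \<Sum>m\<in>?T. F i i j m) + (\<Sum>j\<in>?T. \<Sum>i\<in>\<kappa>. \<Sum>k\<in>\<kappa>. F i k j j) + 0 + (\<Sum>i\<in>\<kappa>. \<Sum>k\<in>\<kappa> - {i}. \<Sum>j\<in>?T. \<Sum>m\<in>?T - {j}. F i k j m)))"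
    by (intro Pr_le_add b1 b2 b3 b4)
  have f: "pconst (s\<^sup>2 * fsplit x \<kappa>) = pconst (nuM ?T x * s\<^sup>2) + pconst (nuM \<kappa> x * s\<^sup>2) + pconst (s\<^sup>2 * (16 * (\<Sum>l\<in>Pow {..<n}. 1 / 2 ^ n * al l)))"
    unfolding pconst_hom(1)[symmetric] fsplit_def al_def by (rule arg_cong[where f = pconst]) (simp add: algebra_simps)
  show ?thesis unfolding f w sum_quad_split_le by (rule P)
qed

definition Qp :: "nat \<times> nat \<Rightarrow> rpoly" where
  "Qp r = (\<Sum>i<n. \<Sum>j\<in>{..<n} - {i}. pconst (YP i j r) * (pvar i * pvar j))"

text \<open>\<open>Qp\<close> is four times the average of the \<open>Wk\<close>. The average of the
  squares exceeds the square of the average by the averaged squares of the deviations, which are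
  certified; \<open>16 = 4^2\<close>.\<close>

lemma Qp_bound: "Pr 4 (pconst (16 * s\<^sup>2 * (\<Sum>\<kappa>\<in>Pow {..<n}. 1 / 2 ^ n * fsplit x \<kappa>)) - (\<Sum>r\<in>DD. (Qp r)\<^sup>2))"
proof -
  let ?c = "pconst (1 / 2 ^ n)"
  define m where "m = (\<lambda>r. \<Sum>\<kappa>\<in>Pow {..<n}. ?c * Wk \<kappa> r)"
  have c1: "(\<Sum>\<kappa>\<in>Pow {..<n}. ?c) = 1"
    unfolding pconst_sum[symmetric] by (simp add: card_Pow pconst_hom(4))
  have Qm: "Qp r = 4 * m r" for r
  proof -
    have "4 * (\<Sum>\<kappa>\<in>Pow {..<n}. Wk \<kappa> r) = 2 ^ n * Qp r"
      using decouple2[of "{..<n}" "\<lambda>i j. pconst (YP i j r) * (pvar i * pvar j)"] by (simp add: Wk_def Qp_def)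
    then have "?c * (4 * (\<Sum>\<kappa>\<in>Pow {..<n}. Wk \<kappa> r)) = ?c * (pconst (2 ^ n) * Qp r)"
      by (simp add: pconst_numeral pconst_hom)
    moreover have "?c * (pconst (2 ^ n) * Qp r) = Qp r"
      by (simp add: mult.assoc[symmetric] pconst_hom(2)[symmetric] pconst_hom(4))
    moreover have "4 * m r = ?c * (4 * (\<Sum>\<kappa>\<in>Pow {..<n}. Wk \<kappa> r))"
      unfolding m_def sum_distrib_left[symmetric] by (simp only: mult_ac)
    ultimately show ?thesis by simp
  qed
  have mpol: "pol {..<n} 2 (m r)" for r unfolding m_def by (intro pol_sum pol_cmult Wk_pol) auto
  have jensen: "Pr 4 ((\<Sum>\<kappa>\<in>Pow {..<n}. ?c * (Wk \<kappa> r)\<^sup>2) - (m r)\<^sup>2)" for r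
  proof -
    have ml: "?c * (\<Sum>\<kappa>\<in>Pow {..<n}. Wk \<kappa> r) = m r" by (simp add: m_def sum_distrib_left)
    have "Pr 4 (\<Sum>\<kappa>\<in>Pow {..<n}. ?c * (Wk \<kappa> r - m r)\<^sup>2)"
      by (intro pc_sum Pr_scale Pr_sq pol_diff Wk_pol mpol) auto
    also have "(\<Sum>\<kappa>\<in>Pow {..<n}. ?c * (Wk \<kappa> r - m r)\<^sup>2) = (\<Sum>\<kappa>\<in>Pow {..<n}. ?c * (Wk \<kappa> r)\<^sup>2 - 2 * m r * (?c * Wk \<kappa> r) + (m r)\<^sup>2 * ?c)"
      by (intro sum.cong refl) (simp add: power2_eq_square algebra_simps)
    also have "\<dots> = (\<Sum>\<kappa>\<in>Pow {..<n}. ?c * (Wk \<kappa> r)\<^sup>2) - 2 * m r * m r + (m r)\<^sup>2 * (\<Sum>\<kappa>\<in>Pow {..<n}. ?c)"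
      unfolding sum.distrib sum_subtractf sum_distrib_left[symmetric] ml ..
    also have "\<dots> = (\<Sum>\<kappa>\<in>Pow {..<n}. ?c * (Wk \<kappa> r)\<^sup>2) - (m r)\<^sup>2"
      unfolding c1 by (simp add: power2_eq_square)
    finally show ?thesis .
  qed
  have j1: "Pr 4 ((\<Sum>r\<in>DD. \<Sum>\<kappa>\<in>Pow {..<n}. ?c * (Wk \<kappa> r)\<^sup>2) - (\<Sum>r\<in>DD. (m r)\<^sup>2))"
    by (intro Pr_le_sum jensen)
  have j2: "Pr 4 ((\<Sum>\<kappa>\<in>Pow {..<n}. ?c * pconst (s\<^sup>2 * fsplit x \<kappa>)) - (\<Sum>\<kappa>\<in>Pow {..<n}. ?c * (\<Sum>r\<in>DD. (Wk \<kappa> r)\<^sup>2)))"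
    by (intro Pr_le_sum Pr_le_scale Wk_bound) auto
  have j3: "(\<Sum>\<kappa>\<in>Pow {..<n}. ?c * (\<Sum>r\<in>DD. (Wk \<kappa> r)\<^sup>2)) = (\<Sum>r\<in>DD. \<Sum>\<kappa>\<in>Pow {..<n}. ?c * (Wk \<kappa> r)\<^sup>2)"
    unfolding sum_distrib_left by (rule sum.swap)
  have "Pr 4 ((\<Sum>\<kappa>\<in>Pow {..<n}. ?c * pconst (s\<^sup>2 * fsplit x \<kappa>)) - (\<Sum>r\<in>DD. (m r)\<^sup>2))"
    by (rule Pr_le_trans[OF j1 j2[unfolded j3]])
  then have "Pr 4 (pconst 16 * (\<Sum>\<kappa>\<in>Pow {..<n}. ?c * pconst (s\<^sup>2 * fsplit x \<kappa>)) - pconst 16 * (\<Sum>r\<in>DD. (m r)\<^sup>2))"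
    by (intro Pr_le_scale) auto
  moreover have "pconst 16 * (\<Sum>\<kappa>\<in>Pow {..<n}. ?c * pconst (s\<^sup>2 * fsplit x \<kappa>)) = pconst (16 * s\<^sup>2 * (\<Sum>\<kappa>\<in>Pow {..<n}. 1 / 2 ^ n * fsplit x \<kappa>))"
    unfolding pconst_hom(2)[symmetric] pconst_sum[symmetric]
    by (rule arg_cong[where f = pconst]) (simp add: sum_distrib_left mult_ac)
  moreover have "pconst 16 * (\<Sum>r\<in>DD. (m r)\<^sup>2) = (\<Sum>r\<in>DD. (Qp r)\<^sup>2)"
    by (simp add: Qm power_mult_distrib pconst_numeral sum_distrib_left)
  ultimately show ?thesis by simp
qed

section \<open>The diagonal part of the certificate\<close>

definition D1 :: "nat \<times> nat \<Rightarrow> rpoly" where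
  "D1 r = (\<Sum>i<n. pconst (eps (x i) * x i (fst r) * x i (snd r)) * pvar i)"

text \<open>Zero at Boolean points, but \<open>HH_eq\<close> is an identity in the polynomial ring
  and not modulo the constraints.\<close>

definition D2 :: "nat \<times> nat \<Rightarrow> rpoly" where
  "D2 r = (\<Sum>i<n. pconst (YP i i r) * ((pvar i)\<^sup>2 - pvar i))"

text \<open>Both signs of \<open>e i\<close> are provable, so a product \<open>e i * e j\<close> may
  carry a coefficient of either sign.\<close>

lemma D2_bound: "Pr 4 (- (\<Sum>r\<in>DD. (D2 r)\<^sup>2))"
proof -
  define e where "e = (\<lambda>i. (pvar i)\<^sup>2 - pvar i)"
  have e: "Pr 2 (e i)" "Pr 2 (- e i)" if "i < n" for i using Pr_bool[OF that] by (simp_all add: e_def)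
  have "Pr 4 (pconst c * (e i * e j))" if "i < n" "j < n" for i j c
  proof (cases "0 \<le> c")
    case True then show ?thesis using Pr_mult[OF e(1) e(1)] that by (intro Pr_scale) auto
  next
    case False
    then have "Pr 4 (pconst (- c) * (- e i * e j))" using Pr_mult[OF e(2) e(1)] that by (intro Pr_scale) auto
    then show ?thesis by (simp add: pconst_hom)
  qed
  then have "Pr 4 (\<Sum>i<n. \<Sum>j<n. pconst (- (\<Sum>r\<in>DD. YP i i r * YP j j r)) * (e i * e j))" by (intro pc_sum) auto
  then show ?thesis
    unfolding D2_def sum_square_expand by (simp add: pconst_hom sum_negf e_def)
qed

lemma kM_ge: "i < n \<Longrightarrow> kap1 i x \<le> kM1 x" "i < n \<Longrightarrow> j < n \<Longrightarrow> i \<noteq> j \<Longrightarrow> kap2 i j x \<le> kM2 x" "0 \<le> kM2 x"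
proof -
  show "i < n \<Longrightarrow> kap1 i x \<le> kM1 x" unfolding kM1_def by (intro Max_ge) auto
  show "kap2 i j x \<le> kM2 x" if "i < n" "j < n" "i \<noteq> j"
    unfolding kM2_def using that by (intro Max_ge) (auto intro!: image_eqI[of _ _ "(i, j)"])
  show "0 \<le> kM2 x" unfolding kM2_def using n1 by (intro Max_ge) (auto intro!: image_eqI[of _ _ "(0, 0)"])
qed

lemma kM1_nonneg: "0 \<le> kM1 x"
proof -
  have "0 \<le> kap1 0 x" unfolding kap1_def by (intro mult_nonneg_nonneg sum_nonneg abs_ge_zero) auto
  then show ?thesis using kM_ge(1)[of 0] n1 by linarith
qed

text \<open>Equal indices are charged to the sum of the squares \<open>w_i^2\<close>, at most
  \<open>s\<close>, and distinct ones to the square of the sum, at most \<open>s^2\<close>. So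
  \<open>kM1\<close>, which has the larger size \<open>d^3\<close>, meets only
  \<open>s\<close>.\<close>

lemma D1_bound: "Pr 4 (pconst (kM1 x * s + kM2 x * s\<^sup>2) - (\<Sum>r\<in>DD. (D1 r)\<^sup>2))"
proof -
  define c where "c = (\<lambda>i j. \<Sum>r\<in>DD. (eps (x i) * x i (fst r) * x i (snd r)) * (eps (x j) * x j (fst r) * x j (snd r)))"
  have c: "c i j = eps (x i) * eps (x j) * (\<Sum>a<d. x i a * x j a)\<^sup>2" for i j
    by (simp add: c_def sum_DD power2_eq_square sum_product sum_distrib_left mult_ac)
  have "\<bar>eps (x i)\<bar> * \<bar>eps (x i)\<bar> = eps (x i) * eps (x i)" for i by simp
  then have c1: "c i i = kap1 i x" for i by (simp add: c kap1_def power2_eq_square)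
  have c2: "c i j \<le> kap2 i j x" for i j
    unfolding c kap2_def abs_mult[symmetric] by (intro mult_right_mono) auto
  note k1 = kM1_nonneg
  have o: "(\<Sum>i<n. pvar i)\<^sup>2 = (\<Sum>i<n. \<Sum>j<n. pvar i * pvar j)" by (simp add: power2_eq_square sum_product)
  have s2: "Pr 4 (pconst (s\<^sup>2) - (\<Sum>i<n. \<Sum>j<n. pvar i * pvar j))"
  proof -
    let ?w = "\<Sum>i<n. pvar i"
    have "Pr 4 ((pconst s - ?w) * (pconst s + ?w))"
      using s_nonneg by (intro Pr_mult[OF Pr_budget, where t' = 2] pc_add pc_const pc_sum Pr_w) auto
    moreover have "(pconst s - ?w) * (pconst s + ?w) = pconst (s\<^sup>2) - ?w\<^sup>2"
      by (simp add: pconst_hom power2_eq_square algebra_simps)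
    ultimately show ?thesis unfolding o[symmetric] by simp
  qed
  have t: "Pr 4 ((pconst (kM1 x) * (if i = j then (pvar i)\<^sup>2 else 0) + pconst (kM2 x) * (pvar i * pvar j)) - pconst (c i j) * (pvar i * pvar j))"
    if ij: "i < n" "j < n" for i j
  proof (cases "i = j")
    case True
    have "Pr 4 (pconst (kM1 x - c i i) * (pvar i * pvar i) + pconst (kM2 x) * (pvar i * pvar i))"
      using ij kM_ge(1)[of i] kM_ge(3) by (intro pc_add Pr_scale Pr_mult[OF Pr_w Pr_w]) (auto simp: c1)
    then show ?thesis using True by (simp add: pconst_hom power2_eq_square algebra_simps)
  next
    case False
    have "Pr 4 (pconst (kM2 x - c i j) * (pvar i * pvar j))"
      using ij kM_ge(2)[of i j] c2[of i j] False by (intro Pr_scale Pr_mult[OF Pr_w Pr_w]) auto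
    then show ?thesis using False by (simp add: pconst_hom algebra_simps)
  qed
  have f1: "(\<Sum>r\<in>DD. (D1 r)\<^sup>2) = (\<Sum>i<n. \<Sum>j<n. pconst (c i j) * (pvar i * pvar j))"
    unfolding D1_def sum_square_expand c_def ..
  have f2: "Pr 4 ((\<Sum>i<n. \<Sum>j<n. pconst (kM1 x) * (if i = j then (pvar i)\<^sup>2 else 0) + pconst (kM2 x) * (pvar i * pvar j)) - (\<Sum>i<n. \<Sum>j<n. pconst (c i j) * (pvar i * pvar j)))"
    by (intro Pr_le_sum t) auto
  have f3: "(\<Sum>i<n. \<Sum>j<n. pconst (kM1 x) * (if i = j then (pvar i)\<^sup>2 else 0) + pconst (kM2 x) * (pvar i * pvar j)) = pconst (kM1 x) * (\<Sum>i<n. (pvar i)\<^sup>2) + pconst (kM2 x) * (\<Sum>i<n. \<Sum>j<n. pvar i * pvar j)"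
    by (simp add: sum.distrib sum_distrib_left[symmetric])
  have f4: "Pr 4 ((pconst (kM1 x) * pconst s + pconst (kM2 x) * pconst (s\<^sup>2)) - (pconst (kM1 x) * (\<Sum>i<n. (pvar i)\<^sup>2) + pconst (kM2 x) * (\<Sum>i<n. \<Sum>j<n. pvar i * pvar j)))"
    by (intro Pr_le_add Pr_le_scale s2 pc_mono[OF Pr_sum_w2] k1 kM_ge(3)) auto
  have f5: "pconst (kM1 x) * pconst s + pconst (kM2 x) * pconst (s\<^sup>2) = pconst (kM1 x * s + kM2 x * s\<^sup>2)"
    by (simp only: pconst_hom)
  show ?thesis unfolding f1 by (rule Pr_le_trans[OF f2[unfolded f3] f4[unfolded f5]])
qed

definition NN :: "nat \<Rightarrow> nat \<Rightarrow> rpoly" where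
  "NN a b = (\<Sum>i<n. pconst (YY (x i) a b) * pvar i)"

text \<open>The entries of \<open>n\<^sup>2 h(M)\<close>.\<close>

definition HH :: "nat \<times> nat \<Rightarrow> rpoly" where
  "HH r = (\<Sum>c<d. NN (fst r) c * NN c (snd r))
     - (\<Sum>i<n. pconst (real d * x i (fst r) * x i (snd r) + (if fst r = snd r then 1 else 0)) * pvar i)"

lemma YP_diag: "a < d \<Longrightarrow> b < d \<Longrightarrow> YP i i (a, b) = (eps (x i) + real d) * x i a * x i b + (if a = b then 1 else 0)"
proof -
  assume ab: "a < d" "b < d"
  have "YP i i (a, b) = Yv d (x i) (\<lambda>c. YY (x i) c b) a" by (simp add: YP_def Yv_def)
  also have "\<dots> = x i a * Yv d (x i) (x i) b - YY (x i) a b"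
    using ab by (simp add: Yv_eq[of a]) (simp add: Yv_def YY_sym[of _ _ b] mult.commute)
  also have "\<dots> = (eps (x i) + real d) * x i a * x i b + (if a = b then 1 else 0)"
    using ab by (simp add: Yv_eq YY_def eps_def power2_eq_square algebra_simps)
  finally show ?thesis .
qed

lemma HH_eq: assumes "r \<in> DD" shows "HH r = Qp r + D1 r + D2 r"
proof -
  obtain a b where ab: "r = (a, b)" "a < d" "b < d" using assms by auto
  have "(\<Sum>c<d. NN a c * NN c b) = (\<Sum>c<d. \<Sum>i<n. \<Sum>j<n. pconst (YY (x i) a c * YY (x j) c b) * (pvar i * pvar j))"
    unfolding NN_def sum_product pconst_hom(2) by (simp only: mult_ac)
  also have "\<dots> = (\<Sum>i<n. \<Sum>c<d. \<Sum>j<n. pconst (YY (x i) a c * YY (x j) c b) * (pvar i * pvar j))" by (rule sum.swap)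
  also have "\<dots> = (\<Sum>i<n. \<Sum>j<n. \<Sum>c<d. pconst (YY (x i) a c * YY (x j) c b) * (pvar i * pvar j))" by (intro sum.cong refl sum.swap)
  also have "\<dots> = (\<Sum>i<n. \<Sum>j<n. pconst (YP i j (a, b)) * (pvar i * pvar j))"
    by (simp add: YP_def pconst_sum sum_distrib_right)
  also have "\<dots> = (\<Sum>i<n. pconst (YP i i (a, b)) * (pvar i * pvar i) + (\<Sum>j\<in>{..<n} - {i}. pconst (YP i j (a, b)) * (pvar i * pvar j)))"
    by (intro sum.cong refl sum.remove) auto
  also have "\<dots> = (\<Sum>i<n. pconst (YP i i (a, b)) * (pvar i * pvar i)) + Qp (a, b)"
    unfolding Qp_def by (simp add: sum.distrib)
  also have "(\<Sum>i<n. pconst (YP i i (a, b)) * (pvar i * pvar i)) = D2 (a, b) + (\<Sum>i<n. pconst (YP i i (a, b)) * pvar i)"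
    unfolding D2_def sum.distrib[symmetric] by (intro sum.cong refl) (simp add: power2_eq_square algebra_simps)
  also have "(\<Sum>i<n. pconst (YP i i (a, b)) * pvar i) = D1 (a, b) + (\<Sum>i<n. pconst (real d * x i a * x i b + (if a = b then 1 else 0)) * pvar i)"
    unfolding D1_def sum.distrib[symmetric]
  proof (intro sum.cong refl)
    fix i
    have "YP i i (a, b) = eps (x i) * x i a * x i b + (real d * x i a * x i b + (if a = b then 1 else 0))"
      unfolding YP_diag[OF ab(2,3)] by (simp add: algebra_simps)
    then show "pconst (YP i i (a, b)) * pvar i = pconst (eps (x i) * x i (fst (a, b)) * x i (snd (a, b))) * pvar i + pconst (real d * x i a * x i b + (if a = b then 1 else 0)) * pvar i"
      by (simp only: pconst_hom(1) distrib_right fst_conv snd_conv)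
  qed
  finally have "(\<Sum>c<d. NN a c * NN c b) = D2 (a, b) + (D1 (a, b) + (\<Sum>i<n. pconst (real d * x i a * x i b + (if a = b then 1 else 0)) * pvar i)) + Qp (a, b)" .
  then show ?thesis unfolding HH_def ab(1) fst_conv snd_conv by simp
qed

lemma fsplit_nonneg: "\<kappa> \<subseteq> {..<n} \<Longrightarrow> 0 \<le> fsplit x \<kappa>"
  unfolding fsplit_def alphaA_def alpha_def
  by (intro add_nonneg_nonneg mult_nonneg_nonneg sum_nonneg nuM_nonneg real_sqrt_ge_zero)
     (auto simp: GA_def intro!: nrm_nonneg psd_sum_gram finite_cartesian_product intro: finite_subset[of _ "{..<n}"])

lemma certificate:
  assumes T: "s\<^sup>2 * (real n * (real d)\<^sup>2) \<le> real n ^ 4 * T\<^sup>2" "s * real d ^ 3 \<le> real n ^ 4 * T\<^sup>2"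
  shows "Pr 4 (pconst (real n ^ 4 * fcert T x) - (\<Sum>r\<in>DD. (HH r)\<^sup>2))"
proof -
  define av where "av = (\<Sum>\<kappa>\<in>Pow {..<n}. 1 / 2 ^ n * fsplit x \<kappa>)"
  have av0: "0 \<le> av" unfolding av_def by (intro sum_nonneg mult_nonneg_nonneg fsplit_nonneg) auto
  let ?b = "16 * s\<^sup>2 * av + (kM1 x * s + kM2 x * s\<^sup>2) + 0"
  have polH: "pol {..<n} 2 (Qp r)" "pol {..<n} 2 (D1 r)" "pol {..<n} 2 (D2 r)" for r
    unfolding Qp_def D1_def D2_def power2_eq_square
    by (auto intro!: pol_sum pol_cmult pol_w pol_diff intro: pol_mono[OF pol_w(1)])
  have f1: "Pr 4 (pconst 3 * pconst ?b - pconst 3 * ((\<Sum>r\<in>DD. (Qp r)\<^sup>2) + (\<Sum>r\<in>DD. (D1 r)\<^sup>2) + (\<Sum>r\<in>DD. (D2 r)\<^sup>2)))"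
    unfolding pconst_hom(1)[of _ 0] pconst_hom(1)[of "16 * s\<^sup>2 * av"] using D2_bound
    by (intro Pr_le_scale Pr_le_add D1_bound Qp_bound[folded av_def]) (auto simp: pconst_hom)
  \<comment> \<open>Three times the sum of three squares minus the square of the sum is the sum of
    the squared differences.\<close>
  have f2: "Pr 4 (pconst 3 * ((\<Sum>r\<in>DD. (Qp r)\<^sup>2) + (\<Sum>r\<in>DD. (D1 r)\<^sup>2) + (\<Sum>r\<in>DD. (D2 r)\<^sup>2)) - (\<Sum>r\<in>DD. (HH r)\<^sup>2))"
  proof -
    have "Pr 4 (\<Sum>r\<in>DD. (Qp r - D1 r)\<^sup>2 + (D1 r - D2 r)\<^sup>2 + (Qp r - D2 r)\<^sup>2)"
      by (intro pc_sum pc_add Pr_sq pol_diff polH)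
    also have "(\<Sum>r\<in>DD. (Qp r - D1 r)\<^sup>2 + (D1 r - D2 r)\<^sup>2 + (Qp r - D2 r)\<^sup>2) = (\<Sum>r\<in>DD. 3 * ((Qp r)\<^sup>2 + (D1 r)\<^sup>2 + (D2 r)\<^sup>2) - (HH r)\<^sup>2)"
      by (intro sum.cong refl) (simp only: HH_eq, simp add: power2_eq_square algebra_simps)
    also have "\<dots> = pconst 3 * ((\<Sum>r\<in>DD. (Qp r)\<^sup>2) + (\<Sum>r\<in>DD. (D1 r)\<^sup>2) + (\<Sum>r\<in>DD. (D2 r)\<^sup>2)) - (\<Sum>r\<in>DD. (HH r)\<^sup>2)"
      by (simp only: sum_subtractf sum_distrib_left[symmetric] sum.distrib pconst_numeral)
    finally show ?thesis .
  qed
  have f3: "Pr 4 (pconst (real n ^ 4 * fcert T x) - pconst 3 * pconst ?b)"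
  proof -
    have d0: "0 < real d" "0 < real n" using real_bounds by auto
    define M where "M = real n ^ 4 * T\<^sup>2"
    have "s\<^sup>2 * (1 * (real d)\<^sup>2) \<le> s\<^sup>2 * (real n * (real d)\<^sup>2)"
      using real_bounds by (intro mult_left_mono mult_right_mono) auto
    then have t3: "s\<^sup>2 * (real d)\<^sup>2 \<le> M" using T(1) by (simp add: M_def)
    have "s\<^sup>2 \<le> M / (real n * (real d)\<^sup>2)" "s \<le> M / real d ^ 3" "s\<^sup>2 \<le> M / (real d)\<^sup>2"
      using T t3 d0 by (simp_all add: pos_le_divide_eq M_def)
    then have g: "16 * av * s\<^sup>2 + (kM1 x * s + kM2 x * s\<^sup>2) \<le> 16 * av * (M / (real n * (real d)\<^sup>2)) + (kM1 x * (M / real d ^ 3) + kM2 x * (M / (real d)\<^sup>2))"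
      by (intro add_mono mult_left_mono kM1_nonneg kM_ge(3)) (use av0 in auto)
    have "?b = 16 * av * s\<^sup>2 + (kM1 x * s + kM2 x * s\<^sup>2)" by simp
    also note g
    finally have "3 * ?b \<le> 3 * (16 * av * (M / (real n * (real d)\<^sup>2)) + (kM1 x * (M / real d ^ 3) + kM2 x * (M / (real d)\<^sup>2)))"
      by (rule mult_left_mono) simp
    also have "\<dots> = real n ^ 4 * fcert T x"
      unfolding fcert_def av_def[symmetric] M_def by (simp add: algebra_simps)
    finally have "Pr 4 (pconst (real n ^ 4 * fcert T x - 3 * ?b))" by (intro pc_const) simp
    then show ?thesis by (simp only: pconst_hom(2,6))
  qed
  show ?thesis by (rule Pr_le_trans[OF f2 Pr_le_trans[OF f1 f3]])
qed

end

section \<open>From the certificate to high powers\<close>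

lemma weighted_cov_carrier: "weighted_cov n d x \<in> carrier_mat d d"
  by (simp add: weighted_cov_def)

lemma weighted_cov_pow_Suc:
  assumes "a < d" "b < d"
  shows "(weighted_cov n d x ^\<^sub>m Suc k) $$ (a, b)
    = (\<Sum>c<d. (weighted_cov n d x ^\<^sub>m k) $$ (a, c) * (pconst (1 / real n) * (\<Sum>i<n. pvar i * pconst (x i c * x i b))))"
proof -
  have "(weighted_cov n d x ^\<^sub>m Suc k) $$ (a, b) = (\<Sum>c<d. (weighted_cov n d x ^\<^sub>m k) $$ (a, c) * weighted_cov n d x $$ (c, b))"
    using assms pow_carrier_mat[OF weighted_cov_carrier, of n d x k] weighted_cov_carrier[of n d x]
    by (simp add: scalar_prod_def atLeast0LessThan)
  then show ?thesis using assms by (simp add: weighted_cov_def)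
qed

lemma schatten_pow_weighted_cov:
  "schatten_pow p (weighted_cov n d x) = (\<Sum>a<d. (weighted_cov n d x ^\<^sub>m p) $$ (a, a))"
proof -
  have "dim_row (weighted_cov n d x ^\<^sub>m p) = d"
    using pow_carrier_mat[OF weighted_cov_carrier, of n d x p] by auto
  then show ?thesis
    by (simp add: schatten_pow_def mat_trace_def diag_mat_def interv_sum_list_conv_sum_set_nat atLeast0LessThan)
qed

text \<open>Certifies \<open>k\<^sup>2 z\<^sup>4 \<le> k\<^sup>2 (c + 2 h)\<^sup>2 \<le> k\<^sup>2 (2 c\<^sup>2 + 8 h\<^sup>2)\<close>: completing the square gives
  \<open>c + 2 h - z\<^sup>2 = a\<^sup>2 + e\<close>, where \<open>a\<close> is linear in \<open>z\<close> and \<open>e\<close> does not contain \<open>z\<close>.\<close>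

lemma step_identity:
  fixes c h a z k e :: "'a::comm_ring_1"
  assumes "e = c + 2 * h - a\<^sup>2 - z\<^sup>2"
  shows "2 * (c * (c * k\<^sup>2)) + 8 * (h * k)\<^sup>2 - (k * z\<^sup>2)\<^sup>2
    = (k * (c - 2 * h))\<^sup>2 + 2 * (k * a * z)\<^sup>2 + (k * a\<^sup>2)\<^sup>2 + 2 * (e * (k * a)\<^sup>2) + 2 * (e * (k * z)\<^sup>2) + (k * e)\<^sup>2"
  unfolding assms by (simp add: algebra_simps power2_eq_square)

text \<open>With \<open>U = z ^ p / r\<close> this is the inequality \<open>z ^ p \<le> 3/4 r + z ^ (4p) / (4 r ^ 3)\<close>.\<close>

lemma young_identity:
  fixes U :: "'a::comm_ring_1"
  shows "(U\<^sup>2 - 1)\<^sup>2 + 2 * (U - 1)\<^sup>2 = U ^ 4 - 4 * U + 3"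
proof -
  have "U ^ 4 = U * U * U * U" by (simp add: power4_eq_xxxx)
  then show ?thesis by (simp add: algebra_simps power2_eq_square)
qed

lemma lagrange_identity:
  fixes u v :: "'i \<Rightarrow> 'a::comm_ring_1"
  shows "(\<Sum>c\<in>I. \<Sum>c'\<in>I. (u c * v c' - u c' * v c)\<^sup>2) = 2 * ((\<Sum>c\<in>I. (u c)\<^sup>2) * (\<Sum>c\<in>I. (v c)\<^sup>2) - (\<Sum>c\<in>I. u c * v c)\<^sup>2)"
proof -
  have "(\<Sum>c\<in>I. \<Sum>c'\<in>I. (u c * v c' - u c' * v c)\<^sup>2)
    = (\<Sum>c\<in>I. \<Sum>c'\<in>I. (u c)\<^sup>2 * (v c')\<^sup>2 + (v c)\<^sup>2 * (u c')\<^sup>2 - 2 * ((u c * v c) * (u c' * v c')))"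
    by (intro sum.cong refl) (simp add: power2_eq_square algebra_simps)
  also have "\<dots> = (\<Sum>c\<in>I. (u c)\<^sup>2) * (\<Sum>c\<in>I. (v c)\<^sup>2) + (\<Sum>c\<in>I. (v c)\<^sup>2) * (\<Sum>c\<in>I. (u c)\<^sup>2) - 2 * ((\<Sum>c\<in>I. u c * v c) * (\<Sum>c\<in>I. u c * v c))"
    unfolding sum_product by (simp only: sum.distrib sum_subtractf sum_distrib_left)
  finally show ?thesis by (simp add: power2_eq_square algebra_simps)
qed

section \<open>Polynomials in the matrix \<open>M\<close>\<close>

context cert
begin

definition Mx :: "nat \<Rightarrow> nat \<Rightarrow> rpoly" where
  "Mx a b = pconst (1 / real n) * (\<Sum>i<n. pvar i * pconst (x i a * x i b))"

primrec Mp :: "nat \<Rightarrow> nat \<Rightarrow> nat \<Rightarrow> rpoly" where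
  "Mp 0 a b = (if a = b then 1 else 0)"
| "Mp (Suc k) a b = (\<Sum>c<d. Mp k a c * Mx c b)"

text \<open>Entries of the matrix obtained by substituting \<open>M\<close> for the variable of \<open>g\<close>.\<close>

definition ent :: "rpoly poly \<Rightarrow> nat \<Rightarrow> nat \<Rightarrow> rpoly" where
  "ent g a b = (\<Sum>k\<le>degree g. coeff g k * Mp k a b)"

definition tau :: "rpoly poly \<Rightarrow> rpoly" where
  "tau g = (\<Sum>a<d. ent g a a)"

lemma ent_le: "degree g \<le> N \<Longrightarrow> ent g a b = (\<Sum>k\<le>N. coeff g k * Mp k a b)"
  unfolding ent_def by (intro sum.mono_neutral_left) (auto simp: coeff_eq_0)

lemma ent_add: "ent (g + h) a b = ent g a b + ent h a b"
proof -
  let ?N = "max (degree g) (degree h)"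
  have "ent (g + h) a b = (\<Sum>k\<le>?N. coeff (g + h) k * Mp k a b)"
    by (intro ent_le degree_add_le_max)
  moreover have "ent g a b = (\<Sum>k\<le>?N. coeff g k * Mp k a b)" "ent h a b = (\<Sum>k\<le>?N. coeff h k * Mp k a b)"
    by (intro ent_le; simp)+
  ultimately show ?thesis by (simp add: sum.distrib distrib_right)
qed

lemma ent_smult: "ent (Polynomial.smult c g) a b = c * ent g a b"
  using ent_le[OF Polynomial.degree_smult_le[of c g]] by (simp add: ent_def sum_distrib_left mult.assoc)

lemma ent_0 [simp]: "ent 0 a b = 0"
  by (simp add: ent_def)

lemma ent_uminus: "ent (- g) a b = - ent g a b"
  using ent_add[of g "- g" a b] by (simp add: add_eq_0_iff)

lemma ent_diff: "ent (g - h) a b = ent g a b - ent h a b"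
  using ent_add[of g "- h" a b] by (simp add: ent_uminus)

lemma ent_pCons: "ent (pCons c g) a b = c * (if a = b then 1 else 0) + (\<Sum>e<d. ent g a e * Mx e b)"
proof -
  have "ent (pCons c g) a b = (\<Sum>k\<le>Suc (degree g). coeff (pCons c g) k * Mp k a b)"
    by (intro ent_le degree_pCons_le)
  also have "\<dots> = c * Mp 0 a b + (\<Sum>k\<le>degree g. coeff g k * Mp (Suc k) a b)"
    by (simp add: sum.atMost_Suc_shift del: Mp.simps sum.atMost_Suc)
  also have "(\<Sum>k\<le>degree g. coeff g k * Mp (Suc k) a b) = (\<Sum>k\<le>degree g. \<Sum>e<d. coeff g k * Mp k a e * Mx e b)"
    by (simp add: sum_distrib_left mult.assoc)
  also have "\<dots> = (\<Sum>e<d. \<Sum>k\<le>degree g. coeff g k * Mp k a e * Mx e b)" by (rule sum.swap)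
  finally show ?thesis by (simp add: ent_def sum_distrib_right)
qed

text \<open>Substituting \<open>M\<close> is a ring homomorphism. Identities such as
  \<open>step_identity\<close> can therefore be proved in the commutative ring of polynomials over
  \<open>rpoly\<close> and carried over to matrices by \<open>tau\<close>.\<close>

lemma ent_mult: "b < d \<Longrightarrow> ent (g * h) a b = (\<Sum>c<d. ent g a c * ent h c b)"
proof (induction h arbitrary: b)
  case (pCons c h)
  have "ent (g * pCons c h) a b = c * ent g a b + (\<Sum>e<d. ent (g * h) a e * Mx e b)"
    by (simp add: mult_pCons_right ent_add ent_smult ent_pCons)
  also have "(\<Sum>e<d. ent (g * h) a e * Mx e b) = (\<Sum>e<d. \<Sum>c'<d. ent g a c' * ent h c' e * Mx e b)"
    by (intro sum.cong refl) (simp add: pCons.IH sum_distrib_right)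
  also have "\<dots> = (\<Sum>c'<d. \<Sum>e<d. ent g a c' * ent h c' e * Mx e b)" by (rule sum.swap)
  also have "\<dots> = (\<Sum>c'<d. ent g a c' * (\<Sum>e<d. ent h c' e * Mx e b))" by (simp add: sum_distrib_left mult.assoc)
  also have "c * ent g a b = (\<Sum>c'<d. if c' = b then c * ent g a c' else 0)" using pCons.prems by simp
  also have "\<dots> + (\<Sum>c'<d. ent g a c' * (\<Sum>e<d. ent h c' e * Mx e b)) = (\<Sum>c'<d. ent g a c' * ent (pCons c h) c' b)"
    unfolding sum.distrib[symmetric] by (intro sum.cong refl) (simp add: ent_pCons distrib_left mult_ac)
  finally show ?case .
qed simp

abbreviation zz :: "rpoly poly" where "zz \<equiv> [:0, 1:]"

lemma ent_const: "ent [:c:] a b = (if a = b then c else 0)"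
  by (simp add: ent_def)

lemma ent_1: "ent 1 a b = (if a = b then 1 else 0)"
  using ent_const[of 1] by (simp add: one_pCons)

lemma ent_zz: "a < d \<Longrightarrow> ent zz a b = Mx a b"
proof -
  assume a: "a < d"
  have "ent zz a b = (\<Sum>e<d. (if a = e then 1 else 0) * Mx e b)"
    by (simp only: ent_pCons[of 0 "[:1:]"] ent_const mult_zero_left add_0_left)
  also have "\<dots> = (\<Sum>e<d. if e = a then Mx e b else 0)" by (intro sum.cong) auto
  finally show ?thesis using a by simp
qed

lemma ent_zz_power: "a < d \<Longrightarrow> b < d \<Longrightarrow> ent (zz ^ k) a b = Mp k a b"
proof (induction k arbitrary: b)
  case (Suc k)
  have "ent (zz ^ Suc k) a b = (\<Sum>c<d. ent (zz ^ k) a c * ent zz c b)"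
    unfolding power_Suc2 by (rule ent_mult) (rule Suc)
  then show ?case using Suc by (simp add: ent_zz)
qed (simp add: ent_1)

lemma Mx_sym: "Mx a b = Mx b a"
  by (simp add: Mx_def mult.commute)

lemma Mp_sym: "a < d \<Longrightarrow> b < d \<Longrightarrow> Mp k a b = Mp k b a"
proof (induction k arbitrary: a b)
  case (Suc k)
  have "Mp (Suc k) b a = (\<Sum>c<d. Mx a c * Mp k c b)"
    using Suc by (simp add: Mx_sym[of _ a] mult.commute)
  also have "\<dots> = ent (zz * zz ^ k) a b"
    using Suc.prems by (subst ent_mult) (simp_all add: ent_zz ent_zz_power)
  also have "\<dots> = Mp (Suc k) a b" using ent_zz_power[of a b "Suc k"] Suc.prems by simp
  finally show ?case by simp
qed auto

lemma ent_sym: "a < d \<Longrightarrow> b < d \<Longrightarrow> ent g a b = ent g b a"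
  unfolding ent_def using Mp_sym by simp

lemma tau_add: "tau (g + h) = tau g + tau h"
  by (simp add: tau_def ent_add sum.distrib)

lemma tau_diff: "tau (g - h) = tau g - tau h"
  by (simp add: tau_def ent_diff sum_subtractf)

lemma tau_cmult: "tau ([:c:] * g) = c * tau g"
  by (simp add: tau_def ent_smult sum_distrib_left)

lemma tau_numeral: "tau (numeral w * g) = numeral w * tau g"
  by (simp add: numeral_poly tau_cmult del: mult_pCons_left)

lemma tau_1: "tau 1 = pconst (real d)"
proof -
  have "pconst (real d) = of_nat d" by (induction d) (simp_all add: pconst_hom)
  then show ?thesis by (simp add: tau_def ent_1)
qed

lemma tau_square: "tau (g\<^sup>2) = (\<Sum>a<d. \<Sum>b<d. (ent g a b)\<^sup>2)"
  unfolding tau_def power2_eq_square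
  by (intro sum.cong refl) (auto simp: ent_mult ent_sym[of _ _ g] intro!: sum.cong)

text \<open>Bounds the degree in \<open>w\<close> of the entries of \<open>g(M)\<close>. This is not
  the degree of \<open>g\<close>, whose coefficients are themselves polynomials in
  \<open>w\<close>.\<close>

definition wd :: "nat \<Rightarrow> rpoly poly \<Rightarrow> bool" where
  "wd D g \<longleftrightarrow> (\<forall>a<d. \<forall>b<d. pol {..<n} D (ent g a b))"

lemma wd_mult: "wd D g \<Longrightarrow> wd E h \<Longrightarrow> D + E \<le> F \<Longrightarrow> wd F (g * h)"
  unfolding wd_def by (auto simp: ent_mult intro!: pol_sum pol_mult2)

lemma wd_diff: "wd D g \<Longrightarrow> wd D h \<Longrightarrow> wd D (g - h)"
  unfolding wd_def by (auto simp: ent_diff intro!: pol_diff)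

lemma wd_add: "wd D g \<Longrightarrow> wd D h \<Longrightarrow> wd D (g + h)"
  unfolding wd_def by (auto simp: ent_add intro!: pol_add)

lemma wd_const: "pol {..<n} D c \<Longrightarrow> wd D [:c:]"
  unfolding wd_def by (auto simp: ent_const)

lemma wd_mono: "wd D g \<Longrightarrow> D \<le> E \<Longrightarrow> wd E g"
  unfolding wd_def using pol_mono by blast

lemma Mx_pol: "pol {..<n} 1 (Mx a b)"
  unfolding Mx_def by (intro pol_cmult pol_sum pol_mult2[of _ 1 _ 0] pol_w) auto

lemma wd_zz: "wd 1 zz"
  unfolding wd_def using Mx_pol by (simp add: ent_zz)

lemma wd_zz_power: "wd k (zz ^ k)"
proof (induction k)
  case (Suc k) then show ?case unfolding power_Suc by (intro wd_mult[OF wd_zz]) auto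
qed (use wd_const[of 0 1] in \<open>simp add: one_pCons\<close>)

lemma wd_numeral: "wd D g \<Longrightarrow> wd D (numeral w * g)"
  using wd_mult[OF wd_const[OF pol_const[of _ 0 "numeral w"]], of D g D]
  by (simp add: numeral_poly pconst_numeral del: mult_pCons_left)

lemma Pr_tau_square: "wd D g \<Longrightarrow> 2 * D \<le> t \<Longrightarrow> Pr t (tau (g\<^sup>2))"
  unfolding tau_square wd_def by (auto intro!: pc_sum pc_square)

text \<open>Submultiplicativity of the Frobenius norm. For each entry of the product, Lagrange's
  identity writes the defect in Cauchy-Schwarz as a sum of squares.\<close>

lemma Pr_lagrange:
  assumes g: "wd D g" and h: "wd E h" and t: "2 * (D + E) \<le> t"
  shows "Pr t (tau (g\<^sup>2) * tau (h\<^sup>2) - tau ((g * h)\<^sup>2))"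
proof -
  let ?f = "\<lambda>a b. (\<Sum>c<d. (ent g a c)\<^sup>2) * (\<Sum>c<d. (ent h b c)\<^sup>2) - (\<Sum>c<d. ent g a c * ent h b c)\<^sup>2"
  have "Pr t (?f a b)" if ab: "a < d" "b < d" for a b
  proof -
    have l: "Pr t (pconst (1 / 2) * (\<Sum>c<d. \<Sum>c'<d. (ent g a c * ent h b c' - ent g a c' * ent h b c)\<^sup>2))"
      using g h ab t unfolding wd_def
      by (intro Pr_scale pc_sum pc_square[of _ "D + E"] pol_diff pol_mult) auto
    have "pconst (1 / 2) * (2 * z) = z" for z
      using pconst_hom(2)[of "1 / 2" 2] by (simp add: mult.assoc[symmetric] pconst_numeral pconst_hom(4))
    from l[unfolded lagrange_identity this] show ?thesis .
  qed
  then have "Pr t (\<Sum>a<d. \<Sum>b<d. ?f a b)" by (intro pc_sum) auto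
  moreover have "(\<Sum>a<d. \<Sum>b<d. ?f a b) = tau (g\<^sup>2) * tau (h\<^sup>2) - tau ((g * h)\<^sup>2)"
  proof -
    have "tau ((g * h)\<^sup>2) = (\<Sum>a<d. \<Sum>b<d. (\<Sum>c<d. ent g a c * ent h b c)\<^sup>2)"
      unfolding tau_square by (intro sum.cong refl arg_cong[where f = "\<lambda>z. z\<^sup>2"]) (auto simp: ent_mult ent_sym[of _ _ h] intro!: sum.cong)
    then show ?thesis unfolding sum_subtractf tau_square sum_product by simp
  qed
  ultimately show ?thesis by simp
qed

section \<open>The quadratic \<open>h\<close> and the step from one fourth power to the next\<close>

definition etah :: rpoly where "etah = pconst (1 / real n) * (\<Sum>i<n. pvar i)"

definition hh :: "rpoly poly" where
  "hh = zz\<^sup>2 - [:2 * etah + pconst (real d / real n):] * zz + [:etah\<^sup>2 - pconst (1 / real n) * etah:]"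

lemma etah_pol: "pol {..<n} 1 etah"
  unfolding etah_def by (intro pol_cmult pol_sum pol_w) auto

lemma etah_pol2: "pol {..<n} 2 (etah\<^sup>2)"
  unfolding power2_eq_square by (intro pol_mult2[OF etah_pol etah_pol]) simp

lemma beta_pol: "pol {..<n} 1 (2 * etah + pconst (real d / real n))"
  using pol_add[OF pol_cmult[OF etah_pol, of 2] pol_const] by (simp add: pconst_numeral)

lemma wd_hh: "wd 2 hh"
  unfolding hh_def by (intro wd_add wd_diff wd_zz_power wd_mult[OF wd_const[OF beta_pol] wd_zz] wd_const pol_diff etah_pol2
    pol_cmult pol_mono[OF etah_pol]) auto

lemma ent_hh:
  assumes ab: "a < d" "b < d"
  shows "ent hh a b = pconst (1 / (real n)\<^sup>2) * HH (a, b)"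
proof -
  define m where "m = (\<lambda>a b. \<Sum>i<n. pconst (x i a * x i b) * pvar i)"
  define \<sigma> where "\<sigma> = (\<Sum>i<n. pvar i)"
  let ?k = "pconst (1 / real n)"
  let ?\<delta> = "if a = b then 1 else 0 :: rpoly"
  have Mx: "Mx a b = ?k * m a b" for a b by (simp add: Mx_def m_def mult.commute)
  have NN: "NN a b = m a b - \<sigma> * (if a = b then 1 else 0)" for a b
    by (auto simp: NN_def m_def \<sigma>_def YY_def pconst_hom sum_subtractf left_diff_distrib)
  have "(\<Sum>c<d. NN a c * NN c b) = (\<Sum>c<d. m a c * m c b - \<sigma> * (if c = b then m a c else 0) - \<sigma> * (if c = a then m c b else 0) + \<sigma>\<^sup>2 * (if c = a then ?\<delta> else 0))"
    unfolding NN by (intro sum.cong refl) (auto simp: algebra_simps power2_eq_square)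
  also have "\<dots> = (\<Sum>c<d. m a c * m c b) - 2 * \<sigma> * m a b + \<sigma>\<^sup>2 * ?\<delta>"
    using ab by (simp add: sum.distrib sum_subtractf sum_distrib_left[symmetric])
  finally have N2: "(\<Sum>c<d. NN a c * NN c b) = (\<Sum>c<d. m a c * m c b) - 2 * \<sigma> * m a b + \<sigma>\<^sup>2 * ?\<delta>" .
  have L: "(\<Sum>i<n. pconst (real d * x i a * x i b + (if a = b then 1 else 0)) * pvar i) = pconst (real d) * m a b + \<sigma> * ?\<delta>"
    by (auto simp: m_def \<sigma>_def pconst_hom sum.distrib sum_distrib_left algebra_simps)
  have H: "HH (a, b) = (\<Sum>c<d. m a c * m c b) - 2 * \<sigma> * m a b + \<sigma>\<^sup>2 * ?\<delta> - (pconst (real d) * m a b + \<sigma> * ?\<delta>)"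
    unfolding HH_def fst_conv snd_conv N2 L ..
  have k2: "pconst (1 / (real n)\<^sup>2) = ?k * ?k" by (simp add: pconst_hom(2)[symmetric] power2_eq_square)
  have kd: "pconst (real d / real n) = ?k * pconst (real d)" by (simp add: pconst_hom(2)[symmetric])
  have z2: "ent (zz\<^sup>2) a b = ?k * ?k * (\<Sum>c<d. m a c * m c b)"
    unfolding power2_eq_square using ab by (simp add: ent_mult ent_zz Mx sum_distrib_left mult_ac del: mult_pCons_left mult_pCons_right)
  have "ent hh a b = ?k * ?k * (\<Sum>c<d. m a c * m c b) - (2 * (?k * \<sigma>) + ?k * pconst (real d)) * (?k * m a b) + ((?k * \<sigma>)\<^sup>2 - ?k * (?k * \<sigma>)) * ?\<delta>"
  proof -
    have "ent ([:c:] * zz) a b = c * (?k * m a b)" for c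
      using ab ent_smult[of c zz a b] by (simp add: ent_zz Mx)
    then show ?thesis unfolding hh_def ent_add ent_diff z2 ent_const kd etah_def[folded \<sigma>_def] by simp
  qed
  then show ?thesis unfolding H k2 by (simp add: algebra_simps power2_eq_square)
qed

text \<open>The value of \<open>(2\<sigma> + d/n)^2 - 2 (\<sigma>^2 - \<sigma>/n)\<close> at
  \<open>\<sigma> = \<eta>\<close>, so that \<open>ee\<close> vanishes there.\<close>

definition c0 :: real where
  "c0 = 2 * \<eta>\<^sup>2 + 4 * \<eta> * real d / real n + (real d)\<^sup>2 / (real n)\<^sup>2 + 2 * \<eta> / real n"

definition ee :: rpoly where
  "ee = pconst c0 + 2 * (etah\<^sup>2 - pconst (1 / real n) * etah) - (2 * etah + pconst (real d / real n))\<^sup>2"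

lemma ee_eq: "[:ee:] = [:pconst c0:] + 2 * hh - (zz - [:2 * etah + pconst (real d / real n):])\<^sup>2 - zz\<^sup>2"
  unfolding ee_def hh_def by (simp add: power2_eq_square numeral_poly algebra_simps)

text \<open>\<open>ee\<close> equals \<open>2 (\<eta> - \<sigma>) (\<eta> + \<sigma>) + (4 d/n +
  2/n) (\<eta> - \<sigma>)\<close>, and both linear factors are provable.\<close>

lemma Pr_ee: "Pr 4 ee"
proof -
  have dlt: "Pr 2 (pconst \<eta> - etah)"
  proof -
    have "Pr 2 (pconst (1 / real n) * (pconst s - (\<Sum>i<n. pvar i)))" by (intro Pr_scale Pr_budget) auto
    moreover have "pconst (1 / real n) * pconst s = pconst \<eta>" using n1 by (simp add: pconst_hom(2)[symmetric])
    ultimately show ?thesis by (simp add: etah_def right_diff_distrib)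
  qed
  have eh: "Pr 2 (pconst \<eta> + etah)"
    unfolding etah_def using \<eta>0 by (intro pc_add pc_const Pr_scale pc_sum Pr_w) auto
  have "Pr 4 (pconst 2 * ((pconst \<eta> - etah) * (pconst \<eta> + etah)) + pconst (4 * real d / real n + 2 / real n) * (pconst \<eta> - etah))"
    by (intro pc_add Pr_scale Pr_mult[OF dlt eh] pc_mono[OF dlt]) auto
  moreover have "pconst c0 = pconst 2 * (pconst \<eta> * pconst \<eta>) + pconst (4 * real d / real n + 2 / real n) * pconst \<eta> + pconst (real d / real n) * pconst (real d / real n)"
    unfolding pconst_hom(1,2)[symmetric] c0_def by (rule arg_cong[where f = pconst]) (simp add: power2_eq_square algebra_simps add_divide_distrib)
  moreover have "pconst (4 * real d / real n + 2 / real n) = 4 * pconst (real d / real n) + 2 * pconst (1 / real n)"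
    using pconst_hom(2)[of 4 "real d / real n"] pconst_hom(2)[of 2 "1 / real n"] by (simp add: pconst_hom(1) pconst_numeral)
  ultimately show ?thesis unfolding ee_def by (simp add: pconst_numeral power2_eq_square algebra_simps)
qed

lemma ee_pol: "pol {..<n} 2 ee"
  unfolding ee_def
  using pol_cmult[OF pol_diff[OF etah_pol2 pol_cmult[OF pol_mono[OF etah_pol, of 2]]], of 2]
  by (intro pol_diff pol_add pol_const) (auto simp: pconst_numeral power2_eq_square intro!: pol_mult2[OF beta_pol beta_pol])

lemma tau_hh:
  assumes T: "s\<^sup>2 * (real n * (real d)\<^sup>2) \<le> real n ^ 4 * T\<^sup>2" "s * real d ^ 3 \<le> real n ^ 4 * T\<^sup>2"
  shows "Pr 4 (pconst (fcert T x) - tau (hh\<^sup>2))"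
proof -
  have "Pr 4 (pconst (1 / real n ^ 4) * (pconst (real n ^ 4 * fcert T x) - (\<Sum>r\<in>DD. (HH r)\<^sup>2)))"
    by (intro Pr_scale certificate[OF T]) auto
  moreover have "pconst (1 / real n ^ 4) * pconst (real n ^ 4 * fcert T x) = pconst (fcert T x)"
    using n1 by (simp add: pconst_hom(2)[symmetric])
  moreover have "pconst (1 / real n ^ 4) * (\<Sum>r\<in>DD. (HH r)\<^sup>2) = tau (hh\<^sup>2)"
  proof -
    have "pconst (1 / real n ^ 4) = (pconst (1 / (real n)\<^sup>2))\<^sup>2" unfolding pconst_hom(7)[symmetric] by (simp add: power_divide)
    then show ?thesis unfolding tau_square sum_DD by (simp add: ent_hh sum_distrib_left power_mult_distrib)
  qed
  ultimately show ?thesis by (simp add: right_diff_distrib)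
qed

definition Lam :: "real \<Rightarrow> real" where "Lam T = 2 * c0\<^sup>2 + 8 * fcert T x"

lemma fcert_nonneg: "0 \<le> fcert T x"
  unfolding fcert_def
  by (intro mult_nonneg_nonneg add_nonneg_nonneg sum_nonneg fsplit_nonneg kM1_nonneg kM_ge(3)) auto

lemma tau_step:
  assumes T: "s\<^sup>2 * (real n * (real d)\<^sup>2) \<le> real n ^ 4 * T\<^sup>2" "s * real d ^ 3 \<le> real n ^ 4 * T\<^sup>2"
  shows "Pr (4 * j + 6) (pconst (Lam T) * tau (zz ^ (4 * j)) - tau (zz ^ (4 * Suc j)))"
proof -
  define k where "k = zz ^ (2 * j)"
  define a where "a = zz - [:2 * etah + pconst (real d / real n):]"
  \<comment> \<open>The largest degree belongs to the terms with \<open>ee\<close>: degree 4 for the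
    proof of \<open>ee\<close>, plus \<open>4 j + 2\<close> for the trace of a square of degree
    \<open>2 j + 1\<close>.\<close>
  let ?t = "4 * j + 6"
  let ?c = "[:pconst c0:]"
  have k: "wd (2 * j) k" unfolding k_def by (rule wd_zz_power)
  have a: "wd 1 a" unfolding a_def by (intro wd_diff wd_zz wd_const beta_pol)
  have k2: "zz ^ (4 * j) = k\<^sup>2" by (simp add: k_def power_mult[symmetric])
  have kz: "zz ^ (4 * Suc j) = (k * zz\<^sup>2)\<^sup>2"
    by (simp only: k_def power_mult_distrib power_mult[symmetric] power_add[symmetric]) (rule arg_cong[where f = "\<lambda>m. zz ^ m"], simp)
  have id: "2 * (?c * (?c * k\<^sup>2)) + 8 * (hh * k)\<^sup>2 - (k * zz\<^sup>2)\<^sup>2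
    = (k * (?c - 2 * hh))\<^sup>2 + 2 * (k * a * zz)\<^sup>2 + (k * a\<^sup>2)\<^sup>2 + 2 * ([:ee:] * (k * a)\<^sup>2) + 2 * ([:ee:] * (k * zz)\<^sup>2) + (k * [:ee:])\<^sup>2"
    by (rule step_identity) (simp only: ee_eq a_def)
  from arg_cong[OF id, of tau]
  have id': "2 * (pconst c0 * (pconst c0 * tau (k\<^sup>2))) + 8 * tau ((hh * k)\<^sup>2) - tau ((k * zz\<^sup>2)\<^sup>2)
    = tau ((k * (?c - 2 * hh))\<^sup>2) + 2 * tau ((k * a * zz)\<^sup>2) + tau ((k * a\<^sup>2)\<^sup>2) + 2 * (ee * tau ((k * a)\<^sup>2)) + 2 * (ee * tau ((k * zz)\<^sup>2)) + tau ((k * [:ee:])\<^sup>2)"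
    by (simp only: tau_add tau_diff tau_numeral tau_cmult)
  have two: "Pr t P \<Longrightarrow> Pr t (numeral w * P)" for t P w using Pr_scale[of "numeral w" t P] by (simp add: pconst_numeral)
  have aa: "wd 2 (a\<^sup>2)" unfolding power2_eq_square by (rule wd_mult[OF a a]) simp
  have 1: "Pr ?t (tau ((k * (?c - 2 * hh))\<^sup>2) + 2 * tau ((k * a * zz)\<^sup>2) + tau ((k * a\<^sup>2)\<^sup>2) + 2 * (ee * tau ((k * a)\<^sup>2)) + 2 * (ee * tau ((k * zz)\<^sup>2)) + tau ((k * [:ee:])\<^sup>2))"
  proof (intro pc_add two)
    show "Pr ?t (tau ((k * (?c - 2 * hh))\<^sup>2))"
      by (rule Pr_tau_square[OF wd_mult[OF k wd_diff[OF wd_const wd_numeral[OF wd_hh]] order_refl]]) auto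
    show "Pr ?t (tau ((k * a * zz)\<^sup>2))"
      by (rule Pr_tau_square[OF wd_mult[OF wd_mult[OF k a order_refl] wd_zz order_refl]]) auto
    show "Pr ?t (tau ((k * a\<^sup>2)\<^sup>2))" by (rule Pr_tau_square[OF wd_mult[OF k aa order_refl]]) auto
    show "Pr ?t (ee * tau ((k * a)\<^sup>2))"
      by (rule Pr_mult[OF Pr_ee Pr_tau_square[OF wd_mult[OF k a order_refl] order_refl]]) auto
    show "Pr ?t (ee * tau ((k * zz)\<^sup>2))"
      by (rule Pr_mult[OF Pr_ee Pr_tau_square[OF wd_mult[OF k wd_zz order_refl] order_refl]]) auto
    show "Pr ?t (tau ((k * [:ee:])\<^sup>2))" by (rule Pr_tau_square[OF wd_mult[OF k wd_const[OF ee_pol] order_refl]]) auto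
  qed
  \<comment> \<open>Together with the next fact this bounds \<open>tr (h k)^2\<close> by
    \<open>tr h^2 tr k^2\<close> and then by \<open>f tr k^2\<close>. The certificate thus enters
    only through \<open>tr h^2\<close>, with its degree 4.\<close>
  have 2: "Pr ?t (8 * ((pconst (fcert T x) - tau (hh\<^sup>2)) * tau (k\<^sup>2)))"
    by (intro two Pr_mult[OF tau_hh[OF T] Pr_tau_square[OF k order_refl]]) auto
  have 3: "Pr ?t (8 * (tau (hh\<^sup>2) * tau (k\<^sup>2) - tau ((hh * k)\<^sup>2)))"
    by (intro two Pr_lagrange[OF wd_hh k]) auto
  have "pconst (Lam T) = 2 * (pconst c0 * pconst c0) + 8 * pconst (fcert T x)"
    by (simp add: Lam_def pconst_hom(1,2) pconst_numeral power2_eq_square)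
  then have "pconst (Lam T) * tau (k\<^sup>2) - tau ((k * zz\<^sup>2)\<^sup>2)
    = (2 * (pconst c0 * (pconst c0 * tau (k\<^sup>2))) + 8 * tau ((hh * k)\<^sup>2) - tau ((k * zz\<^sup>2)\<^sup>2))
      + (8 * ((pconst (fcert T x) - tau (hh\<^sup>2)) * tau (k\<^sup>2)) + 8 * (tau (hh\<^sup>2) * tau (k\<^sup>2) - tau ((hh * k)\<^sup>2)))"
    by (simp add: algebra_simps)
  moreover have "Pr ?t \<dots>" unfolding id' by (intro pc_add 1 2 3)
  ultimately show ?thesis unfolding k2 kz by (simp only:)
qed

lemma Lam_nonneg: "0 \<le> Lam T"
  unfolding Lam_def using fcert_nonneg by simp

text \<open>The inductive bound is only multiplied by a constant, and \<open>4 * Suc j + 2\<close>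
  is the degree of \<open>tau_step\<close>; so the degrees of the steps do not accumulate.\<close>

lemma tau_power:
  assumes T: "s\<^sup>2 * (real n * (real d)\<^sup>2) \<le> real n ^ 4 * T\<^sup>2" "s * real d ^ 3 \<le> real n ^ 4 * T\<^sup>2"
  shows "Pr (4 * j + 2) (pconst (Lam T ^ j * real d) - tau (zz ^ (4 * j)))"
proof (induction j)
  case (Suc j)
  have "Pr (4 * Suc j + 2) (pconst (Lam T) * pconst (Lam T ^ j * real d) - pconst (Lam T) * tau (zz ^ (4 * j)))"
    by (intro Pr_le_scale Lam_nonneg pc_mono[OF Suc]) simp
  moreover have "Pr (4 * Suc j + 2) (pconst (Lam T) * tau (zz ^ (4 * j)) - tau (zz ^ (4 * Suc j)))"
    by (rule pc_mono[OF tau_step[OF T]]) simp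
  ultimately have "Pr (4 * Suc j + 2) (pconst (Lam T) * pconst (Lam T ^ j * real d) - tau (zz ^ (4 * Suc j)))"
    using Pr_le_trans by blast
  then show ?case by (simp add: pconst_hom mult.assoc)
qed (simp add: tau_1 pc0)

lemma schatten_tau: "schatten_pow p (weighted_cov n d x) = tau (zz ^ p)"
proof -
  have "(weighted_cov n d x ^\<^sub>m k) $$ (a, b) = Mp k a b" if "a < d" "b < d" for k a b
    using that
  proof (induction k arbitrary: b)
    case 0 then show ?case using weighted_cov_carrier[of n d x] by simp
  next
    case (Suc k)
    show ?case unfolding weighted_cov_pow_Suc[OF Suc.prems] using Suc by (simp add: Mx_def)
  qed
  then show ?thesis by (simp add: schatten_pow_weighted_cov tau_def ent_zz_power)
qed

text \<open>Going up to the exponent \<open>4 p\<close> and down again by Young's inequality serves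
  every \<open>p\<close>. The parameter \<open>r\<close> is free here; it is later chosen to balance
  the two terms.\<close>

lemma sos_bound:
  assumes T: "s\<^sup>2 * (real n * (real d)\<^sup>2) \<le> real n ^ 4 * T\<^sup>2" "s * real d ^ 3 \<le> real n ^ 4 * T\<^sup>2" and r: "0 < r"
  shows "Pr (4 * p + 2) (pconst (3 / 4 * r * real d + 1 / (4 * r ^ 3) * (Lam T ^ p * real d)) - schatten_pow p (weighted_cov n d x))"
proof -
  let ?u = "pconst (1 / r)"
  define U where "U = [:?u:] * zz ^ p"
  let ?t = "4 * p + 2"
  have U: "wd p U" unfolding U_def by (rule wd_mult[OF wd_const wd_zz_power]) auto
  have w1: "wd 0 1" using wd_const[of 0 1] by (simp add: one_pCons)
  have two: "Pr t P \<Longrightarrow> Pr t (numeral w * P)" for t P w using Pr_scale[of "numeral w" t P] by (simp add: pconst_numeral)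
  have "wd (2 * p) (U\<^sup>2)" unfolding power2_eq_square by (rule wd_mult[OF U U]) simp
  then have "Pr ?t (tau ((U\<^sup>2 - 1)\<^sup>2) + 2 * tau ((U - 1)\<^sup>2))"
    by (intro pc_add two Pr_tau_square[of "2 * p"] Pr_tau_square[of p] wd_diff U wd_mono[OF w1]) auto
  moreover have "tau ((U\<^sup>2 - 1)\<^sup>2) + 2 * tau ((U - 1)\<^sup>2) = tau (U ^ 4) - 4 * tau U + 3 * tau 1"
  proof -
    have "tau ((U\<^sup>2 - 1)\<^sup>2 + 2 * (U - 1)\<^sup>2) = tau (U ^ 4 - 4 * U + 3 * 1)" by (simp add: young_identity)
    then show ?thesis unfolding tau_add tau_diff tau_numeral .
  qed
  moreover have "tau U = ?u * tau (zz ^ p)" unfolding U_def tau_cmult ..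
  moreover have "tau (U ^ 4) = pconst ((1 / r) ^ 4) * tau (zz ^ (4 * p))"
  proof -
    have "[:c:] ^ m = [:c ^ m:]" for c :: rpoly and m by (induction m) (auto simp: one_pCons)
    then have "U ^ 4 = [:?u ^ 4:] * zz ^ (4 * p)" by (simp only: U_def power_mult_distrib power_mult[symmetric] mult.commute[of p])
    then show ?thesis by (simp only: tau_cmult pconst_hom(7))
  qed
  ultimately have "Pr ?t (pconst (r / 4) * (pconst ((1 / r) ^ 4) * tau (zz ^ (4 * p)) - 4 * (?u * tau (zz ^ p)) + 3 * pconst (real d)))"
    using r by (intro Pr_scale) (auto simp: tau_1)
  moreover have "pconst (r / 4) * (pconst ((1 / r) ^ 4) * A - 4 * (?u * Z) + 3 * pconst (real d)) = pconst (1 / (4 * r ^ 3)) * A - Z + pconst (3 / 4 * r * real d)" for A Z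
  proof -
    have "r / 4 * (1 / r) ^ 4 = 1 / (4 * r ^ 3)" using r by (simp add: field_simps power4_eq_xxxx power3_eq_cube)
    then have a: "pconst (r / 4) * pconst ((1 / r) ^ 4) = pconst (1 / (4 * r ^ 3))" unfolding pconst_hom(2)[symmetric] by (rule arg_cong)
    have b: "pconst (r / 4) * (pconst 4 * ?u) = 1" unfolding pconst_hom(2)[symmetric] using r by (simp add: pconst_hom(4))
    have c: "pconst (r / 4) * (pconst 3 * pconst (real d)) = pconst (3 / 4 * r * real d)"
      unfolding pconst_hom(2)[symmetric] by (rule arg_cong[where f = pconst]) simp
    have "pconst (r / 4) * (pconst ((1 / r) ^ 4) * A - 4 * (?u * Z) + 3 * pconst (real d))
      = (pconst (r / 4) * pconst ((1 / r) ^ 4)) * A - (pconst (r / 4) * (pconst 4 * ?u)) * Z + pconst (r / 4) * (pconst 3 * pconst (real d))"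
      unfolding pconst_numeral by (simp add: algebra_simps)
    then show ?thesis unfolding a b c by simp
  qed
  ultimately have 1: "Pr ?t (pconst (1 / (4 * r ^ 3)) * tau (zz ^ (4 * p)) - tau (zz ^ p) + pconst (3 / 4 * r * real d))" by simp
  have 2: "Pr ?t (pconst (1 / (4 * r ^ 3)) * pconst (Lam T ^ p * real d) - pconst (1 / (4 * r ^ 3)) * tau (zz ^ (4 * p)))"
    using r by (intro Pr_le_scale tau_power T) auto
  have "pconst (3 / 4 * r * real d + 1 / (4 * r ^ 3) * (Lam T ^ p * real d)) = pconst (3 / 4 * r * real d) + pconst (1 / (4 * r ^ 3)) * pconst (Lam T ^ p * real d)"
    by (simp only: pconst_hom)
  with pc_add[OF 1 2] show ?thesis unfolding schatten_tau by (simp add: algebra_simps)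
qed

end

lemma sos_proves_mono: "sos_proves V t qs P \<Longrightarrow> t \<le> t' \<Longrightarrow> sos_proves V t' qs P"
  unfolding sos_proves_def
proof (elim exE conjE)
  fix b assume b: "\<forall>S\<subseteq>{..<length qs}. is_sos V (b S) \<and> real (total_degree (b S * prod ((!) qs) S)) \<le> t"
    "P = (\<Sum>S\<in>Pow {..<length qs}. b S * prod ((!) qs) S)" and t: "t \<le> t'"
  have "\<forall>S\<subseteq>{..<length qs}. is_sos V (b S) \<and> real (total_degree (b S * prod ((!) qs) S)) \<le> t'"
    using b(1) t order_trans by blast
  with b(2) show "\<exists>b. (\<forall>S\<subseteq>{..<length qs}. is_sos V (b S) \<and> real (total_degree (b S * prod ((!) qs) S)) \<le> t') \<and>
     P = (\<Sum>S\<in>Pow {..<length qs}. b S * prod ((!) qs) S)" by blast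
qed

lemma sos_proves_add_const:
  assumes "sos_proves V t qs (pconst B - P)" "B \<le> B'" "0 \<le> t"
  shows "sos_proves V t qs (pconst B' - P)"
proof -
  let ?c = "pconst (sqrt (B' - B))"
  have c: "?c ^ 2 * (\<Prod>i\<in>{}. qs ! i) = pconst (B' - B)" using assms(2) by (simp add: pconst_hom(7)[symmetric])
  have td: "total_degree (pconst c) = 0" for c using pol_const[of "{}" 0 c] by (simp add: pol_def)
  have "sos_proves V t qs (?c ^ 2 * (\<Prod>i\<in>{}. qs ! i) + (pconst B - P))"
  proof (rule sos_proves_insert[OF assms(1)])
    show "?c \<in> polys_in V" using pol_const[of V 0] by (simp add: pol_def)
    show "real (total_degree (?c ^ 2 * (\<Prod>i\<in>{}. qs ! i))) \<le> t" unfolding c td using assms(3) by simp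
  qed simp
  then show ?thesis unfolding c by (simp add: pconst_hom(6))
qed

section \<open>Measurability of the optimal bound\<close>

text \<open>Families with a fixed finite set of monomials and continuous coefficients. Products stay
  in this class by bilinearity, and continuity of coefficients needs no topology on
  \<open>rpoly\<close>.\<close>

inductive pcont :: "('y::topological_space \<Rightarrow> rpoly) \<Rightarrow> bool" where
  pcont_0: "pcont (\<lambda>_. 0)"
| pcont_insert: "pcont P \<Longrightarrow> continuous_on UNIV g \<Longrightarrow> pcont (\<lambda>y. Poly_Mapping.single m (g y) + P y)"

lemma pcont_single: "continuous_on UNIV g \<Longrightarrow> pcont (\<lambda>y. Poly_Mapping.single m (g y))"
  using pcont_insert[OF pcont_0] by simp

lemma pcont_add: "pcont P \<Longrightarrow> pcont Q \<Longrightarrow> pcont (\<lambda>y. P y + Q y)"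
proof (induction rule: pcont.induct)
  case (pcont_insert P g m)
  from pcont.pcont_insert[OF pcont_insert.IH[OF pcont_insert.prems] pcont_insert.hyps(2), of m]
  show ?case by (simp add: add.assoc)
qed simp

lemma pcont_sum: "(\<And>i. i \<in> I \<Longrightarrow> pcont (P i)) \<Longrightarrow> pcont (\<lambda>y. \<Sum>i\<in>I. P i y)"
  by (induction I rule: infinite_finite_induct) (auto intro: pcont_0 pcont_add)

lemma pcont_mult: "pcont P \<Longrightarrow> pcont Q \<Longrightarrow> pcont (\<lambda>y. P y * Q y)"
proof (induction rule: pcont.induct)
  case pcont_0 then show ?case by (simp add: pcont.pcont_0)
next
  case (pcont_insert P g m)
  have "pcont (\<lambda>y. Poly_Mapping.single m (g y) * Q y)" using pcont_insert.prems
  proof (induction rule: pcont.induct)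
    case pcont_0 then show ?case by (simp add: pcont.pcont_0)
  next
    case (pcont_insert Q h m')
    have "pcont (\<lambda>y. Poly_Mapping.single (m + m') (g y * h y) + Poly_Mapping.single m (g y) * Q y)"
      using pcont_insert \<open>continuous_on UNIV g\<close> by (intro pcont.pcont_insert continuous_on_mult)
    then show ?case by (simp add: distrib_left mult_single)
  qed
  then show ?case using pcont_insert by (simp add: distrib_right pcont_add)
qed

lemma poly_sum_single: "P = (\<Sum>m\<in>Poly_Mapping.keys P. Poly_Mapping.single m (Poly_Mapping.lookup P m))"
proof (rule poly_mapping_eqI)
  fix k
  have "Poly_Mapping.lookup (\<Sum>m\<in>Poly_Mapping.keys P. Poly_Mapping.single m (Poly_Mapping.lookup P m)) k
    = (\<Sum>m\<in>Poly_Mapping.keys P. if m = k then Poly_Mapping.lookup P m else 0)"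
    unfolding lookup_sum by (intro sum.cong refl) (simp add: lookup_single when_def)
  then show "Poly_Mapping.lookup P k = Poly_Mapping.lookup (\<Sum>m\<in>Poly_Mapping.keys P. Poly_Mapping.single m (Poly_Mapping.lookup P m)) k"
    by (simp add: in_keys_iff)
qed

lemma pcont_const: "pcont (\<lambda>_. P)"
proof -
  have "pcont (\<lambda>_. \<Sum>m\<in>Poly_Mapping.keys P. Poly_Mapping.single m (Poly_Mapping.lookup P m))"
    by (intro pcont_sum pcont_single continuous_on_const)
  then show ?thesis unfolding poly_sum_single[symmetric] .
qed

lemma pcont_diff: assumes "pcont P" "pcont Q" shows "pcont (\<lambda>y. P y - Q y)"
  using pcont_add[OF assms(1) pcont_mult[OF pcont_const[of "-1"] assms(2)]] by simp

lemma pcont_pconst: "continuous_on UNIV g \<Longrightarrow> pcont (\<lambda>y. pconst (g y))"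
  unfolding pconst_def by (rule pcont_single)

lemma pcont_lookup: "pcont P \<Longrightarrow> continuous_on UNIV (\<lambda>y. Poly_Mapping.lookup (P y) k)"
proof (induction rule: pcont.induct)
  case (pcont_insert P g m)
  then show ?case by (cases "m = k") (auto simp: lookup_add lookup_single intro!: continuous_on_add)
qed simp

lemma pcont_schatten:
  assumes x: "\<And>i a. continuous_on UNIV (\<lambda>y. x y i a)"
  shows "pcont (\<lambda>y. schatten_pow p (weighted_cov n d (x y)))"
proof -
  have "pcont (\<lambda>y. (weighted_cov n d (x y) ^\<^sub>m k) $$ (a, b))" if "a < d" "b < d" for k a b
    using that
  proof (induction k arbitrary: b)
    case 0
    then have "(weighted_cov n d (x y) ^\<^sub>m 0) $$ (a, b) = (if a = b then 1 else 0)" for y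
      using weighted_cov_carrier[of n d "x y"] by simp
    then show ?case by (simp add: pcont_const)
  next
    case (Suc k)
    show ?case unfolding weighted_cov_pow_Suc[OF Suc.prems]
      using Suc by (intro pcont_sum pcont_mult pcont_const pcont_pconst continuous_on_mult x) auto
  qed
  then show ?thesis unfolding schatten_pow_weighted_cov by (intro pcont_sum) auto
qed

section \<open>Proofs as points of a compact set\<close>

definition monoms_le :: "nat set \<Rightarrow> nat \<Rightarrow> (nat \<Rightarrow>\<^sub>0 nat) set" where
  "monoms_le V D = {m. Poly_Mapping.keys m \<subseteq> V \<and> mdeg m \<le> D}"

lemma finite_monoms_le: assumes "finite V" shows "finite (monoms_le V D)"
proof (rule finite_imageD)
  have "Poly_Mapping.lookup ` monoms_le V D \<subseteq> {f. \<forall>x. (x \<in> V \<longrightarrow> f x \<in> {..D}) \<and> (x \<notin> V \<longrightarrow> f x = 0)}"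
  proof clarify
    fix m x assume m: "m \<in> monoms_le V D"
    have "Poly_Mapping.lookup m x \<le> D" if "x \<in> Poly_Mapping.keys m"
      using m member_le_sum[OF that, of "Poly_Mapping.lookup m"] by (auto simp: monoms_le_def mdeg_def)
    then show "(x \<in> V \<longrightarrow> Poly_Mapping.lookup m x \<in> {..D}) \<and> (x \<notin> V \<longrightarrow> Poly_Mapping.lookup m x = 0)"
      using m by (cases "x \<in> Poly_Mapping.keys m") (auto simp: monoms_le_def in_keys_iff)
  qed
  then show "finite (Poly_Mapping.lookup ` monoms_le V D)"
    by (rule finite_subset) (intro finite_set_of_finite_funs assms finite_atMost)
  show "inj_on Poly_Mapping.lookup (monoms_le V D)" by (auto intro!: inj_onI poly_mapping_eqI)
qed

lemma pol_eq_sum_monoms_le: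
  assumes "finite V" "pol V D P"
  shows "P = (\<Sum>m\<in>monoms_le V D. Poly_Mapping.single m (Poly_Mapping.lookup P m))"
proof -
  have "Poly_Mapping.keys P \<subseteq> monoms_le V D"
    using assms(2) by (auto simp: pol_def polys_in_def monoms_le_def total_degree_le_iff)
  then have "(\<Sum>m\<in>Poly_Mapping.keys P. Poly_Mapping.single m (Poly_Mapping.lookup P m)) = (\<Sum>m\<in>monoms_le V D. Poly_Mapping.single m (Poly_Mapping.lookup P m))"
    using finite_monoms_le[OF assms(1)] by (intro sum.mono_neutral_left) (auto simp: in_keys_iff)
  then show ?thesis using poly_sum_single[of P] by simp
qed

type_synonym coeffs = "nat set \<times> nat \<times> (nat \<Rightarrow>\<^sub>0 nat) \<Rightarrow> real"

text \<open>A proof with at most \<open>N\<close> squares per product, of polynomials of degree at most \<open>N\<close>, is a point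
  of a product of intervals once a bound for the coefficients is fixed.\<close>

definition cpoly :: "nat set \<Rightarrow> nat \<Rightarrow> coeffs \<Rightarrow> nat set \<Rightarrow> nat \<Rightarrow> rpoly" where
  "cpoly V N c S j = (\<Sum>m\<in>monoms_le V N. Poly_Mapping.single m (c (S, j, m)))"

definition csos :: "nat set \<Rightarrow> nat \<Rightarrow> coeffs \<Rightarrow> nat set \<Rightarrow> rpoly" where
  "csos V N c S = (\<Sum>j<N. cpoly V N c S j * cpoly V N c S j)"

text \<open>The degree bound is phrased as vanishing of the coefficients of high degree. The whole
  condition is then a family of equations between continuous functions, hence closed.\<close>

definition cproof :: "nat set \<Rightarrow> nat \<Rightarrow> rpoly list \<Rightarrow> nat \<Rightarrow> coeffs \<Rightarrow> rpoly \<Rightarrow> bool" where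
  "cproof V D qs N c P \<longleftrightarrow>
     (\<forall>S m. S \<subseteq> {..<length qs} \<and> D < mdeg m \<longrightarrow> Poly_Mapping.lookup (csos V N c S * (\<Prod>i\<in>S. qs ! i)) m = 0) \<and>
     (\<forall>m. Poly_Mapping.lookup P m = Poly_Mapping.lookup (\<Sum>S\<in>Pow {..<length qs}. csos V N c S * (\<Prod>i\<in>S. qs ! i)) m)"

lemma real_le_floor_iff: "0 \<le> t \<Longrightarrow> real k \<le> t \<longleftrightarrow> k \<le> nat \<lfloor>t\<rfloor>"
  by (metis le_nat_floor nat_floor_neg of_nat_0_le_iff le_floor_iff le_nat_iff of_int_of_nat_eq zero_le_floor)

lemma cpoly_pol: "pol V N (cpoly V N c S j)"
  unfolding cpoly_def
proof (rule pol_sum)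
  fix m assume "m \<in> monoms_le V N"
  then show "pol V N (Poly_Mapping.single m (c (S, j, m)))"
    by (auto simp: pol_def polys_in_def monoms_le_def total_degree_le_iff split: if_splits)
qed

text \<open>A given proof is finite, so one number \<open>N\<close> dominates the lengths of its
  sums, their degrees and the absolute values of their coefficients; \<open>X\<close> collects
  these. Shorter sums are padded with zero polynomials.\<close>

lemma sos_proves_iff_cproof:
  assumes V: "finite V" and t: "0 \<le> t"
  shows "sos_proves V t qs P \<longleftrightarrow> (\<exists>N c. (\<forall>i. \<bar>c i\<bar> \<le> real N) \<and> cproof V (nat \<lfloor>t\<rfloor>) qs N c P)"
proof
  assume "sos_proves V t qs P"
  then obtain b where b: "\<And>U. U \<subseteq> {..<length qs} \<Longrightarrow> is_sos V (b U)"
      "\<And>U. U \<subseteq> {..<length qs} \<Longrightarrow> real (total_degree (b U * (\<Prod>i\<in>U. qs ! i))) \<le> t"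
      "P = (\<Sum>U\<in>Pow {..<length qs}. b U * (\<Prod>i\<in>U. qs ! i))"
    unfolding sos_proves_def by auto
  obtain fs where fs: "\<And>U. U \<subseteq> {..<length qs} \<Longrightarrow> set (fs U) \<subseteq> polys_in V" "\<And>U. U \<subseteq> {..<length qs} \<Longrightarrow> b U = (\<Sum>g\<leftarrow>fs U. g ^ 2)"
    using b(1) unfolding is_sos_def by metis
  define A where "A = (\<Union>U\<in>Pow {..<length qs}. set (fs U))"
  have finA: "finite A" by (auto simp: A_def)
  define X where "X = (length \<circ> fs) ` Pow {..<length qs} \<union> total_degree ` A \<union> (\<Union>g\<in>A. (\<lambda>m. nat \<lceil>\<bar>Poly_Mapping.lookup g m\<bar>\<rceil>) ` Poly_Mapping.keys g)"
  have "finite X" using finA by (auto simp: X_def)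
  then obtain N where N': "\<forall>k\<in>X. k \<le> N" by (auto simp: finite_nat_set_iff_bounded_le)
  then have N: "k \<le> N" if "k \<in> X" for k using that by blast
  define c :: coeffs where "c = (\<lambda>(U, j, m). if U \<subseteq> {..<length qs} \<and> j < length (fs U) then Poly_Mapping.lookup (fs U ! j) m else 0)"
  have "\<bar>c i\<bar> \<le> real N" for i
  proof -
    obtain U j m where i: "i = (U, j, m)" by (cases i)
    show ?thesis
    proof (cases "U \<subseteq> {..<length qs} \<and> j < length (fs U) \<and> m \<in> Poly_Mapping.keys (fs U ! j)")
      case True
      then have "fs U ! j \<in> A" unfolding A_def by (intro UN_I[of U]) auto
      then have "nat \<lceil>\<bar>Poly_Mapping.lookup (fs U ! j) m\<bar>\<rceil> \<in> X"
        unfolding X_def using True by (intro UnI2 UN_I[of "fs U ! j"] imageI) auto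
      from N[OF this] show ?thesis using True unfolding i c_def by (simp add: nat_le_iff ceiling_le_iff)
    next
      case False then show ?thesis by (auto simp: i c_def in_keys_iff)
    qed
  qed
  moreover have cs: "csos V N c U = b U" if U: "U \<subseteq> {..<length qs}" for U
  proof -
    have cp: "cpoly V N c U j = (if j < length (fs U) then fs U ! j else 0)" for j
    proof (cases "j < length (fs U)")
      case True
      then have A: "fs U ! j \<in> A" unfolding A_def using U by (intro UN_I[of U]) auto
      then have "total_degree (fs U ! j) \<le> N" by (intro N) (auto simp: X_def)
      moreover have "fs U ! j \<in> polys_in V" using fs(1)[OF U] True by auto
      ultimately have "pol V N (fs U ! j)" by (simp add: pol_def)
      from pol_eq_sum_monoms_le[OF V this] show ?thesis using True U by (simp add: cpoly_def c_def)
    qed (simp add: cpoly_def c_def)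
    have len: "length (fs U) \<le> N" using U by (intro N) (auto simp: X_def)
    have "csos V N c U = (\<Sum>j<N. if j < length (fs U) then (fs U ! j) ^ 2 else 0)"
      unfolding csos_def cp by (intro sum.cong) (auto simp: power2_eq_square)
    also have "\<dots> = (\<Sum>j<length (fs U). (fs U ! j) ^ 2)"
      using len by (intro sum.mono_neutral_cong_right) auto
    also have "\<dots> = (\<Sum>g\<leftarrow>fs U. g ^ 2)" by (simp add: sum_list_sum_nth atLeast0LessThan)
    finally show ?thesis using fs(2)[OF U] by simp
  qed
  then have "cproof V (nat \<lfloor>t\<rfloor>) qs N c P"
  proof -
    have "Poly_Mapping.lookup (csos V N c S * (\<Prod>i\<in>S. qs ! i)) m = 0" if "S \<subseteq> {..<length qs}" "nat \<lfloor>t\<rfloor> < mdeg m" for S m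
      using b(2)[OF that(1)] that(2) unfolding cs[OF that(1)] real_le_floor_iff[OF t] total_degree_le_iff by (force simp: in_keys_iff)
    moreover have "P = (\<Sum>S\<in>Pow {..<length qs}. csos V N c S * (\<Prod>i\<in>S. qs ! i))"
      unfolding b(3) using cs by (intro sum.cong) auto
    ultimately show ?thesis unfolding cproof_def by auto
  qed
  ultimately show "\<exists>N c. (\<forall>i. \<bar>c i\<bar> \<le> real N) \<and> cproof V (nat \<lfloor>t\<rfloor>) qs N c P" by blast
next
  assume "\<exists>N c. (\<forall>i. \<bar>c i\<bar> \<le> real N) \<and> cproof V (nat \<lfloor>t\<rfloor>) qs N c P"
  then obtain N c where c: "cproof V (nat \<lfloor>t\<rfloor>) qs N c P" by blast
  have "is_sos V (csos V N c U) \<and> real (total_degree (csos V N c U * (\<Prod>i\<in>U. qs ! i))) \<le> t" if U: "U \<subseteq> {..<length qs}" for U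
  proof
    show "is_sos V (csos V N c U)"
      unfolding is_sos_def
    proof (intro exI conjI)
      show "set (map (cpoly V N c U) [0..<N]) \<subseteq> polys_in V" using cpoly_pol[of V N c U] by (auto simp: pol_def)
      show "csos V N c U = (\<Sum>g\<leftarrow>map (cpoly V N c U) [0..<N]. g ^ 2)"
        by (simp add: csos_def power2_eq_square o_def interv_sum_list_conv_sum_set_nat atLeast0LessThan)
    qed
    show "real (total_degree (csos V N c U * (\<Prod>i\<in>U. qs ! i))) \<le> t"
      unfolding real_le_floor_iff[OF t] total_degree_le_iff
    proof
      fix m assume "m \<in> Poly_Mapping.keys (csos V N c U * (\<Prod>i\<in>U. qs ! i))"
      then have "Poly_Mapping.lookup (csos V N c U * (\<Prod>i\<in>U. qs ! i)) m \<noteq> 0" by (simp add: in_keys_iff)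
      then show "mdeg m \<le> nat \<lfloor>t\<rfloor>" using c U unfolding cproof_def by (metis not_le)
    qed
  qed
  moreover have "P = (\<Sum>S\<in>Pow {..<length qs}. csos V N c S * (\<Prod>i\<in>S. qs ! i))"
    using c unfolding cproof_def by (intro poly_mapping_eqI) auto
  ultimately show "sos_proves V t qs P" unfolding sos_proves_def by blast
qed

lemma closed_projection:
  fixes Z :: "('a::topological_space \<times> 'b::topological_space) set"
  assumes K: "compact K" and Z: "closed Z"
  shows "closed {x. \<exists>c\<in>K. (x, c) \<in> Z}"
  unfolding closed_def
proof (rule Topological_Spaces.openI)
  fix x assume "x \<in> - {x. \<exists>c\<in>K. (x, c) \<in> Z}"
  then have "{x} \<times> K \<subseteq> - Z" by auto
  from Elementary_Topology.tube_lemma[OF K open_Compl[OF Z] this]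
  obtain X where "x \<in> X" "open X" "X \<times> K \<subseteq> - Z" by blast
  then show "\<exists>T. open T \<and> x \<in> T \<and> T \<subseteq> - {x. \<exists>c\<in>K. (x, c) \<in> Z}" by (intro exI[of _ X]) auto
qed

text \<open>Tychonoff's theorem: a coefficient family is a point of an infinite product of
  intervals.\<close>

lemma compact_box: "compact {c :: 'i \<Rightarrow> real. \<forall>i. \<bar>c i\<bar> \<le> K}"
proof -
  have "compactin (product_topology (\<lambda>_::'i. euclidean) UNIV) (PiE UNIV (\<lambda>_. {- K..K}))"
    unfolding compactin_PiE by simp
  moreover have "PiE UNIV (\<lambda>_::'i. {- K..K}) = {c. \<forall>i. \<bar>c i\<bar> \<le> K}" by (auto simp: PiE_UNIV_domain abs_le_iff minus_le_iff)
  ultimately show ?thesis by (simp add: euclidean_product_topology)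
qed

lemma closed_feasible:
  "closed {x. \<exists>c. (\<forall>i. \<bar>c i\<bar> \<le> real N) \<and> cproof V D qs N c (pconst B - schatten_pow p (weighted_cov n d x))}"
proof -
  let ?P = "\<lambda>z :: (nat \<Rightarrow> nat \<Rightarrow> real) \<times> coeffs. pconst B - schatten_pow p (weighted_cov n d (fst z))"
  have cx: "continuous_on UNIV (\<lambda>z :: (nat \<Rightarrow> nat \<Rightarrow> real) \<times> coeffs. fst z i a)" for i a
    by (rule continuous_on_product_then_coordinatewise[OF continuous_on_product_then_coordinatewise[OF continuous_on_fst[OF continuous_on_id]]])
  have cc: "continuous_on UNIV (\<lambda>z :: (nat \<Rightarrow> nat \<Rightarrow> real) \<times> coeffs. snd z i)" for i
    by (rule continuous_on_product_then_coordinatewise[OF continuous_on_snd[OF continuous_on_id]])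
  have "pcont (\<lambda>z :: (nat \<Rightarrow> nat \<Rightarrow> real) \<times> coeffs. schatten_pow p (weighted_cov n d (fst z)))"
    by (rule pcont_schatten) (rule cx)
  from pcont_diff[OF pcont_const this] have 1: "pcont ?P" .
  have 2: "pcont (\<lambda>z :: (nat \<Rightarrow> nat \<Rightarrow> real) \<times> coeffs. csos V N (snd z) S * (\<Prod>i\<in>S. qs ! i))" for S
    unfolding csos_def cpoly_def by (intro pcont_mult pcont_sum pcont_single pcont_const cc)
  have "closed {z. cproof V D qs N (snd z) (?P z)}"
    unfolding cproof_def
    by (intro closed_Collect_conj closed_Collect_all closed_Collect_imp open_Collect_const closed_Collect_eq
        continuous_on_const pcont_lookup 1 2 pcont_sum)
  from closed_projection[OF compact_box[of "real N"] this]
  show ?thesis by (simp add: Bex_def)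
qed

text \<open>Indices out of range are included, because measurability into the full function space
  concerns every coordinate. There the extensional product spaces yield the constants
  \<open>undefined\<close>.\<close>

lemma gaussian_samples_coord_measurable: "(\<lambda>x. x i a) \<in> borel_measurable (gaussian_samples n d)"
proof (cases "i < n")
  case True
  have i: "(\<lambda>x. x i) \<in> measurable (gaussian_samples n d) (gaussian_vector d)"
    unfolding gaussian_samples_def using True by (intro measurable_component_singleton) auto
  show ?thesis
  proof (cases "a < d")
    case True
    have "(\<lambda>y. y a) \<in> measurable (gaussian_vector d) std_normal_distribution"
      unfolding gaussian_vector_def using True by (intro measurable_component_singleton) auto
    from measurable_compose[OF i this] show ?thesis by (simp cong: measurable_cong_sets)
  next
    case False
    have h: "x i a = undefined" if "x \<in> space (gaussian_samples n d)" for x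
      using measurable_space[OF i that] False by (auto simp: gaussian_vector_def space_PiM PiE_def extensional_def)
    show ?thesis by (subst measurable_cong[OF h]) auto
  qed
next
  case False
  have h: "x i a = undefined a" if "x \<in> space (gaussian_samples n d)" for x
    using that False by (auto simp: gaussian_samples_def space_PiM PiE_def extensional_def)
  show ?thesis by (subst measurable_cong[OF h]) auto
qed

lemma best_sos_bound_measurable:
  assumes t: "0 \<le> t"
  shows "best_sos_bound t n d p \<eta> \<in> borel_measurable (gaussian_samples n d)"
proof (rule borel_measurableI_less)
  fix y :: ereal
  let ?M = "gaussian_samples n d" and ?qs = "sparse_system n \<eta>"
  define F where "F = (\<lambda>B N. {x. \<exists>c. (\<forall>i. \<bar>c i\<bar> \<le> real N) \<and> cproof {..<n} (nat \<lfloor>t\<rfloor>) ?qs N c (pconst B - schatten_pow p (weighted_cov n d x))})"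
  \<comment> \<open>Passes from the product sigma-algebra of the samples to the Borel sets of the
    function space, where closed sets are available.\<close>
  have id: "(\<lambda>x. x) \<in> borel_measurable ?M"
    by (intro measurable_coordinatewise_then_product gaussian_samples_coord_measurable)
  have F: "{x \<in> space ?M. x \<in> F B N} \<in> sets ?M" for B N
  proof -
    have "F B N \<in> sets borel" unfolding F_def by (intro borel_closed closed_feasible)
    from measurable_sets[OF id this] show ?thesis by (simp add: vimage_def Int_def conj_commute)
  qed
  \<comment> \<open>Adding a nonnegative constant preserves provability, so the provable bounds form
    an upward closed set, and rational bounds and natural \<open>N\<close> suffice.\<close>
  have "best_sos_bound t n d p \<eta> x < y \<longleftrightarrow> (\<exists>q\<in>\<rat>. ereal q < y \<and> (\<exists>N. x \<in> F q N))" for x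
  proof -
    have fe: "sos_le {..<n} t ?qs (schatten_pow p (weighted_cov n d x)) (pconst B) \<longleftrightarrow> (\<exists>N. x \<in> F B N)" for B
      unfolding sos_le_def F_def sos_proves_iff_cproof[OF finite_lessThan t] by auto
    have "best_sos_bound t n d p \<eta> x < y \<longleftrightarrow> (\<exists>B. ereal B < y \<and> (\<exists>N. x \<in> F B N))"
      unfolding best_sos_bound_def fe Inf_less_iff by auto
    also have "\<dots> \<longleftrightarrow> (\<exists>q\<in>\<rat>. ereal q < y \<and> (\<exists>N. x \<in> F q N))"
    proof
      assume "\<exists>B. ereal B < y \<and> (\<exists>N. x \<in> F B N)"
      then obtain B where B: "ereal B < y" "\<exists>N. x \<in> F B N" by blast
      obtain B' where B': "ereal B < ereal B'" "ereal B' < y" using ereal_dense2[OF B(1)] by blast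
      obtain q where q: "q \<in> \<rat>" "B < q" "q < B'" using Rats_dense_in_real[of B B'] B' by auto
      have "ereal q < y" using q(3) B'(2) by (meson ereal_less(2) less_ereal.simps(1) order_less_trans)
      moreover have "\<exists>N. x \<in> F q N"
        using B(2) q(2) sos_proves_add_const[OF _ _ t, of "{..<n}" ?qs B _ q] unfolding fe[symmetric] sos_le_def by simp
      ultimately show "\<exists>q\<in>\<rat>. ereal q < y \<and> (\<exists>N. x \<in> F q N)" using q(1) by blast
    qed blast
    finally show ?thesis .
  qed
  then have "{x \<in> space ?M. best_sos_bound t n d p \<eta> x < y} = (\<Union>q\<in>{q\<in>\<rat>. ereal q < y}. \<Union>N. {x \<in> space ?M. x \<in> F q N})"
    by auto
  also have "\<dots> \<in> sets ?M"
    using countable_subset[OF _ countable_rat, of "{q\<in>\<rat>. ereal q < y}"] by (intro sets.countable_UN'' sets.countable_UN' F) auto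
  finally show "{x \<in> space ?M. best_sos_bound t n d p \<eta> x < y} \<in> sets ?M" .
qed

section \<open>The expectation bound\<close>

text \<open>With \<open>L = p ln n\<close> and \<open>ln 2 >= 2/3\<close>, one has
  \<open>L >= 4/3\<close> and \<open>p <= 3/2 L\<close>. So a power of \<open>L\<close> exceeds any
  constant, and powers of \<open>p\<close> become powers of \<open>L\<close>.\<close>

lemma power_absorb:
  fixes A :: real
  assumes A: "0 \<le> A"
  shows "\<exists>N. \<forall>p n. 2 \<le> p \<longrightarrow> 2 \<le> n \<longrightarrow> (A * real p ^ k) ^ p \<le> (real p * ln (real n)) ^ (N * p)"
proof -
  obtain M where M: "A * (3 / 2) ^ k < (4 / 3 :: real) ^ M" using real_arch_pow[of "4 / 3" "A * (3 / 2) ^ k"] by auto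
  have "(A * real p ^ k) ^ p \<le> (real p * ln (real n)) ^ ((M + k) * p)" if pn: "2 \<le> p" "2 \<le> n" for p n :: nat
  proof -
    define L where "L = real p * ln (real n)"
    have "ln 2 \<le> ln (real n)" using pn by simp
    then have ln: "2 / 3 \<le> ln (real n)" using ln2_ge_two_thirds by linarith
    have "real p * (2 / 3) \<le> L" unfolding L_def using ln by (intro mult_left_mono) auto
    then have L: "real p \<le> 3 / 2 * L" "4 / 3 \<le> L" using pn by auto
    have "A * real p ^ k \<le> A * (3 / 2 * L) ^ k" using A L by (intro mult_left_mono power_mono) auto
    also have "\<dots> = (A * (3 / 2) ^ k) * L ^ k" by (simp only: power_mult_distrib mult.assoc)
    also have "\<dots> \<le> L ^ M * L ^ k"
    proof (rule mult_right_mono)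
      have "(4 / 3 :: real) ^ M \<le> L ^ M" using L by (intro power_mono) auto
      then show "A * (3 / 2) ^ k \<le> L ^ M" using M by linarith
    qed (use L in auto)
    finally have "(A * real p ^ k) ^ p \<le> (L ^ (M + k)) ^ p" using A by (intro power_mono) (auto simp: power_add)
    then show ?thesis by (simp only: L_def power_mult)
  qed
  then show ?thesis by blast
qed

lemma power_sum_le:
  fixes a b :: real
  assumes "0 \<le> a" "0 \<le> b"
  shows "(a + b) ^ p \<le> 2 ^ p * (a ^ p + b ^ p)"
proof -
  have "(a + b) ^ p \<le> (2 * max a b) ^ p" using assms by (intro power_mono) auto
  also have "\<dots> = 2 ^ p * max a b ^ p" by (simp add: power_mult_distrib)
  also have "\<dots> \<le> 2 ^ p * (a ^ p + b ^ p)" using assms by (intro mult_left_mono) (auto simp: max_def)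
  finally show ?thesis .
qed

section \<open>The scale \<open>T\<close> and the integrated bound\<close>

locale cov_sparse = cov_model n d for n d +
  fixes \<eta> :: real and p :: nat
  assumes \<eta>: "0 \<le> \<eta>" "\<eta> \<le> 1" and p2: "2 \<le> p"
begin

definition T :: real where "T = max (real d / real n) (\<eta> * real d / sqrt (real n))"

text \<open>Chosen so that \<open>r^4 = T^(2p)\<close>, the size of the \<open>p\<close>-th power of
  \<open>cert.Lam\<close>; both terms of \<open>cert.sos_bound\<close> then have size
  \<open>r\<close>, up to the other factors.\<close>

definition r :: real where "r = T powr (real p / 2)"

lemma cert: "cert n d \<eta>"
  by unfold_locales (rule \<eta>)+

text \<open>The constant \<open>cert.c0\<close>, restated in a locale without a fixed
  sample.\<close>

definition c :: real where
  "c = 2 * \<eta>\<^sup>2 + 4 * \<eta> * real d / real n + (real d)\<^sup>2 / (real n)\<^sup>2 + 2 * \<eta> / real n"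

lemma nd0: "0 < real n" "0 < real d" "0 < sqrt (real n)"
  using real_bounds by auto

lemma T0: "0 < T"
  unfolding T_def using nd0 by (simp add: less_max_iff_disj)

lemma r0: "0 < r"
  unfolding r_def using T0 by simp

lemma r4: "(T\<^sup>2) ^ p = r ^ 4"
proof -
  have "r ^ 4 = T powr (4 * (real p / 2))" unfolding r_def using T0 by (simp add: powr_power mult.commute)
  also have "4 * (real p / 2) = real (2 * p)" by simp
  also have "T powr real (2 * p) = T ^ (2 * p)" using T0 by (rule powr_realpow)
  finally show ?thesis by (simp add: power_mult)
qed

lemma T_ge: "real d / real n \<le> T" "\<eta> * real d / sqrt (real n) \<le> T" "\<eta> \<le> T"
proof -
  show "real d / real n \<le> T" and e: "\<eta> * real d / sqrt (real n) \<le> T" unfolding T_def by auto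
  \<comment> \<open>\<open>n <= d^2\<close> enters here, to place \<open>\<eta>\<close> itself below
    \<open>T\<close>.\<close>
  have "sqrt (real n) \<le> real d" using real_bounds by (intro real_le_lsqrt) auto
  then have "\<eta> * sqrt (real n) \<le> \<eta> * real d" using \<eta> by (intro mult_left_mono) auto
  then have "\<eta> \<le> \<eta> * real d / sqrt (real n)" using nd0 by (simp add: pos_le_divide_eq)
  then show "\<eta> \<le> T" using e by linarith
qed

text \<open>The first bound is the square of \<open>\<eta> d / sqrt n <= T\<close>. The second
  multiplies \<open>d/n <= T\<close> by the weaker \<open>\<eta> d / n <= T\<close> and uses
  \<open>d <= n\<close>.\<close>

lemma T_sq: "(\<eta> * real n)\<^sup>2 * (real n * (real d)\<^sup>2) \<le> real n ^ 4 * T\<^sup>2" "\<eta> * real n * real d ^ 3 \<le> real n ^ 4 * T\<^sup>2"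
proof -
  have e0: "0 \<le> \<eta> * real d / sqrt (real n)" using \<eta> nd0 by simp
  have "(\<eta> * real d / sqrt (real n))\<^sup>2 \<le> T\<^sup>2" using T_ge(2) e0 by (intro power_mono) auto
  then have "real n ^ 4 * (\<eta> * real d / sqrt (real n))\<^sup>2 \<le> real n ^ 4 * T\<^sup>2" by (intro mult_left_mono) auto
  moreover have "real n ^ 4 * (\<eta> * real d / sqrt (real n))\<^sup>2 = (\<eta> * real n)\<^sup>2 * (real n * (real d)\<^sup>2)"
    using nd0 by (simp add: power_divide power_mult_distrib field_simps power2_eq_square power4_eq_xxxx)
  ultimately show "(\<eta> * real n)\<^sup>2 * (real n * (real d)\<^sup>2) \<le> real n ^ 4 * T\<^sup>2" by simp
  have "real d / real n * (\<eta> * real d / real n) \<le> T * T"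
  proof (intro mult_mono T_ge)
    have "1 * sqrt (real n) \<le> sqrt (real n) * sqrt (real n)" using real_bounds by (intro mult_right_mono) auto
    then have "sqrt (real n) \<le> real n" by simp
    then have "\<eta> * real d / real n \<le> \<eta> * real d / sqrt (real n)" using \<eta> nd0 by (intro divide_left_mono) auto
    then show "\<eta> * real d / real n \<le> T" using T_ge(2) by linarith
  qed (use \<eta> nd0 T0 in auto)
  then have "real n ^ 4 * (real d / real n * (\<eta> * real d / real n)) \<le> real n ^ 4 * (T * T)" by (intro mult_left_mono) auto
  moreover have "real n ^ 4 * (real d / real n * (\<eta> * real d / real n)) = \<eta> * real n * (real d)\<^sup>2 * real n"
    using nd0 by (simp add: field_simps power2_eq_square power4_eq_xxxx)
  moreover have "\<eta> * real n * (real d)\<^sup>2 * real d \<le> \<eta> * real n * (real d)\<^sup>2 * real n"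
    using real_bounds \<eta> by (intro mult_left_mono) auto
  ultimately show "\<eta> * real n * real d ^ 3 \<le> real n ^ 4 * T\<^sup>2"
    by (simp add: power3_eq_cube power2_eq_square mult.assoc)
qed

text \<open>The four terms contribute \<open>9 = 2 + 4 + 1 + 2\<close>.\<close>

lemma c_bounds: "0 \<le> c" "c \<le> 9 * T"
proof -
  show "0 \<le> c" unfolding c_def using \<eta> by simp
  have q1: "real d / real n \<le> 1" using real_bounds by simp
  have "\<eta>\<^sup>2 \<le> \<eta> * 1" unfolding power2_eq_square using \<eta> by (intro mult_left_mono) auto
  moreover have "\<eta> * (real d / real n) \<le> 1 * (real d / real n)" using \<eta> by (intro mult_right_mono) auto
  moreover have "real d / real n * (real d / real n) \<le> real d / real n * 1"
    using q1 by (intro mult_left_mono) auto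
  then have "(real d)\<^sup>2 / (real n)\<^sup>2 \<le> real d / real n" by (simp add: power2_eq_square)
  moreover have "\<eta> / real n \<le> \<eta> / 1" using \<eta> real_bounds by (intro divide_left_mono) auto
  ultimately show "c \<le> 9 * T" using T_ge unfolding c_def by (simp add: mult.assoc)
qed

definition Bd :: "(nat \<Rightarrow> nat \<Rightarrow> real) \<Rightarrow> real" where
  "Bd x = 3 / 4 * r * real d + 1 / (4 * r ^ 3) * ((2 * c\<^sup>2 + 8 * fcert T x) ^ p * real d)"

lemma best_le:
  assumes t: "5 * real p \<le> t"
  shows "best_sos_bound t n d p \<eta> x \<le> ereal (Bd x)"
proof -
  have "cert.c0 n d \<eta> = c" unfolding cert.c0_def[OF cert] c_def ..
  then have "cert.Lam n d \<eta> x T = 2 * c\<^sup>2 + 8 * fcert T x" unfolding cert.Lam_def[OF cert] by simp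
  then have "pc {..<n} (sparse_system n \<eta>) (4 * p + 2) (pconst (Bd x) - schatten_pow p (weighted_cov n d x))"
    using cert.sos_bound[OF cert T_sq r0, of p x] by (simp only: Bd_def)
  from pc_sos_proves[OF this] have "sos_le {..<n} t (sparse_system n \<eta>) (schatten_pow p (weighted_cov n d x)) (pconst (Bd x))"
    unfolding sos_le_def by (rule sos_proves_mono) (use t p2 in auto)
  then show ?thesis unfolding best_sos_bound_def by (intro Inf_lower) auto
qed

text \<open>\<open>640000000000\<close> is \<open>16 * 40000000000\<close>: the second factor comes
  from \<open>fcert_mb\<close>, and \<open>16 = 2 * 8\<close> from splitting the \<open>p\<close>-th
  power in \<open>Bd\<close>. Further \<open>924800 = 2 * 680^2\<close>, with the 680 of
  \<open>fcert_mb\<close>.\<close>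

definition a :: real where "a = 640000000000 * real (924800 * p) ^ 680"

lemma a_ge: "324 \<le> a" "0 \<le> a"
proof -
  define q where "q = real (924800 * p) ^ 680"
  have "1 \<le> q" unfolding q_def using p2 by (intro one_le_power) simp
  moreover have "a = 640000000000 * q" by (simp only: a_def q_def)
  ultimately show "324 \<le> a" "0 \<le> a" by simp_all
qed

lemma nn_integral_Bd: "(\<integral>\<^sup>+x. ennreal (Bd x) \<partial>S.Om) \<le> ennreal (r * (real d)\<^sup>2 * (2 * a) ^ p)"
proof -
  define K2 where "K2 = real d / (4 * r ^ 3) * 16 ^ p"
  define K1 where "K1 = 3 / 4 * r * real d + real d / (4 * r ^ 3) * (2 ^ p * (2 * c\<^sup>2) ^ p)"
  define M where "M = 2 * real d * real (924800 * p) ^ (680 * p) * (40000000000 * T\<^sup>2) ^ p"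
  have pos: "0 \<le> K1" "0 \<le> K2" "0 \<le> M" unfolding K1_def K2_def M_def using r0 by auto
  have f0: "0 \<le> fcert T x" for x by (rule mbD(6)[OF fcert_mb[OF T0]])
  have fm: "fcert T \<in> borel_measurable S.Om" by (rule mbD(5)[OF fcert_mb[OF T0]])
  have "Bd x \<le> K1 + K2 * fcert T x ^ p" for x
  proof -
    have "(2 * c\<^sup>2 + 8 * fcert T x) ^ p \<le> 2 ^ p * ((2 * c\<^sup>2) ^ p + (8 * fcert T x) ^ p)"
      using f0 by (intro power_sum_le) auto
    then have "1 / (4 * r ^ 3) * ((2 * c\<^sup>2 + 8 * fcert T x) ^ p * real d) \<le> 1 / (4 * r ^ 3) * ((2 ^ p * ((2 * c\<^sup>2) ^ p + (8 * fcert T x) ^ p)) * real d)"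
      using r0 by (intro mult_left_mono mult_right_mono) auto
    also have "\<dots> = real d / (4 * r ^ 3) * (2 ^ p * (2 * c\<^sup>2) ^ p) + real d / (4 * r ^ 3) * ((2 ^ p * 8 ^ p) * fcert T x ^ p)"
      by (simp only: power_mult_distrib[of 8]) (simp add: algebra_simps)
    also have "(2 ^ p * 8 ^ p :: real) = 16 ^ p" by (simp add: power_mult_distrib[symmetric])
    finally show ?thesis by (simp add: Bd_def K1_def K2_def)
  qed
  then have "(\<integral>\<^sup>+x. ennreal (Bd x) \<partial>S.Om) \<le> (\<integral>\<^sup>+x. ennreal K1 + ennreal K2 * ennreal (fcert T x ^ p) \<partial>S.Om)"
    using pos f0 by (intro nn_integral_mono) (simp add: ennreal_plus[symmetric] ennreal_mult'[symmetric] ennreal_leI del: ennreal_plus)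
  also have "\<dots> = ennreal K1 + ennreal K2 * (\<integral>\<^sup>+x. ennreal (fcert T x ^ p) \<partial>S.Om)"
    using fm by (simp add: nn_integral_add nn_integral_cmult S.Om.emeasure_space_1)
  also have "\<dots> \<le> ennreal K1 + ennreal K2 * ennreal M"
    unfolding M_def using p2 by (intro add_left_mono mult_left_mono fcert_moment T0) auto
  also have "\<dots> = ennreal (K1 + K2 * M)" using pos by (simp add: ennreal_plus[symmetric] ennreal_mult'[symmetric] del: ennreal_plus)
  also have "\<dots> \<le> ennreal (r * (real d)\<^sup>2 * (2 * a) ^ p)"
  proof (rule ennreal_leI)
    have rr: "r ^ 4 / r ^ 3 = r" using r0 by (simp add: power_diff[symmetric])
    define q where "q = real (924800 * p) ^ 680"
    have a1: "324 \<le> a" "1 \<le> a" using a_ge by auto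
    have "c\<^sup>2 \<le> (9 * T)\<^sup>2" using c_bounds by (intro power_mono) auto
    then have "(2 * c\<^sup>2) ^ p \<le> (162 * T\<^sup>2) ^ p" by (intro power_mono) (auto simp: power_mult_distrib)
    also have "\<dots> = 162 ^ p * r ^ 4" by (simp add: power_mult_distrib r4)
    finally have "real d / (4 * r ^ 3) * (2 ^ p * (2 * c\<^sup>2) ^ p) \<le> real d / (4 * r ^ 3) * (2 ^ p * (162 ^ p * r ^ 4))"
      using r0 by (intro mult_left_mono) auto
    also have "\<dots> = real d / 4 * (2 ^ p * 162 ^ p) * (r ^ 4 / r ^ 3)" by simp
    also have "\<dots> = real d / 4 * 324 ^ p * r" unfolding rr by (simp add: power_mult_distrib[symmetric])
    also have "\<dots> \<le> real d / 4 * a ^ p * r"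
      using a1 r0 by (intro mult_right_mono mult_left_mono power_mono) auto
    finally have k1: "K1 \<le> 3 / 4 * r * real d + real d / 4 * a ^ p * r" by (simp add: K1_def)
    have "real d * 1 * r \<le> real d * a ^ p * r" using a1 r0 by (intro mult_right_mono mult_left_mono one_le_power) auto
    with k1 have "K1 \<le> real d * a ^ p * r" by (simp add: algebra_simps)
    also have "\<dots> \<le> (real d)\<^sup>2 * a ^ p * r"
      using a1 r0 real_bounds by (intro mult_right_mono) (auto simp: power2_eq_square)
    finally have k1: "K1 \<le> (real d)\<^sup>2 * a ^ p * r" .
    have "K2 * M = (real d)\<^sup>2 / 2 * ((16 ^ p * 40000000000 ^ p) * q ^ p) * (r ^ 4 / r ^ 3)"
      unfolding K2_def M_def power_mult q_def[symmetric] power_mult_distrib[of 40000000000] r4 by (simp add: power2_eq_square)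
    also have "(16 ^ p * 40000000000 ^ p) * q ^ p = a ^ p"
      by (simp only: a_def q_def[symmetric] power_mult_distrib[symmetric]) simp
    finally have k2: "K2 * M = (real d)\<^sup>2 / 2 * a ^ p * r" unfolding rr .
    have "0 \<le> (real d)\<^sup>2 * a ^ p * r" using a1 r0 by simp
    then have "K1 + K2 * M \<le> (real d)\<^sup>2 * a ^ p * r * 2" using k1 k2 by simp
    also have "\<dots> \<le> (real d)\<^sup>2 * a ^ p * r * 2 ^ p"
      using a1 r0 p2 self_le_power[of "2::real" p] by (intro mult_left_mono) auto
    also have "\<dots> = r * (real d)\<^sup>2 * (2 * a) ^ p" by (simp add: power_mult_distrib)
    finally show "K1 + K2 * M \<le> r * (real d)\<^sup>2 * (2 * a) ^ p" .
  qed
  finally show ?thesis .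
qed

lemma samples_eq: "gaussian_samples n d = S.Om"
  unfolding gaussian_samples_def gaussian_vector_def ..

lemma expectation_le:
  assumes t: "5 * real p \<le> t"
  shows "ereal_expectation (gaussian_samples n d) (best_sos_bound t n d p \<eta>) \<le> ereal (r * (real d)\<^sup>2 * (2 * a) ^ p)"
proof -
  let ?f = "best_sos_bound t n d p \<eta>"
  \<comment> \<open>The subtracted integral of the negative part is nonnegative, so dropping it
    gives an upper bound.\<close>
  have "ereal_expectation S.Om ?f \<le> enn2ereal (\<integral>\<^sup>+x. e2ennreal (?f x) \<partial>S.Om) - 0"
    unfolding ereal_expectation_def by (intro ereal_minus_mono) auto
  also have "\<dots> \<le> enn2ereal (ennreal (r * (real d)\<^sup>2 * (2 * a) ^ p))"
  proof -
    have "(\<integral>\<^sup>+x. e2ennreal (?f x) \<partial>S.Om) \<le> (\<integral>\<^sup>+x. ennreal (Bd x) \<partial>S.Om)"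
    proof (rule nn_integral_mono)
      fix x
      have "e2ennreal (?f x) \<le> e2ennreal (ereal (Bd x))" by (intro e2ennreal_mono best_le t)
      then show "e2ennreal (?f x) \<le> ennreal (Bd x)" by simp
    qed
    also note nn_integral_Bd
    finally show ?thesis by (simp add: less_eq_ennreal.rep_eq)
  qed
  also have "\<dots> = ereal (r * (real d)\<^sup>2 * (2 * a) ^ p)"
    by (rule enn2ereal_ennreal) (use r0 a_ge in simp)
  finally show ?thesis unfolding samples_eq .
qed

end

theorem theorem4p1:
  shows "\<exists>C :: real. C > 0 \<and>
    (\<forall>(n :: nat) (d :: nat) (p :: nat) (\<eta> :: real).
       2 \<le> n \<longrightarrow> 2 \<le> p \<longrightarrow> d \<le> n \<longrightarrow> n \<le> d ^ 2 \<longrightarrow> 0 \<le> \<eta> \<longrightarrow> \<eta> \<le> 1 \<longrightarrow>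
       best_sos_bound (C * real p) n d p \<eta> \<in> borel_measurable (gaussian_samples n d) \<and>
       ereal_expectation (gaussian_samples n d) (best_sos_bound (C * real p) n d p \<eta>)
         \<le> ereal ((real p * ln (real n)) powr (C * real p) * real d powr (5 / 2) *
                  max (real d / real n) (\<eta> * real d / sqrt (real n)) powr (real p / 2)))"
proof -
  define A :: real where "A = 2 * (640000000000 * real 924800 ^ 680)"
  have "0 \<le> A" unfolding A_def by (intro mult_nonneg_nonneg zero_le_power) auto
  then obtain N where N: "\<And>p n. 2 \<le> p \<Longrightarrow> 2 \<le> n \<Longrightarrow> (A * real p ^ 680) ^ p \<le> (real p * ln (real n)) ^ (N * p)"
    using power_absorb[of A 680] by blast
  show ?thesis
  \<comment> \<open>\<open>N\<close> absorbs the constants and powers of \<open>p\<close>; the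
    additional 5 provides the degree, since \<open>4 p + 2 <= 5 p\<close> for
    \<open>p >= 2\<close>.\<close>
  proof (intro exI[of _ "real (N + 5)"] conjI allI impI)
    fix n d p :: nat and \<eta> :: real
    assume h: "2 \<le> n" "2 \<le> p" "d \<le> n" "n \<le> d ^ 2" "0 \<le> \<eta>" "\<eta> \<le> 1"
    then interpret cov_sparse n d \<eta> p by unfold_locales
    show "best_sos_bound (real (N + 5) * real p) n d p \<eta> \<in> borel_measurable (gaussian_samples n d)"
      by (rule best_sos_bound_measurable) simp
    have "ereal_expectation (gaussian_samples n d) (best_sos_bound (real (N + 5) * real p) n d p \<eta>) \<le> ereal (r * (real d)\<^sup>2 * (2 * a) ^ p)"
      by (rule expectation_le) (simp add: distrib_right)
    also have "\<dots> \<le> ereal ((real p * ln (real n)) powr (real (N + 5) * real p) * real d powr (5 / 2) *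
                  max (real d / real n) (\<eta> * real d / sqrt (real n)) powr (real p / 2))"
    proof -
      define L where "L = real p * ln (real n)"
      have "ln 2 \<le> ln (real n)" using h by simp
      then have "2 / 3 \<le> ln (real n)" using ln2_ge_two_thirds by linarith
      then have "2 * (2 / 3) \<le> L" unfolding L_def using h by (intro mult_mono) auto
      then have L: "1 \<le> L" by simp
      have "2 * a = A * real p ^ 680" unfolding a_def A_def of_nat_mult power_mult_distrib by (simp only: mult_ac)
      then have "(2 * a) ^ p \<le> L ^ (N * p)" using N[OF h(2,1)] by (simp only: L_def)
      also have "\<dots> \<le> L ^ ((N + 5) * p)" using L by (intro power_increasing) auto
      also have "\<dots> = L powr real ((N + 5) * p)" using L by (intro powr_realpow[symmetric]) auto
      finally have 1: "(2 * a) ^ p \<le> L powr (real (N + 5) * real p)" by simp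
      \<comment> \<open>One factor \<open>d\<close> is the trace of the identity, the other bounds
        the \<open>sqrt n\<close> left over in \<open>fcert_moment\<close>.\<close>
      have "(real d)\<^sup>2 = real d powr 2" using nd0 by simp
      also have "\<dots> \<le> real d powr (5 / 2)" using real_bounds by (intro powr_mono) auto
      finally have 2: "(real d)\<^sup>2 \<le> real d powr (5 / 2)" .
      have "r * (real d)\<^sup>2 * (2 * a) ^ p \<le> r * real d powr (5 / 2) * L powr (real (N + 5) * real p)"
        using 1 2 r0 a_ge by (intro mult_mono) auto
      then show ?thesis by (simp add: L_def r_def T_def mult_ac)
    qed
    finally show "ereal_expectation (gaussian_samples n d) (best_sos_bound (real (N + 5) * real p) n d p \<eta>)
         \<le> ereal ((real p * ln (real n)) powr (real (N + 5) * real p) * real d powr (5 / 2) *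
                  max (real d / real n) (\<eta> * real d / sqrt (real n)) powr (real p / 2))" .
  qed simp
qed

end
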